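(* Let $(g,f)$ be a homogeneous pair of degree $\alpha\in\mathbb{R}-\{0\}$ on a manifold $M$ with a free $\mathbb{R}_{>0}$-action. Let $l>0$, let $M_l=f^{-1}(l)$, let $g_l$ be the pullback of $g$ to $M_l$ (a pseudo-Riemannian metric), and suppose that $g_l$ has constant sectional curvature $\hat C_l\in\mathbb{R}$. Then, given $C\in\mathbb{R}$, the metric $(v\circ f)g$ has constant sectional curvature $C$ if $$v(r)=\frac1r\,w\left(\frac{C}{\alpha},\frac{l\hat C_l}{\alpha},C_2,r\right),$$ where $C_2\in\mathbb{R}$ is such that $\left(\frac{C}{\alpha},\frac{l\hat C_l}{\alpha},C_2\right)\in\Delta_1\cup\Delta_2\cup\Delta_3$.
   Context: Homogeneous pair: $m:\mathbb{R}_{>0}\times M\to M$ is a smooth free action, $m_\lambda=m(\lambda,\cdot)$, $P_x=\frac{d}{dt}m(e^t,x)|_{t=0}$. For a pseudo-Riemannian metric $g$, a smooth $f:M\to\mathbb{R}_{>0}$ and $\alpha\in\mathbb{R}-\{0\}$, $(g,f)$ is a homogeneous pair of degree $\alpha$ if $m_\lambda^*g=\lambda^\alpha g$, $m_\lambda^*f=\lambda^\alpha f$ for all $\lambda>0$ and $g(P,\cdot)=df$. The function $w$: set $\Delta_1=\{(s,C_1,C_2)\in\mathbb{R}^3\mid s>0,\ C_1>0\}$, $\Delta_2=\{(s,C_1,C_2)\in\mathbb{R}^3\mid s=0,\ C_1\ge0\}$, $\Delta_3=\{(s,C_1,C_2)\in\mathbb{R}^3\mid s<0,\ C_1\le0\}$.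 For (generic) $r\in\mathbb{R}_{>0}$ define - for $(s,C_1,C_2)\in\Delta_1$: $w(s,C_1,C_2,r)=\dfrac{C_1}{s\cosh^2(\sqrt{C_1}(\log r+C_2))}$; - for $(0,C_1,C_2)\in\Delta_2$: $w(0,C_1,C_2,r)=e^{C_2}r^{\pm2\sqrt{C_1}}$ (either choice of sign is allowed); - for $(s,C_1,C_2)\in\Delta_3$ with $C_1<0$: $w(s,C_1,C_2,r)=\dfrac{C_1}{s\sin^2(\sqrt{-C_1}(\log r+C_2))}$; - for $(s,0,C_2)\in\Delta_3$: $w(s,0,C_2,r)=\dfrac{-1}{s(\log r+C_2)^2}$. When $\alpha C\ge0$, $v$ is defined for all $r>0$; when $\alpha C<0$, $v$ is only defined on the complement of a discrete subset of $\mathbb{R}_{>0}$, and $(v\circ f)g$ is considered on the open subset of $M$ where $v\circ f$ is defined. Sectional curvature is that of nondegenerate planes. *)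

theory Defs
  imports "HOL-Analysis.Analysis"
begin

text \<open>
  For a relatively open subset S of a linear subspace E, \<open>Ck_on E k f S\<close> says that f is of
  class C^k on S.  Derivatives within S are determined only in the directions of E, hence the
  restriction to directions in E.
\<close>

fun Ck_on :: "'a::euclidean_space set \<Rightarrow> nat \<Rightarrow> ('a \<Rightarrow> 'b::euclidean_space) \<Rightarrow> 'a set \<Rightarrow> bool" where
  "Ck_on E 0 f S \<longleftrightarrow> continuous_on S f"
| "Ck_on E (Suc k) f S \<longleftrightarrow>
     (\<exists>f'. (\<forall>x\<in>S. (f has_derivative f' x) (at x within S)) \<and>
           (\<forall>v\<in>E. Ck_on E k (\<lambda>x. f' x v) S))"

definition smooth_on :: "'a::euclidean_space set \<Rightarrow> 'a set \<Rightarrow> ('a \<Rightarrow> 'b::euclidean_space) \<Rightarrow> bool" where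
  "smooth_on E S f \<longleftrightarrow> (\<forall>k. Ck_on E k f S)"

text \<open>
  Manifolds are modelled on a linear subspace of a Euclidean space rather than on a whole type;
  the dimension is the dimension of that subspace.  In this way a hypersurface can be modelled
  on a hyperplane of the same type, and dimension 0 is not excluded.
\<close>

type_synonym ('p, 'e) chart = "'p set \<times> ('p \<Rightarrow> 'e)"

record ('p, 'e) mfd =
  mtop :: "'p topology"
  model :: "'e set"
  atlas :: "('p, 'e) chart set"

abbreviation pts :: "('p, 'e) mfd \<Rightarrow> 'p set" where
  "pts M \<equiv> topspace (mtop M)"

definition is_chart :: "('p, 'e::euclidean_space) mfd \<Rightarrow> ('p, 'e) chart \<Rightarrow> bool" where
  "is_chart M = (\<lambda>(U, \<phi>).
     openin (mtop M) U \<and>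
     openin (top_of_set (model M)) (\<phi> ` U) \<and>
     homeomorphic_map (subtopology (mtop M) U) (top_of_set (\<phi> ` U)) \<phi>)"

definition compatible :: "('p, 'e::euclidean_space) mfd \<Rightarrow> ('p, 'e) chart \<Rightarrow> ('p, 'e) chart \<Rightarrow> bool" where
  "compatible M = (\<lambda>(U, \<phi>) (V, \<psi>).
     smooth_on (model M) (\<phi> ` (U \<inter> V)) (\<psi> \<circ> inv_into U \<phi>) \<and>
     smooth_on (model M) (\<psi> ` (U \<inter> V)) (\<phi> \<circ> inv_into V \<psi>))"

definition smooth_manifold :: "('p, 'e::euclidean_space) mfd \<Rightarrow> bool" where
  "smooth_manifold M \<longleftrightarrow>
     Hausdorff_space (mtop M) \<and> second_countable (mtop M) \<and> subspace (model M) \<and>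
     (\<forall>c\<in>atlas M. is_chart M c) \<and>
     pts M = (\<Union>c\<in>atlas M. fst c) \<and>
     (\<forall>c\<in>atlas M. \<forall>d\<in>atlas M. compatible M c d)"

definition maximal_atlas :: "('p, 'e::euclidean_space) mfd \<Rightarrow> ('p, 'e) chart set" where
  "maximal_atlas M = {c. is_chart M c \<and> (\<forall>d\<in>atlas M. compatible M c d)}"

definition smooth_map ::
    "('p, 'e::euclidean_space) mfd \<Rightarrow> ('q, 'f::euclidean_space) mfd \<Rightarrow> ('p \<Rightarrow> 'q) \<Rightarrow> bool" where
  "smooth_map M N F \<longleftrightarrow>
     continuous_map (mtop M) (mtop N) F \<and>
     (\<forall>(U, \<phi>)\<in>atlas M. \<forall>(V, \<psi>)\<in>atlas N.
        smooth_on (model M) (\<phi> ` {x\<in>U. F x \<in> V}) (\<psi> \<circ> F \<circ> inv_into U \<phi>))"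

definition open_mfd :: "'e::euclidean_space set \<Rightarrow> ('e, 'e) mfd" where
  "open_mfd S = \<lparr>mtop = top_of_set S, model = UNIV, atlas = {(S, id)}\<rparr>"

definition prod_mfd :: "('p, 'e) mfd \<Rightarrow> ('q, 'f) mfd \<Rightarrow> ('p \<times> 'q, 'e \<times> 'f) mfd" where
  "prod_mfd M N =
     \<lparr>mtop = prod_topology (mtop M) (mtop N), model = model M \<times> model N,
      atlas = {(U \<times> V, map_prod \<phi> \<psi>) | U \<phi> V \<psi>. (U, \<phi>) \<in> atlas M \<and> (V, \<psi>) \<in> atlas N}\<rparr>"

definition open_sub :: "('p, 'e) mfd \<Rightarrow> 'p set \<Rightarrow> ('p, 'e) mfd" where
  "open_sub M W =
     \<lparr>mtop = subtopology (mtop M) W, model = model M,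
      atlas = {(U \<inter> W, \<phi>) | U \<phi>. (U, \<phi>) \<in> atlas M}\<rparr>"

text \<open>
  The manifold structure on an embedded submanifold S, given by the slice charts of the ambient
  manifold; H is a subspace of the ambient model, of the dimension of S.
\<close>

definition embedded_sub :: "('p, 'e::euclidean_space) mfd \<Rightarrow> 'e set \<Rightarrow> 'p set \<Rightarrow> ('p, 'e) mfd" where
  "embedded_sub M H S =
     \<lparr>mtop = subtopology (mtop M) S, model = H,
      atlas = {(U \<inter> S, \<phi>) | U \<phi>. (U, \<phi>) \<in> maximal_atlas M \<and> \<phi> ` (U \<inter> S) = \<phi> ` U \<inter> H}\<rparr>"

text \<open>
  A tangent vector at p is the velocity of a smooth curve through p, regarded as an operator on
  the functions that are smooth in a neighbourhood of p.  It is set to 0 on all other functions,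
  so that equality of operators is equality of tangent vectors.
\<close>

type_synonym 'p tvec = "('p \<Rightarrow> real) \<Rightarrow> real"

abbreviation smooth_fun :: "('p, 'e::euclidean_space) mfd \<Rightarrow> ('p \<Rightarrow> real) \<Rightarrow> bool" where
  "smooth_fun M h \<equiv> smooth_map M (open_mfd (UNIV :: real set)) h"

definition smooth_near :: "('p, 'e::euclidean_space) mfd \<Rightarrow> 'p \<Rightarrow> ('p \<Rightarrow> real) \<Rightarrow> bool" where
  "smooth_near M p h \<longleftrightarrow> (\<exists>U. openin (mtop M) U \<and> p \<in> U \<and> smooth_fun (open_sub M U) h)"

definition velocity :: "('p, 'e::euclidean_space) mfd \<Rightarrow> (real \<Rightarrow> 'p) \<Rightarrow> 'p tvec" where
  "velocity M \<gamma> = (\<lambda>h. if smooth_near M (\<gamma> 0) h then deriv (\<lambda>t. h (\<gamma> t)) 0 else 0)"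

definition tangent_space :: "('p, 'e::euclidean_space) mfd \<Rightarrow> 'p \<Rightarrow> 'p tvec set" where
  "tangent_space M p =
     {velocity M \<gamma> | \<gamma>. \<gamma> 0 = p \<and> (\<exists>\<epsilon>>0. smooth_map (open_mfd {-\<epsilon><..<\<epsilon>}) M \<gamma>)}"

definition pushforward ::
    "('q, 'f::euclidean_space) mfd \<Rightarrow> ('p \<Rightarrow> 'q) \<Rightarrow> 'p \<Rightarrow> 'p tvec \<Rightarrow> 'q tvec" where
  "pushforward N F p v = (\<lambda>h. if smooth_near N (F p) h then v (\<lambda>x. h (F x)) else 0)"

definition smooth_field :: "('p, 'e::euclidean_space) mfd \<Rightarrow> ('p \<Rightarrow> 'p tvec) \<Rightarrow> bool" where
  "smooth_field M X \<longleftrightarrow>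
     (\<forall>p\<in>pts M. X p \<in> tangent_space M p) \<and>
     (\<forall>U h. openin (mtop M) U \<and> smooth_fun (open_sub M U) h \<longrightarrow>
        smooth_fun (open_sub M U) (\<lambda>p. X p h))"

definition lie_bracket ::
    "('p, 'e::euclidean_space) mfd \<Rightarrow> ('p \<Rightarrow> 'p tvec) \<Rightarrow> ('p \<Rightarrow> 'p tvec) \<Rightarrow> 'p \<Rightarrow> 'p tvec" where
  "lie_bracket M X Y p =
     (\<lambda>h. if smooth_near M p h then X p (\<lambda>q. Y q h) - Y p (\<lambda>q. X q h) else 0)"

type_synonym 'p metric = "'p \<Rightarrow> 'p tvec \<Rightarrow> 'p tvec \<Rightarrow> real"

definition pseudo_riemannian :: "('p, 'e::euclidean_space) mfd \<Rightarrow> 'p metric \<Rightarrow> bool" where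
  "pseudo_riemannian M g \<longleftrightarrow>
     (\<forall>p\<in>pts M.
        (\<forall>u\<in>tangent_space M p. \<forall>v\<in>tangent_space M p. g p u v = g p v u) \<and>
        (\<forall>u\<in>tangent_space M p. \<forall>v\<in>tangent_space M p. \<forall>w\<in>tangent_space M p. \<forall>a b.
           g p (\<lambda>h. a * u h + b * v h) w = a * g p u w + b * g p v w) \<and>
        (\<forall>u\<in>tangent_space M p. (\<forall>v\<in>tangent_space M p. g p u v = 0) \<longrightarrow> u = (\<lambda>h. 0))) \<and>
     (\<forall>U X Y. openin (mtop M) U \<and> smooth_field (open_sub M U) X \<and> smooth_field (open_sub M U) Y \<longrightarrow>
        smooth_fun (open_sub M U) (\<lambda>p. g p (X p) (Y p)))"

definition pullback ::
    "('q, 'f::euclidean_space) mfd \<Rightarrow> ('p \<Rightarrow> 'q) \<Rightarrow> 'q metric \<Rightarrow> 'p metric" where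
  "pullback N F g = (\<lambda>p u v. g (F p) (pushforward N F p u) (pushforward N F p v))"

text \<open>
  A connection acts on vector fields defined on arbitrary open subsets.  The value
  \<open>D X Y p\<close> is only constrained where both X and Y are smooth near p; there the
  conditions below determine it uniquely (by the Koszul formula).
\<close>

type_synonym 'p connection = "('p \<Rightarrow> 'p tvec) \<Rightarrow> ('p \<Rightarrow> 'p tvec) \<Rightarrow> 'p \<Rightarrow> 'p tvec"

definition affine_connection :: "('p, 'e::euclidean_space) mfd \<Rightarrow> 'p connection \<Rightarrow> bool" where
  "affine_connection M D \<longleftrightarrow>
     (\<forall>U X Y Z k. openin (mtop M) U \<and> smooth_field (open_sub M U) X \<and>
        smooth_field (open_sub M U) Y \<and> smooth_field (open_sub M U) Z \<and>
        smooth_fun (open_sub M U) k \<longrightarrow>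
        smooth_field (open_sub M U) (D X Y) \<and>
        (\<forall>p\<in>U.
           D (\<lambda>q h. X q h + Y q h) Z p = (\<lambda>h. D X Z p h + D Y Z p h) \<and>
           D (\<lambda>q h. k q * X q h) Y p = (\<lambda>h. k p * D X Y p h) \<and>
           D X (\<lambda>q h. Y q h + Z q h) p = (\<lambda>h. D X Y p h + D X Z p h) \<and>
           D X (\<lambda>q h. k q * Y q h) p = (\<lambda>h. X p k * Y p h + k p * D X Y p h)))"

definition levi_civita ::
    "('p, 'e::euclidean_space) mfd \<Rightarrow> 'p metric \<Rightarrow> 'p connection \<Rightarrow> bool" where
  "levi_civita M g D \<longleftrightarrow> affine_connection M D \<and>
     (\<forall>U X Y Z. openin (mtop M) U \<and> smooth_field (open_sub M U) X \<and>
        smooth_field (open_sub M U) Y \<and> smooth_field (open_sub M U) Z \<longrightarrow>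
        (\<forall>p\<in>U.
           (\<lambda>h. D X Y p h - D Y X p h) = lie_bracket M X Y p \<and>
           X p (\<lambda>q. g q (Y q) (Z q)) = g p (D X Y p) (Z p) + g p (Y p) (D X Z p)))"

definition curvature ::
    "('p, 'e::euclidean_space) mfd \<Rightarrow> 'p connection \<Rightarrow>
     ('p \<Rightarrow> 'p tvec) \<Rightarrow> ('p \<Rightarrow> 'p tvec) \<Rightarrow> ('p \<Rightarrow> 'p tvec) \<Rightarrow> 'p \<Rightarrow> 'p tvec" where
  "curvature M D X Y Z p =
     (\<lambda>h. D X (D Y Z) p h - D Y (D X Z) p h - D (lie_bracket M X Y) Z p h)"

definition gram_det :: "'p metric \<Rightarrow> 'p \<Rightarrow> 'p tvec \<Rightarrow> 'p tvec \<Rightarrow> real" where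
  "gram_det g p u v = g p u u * g p v v - (g p u v)\<^sup>2"

text \<open>
  Sectional curvature of the plane spanned by X p and Y p.  Fields X and Y spanning a given plane
  exist locally, and the value depends only on that plane.  Vectors u, v span a nondegenerate
  plane if and only if \<open>gram_det g p u v\<close> is nonzero.
\<close>

definition sectional_curvature ::
    "('p, 'e::euclidean_space) mfd \<Rightarrow> 'p metric \<Rightarrow> 'p connection \<Rightarrow>
     ('p \<Rightarrow> 'p tvec) \<Rightarrow> ('p \<Rightarrow> 'p tvec) \<Rightarrow> 'p \<Rightarrow> real" where
  "sectional_curvature M g D X Y p =
     g p (curvature M D X Y Y p) (X p) / gram_det g p (X p) (Y p)"

definition constant_sectional_curvature ::
    "('p, 'e::euclidean_space) mfd \<Rightarrow> 'p metric \<Rightarrow> real \<Rightarrow> bool" where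
  "constant_sectional_curvature M g C \<longleftrightarrow>
     (\<exists>D. levi_civita M g D \<and>
       (\<forall>U X Y. openin (mtop M) U \<and> smooth_field (open_sub M U) X \<and> smooth_field (open_sub M U) Y \<longrightarrow>
          (\<forall>p\<in>U. gram_det g p (X p) (Y p) \<noteq> 0 \<longrightarrow> sectional_curvature M g D X Y p = C)))"

definition smooth_free_action ::
    "('p, 'e::euclidean_space) mfd \<Rightarrow> (real \<Rightarrow> 'p \<Rightarrow> 'p) \<Rightarrow> bool" where
  "smooth_free_action M m \<longleftrightarrow>
     smooth_map (prod_mfd (open_mfd {0<..}) M) M (\<lambda>(t, x). m t x) \<and>
     (\<forall>x\<in>pts M. m 1 x = x) \<and>
     (\<forall>a>0. \<forall>b>0. \<forall>x\<in>pts M. m (a * b) x = m a (m b x)) \<and>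
     (\<forall>a>0. \<forall>x\<in>pts M. m a x = x \<longrightarrow> a = 1)"

definition fundamental_field ::
    "('p, 'e::euclidean_space) mfd \<Rightarrow> (real \<Rightarrow> 'p \<Rightarrow> 'p) \<Rightarrow> 'p \<Rightarrow> 'p tvec" where
  "fundamental_field M m x = velocity M (\<lambda>t. m (exp t) x)"

definition homogeneous_pair ::
    "('p, 'e::euclidean_space) mfd \<Rightarrow> (real \<Rightarrow> 'p \<Rightarrow> 'p) \<Rightarrow> real \<Rightarrow> 'p metric \<Rightarrow> ('p \<Rightarrow> real) \<Rightarrow> bool" where
  "homogeneous_pair M m \<alpha> g f \<longleftrightarrow>
     pseudo_riemannian M g \<and>
     smooth_map M (open_mfd {0<..}) f \<and>
     (\<forall>t>0. \<forall>x\<in>pts M. \<forall>u\<in>tangent_space M x. \<forall>v\<in>tangent_space M x.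
        pullback M (m t) g x u v = t powr \<alpha> * g x u v) \<and>
     (\<forall>t>0. \<forall>x\<in>pts M. f (m t x) = t powr \<alpha> * f x) \<and>
     (\<forall>x\<in>pts M. \<forall>v\<in>tangent_space M x. g x (fundamental_field M m x) v = v f)"

definition \<Delta>\<^sub>1 :: "(real \<times> real \<times> real) set" where
  "\<Delta>\<^sub>1 = {(s, C1, C2). s > 0 \<and> C1 > 0}"

definition \<Delta>\<^sub>2 :: "(real \<times> real \<times> real) set" where
  "\<Delta>\<^sub>2 = {(s, C1, C2). s = 0 \<and> C1 \<ge> 0}"

definition \<Delta>\<^sub>3 :: "(real \<times> real \<times> real) set" where
  "\<Delta>\<^sub>3 = {(s, C1, C2). s < 0 \<and> C1 \<le> 0}"

text \<open>The argument \<open>\<sigma>\<close> is the sign, 1 or -1, in the exponent in the case s = 0.\<close>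

definition w :: "real \<Rightarrow> real \<Rightarrow> real \<Rightarrow> real \<Rightarrow> real \<Rightarrow> real" where
  "w \<sigma> s C1 C2 r =
     (if s > 0 then C1 / (s * (cosh (sqrt C1 * (ln r + C2)))\<^sup>2)
      else if s = 0 then exp C2 * r powr (\<sigma> * 2 * sqrt C1)
      else if C1 < 0 then C1 / (s * (sin (sqrt (- C1) * (ln r + C2)))\<^sup>2)
      else - 1 / (s * (ln r + C2)\<^sup>2))"

text \<open>The positive r at which w is defined: those at which no denominator vanishes.\<close>

definition w_dom :: "real \<Rightarrow> real \<Rightarrow> real \<Rightarrow> real set" where
  "w_dom s C1 C2 =
     {r. r > 0 \<and>
         (s < 0 \<longrightarrow> (if C1 < 0 then sin (sqrt (- C1) * (ln r + C2)) \<noteq> 0 else ln r + C2 \<noteq> 0))}"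

end

theory Submission
  imports Defs
begin

text \<open>
  Since \<open>f (m\<^sub>\<lambda> x) = \<lambda>\<^sup>\<alpha> f x\<close> and \<open>g (P, P) = \<alpha> f\<close>, the action identifies \<open>M\<close> with \<open>\<real> \<times> M\<^sub>l\<close>, the first
  coordinate being \<open>\<rho> = ln f\<close>, and in this splitting \<open>g = (f / \<alpha>) (d\<rho>\<^sup>2 + h)\<close> with \<open>h = (\<alpha> / l) g\<^sub>l\<close>
  of constant curvature \<open>C\<^sub>1 = l C\<^sub>l / \<alpha>\<close>.  Hence \<open>(v \<circ> f) g = (w / \<alpha>) (d\<rho>\<^sup>2 + h)\<close> is conformal to a
  product, and with \<open>\<theta> = w' / (2 w)\<close> its curvature is constant as soon as
  \<open>\<theta>' = \<theta>\<^sup>2 - C\<^sub>1\<close> and \<open>\<theta>\<^sup>2 = C\<^sub>1 - (C / \<alpha>) w\<close>; every branch of the definition of \<open>w\<close> solves these equations.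

  A Levi-Civita connection exists as soon as every point has a chart with Christoffel symbols,
  because the Koszul formula makes the local connections agree.
\<close>

section \<open>Calculus on relatively open subsets of a subspace\<close>

text \<open>The two equations for \<open>\<theta>\<close> come from two kinds of planes. For
  \<open>k W (d\<rho>\<^sup>2 + h)\<close>, planes containing the \<rho>-direction have curvature
  \<open>- \<theta>' / (k W)\<close> and planes tangent to the slices have
  \<open>(C1 - \<theta>\<^sup>2) / (k W)\<close>; with \<open>k = 1 / \<alpha>\<close> both are
  \<open>C\<close> under the equations. All planes are treated at once. The projection of a
  nondegenerate plane to a slice may be degenerate, where sectional curvature says nothing, so
  constant curvature is first rewritten without denominators. The splitting of \<open>g\<close>
  holds because \<open>g (P, .) = df\<close> makes P normal to the level sets and the action carries
  \<open>M\<^sub>l\<close> to the other levels, scaling the metric by \<open>f / l\<close>. No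
  metric is ever inverted. The connection of \<open>g\<^sub>l\<close> comes with the hypothesis and
  its Christoffel symbols are read off from constant fields; those of the warped metric are written
  down explicitly and checked. Charts take values in a linear subspace, so the calculus is relative
  to a subspace and derivatives are used in its directions only.\<close>

definition relopen :: "'a::euclidean_space set \<Rightarrow> 'a set \<Rightarrow> bool" where
  "relopen E S \<longleftrightarrow> subspace E \<and> openin (top_of_set E) S"

text \<open>
  Unlike a derivative within \<open>S\<close>, the directional derivative does not refer to \<open>S\<close> or \<open>E\<close>; for directions in \<open>E\<close>
  it agrees with every derivative within a relatively open subset of \<open>E\<close>.
\<close>

definition dd :: "('a::real_normed_vector \<Rightarrow> 'b::real_normed_vector) \<Rightarrow> 'a \<Rightarrow> 'a \<Rightarrow> 'b" where
  "dd f x v = vector_derivative (\<lambda>t. f (x + t *\<^sub>R v)) (at 0)"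

lemma relopenD:
  assumes "relopen E S"
  shows "subspace E" "openin (top_of_set E) S" "S \<subseteq> E"
  using assms openin_imp_subset [of "top_of_set E" S] by (auto simp: relopen_def dest: openin_imp_subset)

lemma relopen_ball:
  assumes "relopen E S" "x \<in> S"
  obtains e where "e > 0" "ball x e \<inter> E \<subseteq> S"
  using assms that openin_contains_ball [of E S] by (auto simp: relopen_def)

lemma relopen_line:
  assumes "relopen E S" "x \<in> S" "v \<in> E"
  obtains d where "d > 0" "\<And>t. \<bar>t\<bar> < d \<Longrightarrow> x + t *\<^sub>R v \<in> S"
proof -
  obtain e where e: "e > 0" "ball x e \<inter> E \<subseteq> S" using relopen_ball [OF assms(1,2)] by metis
  define d where "d = e / (norm v + 1)"
  have "d > 0" using e unfolding d_def by (simp add: add_nonneg_pos)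
  moreover have "x + t *\<^sub>R v \<in> S" if "\<bar>t\<bar> < d" for t
  proof -
    have "norm (t *\<^sub>R v) \<le> \<bar>t\<bar> * (norm v + 1)" by (simp add: algebra_simps)
    also have "\<dots> < d * (norm v + 1)" using that by (simp add: add_nonneg_pos)
    also have "\<dots> = e" unfolding d_def by (simp add: add_nonneg_eq_0_iff)
    finally have "x + t *\<^sub>R v \<in> ball x e" by (simp add: dist_norm)
    moreover have "x + t *\<^sub>R v \<in> E"
      using assms relopenD by (metis subsetD subspace_add subspace_scale)
    ultimately show ?thesis using e by blast
  qed
  ultimately show ?thesis by (rule that)
qed

lemma relopen_UNIV_iff [simp]: "relopen UNIV S \<longleftrightarrow> open S"
  by (simp add: relopen_def)

text \<open>A line through x in a direction of \<open>E\<close> stays in \<open>S\<close> for small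
  parameters, so a derivative within \<open>S\<close> restricts to a genuine two-sided derivative at
  0.\<close>

lemma has_dd:
  assumes "relopen E S" "x \<in> S" "v \<in> E" "(f has_derivative f') (at x within S)"
  shows "((\<lambda>t. f (x + t *\<^sub>R v)) has_vector_derivative f' v) (at 0)"
proof -
  obtain d where d: "d > 0" "\<And>t. \<bar>t\<bar> < d \<Longrightarrow> x + t *\<^sub>R v \<in> S"
    using relopen_line [OF assms(1-3)] by metis
  have 1: "((\<lambda>t. x + t *\<^sub>R v) has_derivative (\<lambda>h. h *\<^sub>R v)) (at 0 within ball 0 d)"
    by (auto intro!: derivative_eq_intros)
  have "(f has_derivative f') (at (x + 0 *\<^sub>R v) within ((\<lambda>t. x + t *\<^sub>R v) ` ball 0 d))"
    by (simp, rule has_derivative_subset [OF assms(4)]) (auto simp: dist_norm intro: d(2))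
  from has_derivative_in_compose [OF 1 this]
  have "((\<lambda>t. f (x + t *\<^sub>R v)) has_derivative (\<lambda>h. f' (h *\<^sub>R v))) (at 0 within ball 0 d)" .
  moreover have "at (0::real) within ball 0 d = at 0"
    by (rule at_within_open) (use d in auto)
  moreover have "(\<lambda>h. f' (h *\<^sub>R v)) = (\<lambda>h. h *\<^sub>R f' v)"
    by (rule ext) (rule linear_cmul [OF has_derivative_linear [OF assms(4)]])
  ultimately show ?thesis unfolding has_vector_derivative_def by metis
qed

lemma dd_eq:
  assumes "relopen E S" "x \<in> S" "v \<in> E" "(f has_derivative f') (at x within S)"
  shows "dd f x v = f' v"
  unfolding dd_def using has_dd [OF assms] by (rule vector_derivative_at)

lemma dd_cong:
  assumes "relopen E S" "x \<in> S" "v \<in> E" "\<And>y. y \<in> S \<Longrightarrow> f y = g y"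
  shows "dd f x v = dd g x v"
proof -
  obtain d where d: "d > 0" "\<And>t. \<bar>t\<bar> < d \<Longrightarrow> x + t *\<^sub>R v \<in> S"
    using relopen_line [OF assms(1-3)] by metis
  have "eventually (\<lambda>t. f (x + t *\<^sub>R v) = g (x + t *\<^sub>R v)) (nhds 0)"
    unfolding eventually_nhds_metric using d assms(4) by (auto simp: dist_norm)
  then show ?thesis unfolding dd_def by (intro vector_derivative_cong_eq) auto
qed

section \<open>The classes C^k expressed by directional derivatives\<close>

lemma Ck_on_cong:
  assumes "\<And>x. x \<in> S \<Longrightarrow> f x = g x"
  shows "Ck_on E k f S \<longleftrightarrow> Ck_on E k g S"
proof -
  have "(f has_derivative f') (at x within S) \<longleftrightarrow> (g has_derivative f') (at x within S)" if "x \<in> S" for x f'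
    using that assms has_derivative_transform [of x S f g] has_derivative_transform [of x S g f] by metis
  moreover have "continuous_on S f \<longleftrightarrow> continuous_on S g"
    using assms by (intro continuous_on_cong) auto
  ultimately show ?thesis
    using Ck_on.simps by (cases k) (simp_all cong: conj_cong ball_cong)
qed

text \<open>The derivative \<open>f'\<close> quantified in \<open>Ck_on\<close> is determined in the
  directions of \<open>E\<close>, where it must be \<open>dd\<close>. With this canonical choice the
  later inductions on k never have to pick derivatives.\<close>

lemma Ck_on_Suc:
  assumes "relopen E S"
  shows "Ck_on E (Suc k) f S \<longleftrightarrow>
    (\<forall>x\<in>S. f differentiable (at x within S)) \<and> (\<forall>v\<in>E. Ck_on E k (\<lambda>x. dd f x v) S)"
    (is "_ \<longleftrightarrow> ?R")
proof
  assume "Ck_on E (Suc k) f S"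
  then obtain f' where f': "\<And>x. x \<in> S \<Longrightarrow> (f has_derivative f' x) (at x within S)"
    "\<And>v. v \<in> E \<Longrightarrow> Ck_on E k (\<lambda>x. f' x v) S" by auto
  have "Ck_on E k (\<lambda>x. dd f x v) S" if "v \<in> E" for v
  proof -
    have "\<And>x. x \<in> S \<Longrightarrow> f' x v = dd f x v" using dd_eq [OF assms] f'(1) that by metis
    then show ?thesis using f'(2) [OF that] Ck_on_cong [of S "\<lambda>x. f' x v" "\<lambda>x. dd f x v"] by simp
  qed
  then show ?R using f'(1) unfolding differentiable_def by blast
next
  assume R: ?R
  then obtain f' where f': "\<And>x. x \<in> S \<Longrightarrow> (f has_derivative f' x) (at x within S)"
    unfolding differentiable_def by metis
  have "Ck_on E k (\<lambda>x. f' x v) S" if "v \<in> E" for v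
  proof -
    have "\<And>x. x \<in> S \<Longrightarrow> dd f x v = f' x v" using dd_eq [OF assms] f'(1) that by metis
    then show ?thesis using R that Ck_on_cong [of S "\<lambda>x. dd f x v" "\<lambda>x. f' x v"] by metis
  qed
  then show "Ck_on E (Suc k) f S" using f' by auto
qed

declare Ck_on.simps(2) [simp del]

lemma Ck_on_Suc_imp:
  assumes "relopen E S"
  shows "Ck_on E (Suc k) f S \<Longrightarrow> Ck_on E k f S"
proof (induction k arbitrary: f)
  case 0
  then show ?case using Ck_on_Suc [OF assms]
    by (auto simp: continuous_on_eq_continuous_within intro: differentiable_imp_continuous_within)
next
  case (Suc k)
  then show ?case using Ck_on_Suc [OF assms] by blast
qed

text \<open>Being C^k for all k is the same as being C^(k+1) for all k, because the classes
  decrease. This gives a rule for smoothness in which no k occurs.\<close>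

lemma smooth_on_iff:
  assumes "relopen E S"
  shows "smooth_on E S f \<longleftrightarrow>
    (\<forall>x\<in>S. f differentiable (at x within S)) \<and> (\<forall>v\<in>E. smooth_on E S (\<lambda>x. dd f x v))"
proof -
  have "smooth_on E S f \<longleftrightarrow> (\<forall>k. Ck_on E (Suc k) f S)"
    unfolding smooth_on_def using Ck_on_Suc_imp [OF assms] by blast
  then show ?thesis unfolding Ck_on_Suc [OF assms] smooth_on_def by auto
qed

lemma smooth_on_cong:
  assumes "\<And>x. x \<in> S \<Longrightarrow> f x = g x"
  shows "smooth_on E S f \<longleftrightarrow> smooth_on E S g"
  unfolding smooth_on_def using Ck_on_cong [of S f g] assms by blast

lemma smooth_on_imp_continuous_on: "smooth_on E S f \<Longrightarrow> continuous_on S f"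
  unfolding smooth_on_def using Ck_on.simps(1) by blast

lemma smooth_on_dd: "relopen E S \<Longrightarrow> smooth_on E S f \<Longrightarrow> v \<in> E \<Longrightarrow> smooth_on E S (\<lambda>x. dd f x v)"
  using smooth_on_iff by blast

lemma smooth_has_derivative:
  assumes "relopen E S" "smooth_on E S f" "x \<in> S"
  obtains f' where "(f has_derivative f') (at x within S)" "\<And>v. v \<in> E \<Longrightarrow> dd f x v = f' v"
  using assms smooth_on_iff dd_eq unfolding differentiable_def by metis

lemma smooth_has_dd:
  assumes "relopen E S" "smooth_on E S f" "x \<in> S" "v \<in> E"
  shows "((\<lambda>t. f (x + t *\<^sub>R v)) has_vector_derivative dd f x v) (at 0)"
  using assms smooth_has_derivative has_dd by metis

lemma dd_add:
  assumes "relopen E S" "smooth_on E S f" "x \<in> S" "a \<in> E" "b \<in> E"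
  shows "dd f x (a + b) = dd f x a + dd f x b"
proof -
  obtain f' where f': "(f has_derivative f') (at x within S)" "\<And>v. v \<in> E \<Longrightarrow> dd f x v = f' v"
    using smooth_has_derivative assms by metis
  have "a + b \<in> E" using assms relopenD subspace_add by metis
  then show ?thesis using f' assms linear_cmul [OF has_derivative_linear [OF f'(1)]]
      linear_add [OF has_derivative_linear [OF f'(1)]] by simp
qed

lemma dd_scaleR:
  assumes "relopen E S" "smooth_on E S f" "x \<in> S" "a \<in> E"
  shows "dd f x (r *\<^sub>R a) = r *\<^sub>R dd f x a"
proof -
  obtain f' where f': "(f has_derivative f') (at x within S)" "\<And>v. v \<in> E \<Longrightarrow> dd f x v = f' v"
    using smooth_has_derivative assms by metis
  have "r *\<^sub>R a \<in> E" using assms relopenD subspace_scale by metis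
  then show ?thesis using f' assms linear_cmul [OF has_derivative_linear [OF f'(1)]]
      linear_add [OF has_derivative_linear [OF f'(1)]] by simp
qed

lemma Ck_on_subset: "Ck_on E k f S \<Longrightarrow> T \<subseteq> S \<Longrightarrow> Ck_on E k f T"
proof (induction k arbitrary: f)
  case 0
  then show ?case using continuous_on_subset by auto
next
  case (Suc k)
  then obtain f' where "\<forall>x\<in>S. (f has_derivative f' x) (at x within S)" "\<forall>v\<in>E. Ck_on E k (\<lambda>x. f' x v) S"
    unfolding Ck_on.simps(2) by blast
  then show ?case unfolding Ck_on.simps(2)
    using Suc.IH Suc.prems(2) has_derivative_subset by (intro exI [of _ f']) blast
qed

lemma smooth_on_subset: "smooth_on E S f \<Longrightarrow> T \<subseteq> S \<Longrightarrow> smooth_on E T f"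
  unfolding smooth_on_def using Ck_on_subset by blast

text \<open>Near x both sets contain a ball of \<open>E\<close>, so the filters agree. This makes
  differentiability within \<open>S\<close> a local notion although \<open>S\<close> need not be
  open in the ambient space.\<close>

lemma at_within_relopen:
  assumes "relopen E S" "relopen E T" "T \<subseteq> S" "x \<in> T"
  shows "at x within S = at x within T"
proof -
  obtain e where e: "e > 0" "ball x e \<inter> E \<subseteq> T" using relopen_ball assms by metis
  have "S \<subseteq> E" "T \<subseteq> E" using relopenD(3) assms(1,2) by blast+
  then have "S \<inter> ball x e - {x} = T \<inter> ball x e - {x}" using e assms by auto
  then show ?thesis using e by (intro at_within_nhd [of x "ball x e"]) auto
qed

lemma Ck_on_local:
  assumes "relopen E S" "\<And>x. x \<in> S \<Longrightarrow> \<exists>T. relopen E T \<and> T \<subseteq> S \<and> x \<in> T \<and> Ck_on E k f T"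
  shows "Ck_on E k f S"
  using assms(2)
proof (induction k arbitrary: f)
  case 0
  show ?case unfolding Ck_on.simps continuous_on_eq_continuous_within
  proof
    fix x assume "x \<in> S"
    then obtain T where T: "relopen E T" "T \<subseteq> S" "x \<in> T" "continuous_on T f" using 0 by fastforce
    then show "continuous (at x within S) f"
      using at_within_relopen [OF assms(1) T(1,2,3)] continuous_on_eq_continuous_within by fastforce
  qed
next
  case (Suc k)
  show ?case unfolding Ck_on_Suc [OF assms(1)]
  proof (intro conjI ballI)
    fix x assume "x \<in> S"
    then obtain T where T: "relopen E T" "T \<subseteq> S" "x \<in> T" "Ck_on E (Suc k) f T" using Suc by metis
    then show "f differentiable (at x within S)"
      using at_within_relopen [OF assms(1) T(1,2,3)] Ck_on_Suc by metis
  next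
    fix v assume "v \<in> E"
    show "Ck_on E k (\<lambda>x. dd f x v) S"
      by (rule Suc.IH) (metis Suc.prems Ck_on_Suc \<open>v \<in> E\<close>)
  qed
qed

lemma smooth_on_local:
  assumes "relopen E S" "\<And>x. x \<in> S \<Longrightarrow> \<exists>T. relopen E T \<and> T \<subseteq> S \<and> x \<in> T \<and> smooth_on E T f"
  shows "smooth_on E S f"
  unfolding smooth_on_def
proof
  fix k show "Ck_on E k f S"
    by (rule Ck_on_local [OF assms(1)]) (use assms(2) in \<open>unfold smooth_on_def, blast\<close>)
qed

section \<open>Algebraic closure properties of smooth functions\<close>

lemma Ck_on_bounded_linear:
  assumes "relopen E S" "bounded_linear L"
  shows "Ck_on E k f S \<Longrightarrow> Ck_on E k (\<lambda>x. L (f x)) S"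
proof (induction k arbitrary: f)
  case 0
  then show ?case using bounded_linear.continuous_on [OF assms(2)] by auto
next
  case (Suc k)
  have df: "\<exists>f'. (f has_derivative f') (at x within S)" if "x \<in> S" for x
    using that Suc.prems Ck_on_Suc [OF assms(1)] unfolding differentiable_def by blast
  have 1: "((\<lambda>x. L (f x)) has_derivative (\<lambda>v. L (f' v))) (at x within S)"
    if "(f has_derivative f') (at x within S)" for x f'
    using bounded_linear.has_derivative [OF assms(2) that] by simp
  show ?case unfolding Ck_on_Suc [OF assms(1)]
  proof (intro conjI ballI)
    fix x assume "x \<in> S" then show "(\<lambda>x. L (f x)) differentiable (at x within S)"
      using df 1 unfolding differentiable_def by blast
  next
    fix v assume v: "v \<in> E"
    have "dd (\<lambda>x. L (f x)) x v = L (dd f x v)" if x: "x \<in> S" for x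
      using df [OF x] 1 dd_eq [OF assms(1) x v] by metis
    then show "Ck_on E k (\<lambda>x. dd (\<lambda>x. L (f x)) x v) S"
      using Suc.IH [of "\<lambda>x. dd f x v"] Suc.prems v by (simp add: Ck_on_Suc [OF assms(1)] cong: Ck_on_cong)
  qed
qed

lemma Ck_on_add:
  assumes "relopen E S"
  shows "Ck_on E k f S \<Longrightarrow> Ck_on E k g S \<Longrightarrow> Ck_on E k (\<lambda>x. f x + g x) S"
proof (induction k arbitrary: f g)
  case 0
  then show ?case by (auto intro: continuous_intros)
next
  case (Suc k)
  note A = Suc.prems[unfolded Ck_on_Suc [OF assms]]
  show ?case unfolding Ck_on_Suc [OF assms]
  proof (intro conjI ballI)
    fix x assume "x \<in> S" then show "(\<lambda>x. f x + g x) differentiable (at x within S)"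
      using A by (auto intro: derivative_intros)
  next
    fix v assume v: "v \<in> E"
    have "dd (\<lambda>x. f x + g x) x v = dd f x v + dd g x v" if x: "x \<in> S" for x
    proof -
      obtain f' g' where d: "(f has_derivative f') (at x within S)" "(g has_derivative g') (at x within S)"
        using A x unfolding differentiable_def by metis
      show ?thesis using dd_eq [OF assms x v has_derivative_add [OF d]] dd_eq [OF assms x v d(1)]
        dd_eq [OF assms x v d(2)] by simp
    qed
    then show "Ck_on E k (\<lambda>x. dd (\<lambda>x. f x + g x) x v) S"
      using Suc.IH [of "\<lambda>x. dd f x v" "\<lambda>x. dd g x v"] A v by (simp cong: Ck_on_cong)
  qed
qed

text \<open>By the Leibniz rule a derivative is a sum of two terms of the same shape with other
  arguments, so the induction leaves \<open>f\<close> and \<open>g\<close> arbitrary.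
  \<open>smooth_on_scaleR\<close> and \<open>smooth_on_mult\<close> are instances.\<close>

lemma Ck_on_bilinear:
  assumes "relopen E S" "bounded_bilinear pr"
  shows "Ck_on E k f S \<Longrightarrow> Ck_on E k g S \<Longrightarrow> Ck_on E k (\<lambda>x. pr (f x) (g x)) S"
proof (induction k arbitrary: f g)
  case 0
  then show ?case using bounded_bilinear.continuous_on [OF assms(2)] by auto
next
  case (Suc k)
  note A = Suc.prems[unfolded Ck_on_Suc [OF assms(1)]]
  have 1: "\<exists>f' g'. (f has_derivative f') (at x within S) \<and> (g has_derivative g') (at x within S) \<and>
     ((\<lambda>x. pr (f x) (g x)) has_derivative (\<lambda>v. pr (f x) (g' v) + pr (f' v) (g x))) (at x within S)"
    if "x \<in> S" for x
    using A that bounded_bilinear.FDERIV [OF assms(2)] unfolding differentiable_def by metis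
  show ?case unfolding Ck_on_Suc [OF assms(1)]
  proof (intro conjI ballI)
    fix x assume "x \<in> S" then show "(\<lambda>x. pr (f x) (g x)) differentiable (at x within S)"
      using 1 unfolding differentiable_def by metis
  next
    fix v assume v: "v \<in> E"
    have "dd (\<lambda>x. pr (f x) (g x)) x v = pr (f x) (dd g x v) + pr (dd f x v) (g x)" if x: "x \<in> S" for x
      using 1 [OF x] dd_eq [OF assms(1) x v] by metis
    moreover have "Ck_on E k (\<lambda>x. pr (f x) (dd g x v) + pr (dd f x v) (g x)) S"
    proof (rule Ck_on_add [OF assms(1)])
      have fg: "Ck_on E k f S" "Ck_on E k g S"
        using Suc.prems Ck_on_Suc_imp [OF assms(1)] by auto
      have dfg: "Ck_on E k (\<lambda>x. dd f x v) S" "Ck_on E k (\<lambda>x. dd g x v) S" using A v by auto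
      show "Ck_on E k (\<lambda>x. pr (f x) (dd g x v)) S" by (rule Suc.IH [OF fg(1) dfg(2)])
      show "Ck_on E k (\<lambda>x. pr (dd f x v) (g x)) S" by (rule Suc.IH [OF dfg(1) fg(2)])
    qed
    ultimately show "Ck_on E k (\<lambda>x. dd (\<lambda>x. pr (f x) (g x)) x v) S"
      by (simp cong: Ck_on_cong)
  qed
qed

lemma dd_const [simp]: "dd (\<lambda>x. c) x v = 0"
  unfolding dd_def by (simp add: vector_derivative_at)

lemma Ck_on_const: "relopen E S \<Longrightarrow> Ck_on E k (\<lambda>x. c) S"
proof (induction k arbitrary: c)
  case (Suc k)
  then show ?case using Ck_on_Suc [of E S k "\<lambda>x. c"] by simp
qed simp

lemma Ck_on_ident: 
  assumes "relopen E S"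
  shows "Ck_on E k (\<lambda>x. x) S"
proof (cases k)
  case (Suc l)
  have "Ck_on E l (\<lambda>x. dd (\<lambda>x. x) x v) S" if "v \<in> E" for v
  proof -
    have "dd (\<lambda>x. x) x v = v" if "x \<in> S" for x
      using dd_eq [OF assms that \<open>v \<in> E\<close> has_derivative_ident] .
    then show ?thesis using Ck_on_const [OF assms, of l v] by (simp cong: Ck_on_cong)
  qed
  then show ?thesis unfolding Suc Ck_on_Suc [OF assms] by auto
qed auto

lemma smooth_on_const [simp]: "relopen E S \<Longrightarrow> smooth_on E S (\<lambda>x. c)"
  by (simp add: smooth_on_def Ck_on_const)

lemma smooth_on_ident [simp]: "relopen E S \<Longrightarrow> smooth_on E S (\<lambda>x. x)"
  by (simp add: smooth_on_def Ck_on_ident)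

lemma smooth_on_linear: "relopen E S \<Longrightarrow> bounded_linear L \<Longrightarrow> smooth_on E S f \<Longrightarrow> smooth_on E S (\<lambda>x. L (f x))"
  by (simp add: smooth_on_def Ck_on_bounded_linear)

lemma smooth_on_add: "relopen E S \<Longrightarrow> smooth_on E S f \<Longrightarrow> smooth_on E S g \<Longrightarrow> smooth_on E S (\<lambda>x. f x + g x)"
  by (simp add: smooth_on_def Ck_on_add)

lemma smooth_on_minus: "relopen E S \<Longrightarrow> smooth_on E S f \<Longrightarrow> smooth_on E S (\<lambda>x. - f x)"
  by (rule smooth_on_linear [OF _ bounded_linear_minus [OF bounded_linear_ident]])

lemma smooth_on_diff: "relopen E S \<Longrightarrow> smooth_on E S f \<Longrightarrow> smooth_on E S g \<Longrightarrow> smooth_on E S (\<lambda>x. f x - g x)"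
  using smooth_on_add [of E S f "\<lambda>x. - g x"] smooth_on_minus by auto

lemma smooth_on_bilinear:
  "relopen E S \<Longrightarrow> bounded_bilinear pr \<Longrightarrow> smooth_on E S f \<Longrightarrow> smooth_on E S g \<Longrightarrow> smooth_on E S (\<lambda>x. pr (f x) (g x))"
  by (simp add: smooth_on_def Ck_on_bilinear)

lemma smooth_on_scaleR:
  "relopen E S \<Longrightarrow> smooth_on E S f \<Longrightarrow> smooth_on E S g \<Longrightarrow> smooth_on E S (\<lambda>x. f x *\<^sub>R g x)"
  by (rule smooth_on_bilinear [OF _ bounded_bilinear_scaleR])

lemma smooth_on_mult:
  fixes f g :: "'a::euclidean_space \<Rightarrow> real"
  shows "relopen E S \<Longrightarrow> smooth_on E S f \<Longrightarrow> smooth_on E S g \<Longrightarrow> smooth_on E S (\<lambda>x. f x * g x)"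
  by (rule smooth_on_bilinear [OF _ bounded_bilinear_mult])

lemma smooth_on_sum:
  assumes "relopen E S" "\<And>i. i \<in> I \<Longrightarrow> smooth_on E S (f i)"
  shows "smooth_on E S (\<lambda>x. \<Sum>i\<in>I. f i x)"
proof (cases "finite I")
  case True
  then show ?thesis using assms(2)
    by (induction I rule: finite_induct) (auto intro!: smooth_on_add assms(1) smooth_on_const)
qed (simp add: assms)

lemma smooth_on_Pair:
  assumes "relopen E S" "smooth_on E S f" "smooth_on E S g"
  shows "smooth_on E S (\<lambda>x. (f x, g x))"
proof -
  have "smooth_on E S (\<lambda>x. (f x, 0) + (0, g x))"
    using assms by (intro smooth_on_add smooth_on_linear [of E S "\<lambda>y. (y,0)"] smooth_on_linear [of E S "\<lambda>y. (0,y)"])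
      (auto intro!: bounded_linear_Pair bounded_linear_ident bounded_linear_zero)
  then show ?thesis by simp
qed

lemma dd_plus:
  assumes "relopen E S" "smooth_on E S f" "smooth_on E S g" "x \<in> S" "v \<in> E"
  shows "dd (\<lambda>x. f x + g x) x v = dd f x v + dd g x v"
  unfolding dd_def [of "\<lambda>x. f x + g x"]
  by (rule vector_derivative_at [OF has_vector_derivative_add])
    (use smooth_has_dd assms in blast)+

lemma dd_linear:
  assumes "relopen E S" "bounded_linear L" "smooth_on E S f" "x \<in> S" "v \<in> E"
  shows "dd (\<lambda>x. L (f x)) x v = L (dd f x v)"
  unfolding dd_def [of "\<lambda>x. L (f x)"]
  by (rule vector_derivative_at [OF bounded_linear.has_vector_derivative [OF assms(2)]])
    (use smooth_has_dd assms in blast)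

lemma dd_minus:
  assumes "relopen E S" "smooth_on E S f" "smooth_on E S g" "x \<in> S" "v \<in> E"
  shows "dd (\<lambda>x. f x - g x) x v = dd f x v - dd g x v"
  unfolding dd_def [of "\<lambda>x. f x - g x"]
  by (rule vector_derivative_at [OF has_vector_derivative_diff])
    (use smooth_has_dd assms in blast)+

lemma dd_bilinear:
  assumes "relopen E S" "bounded_bilinear pr" "smooth_on E S f" "smooth_on E S g" "x \<in> S" "v \<in> E"
  shows "dd (\<lambda>x. pr (f x) (g x)) x v = pr (f x) (dd g x v) + pr (dd f x v) (g x)"
proof -
  obtain f' where f': "(f has_derivative f') (at x within S)" "\<And>v. v \<in> E \<Longrightarrow> dd f x v = f' v"
    using smooth_has_derivative [OF assms(1,3,5)] by metis
  obtain g' where g': "(g has_derivative g') (at x within S)" "\<And>v. v \<in> E \<Longrightarrow> dd g x v = g' v"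
    using smooth_has_derivative [OF assms(1,4,5)] by metis
  show ?thesis
    using dd_eq [OF assms(1,5,6) bounded_bilinear.FDERIV [OF assms(2) f'(1) g'(1)]]
      f'(2) [OF assms(6)] g'(2) [OF assms(6)] by simp
qed

lemma dd_scaleR_fun:
  assumes "relopen E S" "smooth_on E S f" "smooth_on E S g" "x \<in> S" "v \<in> E"
  shows "dd (\<lambda>x. f x *\<^sub>R g x) x v = f x *\<^sub>R dd g x v + dd f x v *\<^sub>R g x"
  by (rule dd_bilinear [OF assms(1) bounded_bilinear_scaleR assms(2-)])

lemma dd_mult:
  fixes f g :: "'a::euclidean_space \<Rightarrow> real"
  assumes "relopen E S" "smooth_on E S f" "smooth_on E S g" "x \<in> S" "v \<in> E"
  shows "dd (\<lambda>x. f x * g x) x v = f x * dd g x v + dd f x v * g x"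
  by (rule dd_bilinear [OF assms(1) bounded_bilinear_mult assms(2-)])

lemma dd_sum:
  assumes "relopen E S" "\<And>i. i \<in> I \<Longrightarrow> smooth_on E S (f i)" "x \<in> S" "v \<in> E"
  shows "dd (\<lambda>x. \<Sum>i\<in>I. f i x) x v = (\<Sum>i\<in>I. dd (f i) x v)"
  unfolding dd_def [of "\<lambda>x. \<Sum>i\<in>I. f i x"]
  by (rule vector_derivative_at [OF has_vector_derivative_sum])
    (use smooth_has_dd assms in blast)

text \<open>\<open>B\<close> is an orthonormal basis of \<open>F\<close>. The sum is the orthogonal
  projection to \<open>F\<close>, a bounded linear map of the whole space; it is used both as a
  projection and as an expansion along finitely many fixed directions.\<close>

lemma subspace_expansion:
  fixes F :: "'a::euclidean_space set"
  assumes "subspace F"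
  obtains B where "finite B" "B \<subseteq> F" "\<And>y. y \<in> F \<Longrightarrow> (\<Sum>b\<in>B. (y \<bullet> b) *\<^sub>R b) = y"
proof -
  obtain B where B: "B \<subseteq> F" "pairwise orthogonal B" "\<And>x. x \<in> B \<Longrightarrow> norm x = 1"
    "independent B" "card B = dim F" "span B = F"
    using orthonormal_basis_subspace [OF assms] by metis
  have fin: "finite B" using B(4) by (simp add: independent_imp_finite)
  have "(\<Sum>b\<in>B. (y \<bullet> b) *\<^sub>R b) = y" if "y \<in> F" for y
  proof -
    obtain c where "(\<Sum>b\<in>B. c b *\<^sub>R b) = y"
      using \<open>y \<in> F\<close> span_finite [OF fin] B(6) by auto
    note c = this [symmetric]
    have "y \<bullet> b = c b" if "b \<in> B" for b
    proof -
      have "y \<bullet> b = (\<Sum>a\<in>B. c a * (a \<bullet> b))" unfolding c by (simp add: inner_sum_left)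
      also have "\<dots> = (\<Sum>a\<in>B. if a = b then c b else 0)"
        using B(2,3) that by (intro sum.cong) (auto simp: pairwise_def orthogonal_def norm_eq_1)
      finally show ?thesis using that fin by simp
    qed
    then show ?thesis unfolding c by (intro sum.cong) auto
  qed
  then show ?thesis using that fin B(1) by blast
qed

text \<open>On \<open>S\<close> the function equals its projection to \<open>F\<close>, and
  differentiation commutes with that bounded linear projection.\<close>

lemma dd_in_subspace:
  assumes "relopen E S" "smooth_on E S f" "subspace F" "\<And>y. y \<in> S \<Longrightarrow> f y \<in> F" "x \<in> S" "v \<in> E"
  shows "dd f x v \<in> F"
proof -
  obtain B where B: "finite B" "B \<subseteq> F" "\<And>y. y \<in> F \<Longrightarrow> (\<Sum>b\<in>B. (y \<bullet> b) *\<^sub>R b) = y"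
    using subspace_expansion [OF assms(3)] by metis
  have bl: "bounded_linear (\<lambda>y. \<Sum>b\<in>B. (y \<bullet> b) *\<^sub>R b)"
    by (intro bounded_linear_sum bounded_linear_scaleR_const bounded_linear_inner_left)
  have "dd f x v = dd (\<lambda>x. \<Sum>b\<in>B. (f x \<bullet> b) *\<^sub>R b) x v"
    using B(3) assms by (intro dd_cong [OF assms(1,5,6)]) simp
  also have "\<dots> = (\<Sum>b\<in>B. (dd f x v \<bullet> b) *\<^sub>R b)"
    using dd_linear [OF assms(1) bl assms(2,5,6)] .
  also have "\<dots> \<in> F" using B(2) assms(3) by (intro subspace_sum subspace_scale) auto
  finally show ?thesis .
qed

text \<open>\<open>g\<close> is differentiable only within \<open>T\<close>, so its directional
  derivative is controlled only along \<open>F\<close>; hence the condition that the derivative of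
  \<open>f\<close> lies in \<open>F\<close>.\<close>

lemma dd_chain:
  assumes "relopen E S" "relopen F T" "f differentiable (at x within S)" "g differentiable (at (f x) within T)"
    "f ` S \<subseteq> T" "x \<in> S" "v \<in> E" "dd f x v \<in> F"
  shows "(\<lambda>x. g (f x)) differentiable (at x within S)" "dd (\<lambda>x. g (f x)) x v = dd g (f x) (dd f x v)"
proof -
  obtain f' g' where f': "(f has_derivative f') (at x within S)" and g': "(g has_derivative g') (at (f x) within T)"
    using assms unfolding differentiable_def by blast
  have *: "((\<lambda>x. g (f x)) has_derivative (\<lambda>v. g' (f' v))) (at x within S)"
    using has_derivative_in_compose [OF f' has_derivative_subset [OF g' assms(5)]] .
  then show "(\<lambda>x. g (f x)) differentiable (at x within S)" unfolding differentiable_def by blast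
  have "f x \<in> T" using assms by blast
  show "dd (\<lambda>x. g (f x)) x v = dd g (f x) (dd f x v)"
    using dd_eq [OF assms(1,6,7) *] dd_eq [OF assms(1,6,7) f'] dd_eq [OF assms(2) \<open>f x \<in> T\<close> _ g'] assms(8)
    by simp
qed

text \<open>The induction hypothesis speaks of derivatives of \<open>g\<close> in fixed directions,
  but the chain rule differentiates \<open>g\<close> in the moving direction
  \<open>dd f x v\<close>. Expanding this direction in a fixed basis of \<open>F\<close> turns the
  derivative into a finite sum of products to which the hypothesis applies.\<close>

lemma Ck_on_compose:
  assumes ES: "relopen E S" and FT: "relopen F T" and fT: "f ` S \<subseteq> T"
    and dF: "\<And>x v. x \<in> S \<Longrightarrow> v \<in> E \<Longrightarrow> dd f x v \<in> F"
  shows "Ck_on E k f S \<Longrightarrow> Ck_on F k g T \<Longrightarrow> Ck_on E k (\<lambda>x. g (f x)) S"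
proof (induction k arbitrary: g)
  case 0
  then show ?case using continuous_on_compose2 [of T g S f] fT by simp
next
  case (Suc k)
  note A = Suc.prems [unfolded Ck_on_Suc [OF ES] Ck_on_Suc [OF FT]]
  have fk: "Ck_on E k f S" using Suc.prems Ck_on_Suc_imp [OF ES] by blast
  have chain: "(\<lambda>x. g (f x)) differentiable (at x within S)"
    "v \<in> E \<Longrightarrow> dd (\<lambda>x. g (f x)) x v = dd g (f x) (dd f x v)" if "x \<in> S" for x v
  proof -
    have *: "f differentiable (at x within S)" "g differentiable (at (f x) within T)"
      using A that fT by auto
    have "0 \<in> E" using ES relopenD(1) subspace_0 by blast
    then show "(\<lambda>x. g (f x)) differentiable (at x within S)"
      using dd_chain(1) [OF ES FT * fT that] dF [OF that] by blast
    show "v \<in> E \<Longrightarrow> dd (\<lambda>x. g (f x)) x v = dd g (f x) (dd f x v)"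
      using dd_chain(2) [OF ES FT * fT that] dF [OF that] by blast
  qed
  obtain B where B: "finite B" "B \<subseteq> F" "\<And>y. y \<in> F \<Longrightarrow> (\<Sum>b\<in>B. (y \<bullet> b) *\<^sub>R b) = y"
    using subspace_expansion relopenD(1) [OF FT] by metis
  have lin: "dd g (f x) (dd f x v) = (\<Sum>b\<in>B. (dd f x v \<bullet> b) *\<^sub>R dd g (f x) b)" if "x \<in> S" "v \<in> E" for x v
  proof -
    have fx: "f x \<in> T" using that fT by auto
    obtain g' where g': "(g has_derivative g') (at (f x) within T)"
      using A fx unfolding differentiable_def by blast
    have g'_eq: "\<And>w. w \<in> F \<Longrightarrow> dd g (f x) w = g' w" using dd_eq [OF FT fx _ g'] .
    have bl: "linear g'" using g' has_derivative_linear by blast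
    have "dd g (f x) (dd f x v) = g' (dd f x v)" using g'_eq dF that by blast
    also have "\<dots> = g' (\<Sum>b\<in>B. (dd f x v \<bullet> b) *\<^sub>R b)" using B(3) dF that by simp
    also have "\<dots> = (\<Sum>b\<in>B. (dd f x v \<bullet> b) *\<^sub>R g' b)"
      using bl by (simp add: linear_sum linear_cmul)
    also have "\<dots> = (\<Sum>b\<in>B. (dd f x v \<bullet> b) *\<^sub>R dd g (f x) b)"
      using g'_eq B(2) by (intro sum.cong) auto
    finally show ?thesis .
  qed
  show ?case unfolding Ck_on_Suc [OF ES]
  proof (intro conjI ballI)
    fix x assume "x \<in> S" then show "(\<lambda>x. g (f x)) differentiable (at x within S)" by (rule chain(1))
  next
    fix v assume v: "v \<in> E"
    have dfk: "Ck_on E k (\<lambda>x. dd f x v) S" using A v by blast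
    have "Ck_on E k (\<lambda>x. (dd f x v \<bullet> b) *\<^sub>R dd g (f x) b) S" if "b \<in> B" for b
    proof (rule Ck_on_bilinear [OF ES bounded_bilinear_scaleR])
      show "Ck_on E k (\<lambda>x. dd f x v \<bullet> b) S"
        by (rule Ck_on_bounded_linear [OF ES bounded_linear_inner_left dfk])
      show "Ck_on E k (\<lambda>x. dd g (f x) b) S"
        by (rule Suc.IH [OF fk]) (use A B(2) that in blast)
    qed
    note T = this
    have "Ck_on E k (\<lambda>x. \<Sum>b\<in>B'. (dd f x v \<bullet> b) *\<^sub>R dd g (f x) b) S" if "B' \<subseteq> B" for B'
      using finite_subset [OF that B(1)] that
    proof (induction B' rule: finite_induct)
      case (insert b B')
      then show ?case
        using T [of b] Ck_on_add [OF ES, of k "\<lambda>x. (dd f x v \<bullet> b) *\<^sub>R dd g (f x) b"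
            "\<lambda>x. \<Sum>b\<in>B'. (dd f x v \<bullet> b) *\<^sub>R dd g (f x) b"] by auto
    qed (use Ck_on_const [OF ES] in simp)
    then have "Ck_on E k (\<lambda>x. \<Sum>b\<in>B. (dd f x v \<bullet> b) *\<^sub>R dd g (f x) b) S" by blast
    then show "Ck_on E k (\<lambda>x. dd (\<lambda>x. g (f x)) x v) S"
      using chain(2) lin v by (simp cong: Ck_on_cong)
  qed
qed

lemma smooth_on_compose:
  assumes "relopen E S" "relopen F T" "smooth_on E S f" "smooth_on F T g" "f ` S \<subseteq> T"
  shows "smooth_on E S (\<lambda>x. g (f x))"
proof -
  have "dd f x v \<in> F" if "x \<in> S" "v \<in> E" for x v
    by (rule dd_in_subspace [OF assms(1,3) relopenD(1) [OF assms(2)] _ that])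
      (use assms(5) relopenD(3) [OF assms(2)] in auto)
  then show ?thesis
    using Ck_on_compose [OF assms(1,2,5)] assms(3,4) unfolding smooth_on_def by blast
qed

lemma dd_compose:
  assumes "relopen E S" "relopen F T" "smooth_on E S f" "smooth_on F T g" "f ` S \<subseteq> T" "x \<in> S" "v \<in> E"
  shows "dd (\<lambda>x. g (f x)) x v = dd g (f x) (dd f x v)"
proof -
  have "dd f x v \<in> F"
    by (rule dd_in_subspace [OF assms(1,3) relopenD(1) [OF assms(2)] _ assms(6,7)])
      (use assms(5) relopenD(3) [OF assms(2)] in auto)
  moreover have "f differentiable (at x within S)" "g differentiable (at (f x) within T)"
    using assms(3-6) smooth_on_iff [OF assms(1), of f] smooth_on_iff [OF assms(2), of g] by auto
  ultimately show ?thesis using dd_chain(2) [OF assms(1,2) _ _ assms(5,6,7)] by blast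
qed

section \<open>Elementary functions of one real variable\<close>

lemma dd_real:
  assumes "(F has_real_derivative F') (at x)"
  shows "dd F x v = v * F'"
proof -
  have "(F has_derivative (\<lambda>h. F' * h)) (at x within UNIV)"
    using assms unfolding has_field_derivative_def .
  then show ?thesis using dd_eq [of UNIV UNIV x v F] by (simp add: mult.commute)
qed

text \<open>The step of a regularity bootstrap: exp, inverse and later the solutions of differential
  equations have derivatives that are expressed by the functions themselves.\<close>

lemma Ck_on_Suc_real:
  assumes "open T" "\<And>x. x \<in> T \<Longrightarrow> (F has_real_derivative F' x) (at x)" "Ck_on UNIV k F' T"
  shows "Ck_on UNIV (Suc k) F T"
proof -
  have T: "relopen UNIV T" using assms by simp
  show ?thesis unfolding Ck_on_Suc [OF T]
  proof (intro conjI ballI)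
    fix x assume "x \<in> T" then show "F differentiable (at x within T)"
      using assms(2) has_field_derivative_at_within real_differentiable_def by blast
  next
    fix v :: real
    have "Ck_on UNIV k (\<lambda>x. v * F' x) T"
      by (rule Ck_on_bounded_linear [OF T bounded_linear_mult_right assms(3)])
    then show "Ck_on UNIV k (\<lambda>x. dd F x v) T"
      using dd_real [OF assms(2)] by (simp cong: Ck_on_cong)
  qed
qed

lemma smooth_on_exp: "smooth_on UNIV UNIV (exp :: real \<Rightarrow> real)"
proof -
  have "Ck_on UNIV k (exp :: real \<Rightarrow> real) UNIV" for k
  proof (induction k)
    case (Suc k)
    show ?case by (rule Ck_on_Suc_real [OF open_UNIV DERIV_exp Suc])
  qed (auto intro: continuous_intros)
  then show ?thesis unfolding smooth_on_def by blast
qed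

lemma smooth_on_inverse_real: "smooth_on UNIV (- {0}) (inverse :: real \<Rightarrow> real)"
proof -
  have o: "open (- {0::real})" by auto
  have "Ck_on UNIV k (inverse :: real \<Rightarrow> real) (- {0})" for k
  proof (induction k)
    case 0
    then show ?case by (auto intro!: continuous_intros)
  next
    case (Suc k)
    have "Ck_on UNIV k (\<lambda>x. inverse x * inverse x :: real) (- {0})"
      by (rule Ck_on_bilinear [OF _ bounded_bilinear_mult Suc Suc]) (simp add: o)
    then have "Ck_on UNIV k (\<lambda>x. - (inverse x * inverse x) :: real) (- {0})"
      by (intro Ck_on_bounded_linear [OF _ bounded_linear_minus [OF bounded_linear_ident]]) (auto simp: o)
    then show ?case
      by (rule Ck_on_Suc_real [OF o, rotated]) (auto intro!: derivative_eq_intros)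
  qed
  then show ?thesis unfolding smooth_on_def by blast
qed

lemma smooth_on_ln: "smooth_on UNIV {0<..} (ln :: real \<Rightarrow> real)"
proof -
  have "Ck_on UNIV k (ln :: real \<Rightarrow> real) {0<..}" for k
  proof (cases k)
    case 0
    then show ?thesis by (auto intro!: continuous_intros)
  next
    case (Suc l)
    have "smooth_on UNIV {0<..} (inverse :: real \<Rightarrow> real)"
      by (rule smooth_on_subset [OF smooth_on_inverse_real]) auto
    then have "Ck_on UNIV l inverse ({0<..} :: real set)" unfolding smooth_on_def by blast
    then show ?thesis unfolding Suc
      by (rule Ck_on_Suc_real [rotated 2]) (auto intro!: derivative_eq_intros simp: divide_inverse)
  qed
  then show ?thesis unfolding smooth_on_def by blast
qed

lemma smooth_on_comp_real:
  fixes F :: "real \<Rightarrow> real"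
  assumes "relopen E S" "smooth_on E S f" "open T" "smooth_on UNIV T F" "\<And>x. x \<in> S \<Longrightarrow> f x \<in> T"
  shows "smooth_on E S (\<lambda>x. F (f x))"
  by (rule smooth_on_compose [OF assms(1) _ assms(2,4)]) (use assms in auto)

lemma smooth_on_divide:
  fixes f g :: "'a::euclidean_space \<Rightarrow> real"
  assumes "relopen E S" "smooth_on E S f" "smooth_on E S g" "\<And>x. x \<in> S \<Longrightarrow> g x \<noteq> 0"
  shows "smooth_on E S (\<lambda>x. f x / g x)"
  unfolding divide_inverse
  by (intro smooth_on_mult assms smooth_on_comp_real [OF _ _ _ smooth_on_inverse_real]) (use assms in auto)

text \<open>A smooth family of linear maps, the model case being \<open>x \<mapsto> dd f x\<close>.
  Linearity is asked on \<open>F\<close> only, since \<open>dd f x\<close> is not controlled in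
  directions outside \<open>E\<close>.\<close>

definition linfam :: "'a::euclidean_space set \<Rightarrow> 'a set \<Rightarrow> 'b::euclidean_space set \<Rightarrow> ('a \<Rightarrow> 'b \<Rightarrow> 'c::euclidean_space) \<Rightarrow> bool" where
  "linfam E S F A \<longleftrightarrow>
     (\<forall>x\<in>S. \<forall>a\<in>F. \<forall>b\<in>F. \<forall>r. A x (a + b) = A x a + A x b \<and> A x (r *\<^sub>R a) = r *\<^sub>R A x a) \<and>
     (\<forall>a\<in>F. smooth_on E S (\<lambda>x. A x a))"

lemma linfam_dd: "relopen E S \<Longrightarrow> smooth_on E S f \<Longrightarrow> linfam E S E (\<lambda>x. dd f x)"
  unfolding linfam_def using dd_add dd_scaleR smooth_on_dd by blast

text \<open>With \<open>\<eta>\<close> expanded in a basis of \<open>F\<close> this is the Leibniz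
  rule for a finite sum of scalar functions times the functions \<open>A y b\<close>; afterwards the
  sum is folded back with \<open>\<eta>\<close> frozen at x.\<close>

lemma linfam_apply:
  assumes ES: "relopen E S" and F: "subspace F" and A: "linfam E S F A"
    and eta: "smooth_on E S \<eta>" "\<And>x. x \<in> S \<Longrightarrow> \<eta> x \<in> F"
  shows "smooth_on E S (\<lambda>x. A x (\<eta> x))"
    "x \<in> S \<Longrightarrow> v \<in> E \<Longrightarrow> dd (\<lambda>y. A y (\<eta> y)) x v = dd (\<lambda>y. A y (\<eta> x)) x v + A x (dd \<eta> x v)"
proof -
  obtain B where B: "finite B" "B \<subseteq> F" "\<And>y. y \<in> F \<Longrightarrow> (\<Sum>b\<in>B. (y \<bullet> b) *\<^sub>R b) = y"
    using subspace_expansion [OF F] by metis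
  have lin: "A y (\<Sum>b\<in>B. u b *\<^sub>R b) = (\<Sum>b\<in>B. u b *\<^sub>R A y b)" if y: "y \<in> S" for y u
  proof -
    have 0: "A y 0 = 0" using A y subspace_0 [OF F] unfolding linfam_def by (metis scaleR_zero_left)
    have "A y (\<Sum>b\<in>B'. u b *\<^sub>R b) = (\<Sum>b\<in>B'. u b *\<^sub>R A y b)" if "B' \<subseteq> B" for B'
      using finite_subset [OF that B(1)] that
    proof (induction B' rule: finite_induct)
      case (insert b B')
      have "u b *\<^sub>R b \<in> F" "(\<Sum>b\<in>B'. u b *\<^sub>R b) \<in> F"
        using insert B(2) by (auto intro!: subspace_sum [OF F] subspace_scale [OF F])
      then show ?case using insert A B(2) y unfolding linfam_def by auto
    qed (simp add: 0)
    then show ?thesis by blast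
  qed
  have exp: "A y u = (\<Sum>b\<in>B. (u \<bullet> b) *\<^sub>R A y b)" if "y \<in> S" "u \<in> F" for y u
    using lin [OF that(1), of "\<lambda>b. u \<bullet> b"] B(3) [OF that(2)] by simp
  have sA: "smooth_on E S (\<lambda>y. A y b)" if "b \<in> B" for b using A B(2) that unfolding linfam_def by blast
  have sI: "smooth_on E S (\<lambda>y. \<eta> y \<bullet> b)" for b
    by (rule smooth_on_linear [OF ES bounded_linear_inner_left eta(1)])
  have sT: "smooth_on E S (\<lambda>y. (\<eta> y \<bullet> b) *\<^sub>R A y b)" if "b \<in> B" for b
    by (rule smooth_on_scaleR [OF ES sI sA [OF that]])
  have "smooth_on E S (\<lambda>y. \<Sum>b\<in>B. (\<eta> y \<bullet> b) *\<^sub>R A y b)"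
    by (rule smooth_on_sum [OF ES sT])
  then show "smooth_on E S (\<lambda>x. A x (\<eta> x))" using exp eta(2) by (simp cong: smooth_on_cong)
  assume x: "x \<in> S" and v: "v \<in> E"
  have "dd (\<lambda>y. A y (\<eta> y)) x v = dd (\<lambda>y. \<Sum>b\<in>B. (\<eta> y \<bullet> b) *\<^sub>R A y b) x v"
    using exp eta(2) by (intro dd_cong [OF ES x v]) auto
  also have "\<dots> = (\<Sum>b\<in>B. dd (\<lambda>y. (\<eta> y \<bullet> b) *\<^sub>R A y b) x v)"
    by (rule dd_sum [OF ES sT x v])
  also have "\<dots> = (\<Sum>b\<in>B. (\<eta> x \<bullet> b) *\<^sub>R dd (\<lambda>y. A y b) x v + (dd \<eta> x v \<bullet> b) *\<^sub>R A x b)"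
    by (intro sum.cong refl)
      (simp add: dd_scaleR_fun [OF ES sI sA x v] dd_linear [OF ES bounded_linear_inner_left eta(1) x v])
  also have "\<dots> = (\<Sum>b\<in>B. (\<eta> x \<bullet> b) *\<^sub>R dd (\<lambda>y. A y b) x v) + A x (dd \<eta> x v)"
    using exp [OF x dd_in_subspace [OF ES eta(1) F eta(2) x v]] by (simp add: sum.distrib)
  also have "(\<Sum>b\<in>B. (\<eta> x \<bullet> b) *\<^sub>R dd (\<lambda>y. A y b) x v) = dd (\<lambda>y. A y (\<eta> x)) x v"
  proof -
    have "dd (\<lambda>y. A y (\<eta> x)) x v = dd (\<lambda>y. \<Sum>b\<in>B. (\<eta> x \<bullet> b) *\<^sub>R A y b) x v"
      using exp eta(2) [OF x] by (intro dd_cong [OF ES x v]) auto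
    also have "\<dots> = (\<Sum>b\<in>B. dd (\<lambda>y. (\<eta> x \<bullet> b) *\<^sub>R A y b) x v)"
      using sA by (intro dd_sum [OF ES _ x v] smooth_on_scaleR [OF ES] smooth_on_const [OF ES])
    also have "\<dots> = (\<Sum>b\<in>B. (\<eta> x \<bullet> b) *\<^sub>R dd (\<lambda>y. A y b) x v)"
      using sA by (intro sum.cong refl dd_linear [OF ES bounded_linear_scaleR_right _ x v])
    finally show ?thesis by simp
  qed
  finally show "dd (\<lambda>y. A y (\<eta> y)) x v = dd (\<lambda>y. A y (\<eta> x)) x v + A x (dd \<eta> x v)" .
qed

text \<open>The second difference of \<open>f\<close> over a parallelogram with sides
  \<open>h a\<close> and \<open>h b\<close> is, by two applications of the mean value theorem,
  \<open>h\<^sup>2\<close> times the mixed derivative in either order at some point near x. Letting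
  the parallelogram shrink, continuity of both mixed derivatives gives the claim.\<close>

lemma dd_commute_real:
  fixes f :: "'a::euclidean_space \<Rightarrow> real"
  assumes ES: "relopen E S" and f: "smooth_on E S f" and x: "x \<in> S" and a: "a \<in> E" and b: "b \<in> E"
  shows "dd (\<lambda>y. dd f y a) x b = dd (\<lambda>y. dd f y b) x a"
proof -
  have E: "subspace E" using relopenD ES by blast
  obtain e where e: "e > 0" "ball x e \<inter> E \<subseteq> S" using relopen_ball [OF ES x] by metis
  have xE: "x \<in> E" using x relopenD(3) [OF ES] by auto
  have mvt: "\<exists>y z. y \<in> ball x r \<inter> S \<and> z \<in> ball x r \<inter> S \<and> dd (\<lambda>y. dd f y a) y b = dd (\<lambda>y. dd f y b) z a"
    if "0 < r" "r \<le> e" for r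
  proof -
    \<comment> \<open>The side length keeps the closed parallelogram inside the ball of radius
      \<open>r\<close>; the summand 1 allows a = b = 0.\<close>
    define h where "h = r / (norm a + norm b + 1)"
    have pos: "norm a + norm b + 1 > 0" by (simp add: add_nonneg_pos)
    then have h: "h > 0" unfolding h_def using that by simp
    have inb: "x + s *\<^sub>R a + t *\<^sub>R b \<in> ball x r" "x + s *\<^sub>R a + t *\<^sub>R b \<in> S" if "0 \<le> s" "s \<le> h" "0 \<le> t" "t \<le> h" for s t
    proof -
      have "norm (s *\<^sub>R a + t *\<^sub>R b) \<le> s * norm a + t * norm b"
        using norm_triangle_ineq [of "s *\<^sub>R a" "t *\<^sub>R b"] that by simp
      also have "\<dots> \<le> h * norm a + h * norm b" using that by (intro add_mono mult_right_mono) auto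
      also have "\<dots> < h * (norm a + norm b + 1)" using h by (simp add: algebra_simps)
      also have "\<dots> = r" using pos unfolding h_def by simp
      finally show 1: "x + s *\<^sub>R a + t *\<^sub>R b \<in> ball x r"
        by (metis ab_group_add_class.ab_diff_conv_add_uminus add.assoc add_diff_cancel_left' dist_commute dist_norm mem_ball)
      have "x + s *\<^sub>R a + t *\<^sub>R b \<in> E" using xE a b by (intro subspace_add [OF E] subspace_scale [OF E])
      moreover have "x + s *\<^sub>R a + t *\<^sub>R b \<in> ball x e" using 1 \<open>r \<le> e\<close> by auto
      ultimately show "x + s *\<^sub>R a + t *\<^sub>R b \<in> S" using e by blast
    qed
    have line: "((\<lambda>s. k (p + s *\<^sub>R c)) has_real_derivative dd k (p + s *\<^sub>R c) c) (at s)"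
      if "smooth_on E S k" "p + s *\<^sub>R c \<in> S" "c \<in> E" for k :: "'a \<Rightarrow> real" and p c s
    proof -
      have "((\<lambda>t. k (p + s *\<^sub>R c + t *\<^sub>R c)) has_vector_derivative dd k (p + s *\<^sub>R c) c) (at 0)"
        using smooth_has_dd [OF ES that] .
      then have "((\<lambda>t. k (p + (t + s) *\<^sub>R c)) has_real_derivative dd k (p + s *\<^sub>R c) c) (at 0)"
        by (simp add: has_real_derivative_iff_has_vector_derivative algebra_simps)
      then show ?thesis using DERIV_shift [of "\<lambda>t. k (p + t *\<^sub>R c)" _ 0 s] by simp
    qed
    have mixed: "\<exists>y. y \<in> ball x r \<inter> S \<and>
      f (x + h *\<^sub>R a' + h *\<^sub>R b') - f (x + h *\<^sub>R a') - f (x + h *\<^sub>R b') + f x = h * h * dd (\<lambda>y. dd f y a') y b'"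
      if ab: "a' \<in> E" "b' \<in> E"
        "\<And>s t. 0 \<le> s \<Longrightarrow> s \<le> h \<Longrightarrow> 0 \<le> t \<Longrightarrow> t \<le> h \<Longrightarrow> x + s *\<^sub>R a' + t *\<^sub>R b' \<in> ball x r \<inter> S" for a' b'
    proof -
      \<comment> \<open>\<open>F\<close> is the difference in direction \<open>b'\<close>. The first
        mean value step differentiates it along \<open>a'\<close>, the second then acts along
        \<open>b'\<close>.\<close>
      define F where "F s = f (x + h *\<^sub>R b' + s *\<^sub>R a') - f (x + s *\<^sub>R a')" for s
      have dF: "(F has_real_derivative dd f (x + h *\<^sub>R b' + s *\<^sub>R a') a' - dd f (x + s *\<^sub>R a') a') (at s)"
        if "0 \<le> s" "s \<le> h" for s
        unfolding F_def
        using ab(3) [of s h] ab(3) [of s 0] that h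
        by (intro DERIV_diff line [OF f _ ab(1)]) (auto simp: algebra_simps)
      obtain s where s: "0 < s" "s < h" "F h - F 0 = h * (dd f (x + h *\<^sub>R b' + s *\<^sub>R a') a' - dd f (x + s *\<^sub>R a') a')"
        using MVT2 [of 0 h F, OF h dF] by auto
      have dG: "((\<lambda>t. dd f (x + s *\<^sub>R a' + t *\<^sub>R b') a') has_real_derivative dd (\<lambda>y. dd f y a') (x + s *\<^sub>R a' + t *\<^sub>R b') b') (at t)"
        if "0 \<le> t" "t \<le> h" for t
        using ab(3) [of s t] that s by (intro line smooth_on_dd [OF ES f ab(1)] ab(2)) auto
      obtain t where t: "0 < t" "t < h"
        "dd f (x + s *\<^sub>R a' + h *\<^sub>R b') a' - dd f (x + s *\<^sub>R a' + 0 *\<^sub>R b') a' = h * dd (\<lambda>y. dd f y a') (x + s *\<^sub>R a' + t *\<^sub>R b') b'"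
        using MVT2 [of 0 h "\<lambda>t. dd f (x + s *\<^sub>R a' + t *\<^sub>R b') a'", OF h dG] by auto
      have "F h - F 0 = h * (h * dd (\<lambda>y. dd f y a') (x + s *\<^sub>R a' + t *\<^sub>R b') b')"
        using s(3) t(3) by (simp add: algebra_simps)
      then show ?thesis
        using ab(3) [of s t] s t unfolding F_def
        by (intro exI [of _ "x + s *\<^sub>R a' + t *\<^sub>R b'"]) (auto simp: algebra_simps)
    qed
    obtain y where y: "y \<in> ball x r \<inter> S"
      "f (x + h *\<^sub>R a + h *\<^sub>R b) - f (x + h *\<^sub>R a) - f (x + h *\<^sub>R b) + f x = h * h * dd (\<lambda>y. dd f y a) y b"
      using mixed [OF a b] inb by blast
    have inb': "x + s *\<^sub>R b + t *\<^sub>R a \<in> ball x r \<inter> S" if "0 \<le> s" "s \<le> h" "0 \<le> t" "t \<le> h" for s t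
      using inb [of t s] that by (simp add: add_ac)
    obtain z where z: "z \<in> ball x r \<inter> S"
      "f (x + h *\<^sub>R b + h *\<^sub>R a) - f (x + h *\<^sub>R b) - f (x + h *\<^sub>R a) + f x = h * h * dd (\<lambda>y. dd f y b) z a"
      using mixed [OF b a inb'] by blast
    have "h * h * dd (\<lambda>y. dd f y a) y b = h * h * dd (\<lambda>y. dd f y b) z a"
      using y(2) z(2) by (simp add: algebra_simps)
    then have "dd (\<lambda>y. dd f y a) y b = dd (\<lambda>y. dd f y b) z a" using h by simp
    then show ?thesis using y z by blast
  qed
  have cont: "continuous_on S (\<lambda>y. dd (\<lambda>y. dd f y a) y b)" "continuous_on S (\<lambda>y. dd (\<lambda>y. dd f y b) y a)"
    using smooth_on_dd [OF ES] f a b smooth_on_imp_continuous_on by blast+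
  \<comment> \<open>Radii tending to 0 and bounded by \<open>e\<close>, so that both sequences of
    intermediate points converge to x.\<close>
  define r where "r n = e / real (Suc n)" for n
  have "\<exists>y z. y \<in> ball x (r n) \<inter> S \<and> z \<in> ball x (r n) \<inter> S \<and> dd (\<lambda>y. dd f y a) y b = dd (\<lambda>y. dd f y b) z a" for n
    using e by (intro mvt) (auto simp: r_def divide_simps)
  then obtain Y Z where YZ: "\<And>n. Y n \<in> ball x (r n) \<inter> S" "\<And>n. Z n \<in> ball x (r n) \<inter> S"
    "\<And>n. dd (\<lambda>y. dd f y a) (Y n) b = dd (\<lambda>y. dd f y b) (Z n) a" by metis
  have r0: "r \<longlonglongrightarrow> 0" unfolding r_def by (rule LIMSEQ_Suc [OF lim_const_over_n])
  have lim: "W \<longlonglongrightarrow> x" if "\<And>n. W n \<in> ball x (r n) \<inter> S" for W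
    unfolding tendsto_dist_iff [of W]
    by (rule tendsto_sandwich [OF _ _ tendsto_const r0]) (use that in \<open>auto simp: dist_commute less_imp_le\<close>)
  have "(\<lambda>n. dd (\<lambda>y. dd f y a) (Y n) b) \<longlonglongrightarrow> dd (\<lambda>y. dd f y a) x b"
    by (rule continuous_on_tendsto_compose [OF cont(1) lim [OF YZ(1)] x]) (use YZ in auto)
  moreover have "(\<lambda>n. dd (\<lambda>y. dd f y b) (Z n) a) \<longlonglongrightarrow> dd (\<lambda>y. dd f y b) x a"
    by (rule continuous_on_tendsto_compose [OF cont(2) lim [OF YZ(2)] x]) (use YZ in auto)
  ultimately show ?thesis using YZ(3) LIMSEQ_unique by simp
qed

lemma dd_commute:
  fixes f :: "'a::euclidean_space \<Rightarrow> 'b::euclidean_space"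
  assumes ES: "relopen E S" and f: "smooth_on E S f" and x: "x \<in> S" and a: "a \<in> E" and b: "b \<in> E"
  shows "dd (\<lambda>y. dd f y a) x b = dd (\<lambda>y. dd f y b) x a"
proof (rule euclidean_eqI)
  fix i :: 'b assume "i \<in> Basis"
  have *: "dd (\<lambda>y. dd f y c) x d \<bullet> i = dd (\<lambda>y. dd (\<lambda>z. f z \<bullet> i) y c) x d" if "c \<in> E" "d \<in> E" for c d
  proof -
    have "dd (\<lambda>y. dd (\<lambda>z. f z \<bullet> i) y c) x d = dd (\<lambda>y. dd f y c \<bullet> i) x d"
      by (intro dd_cong [OF ES x that(2)] dd_linear [OF ES bounded_linear_inner_left f _ that(1)])
    then show ?thesis
      using dd_linear [OF ES bounded_linear_inner_left smooth_on_dd [OF ES f that(1)] x that(2)] by simp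
  qed
  show "dd (\<lambda>y. dd f y a) x b \<bullet> i = dd (\<lambda>y. dd f y b) x a \<bullet> i"
    unfolding * [OF a b] * [OF b a]
    by (rule dd_commute_real [OF ES smooth_on_linear [OF ES bounded_linear_inner_left f] x a b])
qed

section \<open>Charts and smooth maps\<close>

text \<open>The conditions of \<open>smooth_manifold\<close> that concern the atlas and its model.
  They pass to open subsets, to relatively open sets of a subspace and to hypersurfaces by chart
  arguments alone, so everything below can be applied to those as well.\<close>

definition pmfd :: "('p, 'e::euclidean_space) mfd \<Rightarrow> bool" where
  "pmfd M \<longleftrightarrow> subspace (model M) \<and> (\<forall>c\<in>atlas M. is_chart M c) \<and> pts M = (\<Union>c\<in>atlas M. fst c) \<and>
     (\<forall>c\<in>atlas M. \<forall>d\<in>atlas M. compatible M c d)"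

lemma smooth_manifold_pmfd: "smooth_manifold M \<Longrightarrow> pmfd M"
  unfolding smooth_manifold_def pmfd_def by blast

lemma pmfd_subspace: "pmfd M \<Longrightarrow> subspace (model M)"
  unfolding pmfd_def by blast

lemma relopen_preimage:
  assumes "relopen E S" "continuous_on S f" "relopen F T" "f ` S \<subseteq> F"
  shows "relopen E {x \<in> S. f x \<in> T}"
proof -
  obtain T' where T': "open T'" "T = F \<inter> T'" using assms(3) unfolding relopen_def openin_open by blast
  have "{x \<in> S. f x \<in> T} = S \<inter> f -` T'" using T' assms(4) by auto
  moreover have "openin (top_of_set S) (S \<inter> f -` T')"
    using continuous_openin_preimage_gen [OF assms(2) T'(1)] .
  ultimately show ?thesis using assms(1) openin_trans unfolding relopen_def by metis
qed

lemma is_chartD: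
  assumes "is_chart M (U, \<phi>)"
  shows "openin (mtop M) U" "U \<subseteq> pts M" "openin (top_of_set (model M)) (\<phi> ` U)" "inj_on \<phi> U"
    "\<phi> ` U \<subseteq> model M"
proof -
  show U: "openin (mtop M) U" "openin (top_of_set (model M)) (\<phi> ` U)"
    using assms unfolding is_chart_def by auto
  show "U \<subseteq> pts M" using U(1) openin_subset by blast
  show "\<phi> ` U \<subseteq> model M" using U(2) openin_imp_subset by blast
  have "inj_on \<phi> (topspace (subtopology (mtop M) U))"
    using assms homeomorphic_imp_injective_map unfolding is_chart_def by blast
  then show "inj_on \<phi> U" using \<open>U \<subseteq> pts M\<close> by (simp add: topspace_subtopology Int_absorb1)
qed

text \<open>With \<open>is_chartI\<close> this trades the homeomorphism in \<open>is_chart\<close>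
  for injectivity and a correspondence of open sets, which is stable under restriction.\<close>

lemma is_chart_open_iff:
  assumes "is_chart M (U, \<phi>)" "subspace (model M)" "V \<subseteq> U"
  shows "openin (mtop M) V \<longleftrightarrow> relopen (model M) (\<phi> ` V)"
proof -
  note c = is_chartD [OF assms(1)]
  have hom: "homeomorphic_map (subtopology (mtop M) U) (top_of_set (\<phi> ` U)) \<phi>"
    using assms unfolding is_chart_def by auto
  have "V \<subseteq> topspace (subtopology (mtop M) U)" using assms(3) c by auto
  from homeomorphic_map_openness [OF hom this]
  have "openin (top_of_set (\<phi> ` U)) (\<phi> ` V) \<longleftrightarrow> openin (mtop M) V"
    using assms(3) by (simp add: openin_open_subtopology [OF c(1)])
  moreover have "openin (top_of_set (\<phi> ` U)) (\<phi> ` V) \<longleftrightarrow> openin (top_of_set (model M)) (\<phi> ` V)"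
    using openin_trans [OF _ c(3)] openin_subset_trans [of "model M" "\<phi> ` V" "\<phi> ` U"] c(5) assms(3)
    by blast
  ultimately show ?thesis using assms(2) unfolding relopen_def by blast
qed

lemma is_chartI:
  assumes "openin (mtop M) U" "inj_on \<phi> U"
    "\<And>V. V \<subseteq> U \<Longrightarrow> openin (mtop M) V \<longleftrightarrow> relopen (model M) (\<phi> ` V)"
  shows "is_chart M (U, \<phi>)"
proof -
  have U: "relopen (model M) (\<phi> ` U)" using assms by blast
  have top: "topspace (subtopology (mtop M) U) = U" using openin_subset [OF assms(1)] by auto
  have o: "openin (subtopology (mtop M) U) V \<longleftrightarrow> openin (top_of_set (\<phi> ` U)) (\<phi> ` V)" if "V \<subseteq> U" for V
  proof -
    have "openin (top_of_set (\<phi> ` U)) (\<phi> ` V) \<longleftrightarrow> openin (top_of_set (model M)) (\<phi> ` V)"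
      using openin_trans [OF _ relopenD(2) [OF U]] openin_subset_trans [of "model M" "\<phi> ` V" "\<phi> ` U"]
        relopenD(3) [OF U] that by blast
    then show ?thesis using assms(3) [OF that] that U
      by (simp add: openin_open_subtopology [OF assms(1)] relopen_def)
  qed
  have "homeomorphic_map (subtopology (mtop M) U) (top_of_set (\<phi> ` U)) \<phi>"
  proof (rule bijective_open_imp_homeomorphic_map)
    show "continuous_map (subtopology (mtop M) U) (top_of_set (\<phi> ` U)) \<phi>"
      unfolding continuous_map_def top
    proof (intro conjI allI impI)
      fix W assume W: "openin (top_of_set (\<phi> ` U)) W"
      have "W \<subseteq> \<phi> ` U" using W openin_imp_subset by blast
      then have "\<phi> ` {x \<in> U. \<phi> x \<in> W} = W" by blast
      then show "openin (subtopology (mtop M) U) {x \<in> U. \<phi> x \<in> W}"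
        using W o [of "{x \<in> U. \<phi> x \<in> W}"] by (metis (no_types, lifting) mem_Collect_eq subsetI)
    qed simp
    show "open_map (subtopology (mtop M) U) (top_of_set (\<phi> ` U)) \<phi>"
      unfolding open_map_def using o openin_subset top by metis
  qed (use assms(2) top in auto)
  then show ?thesis using assms(1) U unfolding is_chart_def relopen_def by auto
qed

lemma is_chart_restrict:
  assumes "is_chart M (U, \<phi>)" "subspace (model M)" "openin (mtop M) V" "V \<subseteq> U"
  shows "is_chart M (V, \<phi>)"
  using is_chartD(4) [OF assms(1)] assms is_chart_open_iff [OF assms(1,2)]
  by (intro is_chartI) (auto intro: inj_on_subset)

lemma max_atlas_chart: "(U, \<phi>) \<in> maximal_atlas M \<Longrightarrow> is_chart M (U, \<phi>)"
  unfolding maximal_atlas_def by auto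

lemma max_chart:
  assumes "pmfd M" "(U, \<phi>) \<in> maximal_atlas M"
  shows "openin (mtop M) U" "U \<subseteq> pts M" "inj_on \<phi> U" "relopen (model M) (\<phi> ` U)" "\<phi> ` U \<subseteq> model M"
    "\<And>V. V \<subseteq> U \<Longrightarrow> openin (mtop M) V \<longleftrightarrow> relopen (model M) (\<phi> ` V)"
  using is_chartD [OF max_atlas_chart [OF assms(2)]] is_chart_open_iff [OF max_atlas_chart [OF assms(2)]]
    pmfd_subspace [OF assms(1)] unfolding relopen_def by auto

text \<open>Restricting a chart changes the term for its inverse; this allows the inverse of the
  larger chart to be kept in coordinate expressions.\<close>

lemma inv_into_sub: "inj_on \<phi> U \<Longrightarrow> V \<subseteq> U \<Longrightarrow> x \<in> \<phi> ` V \<Longrightarrow> inv_into V \<phi> x = inv_into U \<phi> x"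
  by (metis f_inv_into_f inv_into_f_f inj_on_subset inv_into_into subsetD)

lemma atlas_max: "pmfd M \<Longrightarrow> c \<in> atlas M \<Longrightarrow> c \<in> maximal_atlas M"
  unfolding pmfd_def maximal_atlas_def by auto

lemma pmfd_cover:
  assumes "pmfd M" "p \<in> pts M"
  obtains U \<phi> where "(U, \<phi>) \<in> atlas M" "(U, \<phi>) \<in> maximal_atlas M" "p \<in> U"
proof -
  have "p \<in> (\<Union>c\<in>atlas M. fst c)" using assms unfolding pmfd_def by blast
  then obtain c where "c \<in> atlas M" "p \<in> fst c" by blast
  then show ?thesis using that [of "fst c" "snd c"] atlas_max [OF assms(1)] by simp
qed

lemma chart_img_Int:
  assumes "pmfd M" "(U, \<phi>) \<in> maximal_atlas M" "openin (mtop M) V"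
  shows "relopen (model M) (\<phi> ` (U \<inter> V))"
  using max_chart [OF assms(1,2)] assms(3) by (metis Int_lower1 openin_Int)

text \<open>By definition, members of \<open>maximal_atlas M\<close> are compatible with the charts
  of the atlas. Near each point one passes through such a chart, where both transition maps are
  smooth, and composes them.\<close>

lemma max_compatible:
  assumes M: "pmfd M" and U: "(U, \<phi>) \<in> maximal_atlas M" and V: "(V, \<psi>) \<in> maximal_atlas M"
  shows "smooth_on (model M) (\<phi> ` (U \<inter> V)) (\<lambda>x. \<psi> (inv_into U \<phi> x))"
proof (rule smooth_on_local)
  show "relopen (model M) (\<phi> ` (U \<inter> V))" using chart_img_Int [OF M U max_chart(1) [OF M V]] .
  fix x assume "x \<in> \<phi> ` (U \<inter> V)"
  then obtain p where p: "p \<in> U" "p \<in> V" "x = \<phi> p" by blast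
  obtain W \<zeta> where W: "(W, \<zeta>) \<in> atlas M" "(W, \<zeta>) \<in> maximal_atlas M" "p \<in> W"
    using pmfd_cover [OF M, of p] max_chart(2) [OF M U] p by blast
  define O' where "O' = U \<inter> V \<inter> W"
  have o: "openin (mtop M) O'" unfolding O'_def using max_chart(1) M U V W by (metis openin_Int)
  have rO: "relopen (model M) (\<phi> ` O')" using max_chart(6) [OF M U, of O'] o O'_def by blast
  have rW: "relopen (model M) (\<zeta> ` (W \<inter> V))" using chart_img_Int [OF M W(2) max_chart(1) [OF M V]] .
  have 1: "smooth_on (model M) (\<phi> ` (U \<inter> W)) (\<zeta> \<circ> inv_into U \<phi>)"
    using U W(1) unfolding maximal_atlas_def compatible_def by blast
  have 1: "smooth_on (model M) (\<phi> ` O') (\<zeta> \<circ> inv_into U \<phi>)"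
    by (rule smooth_on_subset [OF 1]) (auto simp: O'_def)
  have 2: "smooth_on (model M) (\<zeta> ` (W \<inter> V)) (\<psi> \<circ> inv_into W \<zeta>)"
    using V W(1) unfolding maximal_atlas_def compatible_def by (force simp: Int_commute)
  have inj: "inj_on \<phi> U" "inj_on \<zeta> W" using max_chart(3) M U W by auto
  have "smooth_on (model M) (\<phi> ` O') (\<lambda>x. (\<psi> \<circ> inv_into W \<zeta>) ((\<zeta> \<circ> inv_into U \<phi>) x))"
    by (rule smooth_on_compose [OF rO rW 1 2]) (use inj in \<open>auto simp: O'_def\<close>)
  moreover have "(\<psi> \<circ> inv_into W \<zeta>) ((\<zeta> \<circ> inv_into U \<phi>) x) = \<psi> (inv_into U \<phi> x)" if "x \<in> \<phi> ` O'" for x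
    using that inj by (auto simp: O'_def)
  ultimately have "smooth_on (model M) (\<phi> ` O') (\<lambda>x. \<psi> (inv_into U \<phi> x))"
    by (simp cong: smooth_on_cong)
  then show "\<exists>T. relopen (model M) T \<and> T \<subseteq> \<phi> ` (U \<inter> V) \<and> x \<in> T \<and> smooth_on (model M) T (\<lambda>x. \<psi> (inv_into U \<phi> x))"
    using rO p W by (intro exI [of _ "\<phi> ` O'"]) (auto simp: O'_def)
qed

lemma compatibleI_max:
  assumes M: "pmfd M" and U: "(U, \<phi>) \<in> maximal_atlas M" and V: "(V, \<psi>) \<in> maximal_atlas M"
  shows "compatible M (U, \<phi>) (V, \<psi>)"
  using max_compatible [OF assms] max_compatible [OF M V U]
  unfolding compatible_def by (simp add: comp_def Int_commute)

lemma max_restrict: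
  assumes M: "pmfd M" and U: "(U, \<phi>) \<in> maximal_atlas M" and V: "openin (mtop M) V" "V \<subseteq> U"
  shows "(V, \<phi>) \<in> maximal_atlas M"
  unfolding maximal_atlas_def
proof (clarify, intro conjI ballI)
  show "is_chart M (V, \<phi>)"
    using is_chart_restrict [OF max_atlas_chart [OF U] pmfd_subspace [OF M] V] .
  fix d assume d: "d \<in> atlas M"
  obtain W \<zeta> where W: "d = (W, \<zeta>)" by fastforce
  have Wm: "(W, \<zeta>) \<in> maximal_atlas M" using atlas_max [OF M] d W by blast
  have inj: "inj_on \<phi> U" using max_chart(3) M U by auto
  have "smooth_on (model M) (\<phi> ` (V \<inter> W)) (\<lambda>x. \<zeta> (inv_into U \<phi> x))"
    by (rule smooth_on_subset [OF max_compatible [OF M U Wm]]) (use V in auto)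
  moreover have "inv_into V \<phi> x = inv_into U \<phi> x" if "x \<in> \<phi> ` (V \<inter> W)" for x
    using that by (intro inv_into_sub [OF inj V(2)]) auto
  ultimately have 1: "smooth_on (model M) (\<phi> ` (V \<inter> W)) (\<lambda>x. \<zeta> (inv_into V \<phi> x))"
    by (simp cong: smooth_on_cong)
  have 2: "smooth_on (model M) (\<zeta> ` (W \<inter> V)) (\<lambda>x. \<phi> (inv_into W \<zeta> x))"
    by (rule smooth_on_subset [OF max_compatible [OF M Wm U]]) (use V in auto)
  show "compatible M (V, \<phi>) d" unfolding W compatible_def using 1 2 by (simp add: comp_def Int_commute)
qed

text \<open>A pointwise form of \<open>smooth_map\<close>, in charts shrunk so that \<open>F\<close>
  maps one into the other. Composition, restriction and gluing then need no preimages, and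
  \<open>smooth_map_iff\<close> leads back.\<close>

definition smooth_at ::
    "('p, 'e::euclidean_space) mfd \<Rightarrow> ('q, 'f::euclidean_space) mfd \<Rightarrow> ('p \<Rightarrow> 'q) \<Rightarrow> 'p \<Rightarrow> bool" where
  "smooth_at M N F p \<longleftrightarrow> (\<exists>U \<phi> V \<psi>. (U, \<phi>) \<in> maximal_atlas M \<and> (V, \<psi>) \<in> maximal_atlas N \<and>
     p \<in> U \<and> F ` U \<subseteq> V \<and> smooth_on (model M) (\<phi> ` U) (\<lambda>x. \<psi> (F (inv_into U \<phi> x))))"

lemma smooth_atI:
  assumes "pmfd M" "(U, \<phi>) \<in> maximal_atlas M" "(V, \<psi>) \<in> maximal_atlas N" "openin (mtop M) O'" "O' \<subseteq> U"
    "p \<in> O'" "F ` O' \<subseteq> V" "smooth_on (model M) (\<phi> ` O') (\<lambda>x. \<psi> (F (inv_into U \<phi> x)))"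
  shows "smooth_at M N F p"
proof -
  have "smooth_on (model M) (\<phi> ` O') (\<lambda>x. \<psi> (F (inv_into O' \<phi> x)))"
    using assms(8) inv_into_sub [OF max_chart(3) [OF assms(1,2)] assms(5)] by (simp cong: smooth_on_cong)
  then show ?thesis unfolding smooth_at_def
    using max_restrict [OF assms(1,2,4,5)] assms by blast
qed

text \<open>Independence of the charts: \<open>O'\<close> is the set where the given charts and the
  witnessing ones are all available, and there the new coordinate expression is the old one between
  two transition maps.\<close>

lemma smooth_at_chart:
  assumes M: "pmfd M" and N: "pmfd N" and F: "smooth_at M N F p"
    and U': "(U', \<phi>') \<in> maximal_atlas M" "p \<in> U'" and V': "(V', \<psi>') \<in> maximal_atlas N" "F p \<in> V'"
  obtains O' where "openin (mtop M) O'" "p \<in> O'" "O' \<subseteq> U'" "F ` O' \<subseteq> V'"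
    "smooth_on (model M) (\<phi>' ` O') (\<lambda>x. \<psi>' (F (inv_into U' \<phi>' x)))"
proof -
  obtain U \<phi> V \<psi> where U: "(U, \<phi>) \<in> maximal_atlas M" "p \<in> U" and V: "(V, \<psi>) \<in> maximal_atlas N"
    and FU: "F ` U \<subseteq> V" and s: "smooth_on (model M) (\<phi> ` U) (\<lambda>x. \<psi> (F (inv_into U \<phi> x)))"
    using F unfolding smooth_at_def by blast
  note cU = max_chart [OF M U(1)] and cV = max_chart [OF N V] and cU' = max_chart [OF M U'(1)]
    and cV' = max_chart [OF N V'(1)]
  define O' where "O' = {q \<in> U \<inter> U'. F q \<in> V'}"
  have rUU: "relopen (model M) (\<phi> ` (U \<inter> U'))" using chart_img_Int [OF M U(1) cU'(1)] .
  have rVV: "relopen (model N) (\<psi> ` (V \<inter> V'))" using chart_img_Int [OF N V cV'(1)] .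
  have s1: "smooth_on (model M) (\<phi> ` (U \<inter> U')) (\<lambda>x. \<psi> (F (inv_into U \<phi> x)))"
    by (rule smooth_on_subset [OF s]) auto
  have "relopen (model M) {x \<in> \<phi> ` (U \<inter> U'). \<psi> (F (inv_into U \<phi> x)) \<in> \<psi> ` (V \<inter> V')}"
    by (rule relopen_preimage [OF rUU smooth_on_imp_continuous_on [OF s1] rVV])
      (use FU cU(3) cV(5) in \<open>auto simp: image_subset_iff\<close>)
  also have "{x \<in> \<phi> ` (U \<inter> U'). \<psi> (F (inv_into U \<phi> x)) \<in> \<psi> ` (V \<inter> V')} = \<phi> ` O'"
  proof -
    have "\<psi> (F q) \<in> \<psi> ` (V \<inter> V') \<longleftrightarrow> F q \<in> V'" if "q \<in> U" for q
      using inj_onD [OF cV(3)] FU that by (auto simp: image_iff)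
    then have "{q \<in> U \<inter> U'. \<psi> (F q) \<in> \<psi> ` (V \<inter> V')} = O'" unfolding O'_def by blast
    moreover have "{x \<in> \<phi> ` (U \<inter> U'). \<psi> (F (inv_into U \<phi> x)) \<in> \<psi> ` (V \<inter> V')} =
        \<phi> ` {q \<in> U \<inter> U'. \<psi> (F q) \<in> \<psi> ` (V \<inter> V')}"
      using inv_into_f_f [OF cU(3)] by (auto simp del: image_Int)
    ultimately show ?thesis by simp
  qed
  finally have rO: "relopen (model M) (\<phi> ` O')" .
  then have o: "openin (mtop M) O'" using cU(6) [of O'] unfolding O'_def by blast
  have rO': "relopen (model M) (\<phi>' ` O')" using cU'(6) [of O'] o unfolding O'_def by blast
  have t1: "smooth_on (model M) (\<phi>' ` O') (\<lambda>x. \<phi> (inv_into U' \<phi>' x))"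
    by (rule smooth_on_subset [OF max_compatible [OF M U'(1) U(1)]])
      (auto simp: O'_def)
  have t2: "smooth_on (model M) (\<phi> ` O') (\<lambda>x. \<psi> (F (inv_into U \<phi> x)))"
    by (rule smooth_on_subset [OF s]) (auto simp: O'_def)
  have t3: "smooth_on (model N) (\<psi> ` (V \<inter> V')) (\<lambda>x. \<psi>' (inv_into V \<psi> x))"
    using max_compatible [OF N V V'(1)] .
  have t4: "smooth_on (model M) (\<phi>' ` O') (\<lambda>x. \<psi> (F (inv_into U \<phi> (\<phi> (inv_into U' \<phi>' x)))))"
    by (rule smooth_on_compose [OF rO' rO t1 t2]) (use cU'(3) in \<open>auto simp: O'_def\<close>)
  have "smooth_on (model M) (\<phi>' ` O') (\<lambda>x. \<psi>' (inv_into V \<psi> (\<psi> (F (inv_into U \<phi> (\<phi> (inv_into U' \<phi>' x)))))))"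
    by (rule smooth_on_compose [OF rO' rVV t4 t3]) (use cU'(3) cU(3) FU in \<open>auto simp: O'_def\<close>)
  moreover have "\<psi>' (inv_into V \<psi> (\<psi> (F (inv_into U \<phi> (\<phi> (inv_into U' \<phi>' x)))))) = \<psi>' (F (inv_into U' \<phi>' x))"
    if "x \<in> \<phi>' ` O'" for x
  proof -
    obtain q where q: "q \<in> U" "q \<in> U'" "x = \<phi>' q" using \<open>x \<in> \<phi>' ` O'\<close> unfolding O'_def by auto
    then have "F q \<in> V" using FU by auto
    then show ?thesis using q cU(3) cU'(3) cV(3) by simp
  qed
  ultimately have "smooth_on (model M) (\<phi>' ` O') (\<lambda>x. \<psi>' (F (inv_into U' \<phi>' x)))"
    by (simp cong: smooth_on_cong)
  then show ?thesis using that [OF o] U U' V' unfolding O'_def by auto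
qed

lemma smooth_at_cong:
  assumes M: "pmfd M" and N: "pmfd N" and F: "smooth_at M N F p"
    and W: "openin (mtop M) W" "p \<in> W" "\<And>q. q \<in> W \<Longrightarrow> F q = G q"
  shows "smooth_at M N G p"
proof -
  obtain U \<phi> V \<psi> where U: "(U, \<phi>) \<in> maximal_atlas M" "p \<in> U" and V: "(V, \<psi>) \<in> maximal_atlas N"
    and FU: "F ` U \<subseteq> V" and s: "smooth_on (model M) (\<phi> ` U) (\<lambda>x. \<psi> (F (inv_into U \<phi> x)))"
    using F unfolding smooth_at_def by blast
  note cU = max_chart [OF M U(1)]
  have "smooth_on (model M) (\<phi> ` (U \<inter> W)) (\<lambda>x. \<psi> (F (inv_into U \<phi> x)))"
    by (rule smooth_on_subset [OF s]) auto
  moreover have "F (inv_into U \<phi> x) = G (inv_into U \<phi> x)" if "x \<in> \<phi> ` (U \<inter> W)" for x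
    using that W(3) cU(3) by auto
  ultimately have "smooth_on (model M) (\<phi> ` (U \<inter> W)) (\<lambda>x. \<psi> (G (inv_into U \<phi> x)))"
    by (simp cong: smooth_on_cong)
  moreover have "G ` (U \<inter> W) \<subseteq> V" using FU W(3) by auto
  ultimately show ?thesis
    using smooth_atI [OF M U(1) V openin_Int [OF cU(1) W(1)]] U W by blast
qed

lemma smooth_at_compose:
  assumes M: "pmfd M" and N: "pmfd N" and L: "pmfd L"
    and F: "smooth_at M N F p" and G: "smooth_at N L G (F p)"
  shows "smooth_at M L (\<lambda>x. G (F x)) p"
proof -
  obtain U \<phi> V \<psi> where U: "(U, \<phi>) \<in> maximal_atlas N" "F p \<in> U" and V: "(V, \<psi>) \<in> maximal_atlas L"
    and FU: "G ` U \<subseteq> V" and s: "smooth_on (model N) (\<phi> ` U) (\<lambda>x. \<psi> (G (inv_into U \<phi> x)))"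
    using G unfolding smooth_at_def by blast
  obtain W \<zeta> where W: "(W, \<zeta>) \<in> maximal_atlas M" "p \<in> W" using F unfolding smooth_at_def by blast
  note cU = max_chart [OF N U(1)] and cW = max_chart [OF M W(1)]
  obtain O' where O': "openin (mtop M) O'" "p \<in> O'" "O' \<subseteq> W" "F ` O' \<subseteq> U"
    "smooth_on (model M) (\<zeta> ` O') (\<lambda>x. \<phi> (F (inv_into W \<zeta> x)))"
    using smooth_at_chart [OF M N F W U] by metis
  have rO: "relopen (model M) (\<zeta> ` O')" using cW(6) O' by blast
  have "smooth_on (model M) (\<zeta> ` O') (\<lambda>x. \<psi> (G (inv_into U \<phi> (\<phi> (F (inv_into W \<zeta> x))))))"
    by (rule smooth_on_compose [OF rO cU(4) O'(5) s]) (use O' cW(3) in \<open>auto simp: subset_iff image_subset_iff\<close>)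
  moreover have "inv_into U \<phi> (\<phi> (F (inv_into W \<zeta> x))) = F (inv_into W \<zeta> x)" if "x \<in> \<zeta> ` O'" for x
  proof -
    obtain q where "q \<in> O'" "x = \<zeta> q" using \<open>x \<in> \<zeta> ` O'\<close> by auto
    moreover have "F q \<in> U" using O' calculation by auto
    moreover have "q \<in> W" using O' calculation by auto
    ultimately show ?thesis using cU(3) cW(3) by simp
  qed
  ultimately have "smooth_on (model M) (\<zeta> ` O') (\<lambda>x. \<psi> (G (F (inv_into W \<zeta> x))))"
    by (simp cong: smooth_on_cong)
  then show ?thesis by (rule smooth_atI [OF M W(1) V O'(1,3,2), rotated]) (use O' FU in auto)
qed

lemma smooth_at_nbhd:
  assumes M: "pmfd M" and N: "pmfd N" and F: "smooth_at M N F p" and V: "openin (mtop N) V" "F p \<in> V"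
  obtains O' where "openin (mtop M) O'" "p \<in> O'" "F ` O' \<subseteq> V" "\<And>q. q \<in> O' \<Longrightarrow> smooth_at M N F q"
proof -
  have "F p \<in> pts N" using V openin_subset by blast
  then obtain W \<zeta> where W: "(W, \<zeta>) \<in> maximal_atlas N" "F p \<in> W" using pmfd_cover [OF N] by metis
  have WV: "(W \<inter> V, \<zeta>) \<in> maximal_atlas N"
    using max_restrict [OF N W(1)] V max_chart(1) [OF N W(1)] by auto
  obtain U \<phi> where U: "(U, \<phi>) \<in> maximal_atlas M" "p \<in> U" using F unfolding smooth_at_def by blast
  obtain O' where O': "openin (mtop M) O'" "p \<in> O'" "O' \<subseteq> U" "F ` O' \<subseteq> W \<inter> V"
    "smooth_on (model M) (\<phi> ` O') (\<lambda>x. \<zeta> (F (inv_into U \<phi> x)))"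
    using smooth_at_chart [OF M N F U WV] W V by blast
  have "smooth_at M N F q" if "q \<in> O'" for q
    using smooth_atI [OF M U(1) WV O'(1,3) that O'(4,5)] .
  then show ?thesis using that O' by blast
qed

text \<open>\<open>smooth_map\<close> also demands continuity. In the converse direction it comes
  from \<open>smooth_at_nbhd\<close>, since smoothness at a point yields a neighbourhood mapped into
  any given open set.\<close>

lemma smooth_map_iff:
  assumes M: "pmfd M" and N: "pmfd N"
  shows "smooth_map M N F \<longleftrightarrow> (\<forall>p\<in>pts M. smooth_at M N F p)"
proof
  assume F: "smooth_map M N F"
  show "\<forall>p\<in>pts M. smooth_at M N F p"
  proof
    fix p assume p: "p \<in> pts M"
    have cont: "continuous_map (mtop M) (mtop N) F" using F unfolding smooth_map_def by blast
    have "F p \<in> pts N" using p cont unfolding continuous_map_def by blast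
    then obtain V \<psi> where V: "(V, \<psi>) \<in> atlas N" "(V, \<psi>) \<in> maximal_atlas N" "F p \<in> V"
      using pmfd_cover [OF N] by metis
    obtain U \<phi> where U: "(U, \<phi>) \<in> atlas M" "(U, \<phi>) \<in> maximal_atlas M" "p \<in> U"
      using pmfd_cover [OF M p] by metis
    have "openin (mtop M) {x \<in> pts M. F x \<in> V}"
      using cont max_chart(1) [OF N V(2)] unfolding continuous_map_def by blast
    then have "openin (mtop M) (U \<inter> {x \<in> pts M. F x \<in> V})"
      using max_chart(1) [OF M U(2)] by blast
    also have "U \<inter> {x \<in> pts M. F x \<in> V} = {x \<in> U. F x \<in> V}" using max_chart(2) [OF M U(2)] by auto
    finally have o: "openin (mtop M) {x \<in> U. F x \<in> V}" .
    have "smooth_on (model M) (\<phi> ` {x\<in>U. F x \<in> V}) (\<lambda>x. \<psi> (F (inv_into U \<phi> x)))"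
      using F U(1) V(1) unfolding smooth_map_def comp_def by fast
    then show "smooth_at M N F p"
      by (rule smooth_atI [OF M U(2) V(2) o, rotated 3]) (use U V in auto)
  qed
next
  assume F: "\<forall>p\<in>pts M. smooth_at M N F p"
  have Fp: "F p \<in> pts N" if "p \<in> pts M" for p
    using F that max_chart(2) [OF N] unfolding smooth_at_def by (meson image_subset_iff subsetD)
  have opre: "openin (mtop M) {x \<in> pts M. F x \<in> V}" if V: "openin (mtop N) V" for V
  proof (subst openin_subopen, safe)
    fix p assume p: "p \<in> pts M" "F p \<in> V"
    obtain O' where "openin (mtop M) O'" "p \<in> O'" "F ` O' \<subseteq> V"
      using smooth_at_nbhd [OF M N bspec [OF F p(1)] V p(2)] by metis
    then show "\<exists>T. openin (mtop M) T \<and> p \<in> T \<and> T \<subseteq> {x \<in> pts M. F x \<in> V}"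
      using openin_subset by (intro exI [of _ O']) blast
  qed
  show "smooth_map M N F"
    unfolding smooth_map_def
  proof (intro conjI ballI, goal_cases)
    case 1
    show ?case unfolding continuous_map_def using Fp opre by auto
  next
    case (2 c)
    obtain U \<phi> where c: "c = (U, \<phi>)" by fastforce
    have "smooth_on (model M) (\<phi> ` {x\<in>U. F x \<in> V}) (\<psi> \<circ> F \<circ> inv_into U \<phi>)" if "(V, \<psi>) \<in> atlas N" for V \<psi>
    proof (rule smooth_on_local)
      have U: "(U, \<phi>) \<in> maximal_atlas M" using 2 c atlas_max [OF M] by blast
      have V: "(V, \<psi>) \<in> maximal_atlas N" using that atlas_max [OF N] by blast
      note cU = max_chart [OF M U]
      have "openin (mtop M) (U \<inter> {x \<in> pts M. F x \<in> V})"
        using opre [OF max_chart(1) [OF N V]] cU(1) by blast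
      also have "U \<inter> {x \<in> pts M. F x \<in> V} = {x \<in> U. F x \<in> V}" using cU(2) by auto
      finally have "openin (mtop M) {x \<in> U. F x \<in> V}" .
      then show "relopen (model M) (\<phi> ` {x\<in>U. F x \<in> V})" using cU(6) [of "{x \<in> U. F x \<in> V}"] by auto
      fix x assume "x \<in> \<phi> ` {x\<in>U. F x \<in> V}"
      then obtain p where p: "p \<in> U" "F p \<in> V" "x = \<phi> p" by auto
      have "smooth_at M N F p" using F p(1) cU(2) by blast
      then obtain O' where O': "openin (mtop M) O'" "p \<in> O'" "O' \<subseteq> U" "F ` O' \<subseteq> V"
        "smooth_on (model M) (\<phi> ` O') (\<lambda>x. \<psi> (F (inv_into U \<phi> x)))"
        using smooth_at_chart [OF M N \<open>smooth_at M N F p\<close> U p(1) V p(2)] by metis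
      then show "\<exists>T. relopen (model M) T \<and> T \<subseteq> \<phi> ` {x\<in>U. F x \<in> V} \<and> x \<in> T \<and>
           smooth_on (model M) T (\<psi> \<circ> F \<circ> inv_into U \<phi>)"
        using cU(6) p by (intro exI [of _ "\<phi> ` O'"]) (auto simp: comp_def)
    qed
    then show ?case unfolding c by auto
  qed
qed

section \<open>Open submanifolds\<close>

lemma atlas_open_sub: "atlas (open_sub M W) = (\<lambda>(U, \<phi>). (U \<inter> W, \<phi>)) ` atlas M"
  unfolding open_sub_def by force

lemma mfd_eqI: "mtop A = mtop B \<Longrightarrow> model A = model B \<Longrightarrow> atlas A = atlas B \<Longrightarrow> A = (B :: ('p, 'e) mfd)"
  by simp

text \<open>An equality of records, not merely an isomorphism, so that fields and functions on
  nested open sets need no transport.\<close>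

lemma open_sub_open_sub:
  assumes "U \<subseteq> W" shows "open_sub (open_sub M W) U = open_sub M U"
proof (rule mfd_eqI)
  have "W \<inter> U = U" using assms by blast
  then have "(\<lambda>(U', \<phi>). (U' \<inter> U, \<phi>)) ((\<lambda>(U', \<phi>). (U' \<inter> W, \<phi>)) c) = (\<lambda>(U', \<phi>). (U' \<inter> U, \<phi>)) c" for c :: "'a set \<times> ('a \<Rightarrow> 'b)"
    by (cases c) (simp add: Int_assoc)
  then show "atlas (open_sub (open_sub M W) U) = atlas (open_sub M U)"
    unfolding atlas_open_sub image_image by (intro image_cong refl)
qed (use assms in \<open>simp_all add: open_sub_def subtopology_subtopology inf.absorb2\<close>)

lemma open_sub_simps [simp]:
  "mtop (open_sub M W) = subtopology (mtop M) W" "model (open_sub M W) = model M"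
  by (simp_all add: open_sub_def)

lemma pts_open_sub [simp]: "openin (mtop M) W \<Longrightarrow> pts (open_sub M W) = W"
  using openin_subset by fastforce

lemma openin_open_sub: "openin (mtop M) W \<Longrightarrow> openin (mtop (open_sub M W)) U \<longleftrightarrow> openin (mtop M) U \<and> U \<subseteq> W"
  by (simp add: openin_open_subtopology)

lemma is_chart_open_sub:
  assumes "openin (mtop M) W"
  shows "is_chart (open_sub M W) (U, \<phi>) \<longleftrightarrow> is_chart M (U, \<phi>) \<and> U \<subseteq> W"
  unfolding is_chart_def using assms
  by (auto simp: openin_open_subtopology subtopology_subtopology inf.absorb2)

lemma pmfd_open_sub:
  assumes M: "pmfd M" and W: "openin (mtop M) W"
  shows "pmfd (open_sub M W)"
proof -
  have at: "(V \<inter> W, \<phi>) \<in> maximal_atlas M" if "(V, \<phi>) \<in> atlas M" for V \<phi>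
    using max_restrict [OF M atlas_max [OF M that]] W max_chart(1) [OF M atlas_max [OF M that]] by auto
  show ?thesis unfolding pmfd_def
  proof (intro conjI ballI)
    show "subspace (model (open_sub M W))" using pmfd_subspace [OF M] by simp
    show "is_chart (open_sub M W) c" if "c \<in> atlas (open_sub M W)" for c
      using that max_atlas_chart [OF at] is_chart_open_sub [OF W] unfolding atlas_open_sub by (auto split: prod.splits)
    have "W = (\<Union>c\<in>atlas (open_sub M W). fst c)"
    proof
      show "W \<subseteq> (\<Union>c\<in>atlas (open_sub M W). fst c)"
      proof
        fix p assume p: "p \<in> W"
        then have "p \<in> pts M" using W openin_subset by blast
        then obtain U \<phi> where "(U, \<phi>) \<in> atlas M" "p \<in> U" using pmfd_cover [OF M] by metis
        then show "p \<in> (\<Union>c\<in>atlas (open_sub M W). fst c)"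
          using p unfolding atlas_open_sub by (intro UN_I [of "(U \<inter> W, \<phi>)"]) force+
      qed
    qed (auto simp: atlas_open_sub)
    then show "pts (open_sub M W) = (\<Union>c\<in>atlas (open_sub M W). fst c)" using pts_open_sub [OF W] by simp
    show "compatible (open_sub M W) c d" if "c \<in> atlas (open_sub M W)" "d \<in> atlas (open_sub M W)" for c d
    proof -
      obtain U \<phi> V \<psi> where "c = (U \<inter> W, \<phi>)" "(U, \<phi>) \<in> atlas M" "d = (V \<inter> W, \<psi>)" "(V, \<psi>) \<in> atlas M"
        using \<open>c \<in> atlas (open_sub M W)\<close> \<open>d \<in> atlas (open_sub M W)\<close> unfolding atlas_open_sub by auto
      then show ?thesis using compatibleI_max [OF M at at] by (auto simp: compatible_def)
    qed
  qed
qed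

lemma max_atlas_open_sub:
  assumes M: "pmfd M" and W: "openin (mtop M) W"
  shows "(U, \<phi>) \<in> maximal_atlas (open_sub M W) \<longleftrightarrow> (U, \<phi>) \<in> maximal_atlas M \<and> U \<subseteq> W"
proof
  assume "(U, \<phi>) \<in> maximal_atlas M \<and> U \<subseteq> W"
  then have U: "(U, \<phi>) \<in> maximal_atlas M" "U \<subseteq> W" by auto
  have "compatible (open_sub M W) (U, \<phi>) (V \<inter> W, \<psi>)" if V: "(V, \<psi>) \<in> atlas M" for V \<psi>
  proof -
    have "(V \<inter> W, \<psi>) \<in> maximal_atlas M"
      using max_restrict [OF M atlas_max [OF M V]] W max_chart(1) [OF M atlas_max [OF M V]] by auto
    then show ?thesis using compatibleI_max [OF M U(1)] unfolding compatible_def by auto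
  qed
  then show "(U, \<phi>) \<in> maximal_atlas (open_sub M W)"
    unfolding maximal_atlas_def using is_chart_open_sub [OF W] max_atlas_chart [OF U(1)] U(2)
    by (auto simp: atlas_open_sub)
next
  assume L: "(U, \<phi>) \<in> maximal_atlas (open_sub M W)"
  have U: "is_chart M (U, \<phi>)" "U \<subseteq> W" using max_atlas_chart [OF L] is_chart_open_sub [OF W] by auto
  have "compatible M (U, \<phi>) (V, \<psi>)" if V: "(V, \<psi>) \<in> atlas M" for V \<psi>
  proof -
    have c: "compatible (open_sub M W) (U, \<phi>) (V \<inter> W, \<psi>)"
    proof -
      have "(V \<inter> W, \<psi>) \<in> atlas (open_sub M W)" using V unfolding atlas_open_sub by force
      then show ?thesis using L unfolding maximal_atlas_def by blast
    qed
    have e: "U \<inter> (V \<inter> W) = U \<inter> V" using U(2) by auto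
    have e': "inv_into (V \<inter> W) \<psi> x = inv_into V \<psi> x" if "x \<in> \<psi> ` (U \<inter> V)" for x
      by (rule inv_into_sub [OF is_chartD(4) [OF max_atlas_chart [OF atlas_max [OF M V]]]])
        (use U(2) that in auto)
    moreover have "smooth_on (model M) (\<psi> ` (U \<inter> V)) (\<lambda>x. \<phi> (inv_into (V \<inter> W) \<psi> x)) \<longleftrightarrow>
       smooth_on (model M) (\<psi> ` (U \<inter> V)) (\<lambda>x. \<phi> (inv_into V \<psi> x))"
      by (rule smooth_on_cong) (simp add: e')
    ultimately show ?thesis using c unfolding compatible_def comp_def by (simp add: e)
  qed
  then show "(U, \<phi>) \<in> maximal_atlas M \<and> U \<subseteq> W" using U unfolding maximal_atlas_def by auto
qed

lemma smooth_at_open_sub: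
  assumes M: "pmfd M" and W: "openin (mtop M) W" and p: "p \<in> W"
  shows "smooth_at (open_sub M W) N F p \<longleftrightarrow> smooth_at M N F p"
proof
  assume "smooth_at M N F p"
  then obtain U \<phi> V \<psi> where U: "(U, \<phi>) \<in> maximal_atlas M" "p \<in> U" and V: "(V, \<psi>) \<in> maximal_atlas N"
    and FU: "F ` U \<subseteq> V" and s: "smooth_on (model M) (\<phi> ` U) (\<lambda>x. \<psi> (F (inv_into U \<phi> x)))"
    unfolding smooth_at_def by blast
  note cU = max_chart [OF M U(1)]
  have UW: "openin (mtop M) (U \<inter> W)" using cU(1) W by blast
  have m: "(U \<inter> W, \<phi>) \<in> maximal_atlas (open_sub M W)"
    using max_restrict [OF M U(1) UW] max_atlas_open_sub [OF M W] by auto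
  have "smooth_on (model M) (\<phi> ` (U \<inter> W)) (\<lambda>x. \<psi> (F (inv_into U \<phi> x)))"
    by (rule smooth_on_subset [OF s]) auto
  moreover have "inv_into (U \<inter> W) \<phi> x = inv_into U \<phi> x" if "x \<in> \<phi> ` (U \<inter> W)" for x
    by (rule inv_into_sub [OF cU(3) _ that]) auto
  ultimately have "smooth_on (model M) (\<phi> ` (U \<inter> W)) (\<lambda>x. \<psi> (F (inv_into (U \<inter> W) \<phi> x)))"
    by (simp cong: smooth_on_cong)
  then show "smooth_at (open_sub M W) N F p" unfolding smooth_at_def
    using m V U p FU by (intro exI [of _ "U \<inter> W"] exI [of _ \<phi>] exI [of _ V] exI [of _ \<psi>]) auto
qed (auto simp: smooth_at_def max_atlas_open_sub [OF M W])

text \<open>Extends \<open>open_mfd\<close> to relatively open subsets of a subspace. It serves as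
  the domain of curves and as the codomain of charts, so that a chart becomes a smooth map between
  manifolds.\<close>

definition emfd :: "'e::euclidean_space set \<Rightarrow> 'e set \<Rightarrow> ('e, 'e) mfd" where
  "emfd E S = \<lparr>mtop = top_of_set S, model = E, atlas = {(S, id)}\<rparr>"

lemma open_mfd_emfd: "open_mfd S = emfd UNIV S"
  unfolding open_mfd_def emfd_def ..

lemma emfd_simps [simp]: "mtop (emfd E S) = top_of_set S" "model (emfd E S) = E" "atlas (emfd E S) = {(S, id)}"
  by (simp_all add: emfd_def)

lemma pmfd_emfd:
  assumes "relopen E S" shows "pmfd (emfd E S)"
proof -
  have inv: "inv_into S id x = x" if "x \<in> S" for x using that by (metis id_apply inv_into_f_f inj_on_id)
  have "smooth_on E S (\<lambda>x. inv_into S id x)"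
    using smooth_on_ident [OF assms] inv by (simp cong: smooth_on_cong)
  moreover have "is_chart (emfd E S) (S, id)"
    using relopenD [OF assms] unfolding is_chart_def by (simp add: homeomorphic_map_id subtopology_subtopology)
  ultimately show ?thesis using relopenD [OF assms]
    unfolding pmfd_def compatible_def by (auto simp: comp_def)
qed

lemma emfd_max: "relopen E S \<Longrightarrow> (S, id) \<in> maximal_atlas (emfd E S)"
  by (rule atlas_max [OF pmfd_emfd]) simp_all

lemma smooth_at_emfdI:
  assumes "pmfd M" "relopen E S" "(U, \<phi>) \<in> maximal_atlas M" "openin (mtop M) O'" "O' \<subseteq> U"
    "p \<in> O'" "F ` O' \<subseteq> S" "smooth_on (model M) (\<phi> ` O') (\<lambda>x. F (inv_into U \<phi> x))"
  shows "smooth_at M (emfd E S) F p"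
  using smooth_atI [OF assms(1,3) emfd_max [OF assms(2)] assms(4-7)] assms(8) by simp

lemma smooth_at_emfdD:
  assumes "pmfd M" "relopen E S" "smooth_at M (emfd E S) F p" "(U, \<phi>) \<in> maximal_atlas M" "p \<in> U" "F p \<in> S"
  obtains O' where "openin (mtop M) O'" "p \<in> O'" "O' \<subseteq> U" "F ` O' \<subseteq> S"
    "smooth_on (model M) (\<phi> ` O') (\<lambda>x. F (inv_into U \<phi> x))"
  using smooth_at_chart [OF assms(1) pmfd_emfd [OF assms(2)] assms(3-5) emfd_max [OF assms(2)] assms(6)]
  by auto

section \<open>Smooth real-valued functions in charts\<close>

abbreviation real_mfd :: "(real, real) mfd" where "real_mfd \<equiv> emfd UNIV UNIV"

lemma pmfd_real: "pmfd real_mfd" by (rule pmfd_emfd) simp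

lemma smooth_fun_iff:
  assumes M: "pmfd M" and U: "openin (mtop M) U"
  shows "smooth_fun (open_sub M U) h \<longleftrightarrow> (\<forall>p\<in>U. smooth_at M real_mfd h p)"
  unfolding open_mfd_emfd smooth_map_iff [OF pmfd_open_sub [OF assms] pmfd_real] pts_open_sub [OF U]
  using smooth_at_open_sub [OF assms] by blast

lemma smooth_near_iff:
  assumes M: "pmfd M"
  shows "smooth_near M p h \<longleftrightarrow> smooth_at M real_mfd h p"
proof
  assume "smooth_near M p h"
  then show "smooth_at M real_mfd h p" unfolding smooth_near_def using smooth_fun_iff [OF M] by blast
next
  assume h: "smooth_at M real_mfd h p"
  obtain O' where "openin (mtop M) O'" "p \<in> O'" "\<And>q. q \<in> O' \<Longrightarrow> smooth_at M real_mfd h q"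
    using smooth_at_nbhd [OF M pmfd_real h, of UNIV] by auto
  then show "smooth_near M p h" unfolding smooth_near_def using smooth_fun_iff [OF M] by blast
qed

lemma smooth_fun_near_iff:
  assumes M: "pmfd M" and U: "openin (mtop M) U"
  shows "smooth_fun (open_sub M U) h \<longleftrightarrow> (\<forall>p\<in>U. smooth_near M p h)"
  using smooth_fun_iff [OF assms] smooth_near_iff [OF M] by simp

lemma smooth_near_chart:
  assumes M: "pmfd M" and U: "(U, \<phi>) \<in> maximal_atlas M" "p \<in> U"
  shows "smooth_near M p h \<longleftrightarrow>
    (\<exists>O'. openin (mtop M) O' \<and> p \<in> O' \<and> O' \<subseteq> U \<and> smooth_on (model M) (\<phi> ` O') (\<lambda>x. h (inv_into U \<phi> x)))"
  unfolding smooth_near_iff [OF M]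
proof
  assume "smooth_at M real_mfd h p"
  then obtain O' where "openin (mtop M) O'" "p \<in> O'" "O' \<subseteq> U" "h ` O' \<subseteq> UNIV"
    "smooth_on (model M) (\<phi> ` O') (\<lambda>x. h (inv_into U \<phi> x))"
    using smooth_at_emfdD [OF M _ _ U, of UNIV UNIV h] by auto
  then show "\<exists>O'. openin (mtop M) O' \<and> p \<in> O' \<and> O' \<subseteq> U \<and> smooth_on (model M) (\<phi> ` O') (\<lambda>x. h (inv_into U \<phi> x))"
    by blast
next
  assume "\<exists>O'. openin (mtop M) O' \<and> p \<in> O' \<and> O' \<subseteq> U \<and> smooth_on (model M) (\<phi> ` O') (\<lambda>x. h (inv_into U \<phi> x))"
  then show "smooth_at M real_mfd h p" using smooth_at_emfdI [OF M _ U(1), of UNIV UNIV] by auto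
qed

lemma smooth_on_chart_iff:
  assumes M: "pmfd M" and U: "(U, \<phi>) \<in> maximal_atlas M" and V: "openin (mtop M) V" "V \<subseteq> U"
  shows "smooth_on (model M) (\<phi> ` V) (\<lambda>x. h (inv_into U \<phi> x)) \<longleftrightarrow> (\<forall>p\<in>V. smooth_near M p h)"
proof
  assume "smooth_on (model M) (\<phi> ` V) (\<lambda>x. h (inv_into U \<phi> x))"
  then show "\<forall>p\<in>V. smooth_near M p h" using smooth_near_chart [OF M U] V by blast
next
  note cU = max_chart [OF M U]
  assume *: "\<forall>p\<in>V. smooth_near M p h"
  show "smooth_on (model M) (\<phi> ` V) (\<lambda>x. h (inv_into U \<phi> x))"
  proof (rule smooth_on_local)
    show rV: "relopen (model M) (\<phi> ` V)" using cU(6) V by blast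
    fix x assume "x \<in> \<phi> ` V"
    then obtain p where p: "p \<in> V" "x = \<phi> p" by blast
    then obtain O' where O': "openin (mtop M) O'" "p \<in> O'" "O' \<subseteq> U"
      "smooth_on (model M) (\<phi> ` O') (\<lambda>x. h (inv_into U \<phi> x))"
      using * smooth_near_chart [OF M U(1)] V by (meson subsetD)
    have r: "relopen (model M) (\<phi> ` O')" "relopen (model M) (\<phi> ` (O' \<inter> V))"
      using cU(6) O' V openin_Int by (metis, metis inf.coboundedI2)
    have "smooth_on (model M) (\<phi> ` (O' \<inter> V)) (\<lambda>x. h (inv_into U \<phi> x))"
      by (rule smooth_on_subset [OF O'(4)]) auto
    then show "\<exists>T. relopen (model M) T \<and> T \<subseteq> \<phi> ` V \<and> x \<in> T \<and> smooth_on (model M) T (\<lambda>x. h (inv_into U \<phi> x))"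
      using r p O' by (intro exI [of _ "\<phi> ` (O' \<inter> V)"]) auto
  qed
qed

lemma smooth_near_open_sub:
  assumes "pmfd M" "openin (mtop M) W" "p \<in> W"
  shows "smooth_near (open_sub M W) p h \<longleftrightarrow> smooth_near M p h"
  using smooth_near_iff pmfd_open_sub smooth_at_open_sub assms by metis

section \<open>Tangent vectors and vector fields in charts\<close>

abbreviation vfield :: "('p, 'e::euclidean_space) mfd \<Rightarrow> 'p set \<Rightarrow> ('p \<Rightarrow> 'p tvec) \<Rightarrow> bool" where
  "vfield M U X \<equiv> smooth_field (open_sub M U) X"

text \<open>The tangent vector with coordinate vector c in the chart. It is 0 on functions that are
  not smooth near p, as \<open>velocity\<close> is, so that the two can be equal as
  functions.\<close>

definition tv :: "('p, 'e::euclidean_space) mfd \<Rightarrow> 'p set \<Rightarrow> ('p \<Rightarrow> 'e) \<Rightarrow> 'p \<Rightarrow> 'e \<Rightarrow> 'p tvec" where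
  "tv M U \<phi> p c = (\<lambda>h. if smooth_near M p h then dd (\<lambda>x. h (inv_into U \<phi> x)) (\<phi> p) c else 0)"

locale mfd_chart =
  fixes M :: "('p, 'e::euclidean_space) mfd" and U :: "'p set" and \<phi> :: "'p \<Rightarrow> 'e"
  assumes pm: "pmfd M" and mx: "(U, \<phi>) \<in> maximal_atlas M"
begin

abbreviation "E \<equiv> model M"
abbreviation "pt \<equiv> inv_into U \<phi>"
abbreviation "tvc \<equiv> tv M U \<phi>"

lemmas ch = max_chart [OF pm mx]
lemmas subE = pmfd_subspace [OF pm]

lemma pt_phi [simp]: "p \<in> U \<Longrightarrow> pt (\<phi> p) = p"
  using ch(3) by simp

lemma phi_pt [simp]: "x \<in> \<phi> ` U \<Longrightarrow> \<phi> (pt x) = x"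
  by (rule f_inv_into_f)

lemma pt_in: "x \<in> \<phi> ` U \<Longrightarrow> pt x \<in> U"
  by (rule inv_into_into)

lemma pt_in_sub: "x \<in> \<phi> ` V \<Longrightarrow> V \<subseteq> U \<Longrightarrow> pt x \<in> V"
  using pt_phi by (metis imageE subsetD)

lemma phiE: "p \<in> U \<Longrightarrow> \<phi> p \<in> E"
  using ch(5) by auto

lemma relV: "openin (mtop M) V \<Longrightarrow> V \<subseteq> U \<Longrightarrow> relopen E (\<phi> ` V)"
  using ch(6) by blast

lemma smooth_nearE:
  assumes "smooth_near M p h" "p \<in> V" "openin (mtop M) V" "V \<subseteq> U"
  obtains O' where "openin (mtop M) O'" "p \<in> O'" "O' \<subseteq> V" "relopen E (\<phi> ` O')"
    "smooth_on E (\<phi> ` O') (\<lambda>x. h (pt x))" "\<And>q. q \<in> O' \<Longrightarrow> smooth_near M q h"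
proof -
  obtain O' where O': "openin (mtop M) O'" "p \<in> O'" "O' \<subseteq> U"
    "smooth_on E (\<phi> ` O') (\<lambda>x. h (pt x))"
    using smooth_near_chart [OF pm mx] assms by blast
  have o: "openin (mtop M) (O' \<inter> V)" using O' assms by blast
  have r: "relopen E (\<phi> ` O')" "relopen E (\<phi> ` (O' \<inter> V))" using O' o relV assms by (blast, blast)
  have s: "smooth_on E (\<phi> ` (O' \<inter> V)) (\<lambda>x. h (pt x))"
    by (rule smooth_on_subset [OF O'(4)]) auto
  show ?thesis
    by (rule that [OF o _ _ r(2) s]) (use O' assms smooth_on_chart_iff [OF pm mx O'(1,3)] in auto)
qed

lemma tv_apply: "smooth_near M p h \<Longrightarrow> tvc p c h = dd (\<lambda>x. h (pt x)) (\<phi> p) c"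
  unfolding tv_def by simp

lemma tv_add:
  assumes "p \<in> U" "a \<in> E" "b \<in> E"
  shows "tvc p (a + b) = (\<lambda>h. tvc p a h + tvc p b h)"
proof
  fix h show "tvc p (a + b) h = tvc p a h + tvc p b h"
  proof (cases "smooth_near M p h")
    case True
    obtain O' where O': "p \<in> O'" "relopen E (\<phi> ` O')" "smooth_on E (\<phi> ` O') (\<lambda>x. h (pt x))"
      using smooth_nearE [OF True assms(1) ch(1) subset_refl] by metis
    then show ?thesis using dd_add [OF O'(2,3) _ assms(2,3), of "\<phi> p"] True by (simp add: tv_apply)
  qed (simp add: tv_def)
qed

lemma tv_scale:
  assumes "p \<in> U" "a \<in> E"
  shows "tvc p (r *\<^sub>R a) = (\<lambda>h. r * tvc p a h)"
proof
  fix h show "tvc p (r *\<^sub>R a) h = r * tvc p a h"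
  proof (cases "smooth_near M p h")
    case True
    obtain O' where O': "p \<in> O'" "relopen E (\<phi> ` O')" "smooth_on E (\<phi> ` O') (\<lambda>x. h (pt x))"
      using smooth_nearE [OF True assms(1) ch(1) subset_refl] by metis
    then show ?thesis using dd_scaleR [OF O'(2,3) _ assms(2), of "\<phi> p"] True by (simp add: tv_apply)
  qed (simp add: tv_def)
qed

lemma tv_zero: "p \<in> U \<Longrightarrow> tvc p 0 = (\<lambda>h. 0)"
  using tv_scale [of p 0 0] subspace_0 [OF subE] by simp

lemma tv_lincomb:
  assumes "p \<in> U" "a \<in> E" "b \<in> E"
  shows "tvc p (r *\<^sub>R a + s *\<^sub>R b) = (\<lambda>h. r * tvc p a h + s * tvc p b h)"
  using tv_add [OF assms(1), of "r *\<^sub>R a" "s *\<^sub>R b"] tv_scale [OF assms(1)] assms subspace_scale [OF subE]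
  by simp

lemma tv_diff:
  assumes "p \<in> U" "a \<in> E" "b \<in> E"
  shows "tvc p (a - b) = (\<lambda>h. tvc p a h - tvc p b h)"
  using tv_lincomb [OF assms, of 1 "-1"] by simp

lemma smooth_near_comp_chart:
  assumes "smooth_on E (\<phi> ` V) k" "openin (mtop M) V" "V \<subseteq> U" "p \<in> V"
  shows "smooth_near M p (\<lambda>q. k (\<phi> q))"
proof -
  have "\<phi> (pt x) = x" if "x \<in> \<phi> ` V" for x using that assms(3) by (intro phi_pt) auto
  then have "smooth_on E (\<phi> ` V) (\<lambda>x. k (\<phi> (pt x)))" using assms(1) by (simp cong: smooth_on_cong)
  then show ?thesis using smooth_near_chart [OF pm mx] assms by blast
qed

lemma smooth_near_coord: "p \<in> U \<Longrightarrow> smooth_near M p (\<lambda>q. \<phi> q \<bullet> b)"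
  by (rule smooth_near_comp_chart [OF _ ch(1)])
    (auto intro!: smooth_on_linear [OF ch(4) bounded_linear_inner_left] smooth_on_ident ch(4))

lemma dd_ident: "x \<in> \<phi> ` U \<Longrightarrow> c \<in> E \<Longrightarrow> dd (\<lambda>x. x) x c = c"
  using dd_eq [OF ch(4) _ _ has_derivative_ident] .

lemma tv_coord:
  assumes "p \<in> U" "c \<in> E"
  shows "tvc p c (\<lambda>q. \<phi> q \<bullet> b) = c \<bullet> b"
proof -
  have x: "\<phi> p \<in> \<phi> ` U" using assms by blast
  have "tvc p c (\<lambda>q. \<phi> q \<bullet> b) = dd (\<lambda>x. \<phi> (pt x) \<bullet> b) (\<phi> p) c"
    using tv_apply smooth_near_coord assms by blast
  also have "\<dots> = dd (\<lambda>x. x \<bullet> b) (\<phi> p) c" by (rule dd_cong [OF ch(4) x assms(2)]) simp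
  also have "\<dots> = c \<bullet> b"
    using dd_linear [OF ch(4) bounded_linear_inner_left smooth_on_ident [OF ch(4)] x assms(2)]
      dd_ident [OF x assms(2)] by simp
  finally show ?thesis .
qed

text \<open>Inverse of \<open>tvc p\<close> on tangent vectors: coordinates are the values on the
  coordinate functions. No base point enters, and additivity and homogeneity hold for arbitrary
  operators.\<close>

definition rep :: "'p tvec \<Rightarrow> 'e" where
  "rep \<xi> = (\<Sum>b\<in>Basis. \<xi> (\<lambda>q. \<phi> q \<bullet> b) *\<^sub>R b)"

lemma rep_tv [simp]: "p \<in> U \<Longrightarrow> c \<in> E \<Longrightarrow> rep (tvc p c) = c"
  unfolding rep_def by (simp add: tv_coord euclidean_representation)

lemma rep_add: "rep (\<lambda>h. \<xi> h + \<eta> h) = rep \<xi> + rep \<eta>"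
  unfolding rep_def by (simp add: scaleR_add_left sum.distrib)

lemma rep_scale: "rep (\<lambda>h. c * \<xi> h) = c *\<^sub>R rep \<xi>"
  unfolding rep_def by (simp add: scaleR_sum_right)

lemma const_near: "p \<in> U \<Longrightarrow> smooth_near M p (\<lambda>q. c)"
  using smooth_near_comp_chart [OF smooth_on_const ch(1)] ch(4) by auto

lemma tv_inj: "p \<in> U \<Longrightarrow> a \<in> E \<Longrightarrow> b \<in> E \<Longrightarrow> tvc p a = tvc p b \<longleftrightarrow> a = b"
  using rep_tv by metis

text \<open>Chain rule for \<open>h \<circ> \<gamma>\<close>, factored near 0 through the chart as
  \<open>h \<circ> pt\<close> after \<open>\<phi> \<circ> \<gamma>\<close>.\<close>

lemma velocity_tv:
  assumes T: "open T" "0 \<in> T" and g: "smooth_at (emfd UNIV T) M \<gamma> 0" and p: "\<gamma> 0 \<in> U"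
  shows "velocity M \<gamma> = tvc (\<gamma> 0) (dd (\<lambda>t. \<phi> (\<gamma> t)) 0 1)" "dd (\<lambda>t. \<phi> (\<gamma> t)) 0 1 \<in> E"
proof -
  have T': "relopen UNIV T" using T by simp
  obtain I where I: "openin (mtop (emfd UNIV T)) I" "0 \<in> I" "I \<subseteq> T" "\<gamma> ` I \<subseteq> U"
    "smooth_on UNIV (id ` I) (\<lambda>x. \<phi> (\<gamma> (inv_into T id x)))"
    using smooth_at_chart [OF pmfd_emfd [OF T'] pm g emfd_max [OF T'] T(2) mx p] by auto
  have oI: "open I" using I(1) T by (simp add: openin_open_eq)
  have "inv_into T id t = t" if "t \<in> I" for t using I(3) that inv_into_f_f [of id T t] by auto
  then have sI: "smooth_on UNIV I (\<lambda>t. \<phi> (\<gamma> t))"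
    using I(5) smooth_on_cong [of I "\<lambda>x. \<phi> (\<gamma> (inv_into T id x))" "\<lambda>t. \<phi> (\<gamma> t)" UNIV] by simp
  have rI: "relopen UNIV I" using oI by simp
  show cE: "dd (\<lambda>t. \<phi> (\<gamma> t)) 0 1 \<in> E"
    by (rule dd_in_subspace [OF rI sI subE _ I(2)]) (use I(4) phiE in auto)
  show "velocity M \<gamma> = tvc (\<gamma> 0) (dd (\<lambda>t. \<phi> (\<gamma> t)) 0 1)"
  proof
    fix h show "velocity M \<gamma> h = tvc (\<gamma> 0) (dd (\<lambda>t. \<phi> (\<gamma> t)) 0 1) h"
    proof (cases "smooth_near M (\<gamma> 0) h")
      case True
      obtain O' where O': "openin (mtop M) O'" "\<gamma> 0 \<in> O'" "O' \<subseteq> U" "relopen E (\<phi> ` O')"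
        "smooth_on E (\<phi> ` O') (\<lambda>x. h (pt x))"
        using smooth_nearE [OF True p ch(1) subset_refl] by metis
      define J where "J = {t \<in> I. \<phi> (\<gamma> t) \<in> \<phi> ` O'}"
      have rJ: "relopen UNIV J" unfolding J_def
        by (rule relopen_preimage [OF rI smooth_on_imp_continuous_on [OF sI] O'(4)]) (use I(4) phiE in auto)
      have sJ: "smooth_on UNIV J (\<lambda>t. \<phi> (\<gamma> t))"
        by (rule smooth_on_subset [OF sI]) (auto simp: J_def)
      have 0: "0 \<in> J" using I O' by (auto simp: J_def)
      have JO: "(\<lambda>t. \<phi> (\<gamma> t)) ` J \<subseteq> \<phi> ` O'" by (auto simp: J_def)
      have sh: "smooth_on UNIV J (\<lambda>t. h (pt (\<phi> (\<gamma> t))))"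
        by (rule smooth_on_compose [OF rJ O'(4) sJ O'(5) JO])
      have eq: "h (pt (\<phi> (\<gamma> t))) = h (\<gamma> t)" if "t \<in> J" for t using that I(4) by (auto simp: J_def image_subset_iff)
      have sh': "smooth_on UNIV J (\<lambda>t. h (\<gamma> t))" using sh eq by (simp cong: smooth_on_cong)
      have "deriv (\<lambda>t. h (\<gamma> t)) 0 = dd (\<lambda>t. h (\<gamma> t)) 0 1"
        using smooth_has_dd [OF rJ sh' 0, of 1]
        by (simp add: DERIV_imp_deriv has_real_derivative_iff_has_vector_derivative)
      also have "\<dots> = dd (\<lambda>t. h (pt (\<phi> (\<gamma> t)))) 0 1"
        using eq by (intro dd_cong [OF rJ 0]) auto
      also have "\<dots> = dd (\<lambda>x. h (pt x)) (\<phi> (\<gamma> 0)) (dd (\<lambda>t. \<phi> (\<gamma> t)) 0 1)"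
        by (rule dd_compose [OF rJ O'(4) sJ O'(5) JO 0]) simp
      finally show ?thesis using True unfolding velocity_def tv_def by simp
    qed (simp add: velocity_def tv_def)
  qed
qed

text \<open>A velocity has coordinates by \<open>velocity_tv\<close>; conversely c is the velocity
  of the curve that is a straight line in the chart.\<close>

lemma tangent_space_eq:
  assumes p: "p \<in> U"
  shows "tangent_space M p = tvc p ` E"
proof
  show "tangent_space M p \<subseteq> tvc p ` E"
  proof
    fix \<xi> assume "\<xi> \<in> tangent_space M p"
    then obtain \<gamma> \<epsilon> where g: "\<xi> = velocity M \<gamma>" "\<gamma> 0 = p" "\<epsilon> > 0" "smooth_map (open_mfd {-\<epsilon><..<\<epsilon>}) M \<gamma>"
      unfolding tangent_space_def by auto
    have r: "relopen UNIV {-\<epsilon><..<\<epsilon>}" by simp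
    have "smooth_at (emfd UNIV {-\<epsilon><..<\<epsilon>}) M \<gamma> 0"
      using g smooth_map_iff [OF pmfd_emfd [OF r] pm] by (simp add: open_mfd_emfd)
    from velocity_tv [OF _ _ this] show "\<xi> \<in> tvc p ` E" using g p by auto
  qed
  show "tvc p ` E \<subseteq> tangent_space M p"
  proof
    fix \<xi> assume "\<xi> \<in> tvc p ` E"
    then obtain c where c: "c \<in> E" "\<xi> = tvc p c" by blast
    obtain d where d: "d > 0" "\<And>t. \<bar>t\<bar> < d \<Longrightarrow> \<phi> p + t *\<^sub>R c \<in> \<phi> ` U"
      using relopen_line [OF ch(4) _ c(1), of "\<phi> p"] p by blast
    define \<gamma> where "\<gamma> t = pt (\<phi> p + t *\<^sub>R c)" for t
    let ?I = "{-d<..<d}"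
    have rI: "relopen UNIV ?I" by simp
    have phi: "\<phi> (\<gamma> t) = \<phi> p + t *\<^sub>R c" if "t \<in> ?I" for t
      unfolding \<gamma>_def using d that by (intro phi_pt) auto
    have s: "smooth_on UNIV ?I (\<lambda>t. \<phi> p + t *\<^sub>R c)"
      by (intro smooth_on_add smooth_on_scaleR smooth_on_const smooth_on_ident rI)
    have inv: "inv_into ?I id t = t" if "t \<in> ?I" for t using that inv_into_f_f [of id ?I t] by auto
    have "smooth_on UNIV (id ` ?I) (\<lambda>t. \<phi> (\<gamma> (inv_into ?I id t)))"
      using s smooth_on_cong [of ?I "\<lambda>t. \<phi> (\<gamma> (inv_into ?I id t))" "\<lambda>t. \<phi> p + t *\<^sub>R c" UNIV]
        phi inv by simp
    moreover have "\<gamma> ` ?I \<subseteq> U" using d pt_in unfolding \<gamma>_def by auto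
    ultimately have sm: "smooth_at (emfd UNIV ?I) M \<gamma> t" if "t \<in> ?I" for t
      using that emfd_max [OF rI] mx unfolding smooth_at_def emfd_simps by blast
    have g0: "\<gamma> 0 = p" unfolding \<gamma>_def using p by simp
    have 0: "0 \<in> ?I" using d by simp
    have "dd (\<lambda>t. \<phi> (\<gamma> t)) 0 1 = dd (\<lambda>t. \<phi> p + t *\<^sub>R c) 0 1"
      by (rule dd_cong [OF rI 0]) (use phi in auto)
    also have "\<dots> = c"
      unfolding dd_def by (rule vector_derivative_at) (auto intro!: derivative_eq_intros)
    finally have "velocity M \<gamma> = \<xi>" using velocity_tv(1) [OF _ 0 sm [OF 0]] g0 p c(2) by simp
    moreover have "smooth_map (open_mfd ?I) M \<gamma>"
      using sm smooth_map_iff [OF pmfd_emfd [OF rI] pm] by (simp add: open_mfd_emfd)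
    ultimately show "\<xi> \<in> tangent_space M p" unfolding tangent_space_def using g0 d(1) by blast
  qed
qed

lemma tangentE:
  assumes "p \<in> U" "\<xi> \<in> tangent_space M p"
  shows "rep \<xi> \<in> E" "tvc p (rep \<xi>) = \<xi>"
  using assms rep_tv tangent_space_eq by auto

end

lemma mfd_chart_exists:
  assumes "pmfd M" "openin (mtop M) W" "p \<in> W"
  obtains U \<phi> where "mfd_chart M U \<phi>" "p \<in> U" "U \<subseteq> W"
proof -
  have "p \<in> pts M" using assms openin_subset by blast
  then obtain U \<phi> where U: "(U, \<phi>) \<in> maximal_atlas M" "p \<in> U" using pmfd_cover [OF assms(1)] by metis
  have "(U \<inter> W, \<phi>) \<in> maximal_atlas M"
    using max_restrict [OF assms(1) U(1)] max_chart(1) [OF assms(1) U(1)] assms(2) by auto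
  then show ?thesis using that [of "U \<inter> W" \<phi>] U assms by (simp add: mfd_chart_def)
qed

lemma tangent_space_open_sub:
  assumes M: "pmfd M" and W: "openin (mtop M) W" and p: "p \<in> W"
  shows "tangent_space (open_sub M W) p = tangent_space M p"
proof -
  obtain U \<phi> where U: "mfd_chart M U \<phi>" "p \<in> U" "U \<subseteq> W" using mfd_chart_exists [OF assms] by metis
  interpret A: mfd_chart M U \<phi> by fact
  interpret B: mfd_chart "open_sub M W" U \<phi>
    by unfold_locales (use pmfd_open_sub [OF M W] max_atlas_open_sub [OF M W] A.mx U in auto)
  have "tv (open_sub M W) U \<phi> p c = tv M U \<phi> p c" for c
    unfolding tv_def using smooth_near_open_sub [OF assms] by simp
  then show ?thesis using A.tangent_space_eq [OF U(2)] B.tangent_space_eq [OF U(2)] by simp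
qed

text \<open>Tangent vectors act on globally defined functions but see only their germs.\<close>

lemma tangent_local:
  assumes M: "pmfd M" and p: "p \<in> pts M" and \<xi>: "\<xi> \<in> tangent_space M p"
    and W: "openin (mtop M) W" "p \<in> W" "\<And>q. q \<in> W \<Longrightarrow> h q = k q"
  shows "\<xi> h = \<xi> k"
proof -
  obtain U \<phi> where U: "mfd_chart M U \<phi>" "p \<in> U" "U \<subseteq> W" using mfd_chart_exists [OF M W(1,2)] by metis
  interpret mfd_chart M U \<phi> by fact
  obtain c where c: "c \<in> E" "\<xi> = tvc p c" using \<xi> tangent_space_eq [OF U(2)] by auto
  have "smooth_at M real_mfd h p \<longleftrightarrow> smooth_at M real_mfd k p"
    using smooth_at_cong [OF M pmfd_real _ W(1,2)] W(3) by metis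
  then have "smooth_near M p h \<longleftrightarrow> smooth_near M p k" using smooth_near_iff [OF M] by blast
  moreover have "dd (\<lambda>x. h (pt x)) (\<phi> p) c = dd (\<lambda>x. k (pt x)) (\<phi> p) c"
    by (rule dd_cong [OF ch(4) _ c(1)]) (use U pt_in W(3) in auto)
  ultimately show ?thesis unfolding c(2) tv_def by simp
qed

text \<open>Reduces \<open>smooth_field\<close>, which quantifies over all open subsets, to a
  condition at each point. Restriction, gluing and replacement by a field with the same values
  become immediate.\<close>

lemma vfield_iff:
  assumes M: "pmfd M" and V: "openin (mtop M) V"
  shows "vfield M V X \<longleftrightarrow>
    (\<forall>p\<in>V. X p \<in> tangent_space M p \<and> (\<forall>h. smooth_near M p h \<longrightarrow> smooth_near M p (\<lambda>q. X q h)))"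
proof
  assume X: "vfield M V X"
  show "\<forall>p\<in>V. X p \<in> tangent_space M p \<and> (\<forall>h. smooth_near M p h \<longrightarrow> smooth_near M p (\<lambda>q. X q h))"
  proof (intro ballI conjI allI impI)
    fix p assume p: "p \<in> V"
    show "X p \<in> tangent_space M p"
      using X p tangent_space_open_sub [OF M V p] pts_open_sub [OF V] unfolding smooth_field_def by auto
    fix h assume "smooth_near M p h"
    then obtain O' where O': "openin (mtop M) O'" "p \<in> O'" "\<And>q. q \<in> O' \<Longrightarrow> smooth_near M q h"
      using smooth_at_nbhd [OF M pmfd_real, of h p UNIV] smooth_near_iff [OF M] by (metis UNIV_I emfd_simps(1) openin_subtopology_self)
    have oV: "openin (mtop M) (O' \<inter> V)" using O' V by blast
    have o: "openin (mtop (open_sub M V)) (O' \<inter> V)" using oV openin_open_sub [OF V] by auto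
    have eq: "open_sub (open_sub M V) (O' \<inter> V) = open_sub M (O' \<inter> V)" by (rule open_sub_open_sub) auto
    have "smooth_fun (open_sub M (O' \<inter> V)) h" using smooth_fun_near_iff [OF M oV] O'(3) by auto
    then have "smooth_fun (open_sub M (O' \<inter> V)) (\<lambda>p. X p h)"
      using X o eq unfolding smooth_field_def by metis
    then show "smooth_near M p (\<lambda>q. X q h)" using smooth_fun_near_iff [OF M oV] O'(2) p by auto
  qed
next
  assume X: "\<forall>p\<in>V. X p \<in> tangent_space M p \<and> (\<forall>h. smooth_near M p h \<longrightarrow> smooth_near M p (\<lambda>q. X q h))"
  show "vfield M V X" unfolding smooth_field_def
  proof (intro conjI allI impI ballI, goal_cases)
    case (1 p)
    then show ?case using X tangent_space_open_sub [OF M V] pts_open_sub [OF V] by auto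
  next
    case (2 W h)
    then have W: "openin (mtop M) W" "W \<subseteq> V" using openin_open_sub [OF V] by auto
    have eq: "open_sub (open_sub M V) W = open_sub M W" by (rule open_sub_open_sub [OF W(2)])
    show ?case using 2 X W(2) unfolding eq smooth_fun_near_iff [OF M W(1)] by blast
  qed
qed

lemma vfield_subset:
  assumes "pmfd M" "openin (mtop M) V" "openin (mtop M) W" "W \<subseteq> V" "vfield M V X"
  shows "vfield M W X"
  using assms vfield_iff by (meson subsetD)

section \<open>Vector fields and their Lie bracket in a chart\<close>

context mfd_chart begin

abbreviation crep :: "('p \<Rightarrow> 'p tvec) \<Rightarrow> 'e \<Rightarrow> 'e" where
  "crep X \<equiv> \<lambda>x. rep (X (pt x))"

lemma vfield_chartD:
  assumes X: "vfield M V X" and V: "openin (mtop M) V" "V \<subseteq> U"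
  shows "smooth_on E (\<phi> ` V) (crep X)" "\<And>x. x \<in> \<phi> ` V \<Longrightarrow> crep X x \<in> E"
    "\<And>q. q \<in> V \<Longrightarrow> X q = tvc q (rep (X q))"
proof -
  note X' = X [unfolded vfield_iff [OF pm V(1)], rule_format]
  have rV: "relopen E (\<phi> ` V)" using relV V by blast
  have "smooth_on E (\<phi> ` V) (\<lambda>x. X (pt x) (\<lambda>q. \<phi> q \<bullet> b))" for b
    using smooth_on_chart_iff [OF pm mx V, of "\<lambda>q. X q (\<lambda>q. \<phi> q \<bullet> b)"] X' smooth_near_coord V by blast
  then show "smooth_on E (\<phi> ` V) (crep X)" unfolding rep_def
    by (intro smooth_on_sum smooth_on_scaleR smooth_on_const rV)
  show "crep X x \<in> E" if "x \<in> \<phi> ` V" for x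
    using tangentE(1) X' pt_in_sub [OF that V(2)] V(2) by blast
  show "X q = tvc q (rep (X q))" if "q \<in> V" for q
    using tangentE(2) X' V(2) that by (metis subsetD)
qed

lemma field_apply:
  assumes X: "vfield M V X" and V: "openin (mtop M) V" "V \<subseteq> U" and p: "p \<in> V" and h: "smooth_near M p h"
  shows "X p h = dd (\<lambda>x. h (pt x)) (\<phi> p) (crep X (\<phi> p))"
proof -
  have "X p h = tvc p (rep (X p)) h" using vfield_chartD(3) [OF X V p] by simp
  then show ?thesis using h p V(2) by (simp add: tv_apply subset_iff)
qed

text \<open>\<open>X h\<close> is the family of linear maps \<open>dd (h \<circ> pt)\<close>
  evaluated at the smooth function \<open>\<xi>\<close>, so \<open>linfam_apply\<close> gives its
  smoothness.\<close>

lemma vfield_chartI: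
  assumes \<xi>: "smooth_on E (\<phi> ` V) \<xi>" "\<And>x. x \<in> \<phi> ` V \<Longrightarrow> \<xi> x \<in> E" and V: "openin (mtop M) V" "V \<subseteq> U"
    and X: "\<And>q. q \<in> V \<Longrightarrow> X q = tvc q (\<xi> (\<phi> q))"
  shows "vfield M V X"
  unfolding vfield_iff [OF pm V(1)]
proof (intro ballI conjI allI impI)
  fix p assume p: "p \<in> V"
  show "X p \<in> tangent_space M p" using X [OF p] \<xi>(2) p V(2) tangent_space_eq by auto
  fix h assume "smooth_near M p h"
  then obtain O' where O': "openin (mtop M) O'" "p \<in> O'" "O' \<subseteq> V" "relopen E (\<phi> ` O')"
    "smooth_on E (\<phi> ` O') (\<lambda>x. h (pt x))" "\<And>q. q \<in> O' \<Longrightarrow> smooth_near M q h"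
    using smooth_nearE [OF _ p V] by metis
  have \<xi>': "smooth_on E (\<phi> ` O') \<xi>"
    by (rule smooth_on_subset [OF \<xi>(1)]) (use O' in auto)
  have "smooth_on E (\<phi> ` O') (\<lambda>x. dd (\<lambda>x. h (pt x)) x (\<xi> x))"
    by (rule linfam_apply(1) [OF O'(4) subE linfam_dd [OF O'(4,5)] \<xi>']) (use \<xi>(2) O'(3) in auto)
  moreover have "X (pt x) h = dd (\<lambda>x. h (pt x)) x (\<xi> x)" if x: "x \<in> \<phi> ` O'" for x
  proof -
    have q: "pt x \<in> O'" "\<phi> (pt x) = x" using x O'(3) V(2) pt_in_sub [OF x] phi_pt by auto
    then show ?thesis using X [of "pt x"] O'(3,6) by (auto simp: tv_apply)
  qed
  ultimately have "smooth_on E (\<phi> ` O') (\<lambda>x. X (pt x) h)" by (simp cong: smooth_on_cong)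
  then show "smooth_near M p (\<lambda>q. X q h)" using smooth_near_chart [OF pm mx] O' V p by blast
qed

lemma crep_eq:
  assumes "\<And>q. q \<in> V \<Longrightarrow> X q = tvc q (\<xi> (\<phi> q))" "\<And>x. x \<in> \<phi> ` V \<Longrightarrow> \<xi> x \<in> E" "V \<subseteq> U" "x \<in> \<phi> ` V"
  shows "crep X x = \<xi> x"
  using assms by (metis pt_in_sub phi_pt rep_tv image_mono subsetD)

text \<open>The product rule splits \<open>X (Y h)\<close> into a second derivative of h and a term
  with the derivative of the coefficients of Y. The former is symmetric in X and Y and drops out of
  the bracket.\<close>

lemma double_apply:
  assumes X: "vfield M V X" and Y: "vfield M V Y" and V: "openin (mtop M) V" "V \<subseteq> U" and p: "p \<in> V"
    and h: "smooth_near M p h"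
  shows "X p (\<lambda>q. Y q h) =
    dd (\<lambda>y. dd (\<lambda>x. h (pt x)) y (crep Y (\<phi> p))) (\<phi> p) (crep X (\<phi> p)) +
    dd (\<lambda>x. h (pt x)) (\<phi> p) (dd (crep Y) (\<phi> p) (crep X (\<phi> p)))"
proof -
  obtain O' where O': "openin (mtop M) O'" "p \<in> O'" "O' \<subseteq> V" "relopen E (\<phi> ` O')"
    "smooth_on E (\<phi> ` O') (\<lambda>x. h (pt x))" "\<And>q. q \<in> O' \<Longrightarrow> smooth_near M q h"
    using smooth_nearE [OF h p V] by metis
  have OU: "O' \<subseteq> U" using O' V by auto
  have x: "\<phi> p \<in> \<phi> ` O'" using O' by auto
  have YO: "smooth_on E (\<phi> ` O') (crep Y)"
    by (rule smooth_on_subset [OF vfield_chartD(1) [OF Y V]]) (use O' in auto)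
  have XE: "crep X (\<phi> p) \<in> E" using vfield_chartD(2) [OF X V] p by auto
  have "smooth_near M p (\<lambda>q. Y q h)" using Y h p unfolding vfield_iff [OF pm V(1)] by blast
  then have "X p (\<lambda>q. Y q h) = dd (\<lambda>x. Y (pt x) h) (\<phi> p) (crep X (\<phi> p))"
    using field_apply [OF X V p] by simp
  also have "\<dots> = dd (\<lambda>x. dd (\<lambda>x. h (pt x)) x (crep Y x)) (\<phi> p) (crep X (\<phi> p))"
  proof (rule dd_cong [OF O'(4) x XE])
    fix y assume y: "y \<in> \<phi> ` O'"
    then have "pt y \<in> O'" "\<phi> (pt y) = y" using pt_in_sub [OF y OU] OU phi_pt by auto
    then show "Y (pt y) h = dd (\<lambda>x. h (pt x)) y (crep Y y)"
      using field_apply [OF Y V, of "pt y" h] O' by auto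
  qed
  also have "\<dots> = dd (\<lambda>y. dd (\<lambda>x. h (pt x)) y (crep Y (\<phi> p))) (\<phi> p) (crep X (\<phi> p)) +
    dd (\<lambda>x. h (pt x)) (\<phi> p) (dd (crep Y) (\<phi> p) (crep X (\<phi> p)))"
    by (rule linfam_apply(2) [OF O'(4) subE linfam_dd [OF O'(4,5)] YO _ x XE])
      (use vfield_chartD(2) [OF Y V] O'(3) in auto)
  finally show ?thesis .
qed

lemma dd_crep_E:
  assumes "vfield M V X" "openin (mtop M) V" "V \<subseteq> U" "x \<in> \<phi> ` V" "v \<in> E"
  shows "dd (crep X) x v \<in> E"
  using dd_in_subspace [OF relV [OF assms(2,3)] vfield_chartD(1) [OF assms(1-3)] subE vfield_chartD(2) [OF assms(1-3)] assms(4,5)] .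

lemma lie_bracket_chart:
  assumes X: "vfield M V X" and Y: "vfield M V Y" and V: "openin (mtop M) V" "V \<subseteq> U" and p: "p \<in> V"
  shows "lie_bracket M X Y p = tvc p (dd (crep Y) (\<phi> p) (crep X (\<phi> p)) - dd (crep X) (\<phi> p) (crep Y (\<phi> p)))"
proof
  have x: "\<phi> p \<in> \<phi> ` V" and pU: "p \<in> U" using p V by auto
  have XE: "crep X (\<phi> p) \<in> E" and YE: "crep Y (\<phi> p) \<in> E"
    using vfield_chartD(2) [OF X V] vfield_chartD(2) [OF Y V] p by auto
  have dE: "dd (crep Y) (\<phi> p) (crep X (\<phi> p)) \<in> E" "dd (crep X) (\<phi> p) (crep Y (\<phi> p)) \<in> E"
    using dd_crep_E [OF Y V x XE] dd_crep_E [OF X V x YE] .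
  fix h
  show "lie_bracket M X Y p h = tvc p (dd (crep Y) (\<phi> p) (crep X (\<phi> p)) - dd (crep X) (\<phi> p) (crep Y (\<phi> p))) h"
  proof (cases "smooth_near M p h")
    case True
    obtain O' where O': "openin (mtop M) O'" "p \<in> O'" "O' \<subseteq> V" "relopen E (\<phi> ` O')"
      "smooth_on E (\<phi> ` O') (\<lambda>x. h (pt x))" "\<And>q. q \<in> O' \<Longrightarrow> smooth_near M q h"
      using smooth_nearE [OF True p V] by metis
    have "dd (\<lambda>y. dd (\<lambda>x. h (pt x)) y (crep Y (\<phi> p))) (\<phi> p) (crep X (\<phi> p)) =
        dd (\<lambda>y. dd (\<lambda>x. h (pt x)) y (crep X (\<phi> p))) (\<phi> p) (crep Y (\<phi> p))"
      by (rule dd_commute [OF O'(4,5) _ YE XE]) (use O' in auto)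
    then show ?thesis
      using double_apply [OF X Y V p True] double_apply [OF Y X V p True] True
      unfolding lie_bracket_def tv_diff [OF pU dE] by (simp add: tv_apply)
  qed (simp add: lie_bracket_def tv_def)
qed

lemma smooth_dd_fields:
  assumes X: "vfield M V X" and Y: "vfield M V Y" and V: "openin (mtop M) V" "V \<subseteq> U"
  shows "smooth_on E (\<phi> ` V) (\<lambda>x. dd (crep Y) x (crep X x))"
  using linfam_apply(1) [OF relV [OF V] subE linfam_dd [OF relV [OF V] vfield_chartD(1) [OF Y V]]
      vfield_chartD(1,2) [OF X V]] .

lemma lie_bracket_vfield:
  assumes X: "vfield M V X" and Y: "vfield M V Y" and V: "openin (mtop M) V" "V \<subseteq> U"
  shows "vfield M V (lie_bracket M X Y)"
proof (rule vfield_chartI [OF _ _ V lie_bracket_chart [OF X Y V]])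
  show "smooth_on E (\<phi> ` V) (\<lambda>x. dd (crep Y) x (crep X x) - dd (crep X) x (crep Y x))"
    using relV V by (intro smooth_on_diff smooth_dd_fields [OF X Y V] smooth_dd_fields [OF Y X V]) auto
  show "dd (crep Y) x (crep X x) - dd (crep X) x (crep Y x) \<in> E" if "x \<in> \<phi> ` V" for x
    using that vfield_chartD(2) [OF X V that] vfield_chartD(2) [OF Y V that]
    by (intro subspace_diff [OF subE] dd_crep_E [OF Y V] dd_crep_E [OF X V])
qed

end

section \<open>The Levi-Civita connection in charts\<close>

text \<open>The common shape of metric coefficients and of Christoffel symbols in a chart, built
  from \<open>linfam\<close> so that its product rule can be applied to each argument in
  turn.\<close>

definition bilfam :: "'a::euclidean_space set \<Rightarrow> 'a set \<Rightarrow> ('a \<Rightarrow> 'a \<Rightarrow> 'a \<Rightarrow> 'c::euclidean_space) \<Rightarrow> bool" where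
  "bilfam E S A \<longleftrightarrow> (\<forall>a\<in>E. linfam E S E (\<lambda>x. A x a)) \<and> (\<forall>b\<in>E. linfam E S E (\<lambda>x a. A x a b))"

lemma bilfam_rules:
  assumes "bilfam E S A" "x \<in> S" "a \<in> E" "b \<in> E" "c \<in> E"
  shows "A x (a + b) c = A x a c + A x b c" "A x c (a + b) = A x c a + A x c b"
    "A x (r *\<^sub>R a) c = r *\<^sub>R A x a c" "A x c (r *\<^sub>R a) = r *\<^sub>R A x c a"
  using assms unfolding bilfam_def linfam_def by blast+

lemma bilfam_diff:
  assumes A: "bilfam E S A" and E: "subspace E" and x: "x \<in> S" "a \<in> E" "b \<in> E" "c \<in> E"
  shows "A x (a - b) c = A x a c - A x b c" "A x c (a - b) = A x c a - A x c b"
proof -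
  have "(-1) *\<^sub>R b \<in> E" using E x subspace_scale by blast
  then show "A x (a - b) c = A x a c - A x b c" "A x c (a - b) = A x c a - A x c b"
    using bilfam_rules(1,2) [OF A x(1,2) _ x(4), of "(-1) *\<^sub>R b"] bilfam_rules(3,4) [OF A x(1) x(3,3) x(4), of "-1"] by auto
qed

lemma bilfam_smooth: "bilfam E S A \<Longrightarrow> a \<in> E \<Longrightarrow> b \<in> E \<Longrightarrow> smooth_on E S (\<lambda>x. A x a b)"
  unfolding bilfam_def linfam_def by blast

lemma linfam_subset: "linfam E S F A \<Longrightarrow> T \<subseteq> S \<Longrightarrow> linfam E T F A"
  unfolding linfam_def using smooth_on_subset by (metis subsetD)

lemma bilfam_subset: "bilfam E S A \<Longrightarrow> T \<subseteq> S \<Longrightarrow> bilfam E T A"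
  unfolding bilfam_def using linfam_subset by blast

lemma bilfam_apply:
  assumes ES: "relopen E S" and A: "bilfam E S A"
    and \<eta>: "smooth_on E S \<eta>" "\<And>x. x \<in> S \<Longrightarrow> \<eta> x \<in> E" and \<zeta>: "smooth_on E S \<zeta>" "\<And>x. x \<in> S \<Longrightarrow> \<zeta> x \<in> E"
  shows "smooth_on E S (\<lambda>x. A x (\<eta> x) (\<zeta> x))"
    "x \<in> S \<Longrightarrow> v \<in> E \<Longrightarrow> dd (\<lambda>y. A y (\<eta> y) (\<zeta> y)) x v =
       dd (\<lambda>y. A y (\<eta> x) (\<zeta> x)) x v + A x (dd \<eta> x v) (\<zeta> x) + A x (\<eta> x) (dd \<zeta> x v)"
proof -
  have E: "subspace E" using relopenD ES by blast
  have L1: "linfam E S E (\<lambda>x. A x a)" if "a \<in> E" for a using A that unfolding bilfam_def by blast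
  have L: "linfam E S E (\<lambda>x a. A x a (\<zeta> x))"
    unfolding linfam_def
  proof (intro conjI ballI allI)
    fix a assume "a \<in> E" then show "smooth_on E S (\<lambda>x. A x a (\<zeta> x))"
      using linfam_apply(1) [OF ES E L1 \<zeta>] by blast
  qed (use bilfam_rules [OF A] \<zeta>(2) in auto)
  show "smooth_on E S (\<lambda>x. A x (\<eta> x) (\<zeta> x))" using linfam_apply(1) [OF ES E L \<eta>] .
  assume x: "x \<in> S" and v: "v \<in> E"
  show "dd (\<lambda>y. A y (\<eta> y) (\<zeta> y)) x v =
       dd (\<lambda>y. A y (\<eta> x) (\<zeta> x)) x v + A x (dd \<eta> x v) (\<zeta> x) + A x (\<eta> x) (dd \<zeta> x v)"
    using linfam_apply(2) [OF ES E L \<eta> x v] linfam_apply(2) [OF ES E L1 [OF \<eta>(2) [OF x]] \<zeta> x v] by simp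
qed

lemma pr_symD: "pseudo_riemannian M g \<Longrightarrow> p \<in> pts M \<Longrightarrow> u \<in> tangent_space M p \<Longrightarrow> v \<in> tangent_space M p \<Longrightarrow> g p u v = g p v u"
  unfolding pseudo_riemannian_def by blast

lemma pr_linD:
  "pseudo_riemannian M g \<Longrightarrow> p \<in> pts M \<Longrightarrow> u \<in> tangent_space M p \<Longrightarrow> v \<in> tangent_space M p \<Longrightarrow>
    z \<in> tangent_space M p \<Longrightarrow> g p (\<lambda>h. a * u h + b * v h) z = a * g p u z + b * g p v z"
  unfolding pseudo_riemannian_def by blast

lemma pr_nondegD:
  "pseudo_riemannian M g \<Longrightarrow> p \<in> pts M \<Longrightarrow> u \<in> tangent_space M p \<Longrightarrow>
    (\<And>v. v \<in> tangent_space M p \<Longrightarrow> g p u v = 0) \<Longrightarrow> u = (\<lambda>h. 0)"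
  unfolding pseudo_riemannian_def by blast

text \<open>The right-hand side of the Koszul formula. It involves no connection, which makes
  connections comparable across charts.\<close>

definition koszul :: "('p, 'e::euclidean_space) mfd \<Rightarrow> 'p metric \<Rightarrow> ('p \<Rightarrow> 'p tvec) \<Rightarrow> ('p \<Rightarrow> 'p tvec) \<Rightarrow> ('p \<Rightarrow> 'p tvec) \<Rightarrow> 'p \<Rightarrow> real" where
  "koszul M g X Y Z p = X p (\<lambda>q. g q (Y q) (Z q)) + Y p (\<lambda>q. g q (X q) (Z q)) - Z p (\<lambda>q. g q (X q) (Y q))
     + g p (lie_bracket M X Y p) (Z p) - g p (lie_bracket M X Z p) (Y p) - g p (lie_bracket M Y Z p) (X p)"

text \<open>Stated at one point for any \<open>D\<close> that is torsion free and metric on three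
  fields there, so that it covers a given Levi-Civita connection as well as the local operation
  \<open>cov\<close>.\<close>

lemma koszul_formula:
  assumes pr: "pseudo_riemannian M g" and p: "p \<in> pts M"
    and T: "X p \<in> tangent_space M p" "Y p \<in> tangent_space M p" "Z p \<in> tangent_space M p"
    and tor: "\<And>A B. A \<in> {X, Y, Z} \<Longrightarrow> B \<in> {X, Y, Z} \<Longrightarrow> (\<lambda>h. D A B p h - D B A p h) = lie_bracket M A B p"
    and DT: "\<And>A B. A \<in> {X, Y, Z} \<Longrightarrow> B \<in> {X, Y, Z} \<Longrightarrow> D A B p \<in> tangent_space M p"
    and met: "\<And>A B C. A \<in> {X, Y, Z} \<Longrightarrow> B \<in> {X, Y, Z} \<Longrightarrow> C \<in> {X, Y, Z} \<Longrightarrow>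
       A p (\<lambda>q. g q (B q) (C q)) = g p (D A B p) (C p) + g p (B p) (D A C p)"
  shows "2 * g p (D X Y p) (Z p) = koszul M g X Y Z p"
proof -
  have lb: "g p (lie_bracket M A B p) (C p) = g p (D A B p) (C p) - g p (D B A p) (C p)"
    if "A \<in> {X, Y, Z}" "B \<in> {X, Y, Z}" "C \<in> {X, Y, Z}" for A B C
  proof -
    have C: "C p \<in> tangent_space M p" using T that(3) by blast
    show ?thesis
      using pr_linD [OF pr p DT [OF that(1,2)] DT [OF that(2,1)] C, of 1 "-1"] tor [OF that(1,2)] by simp
  qed
  have sym: "g p (B p) (D A C p) = g p (D A C p) (B p)"
    if "A \<in> {X, Y, Z}" "B \<in> {X, Y, Z}" "C \<in> {X, Y, Z}" for A B C
    using pr_symD [OF pr p _ DT [OF that(1,3)]] T that(2) by blast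
  show ?thesis unfolding koszul_def
    using lb [of X Y Z] lb [of X Z Y] lb [of Y Z X] met [of X Y Z] met [of Y X Z] met [of Z X Y]
      sym [of X Y Z] sym [of Y X Z] sym [of Z X Y] by simp
qed

lemma vfield_local:
  assumes M: "pmfd M" and V: "openin (mtop M) V"
    and W: "\<And>p. p \<in> V \<Longrightarrow> \<exists>W. openin (mtop M) W \<and> p \<in> W \<and> vfield M W X"
  shows "vfield M V X"
  unfolding vfield_iff [OF M V]
proof
  fix p assume "p \<in> V"
  then obtain W where "openin (mtop M) W" "p \<in> W" "vfield M W X" using W by blast
  then show "X p \<in> tangent_space M p \<and> (\<forall>h. smooth_near M p h \<longrightarrow> smooth_near M p (\<lambda>q. X q h))"
    using vfield_iff [OF M] by blast
qed

lemma smooth_near_cong: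
  assumes M: "pmfd M" and "smooth_near M p h" "openin (mtop M) W" "p \<in> W" "\<And>q. q \<in> W \<Longrightarrow> h q = k q"
  shows "smooth_near M p k"
  using smooth_at_cong [OF M pmfd_real iffD1 [OF smooth_near_iff [OF M] assms(2)] assms(3-5)]
  unfolding smooth_near_iff [OF M] .

lemma vfield_cong:
  assumes M: "pmfd M" and V: "openin (mtop M) V" and X: "vfield M V X" and XY: "\<And>p. p \<in> V \<Longrightarrow> X p = Y p"
  shows "vfield M V Y"
  unfolding vfield_iff [OF M V]
proof (intro ballI conjI allI impI)
  note X' = X [unfolded vfield_iff [OF M V], rule_format]
  fix p assume p: "p \<in> V"
  show "Y p \<in> tangent_space M p" using X' p XY by metis
  fix h assume "smooth_near M p h"
  then have "smooth_near M p (\<lambda>q. X q h)" using X' p by blast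
  then show "smooth_near M p (\<lambda>q. Y q h)" by (rule smooth_near_cong [OF M _ V p]) (simp add: XY)
qed

section \<open>Metric coefficients in a chart\<close>

locale metric_chart = mfd_chart +
  fixes g :: "'a metric"
  assumes pr: "pseudo_riemannian M g"
begin

definition G :: "'b \<Rightarrow> 'b \<Rightarrow> 'b \<Rightarrow> real" where
  "G x a b = g (pt x) (tvc (pt x) a) (tvc (pt x) b)"

lemma const_vfield: "c \<in> E \<Longrightarrow> openin (mtop M) V \<Longrightarrow> V \<subseteq> U \<Longrightarrow> vfield M V (\<lambda>q. tvc q c)"
  by (rule vfield_chartI [where \<xi> = "\<lambda>x. c"]) (auto intro!: smooth_on_const relV)

lemma metric_smooth_near:
  assumes "vfield M V X" "vfield M V Y" "openin (mtop M) V" "p \<in> V"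
  shows "smooth_near M p (\<lambda>q. g q (X q) (Y q))"
  using pr assms smooth_fun_near_iff [OF pm assms(3)] unfolding pseudo_riemannian_def by blast

lemma ptsU: "x \<in> \<phi> ` U \<Longrightarrow> pt x \<in> pts M"
  using pt_in ch(2) by blast

lemma tv_tangent: "x \<in> \<phi> ` U \<Longrightarrow> a \<in> E \<Longrightarrow> tvc (pt x) a \<in> tangent_space M (pt x)"
  using tangent_space_eq pt_in by blast

lemma G_sym: "x \<in> \<phi> ` U \<Longrightarrow> a \<in> E \<Longrightarrow> b \<in> E \<Longrightarrow> G x a b = G x b a"
  unfolding G_def by (intro pr_symD [OF pr] ptsU tv_tangent)

lemma G_lin1:
  assumes "x \<in> \<phi> ` U" "a \<in> E" "b \<in> E" "c \<in> E"
  shows "G x (r *\<^sub>R a + s *\<^sub>R b) c = r * G x a c + s * G x b c"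
  unfolding G_def tv_lincomb [OF pt_in [OF assms(1)] assms(2,3)]
  by (rule pr_linD [OF pr ptsU tv_tangent tv_tangent tv_tangent]) (use assms in auto)

lemma G_rules:
  assumes "x \<in> \<phi> ` U" "a \<in> E" "b \<in> E" "c \<in> E"
  shows "G x (a + b) c = G x a c + G x b c" "G x c (a + b) = G x c a + G x c b"
    "G x (r *\<^sub>R a) c = r * G x a c" "G x c (r *\<^sub>R a) = r * G x c a"
proof -
  have ab: "a + b \<in> E" "r *\<^sub>R a \<in> E" using assms subE subspace_add subspace_scale by blast+
  show 1: "G x (a + b) c = G x a c + G x b c" using G_lin1 [OF assms, of 1 1] by simp
  show 2: "G x (r *\<^sub>R a) c = r * G x a c" using G_lin1 [OF assms(1,2,2,4), of r 0] by simp
  show "G x c (a + b) = G x c a + G x c b"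
    using 1 G_sym [OF assms(1) ab(1) assms(4)] G_sym [OF assms(1) assms(2,4)] G_sym [OF assms(1) assms(3,4)] by simp
  show "G x c (r *\<^sub>R a) = r * G x c a"
    using 2 G_sym [OF assms(1) ab(2) assms(4)] G_sym [OF assms(1) assms(2,4)] by simp
qed

lemma G_bilfam: "bilfam E (\<phi> ` U) G"
proof -
  have "smooth_on E (\<phi> ` U) (\<lambda>x. G x a b)" if "a \<in> E" "b \<in> E" for a b
    using smooth_on_chart_iff [OF pm mx ch(1) subset_refl, of "\<lambda>q. g q (tvc q a) (tvc q b)"]
      metric_smooth_near [OF const_vfield [OF that(1) ch(1)] const_vfield [OF that(2) ch(1)] ch(1)]
    unfolding G_def by blast
  then show ?thesis unfolding bilfam_def linfam_def using G_rules by auto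
qed

lemma G_nondeg:
  assumes x: "x \<in> \<phi> ` U" and a: "a \<in> E" and 0: "\<And>b. b \<in> E \<Longrightarrow> G x a b = 0"
  shows "a = 0"
proof -
  have "tvc (pt x) a = (\<lambda>h. 0)"
    by (rule pr_nondegD [OF pr ptsU [OF x] tv_tangent [OF x a]])
      (use 0 tangent_space_eq [OF pt_in [OF x]] in \<open>auto simp: G_def\<close>)
  then show ?thesis using tv_inj [OF pt_in [OF x] a subspace_0 [OF subE]] tv_zero [OF pt_in [OF x]] by simp
qed

lemma g_chart:
  assumes "vfield M V X" "vfield M V Y" "openin (mtop M) V" "V \<subseteq> U" "p \<in> V"
  shows "g p (X p) (Y p) = G (\<phi> p) (crep X (\<phi> p)) (crep Y (\<phi> p))"
  using assms vfield_chartD(3) [OF assms(1,3-5)] vfield_chartD(3) [OF assms(2-5)] unfolding G_def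
  by (auto simp: subset_iff)

text \<open>Every vector at p extends to a field on \<open>V\<close> that is constant in the chart,
  so testing against fields is testing against all vectors, and nondegeneracy applies.\<close>

lemma tangent_unique:
  assumes V: "openin (mtop M) V" "V \<subseteq> U" "p \<in> V" and \<xi>: "\<xi> \<in> tangent_space M p" and \<eta>: "\<eta> \<in> tangent_space M p"
    and eq: "\<And>Z. vfield M V Z \<Longrightarrow> g p \<xi> (Z p) = g p \<eta> (Z p)"
  shows "\<xi> = \<eta>"
proof -
  have pU: "p \<in> U" using V by auto
  have x: "\<phi> p \<in> \<phi> ` U" "pt (\<phi> p) = p" using pU by auto
  have "rep \<xi> - rep \<eta> = 0"
  proof (rule G_nondeg [OF x(1)])
    show "rep \<xi> - rep \<eta> \<in> E" using tangentE [OF pU] \<xi> \<eta> subspace_diff [OF subE] by blast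
    fix b assume b: "b \<in> E"
    have "G (\<phi> p) (rep \<xi>) b = G (\<phi> p) (rep \<eta>) b"
      using eq [OF const_vfield [OF b V(1,2)]] tangentE(2) [OF pU] \<xi> \<eta> unfolding G_def x(2) by simp
    then show "G (\<phi> p) (rep \<xi> - rep \<eta>) b = 0"
      using bilfam_diff(1) [OF G_bilfam subE x(1) _ _ b] tangentE(1) [OF pU] \<xi> \<eta> by simp
  qed
  then show ?thesis using tangentE(2) [OF pU] \<xi> \<eta> by (metis eq_iff_diff_eq_0)
qed

end

text \<open>\<open>\<Gamma> x a b\<close> is the covariant derivative at \<open>x\<close> of the constant field \<open>b\<close> in the direction \<open>a\<close>.\<close>

locale chris_chart = metric_chart +
  fixes \<Gamma> :: "'b \<Rightarrow> 'b \<Rightarrow> 'b \<Rightarrow> 'b"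
  assumes \<Gamma>_bil: "bilfam E (\<phi> ` U) \<Gamma>"
    and \<Gamma>_E: "\<And>x a b. x \<in> \<phi> ` U \<Longrightarrow> a \<in> E \<Longrightarrow> b \<in> E \<Longrightarrow> \<Gamma> x a b \<in> E"
    and \<Gamma>_sym: "\<And>x a b. x \<in> \<phi> ` U \<Longrightarrow> a \<in> E \<Longrightarrow> b \<in> E \<Longrightarrow> \<Gamma> x a b = \<Gamma> x b a"
    and \<Gamma>_met: "\<And>x a b c. x \<in> \<phi> ` U \<Longrightarrow> a \<in> E \<Longrightarrow> b \<in> E \<Longrightarrow> c \<in> E \<Longrightarrow>
      dd (\<lambda>y. G y b c) x a = G x (\<Gamma> x a b) c + G x b (\<Gamma> x a c)"
begin

definition nab :: "('a \<Rightarrow> 'a tvec) \<Rightarrow> ('a \<Rightarrow> 'a tvec) \<Rightarrow> 'b \<Rightarrow> 'b" where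
  "nab X Y x = dd (crep Y) x (crep X x) + \<Gamma> x (crep X x) (crep Y x)"

definition cov :: "('a \<Rightarrow> 'a tvec) \<Rightarrow> ('a \<Rightarrow> 'a tvec) \<Rightarrow> 'a \<Rightarrow> 'a tvec" where
  "cov X Y p = tvc p (nab X Y (\<phi> p))"

context
  fixes V assumes V: "openin (mtop M) V" "V \<subseteq> U"
begin

lemma phiV: "\<phi> ` V \<subseteq> \<phi> ` U" using V by auto

lemma nab_smooth:
  assumes X: "vfield M V X" and Y: "vfield M V Y"
  shows "smooth_on E (\<phi> ` V) (nab X Y)" "\<And>x. x \<in> \<phi> ` V \<Longrightarrow> nab X Y x \<in> E"
proof -
  have r: "relopen E (\<phi> ` V)" using relV V by blast
  show "smooth_on E (\<phi> ` V) (nab X Y)" unfolding nab_def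
    using smooth_dd_fields [OF X Y V]
      bilfam_apply(1) [OF r bilfam_subset [OF \<Gamma>_bil phiV] vfield_chartD(1,2) [OF X V] vfield_chartD(1,2) [OF Y V]]
    by (intro smooth_on_add [OF r]) auto
  fix x assume x: "x \<in> \<phi> ` V"
  then show "nab X Y x \<in> E" unfolding nab_def
    using vfield_chartD(2) [OF X V x] vfield_chartD(2) [OF Y V x] dd_crep_E [OF Y V x] phiV
    by (intro subspace_add [OF subE] \<Gamma>_E) auto
qed

lemma cov_vfield: "vfield M V X \<Longrightarrow> vfield M V Y \<Longrightarrow> vfield M V (cov X Y)"
  by (rule vfield_chartI [OF nab_smooth V cov_def])

lemma cov_tangent: "vfield M V X \<Longrightarrow> vfield M V Y \<Longrightarrow> p \<in> V \<Longrightarrow> cov X Y p \<in> tangent_space M p"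
  using cov_vfield vfield_iff [OF pm V(1)] by blast

lemma crep_cov:
  assumes "vfield M V X" "vfield M V Y" "x \<in> \<phi> ` V"
  shows "crep (cov X Y) x = nab X Y x"
  by (rule crep_eq [of V _ "nab X Y"]) (use nab_smooth(2) [OF assms(1,2)] cov_def V assms in auto)

lemma cov_torsion:
  assumes X: "vfield M V X" and Y: "vfield M V Y" and p: "p \<in> V"
  shows "(\<lambda>h. cov X Y p h - cov Y X p h) = lie_bracket M X Y p"
proof -
  have x: "\<phi> p \<in> \<phi> ` V" "p \<in> U" using p V by auto
  have "(\<lambda>h. cov X Y p h - cov Y X p h) = tvc p (nab X Y (\<phi> p) - nab Y X (\<phi> p))"
    unfolding cov_def using tv_diff [OF x(2) nab_smooth(2) [OF X Y x(1)] nab_smooth(2) [OF Y X x(1)]] by simp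
  also have "nab X Y (\<phi> p) - nab Y X (\<phi> p) = dd (crep Y) (\<phi> p) (crep X (\<phi> p)) - dd (crep X) (\<phi> p) (crep Y (\<phi> p))"
    using \<Gamma>_sym [of "\<phi> p" "crep X (\<phi> p)" "crep Y (\<phi> p)"] x phiV
      vfield_chartD(2) [OF X V x(1)] vfield_chartD(2) [OF Y V x(1)] unfolding nab_def by auto
  finally show ?thesis using lie_bracket_chart [OF X Y V p] by simp
qed

text \<open>The product rule for \<open>G\<close> has three terms. \<open>\<Gamma>_met\<close>
  rewrites the one in which \<open>G\<close> itself is differentiated and supplies exactly the
  Christoffel terms of \<open>nab\<close>.\<close>

lemma cov_metric:
  assumes X: "vfield M V X" and Y: "vfield M V Y" and Z: "vfield M V Z" and p: "p \<in> V"
  shows "X p (\<lambda>q. g q (Y q) (Z q)) = g p (cov X Y p) (Z p) + g p (Y p) (cov X Z p)"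
proof -
  have x: "\<phi> p \<in> \<phi> ` V" "\<phi> p \<in> \<phi> ` U" using p V by auto
  have r: "relopen E (\<phi> ` V)" using relV V by blast
  note XE = vfield_chartD(2) [OF X V x(1)] and YE = vfield_chartD(2) [OF Y V x(1)]
    and ZE = vfield_chartD(2) [OF Z V x(1)]
  note E = XE YE ZE dd_crep_E [OF Y V x(1) XE] dd_crep_E [OF Z V x(1) XE] \<Gamma>_E [OF x(2) XE YE] \<Gamma>_E [OF x(2) XE ZE]
  have "X p (\<lambda>q. g q (Y q) (Z q)) = dd (\<lambda>x. g (pt x) (Y (pt x)) (Z (pt x))) (\<phi> p) (crep X (\<phi> p))"
    by (rule field_apply [OF X V p metric_smooth_near [OF Y Z V(1) p]])
  also have "\<dots> = dd (\<lambda>x. G x (crep Y x) (crep Z x)) (\<phi> p) (crep X (\<phi> p))"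
    by (rule dd_cong [OF r x(1) XE]) (use g_chart [OF Y Z V] pt_in_sub [OF _ V(2)] phi_pt phiV in auto)
  also have "\<dots> = dd (\<lambda>x. G x (crep Y (\<phi> p)) (crep Z (\<phi> p))) (\<phi> p) (crep X (\<phi> p)) +
       G (\<phi> p) (dd (crep Y) (\<phi> p) (crep X (\<phi> p))) (crep Z (\<phi> p)) +
       G (\<phi> p) (crep Y (\<phi> p)) (dd (crep Z) (\<phi> p) (crep X (\<phi> p)))"
    by (rule bilfam_apply(2) [OF r bilfam_subset [OF G_bilfam phiV] vfield_chartD(1,2) [OF Y V] vfield_chartD(1,2) [OF Z V] x(1) XE])
  also have "\<dots> = G (\<phi> p) (nab X Y (\<phi> p)) (crep Z (\<phi> p)) + G (\<phi> p) (crep Y (\<phi> p)) (nab X Z (\<phi> p))"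
    unfolding nab_def \<Gamma>_met [OF x(2) XE YE ZE] using E by (simp add: G_rules [OF x(2)])
  also have "\<dots> = g p (cov X Y p) (Z p) + g p (Y p) (cov X Z p)"
    unfolding g_chart [OF cov_vfield [OF X Y] Z V p] g_chart [OF Y cov_vfield [OF X Z] V p]
      crep_cov [OF X Y x(1)] crep_cov [OF X Z x(1)] ..
  finally show ?thesis .
qed

lemma cov_koszul:
  assumes X: "vfield M V X" and Y: "vfield M V Y" and Z: "vfield M V Z" and p: "p \<in> V"
  shows "2 * g p (cov X Y p) (Z p) = koszul M g X Y Z p"
proof -
  have pM: "p \<in> pts M" using p V ch(2) by auto
  have F: "vfield M V A" if "A \<in> {X, Y, Z}" for A using that X Y Z by blast
  have T: "A p \<in> tangent_space M p" if "A \<in> {X, Y, Z}" for A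
    using F [OF that] vfield_iff [OF pm V(1)] p by blast
  show ?thesis
  proof (rule koszul_formula [OF pr pM])
    fix A B assume "A \<in> {X, Y, Z}" "B \<in> {X, Y, Z}"
    then have AB: "vfield M V A" "vfield M V B" using F by auto
    then show "(\<lambda>h. cov A B p h - cov B A p h) = lie_bracket M A B p" "cov A B p \<in> tangent_space M p"
      using cov_torsion [OF _ _ p] cov_tangent [OF _ _ p] by auto
    fix C assume "C \<in> {X, Y, Z}"
    then have "vfield M V C" using F by auto
    then show "A p (\<lambda>q. g q (B q) (C q)) = g p (cov A B p) (C p) + g p (B p) (cov A C p)"
      using cov_metric [OF AB(1,2) _ p] by blast
  qed (use T in auto)
qed

lemma cov_add1:
  assumes "vfield M V X" "vfield M V Y" "vfield M V Z" "p \<in> V"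
  shows "cov (\<lambda>q h. X q h + Y q h) Z p = (\<lambda>h. cov X Z p h + cov Y Z p h)"
proof -
  have x: "\<phi> p \<in> \<phi> ` V" "\<phi> p \<in> \<phi> ` U" "p \<in> U" using assms V by auto
  have r: "relopen E (\<phi> ` V)" using relV V by blast
  note E = vfield_chartD(2) [OF assms(1) V x(1)] vfield_chartD(2) [OF assms(2) V x(1)] vfield_chartD(2) [OF assms(3) V x(1)]
  have "nab (\<lambda>q h. X q h + Y q h) Z (\<phi> p) = nab X Z (\<phi> p) + nab Y Z (\<phi> p)"
    unfolding nab_def using E bilfam_rules(1) [OF \<Gamma>_bil x(2) E]
      dd_add [OF r vfield_chartD(1) [OF assms(3) V] x(1) E(1,2)] by (simp add: rep_add)
  then show ?thesis unfolding cov_def using tv_add [OF x(3)] nab_smooth(2) assms x by simp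
qed

lemma cov_scale1:
  assumes "vfield M V X" "vfield M V Y" "p \<in> V"
  shows "cov (\<lambda>q h. k q * X q h) Y p = (\<lambda>h. k p * cov X Y p h)"
proof -
  have x: "\<phi> p \<in> \<phi> ` V" "\<phi> p \<in> \<phi> ` U" "p \<in> U" using assms V by auto
  have r: "relopen E (\<phi> ` V)" using relV V by blast
  note E = vfield_chartD(2) [OF assms(1) V x(1)] vfield_chartD(2) [OF assms(2) V x(1)]
  have "nab (\<lambda>q h. k q * X q h) Y (\<phi> p) = k p *\<^sub>R nab X Y (\<phi> p)"
    unfolding nab_def using E bilfam_rules(3) [OF \<Gamma>_bil x(2) E(1,1,2)]
      dd_scaleR [OF r vfield_chartD(1) [OF assms(2) V] x(1) E(1)] x(3) by (simp add: rep_scale scaleR_add_right)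
  then show ?thesis unfolding cov_def using tv_scale [OF x(3)] nab_smooth(2) assms x by simp
qed

lemma cov_add2:
  assumes "vfield M V X" "vfield M V Y" "vfield M V Z" "p \<in> V"
  shows "cov X (\<lambda>q h. Y q h + Z q h) p = (\<lambda>h. cov X Y p h + cov X Z p h)"
proof -
  have x: "\<phi> p \<in> \<phi> ` V" "\<phi> p \<in> \<phi> ` U" "p \<in> U" using assms V by auto
  have r: "relopen E (\<phi> ` V)" using relV V by blast
  note E = vfield_chartD(2) [OF assms(1) V x(1)] vfield_chartD(2) [OF assms(2) V x(1)] vfield_chartD(2) [OF assms(3) V x(1)]
  have "nab X (\<lambda>q h. Y q h + Z q h) (\<phi> p) = nab X Y (\<phi> p) + nab X Z (\<phi> p)"
    unfolding nab_def using E bilfam_rules(2) [OF \<Gamma>_bil x(2) E(2,3,1)]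
      dd_plus [OF r vfield_chartD(1) [OF assms(2) V] vfield_chartD(1) [OF assms(3) V] x(1) E(1)] by (simp add: rep_add)
  then show ?thesis unfolding cov_def using tv_add [OF x(3)] nab_smooth(2) assms x by simp
qed

lemma cov_scale2:
  assumes "vfield M V X" "vfield M V Y" "p \<in> V" and k: "\<And>q. q \<in> V \<Longrightarrow> smooth_near M q k"
  shows "cov X (\<lambda>q h. k q * Y q h) p = (\<lambda>h. X p k * Y p h + k p * cov X Y p h)"
proof -
  have x: "\<phi> p \<in> \<phi> ` V" "\<phi> p \<in> \<phi> ` U" "p \<in> U" using assms V by auto
  have r: "relopen E (\<phi> ` V)" using relV V by blast
  note E = vfield_chartD(2) [OF assms(1) V x(1)] vfield_chartD(2) [OF assms(2) V x(1)]
  have ks: "smooth_on E (\<phi> ` V) (\<lambda>x. k (pt x))" using smooth_on_chart_iff [OF pm mx V] k by blast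
  have "nab X (\<lambda>q h. k q * Y q h) (\<phi> p) = X p k *\<^sub>R crep Y (\<phi> p) + k p *\<^sub>R nab X Y (\<phi> p)"
    unfolding nab_def using E bilfam_rules(4) [OF \<Gamma>_bil x(2) E(2,2,1)] x(3)
      dd_scaleR_fun [OF r ks vfield_chartD(1) [OF assms(2) V] x(1) E(1)]
      field_apply [OF assms(1) V assms(3) k [OF assms(3)]] by (simp add: rep_scale scaleR_add_right)
  moreover have "tvc p (crep Y (\<phi> p)) = Y p" using vfield_chartD(3) [OF assms(2) V assms(3)] x(3) by simp
  ultimately show ?thesis unfolding cov_def
    using tv_lincomb [OF x(3) E(2) nab_smooth(2) [OF assms(1,2) x(1)]] by simp
qed

text \<open>Both sides satisfy the Koszul formula, whose right-hand side does not mention the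
  connection, and \<open>g\<close> is nondegenerate.\<close>

lemma connection_eq_cov:
  assumes LC: "levi_civita M g D" and X: "vfield M V X" and Y: "vfield M V Y" and p: "p \<in> V"
  shows "D X Y p = cov X Y p"
proof (rule tangent_unique [OF V p])
  have pM: "p \<in> pts M" using p V ch(2) by auto
  \<comment> \<open>\<open>affine_connection\<close> quantifies over a smooth function together with
    the fields, so some function has to be supplied even to obtain smoothness of
    \<open>D A B\<close>.\<close>
  have k: "smooth_fun (open_sub M V) (\<lambda>q. 0)"
  proof -
    have "smooth_near M q (\<lambda>q. 0)" if "q \<in> V" for q
      using smooth_near_comp_chart [OF smooth_on_const V that] relV V by blast
    then show ?thesis using smooth_fun_near_iff [OF pm V(1)] by blast
  qed
  have vf: "vfield M V (D A B)" if "vfield M V A" "vfield M V B" for A B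
    using LC that V k unfolding levi_civita_def affine_connection_def by blast
  have DT: "D A B p \<in> tangent_space M p" if "vfield M V A" "vfield M V B" for A B
    using vf [OF that] vfield_iff [OF pm V(1)] p by blast
  show "D X Y p \<in> tangent_space M p" using DT X Y by blast
  show "cov X Y p \<in> tangent_space M p" using cov_tangent X Y p by blast
  fix Z assume Z: "vfield M V Z"
  have F: "vfield M V A" if "A \<in> {X, Y, Z}" for A using that X Y Z by blast
  have T: "A p \<in> tangent_space M p" if "A \<in> {X, Y, Z}" for A
    using F [OF that] vfield_iff [OF pm V(1)] p by blast
  have "2 * g p (D X Y p) (Z p) = koszul M g X Y Z p"
  proof (rule koszul_formula [OF pr pM])
    fix A B assume "A \<in> {X, Y, Z}" "B \<in> {X, Y, Z}"
    then have AB: "vfield M V A" "vfield M V B" using F by auto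
    then show "(\<lambda>h. D A B p h - D B A p h) = lie_bracket M A B p" "D A B p \<in> tangent_space M p"
      using LC V p DT unfolding levi_civita_def by blast+
    fix C assume "C \<in> {X, Y, Z}"
    then have "vfield M V C" using F by auto
    then show "A p (\<lambda>q. g q (B q) (C q)) = g p (D A B p) (C p) + g p (B p) (D A C p)"
      using LC V p AB unfolding levi_civita_def by blast
  qed (use T in auto)
  then show "g p (D X Y p) (Z p) = g p (cov X Y p) (Z p)" using cov_koszul [OF X Y Z p] by simp
qed

end

text \<open>The curvature tensor in coordinates, that is, the value of \<open>curvature\<close> on
  three fields that are constant in the chart, whose brackets vanish.\<close>

definition riem :: "'b \<Rightarrow> 'b \<Rightarrow> 'b \<Rightarrow> 'b \<Rightarrow> 'b" where
  "riem x a b c = dd (\<lambda>y. \<Gamma> y b c) x a - dd (\<lambda>y. \<Gamma> y a c) x b + \<Gamma> x a (\<Gamma> x b c) - \<Gamma> x b (\<Gamma> x a c)"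

lemma dd_\<Gamma>_E: "x \<in> \<phi> ` U \<Longrightarrow> a \<in> E \<Longrightarrow> b \<in> E \<Longrightarrow> c \<in> E \<Longrightarrow> dd (\<lambda>y. \<Gamma> y b c) x a \<in> E"
  using dd_in_subspace [OF ch(4) bilfam_smooth [OF \<Gamma>_bil] subE] \<Gamma>_E by metis

lemma riem_E: "x \<in> \<phi> ` U \<Longrightarrow> a \<in> E \<Longrightarrow> b \<in> E \<Longrightarrow> c \<in> E \<Longrightarrow> riem x a b c \<in> E"
  unfolding riem_def by (intro subspace_add [OF subE] subspace_diff [OF subE] dd_\<Gamma>_E \<Gamma>_E)

text \<open>Tensoriality by computation: the second derivatives of Z and the products of its first
  derivatives with \<open>\<Gamma>\<close> are symmetric in X and Y, the derivatives of X and Y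
  cancel against the bracket term, and only the values of the fields remain.\<close>

lemma curvature_chart:
  assumes LC: "levi_civita M g D" and V: "openin (mtop M) V" "V \<subseteq> U" and X: "vfield M V X" and Y: "vfield M V Y"
    and Z: "vfield M V Z" and p: "p \<in> V"
  shows "curvature M D X Y Z p = tvc p (riem (\<phi> p) (crep X (\<phi> p)) (crep Y (\<phi> p)) (crep Z (\<phi> p)))"
proof -
  let ?x = "\<phi> p"
  have x: "?x \<in> \<phi> ` V" "?x \<in> \<phi> ` U" "p \<in> U" using p V by auto
  have r: "relopen E (\<phi> ` V)" using relV V by blast
  have nab2: "nab A (D B Z) ?x =
      (dd (\<lambda>y. dd (crep Z) y (crep B ?x)) ?x (crep A ?x) + dd (crep Z) ?x (dd (crep B) ?x (crep A ?x))) +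
      (dd (\<lambda>y. \<Gamma> y (crep B ?x) (crep Z ?x)) ?x (crep A ?x) + \<Gamma> ?x (dd (crep B) ?x (crep A ?x)) (crep Z ?x)
        + \<Gamma> ?x (crep B ?x) (dd (crep Z) ?x (crep A ?x))) +
      (\<Gamma> ?x (crep A ?x) (dd (crep Z) ?x (crep B ?x)) + \<Gamma> ?x (crep A ?x) (\<Gamma> ?x (crep B ?x) (crep Z ?x)))"
    and D2: "D A (D B Z) p = tvc p (nab A (D B Z) ?x)" and nabE: "nab A (D B Z) ?x \<in> E"
    if A: "vfield M V A" and B: "vfield M V B" for A B
  proof -
    have DBZ: "D B Z q = cov B Z q" if "q \<in> V" for q using connection_eq_cov [OF V LC B Z that] .
    have vD: "vfield M V (D B Z)" using vfield_cong [OF pm V(1) cov_vfield [OF V B Z]] DBZ by simp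
    show "D A (D B Z) p = tvc p (nab A (D B Z) ?x)"
      using connection_eq_cov [OF V LC A vD p] unfolding cov_def .
    show "nab A (D B Z) ?x \<in> E" using nab_smooth(2) [OF V A vD x(1)] .
    have cD: "crep (D B Z) y = nab B Z y" if "y \<in> \<phi> ` V" for y
      using crep_cov [OF V B Z that] DBZ pt_in_sub [OF that V(2)] by simp
    note AE = vfield_chartD(2) [OF A V x(1)] and BE = vfield_chartD(2) [OF B V x(1)]
      and ZE = vfield_chartD(2) [OF Z V x(1)]
    have "nab A (D B Z) ?x = dd (nab B Z) ?x (crep A ?x) + \<Gamma> ?x (crep A ?x) (nab B Z ?x)"
      unfolding nab_def [of A] using dd_cong [OF r x(1) AE cD] cD [OF x(1)] by simp
    also have "dd (nab B Z) ?x (crep A ?x) =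
       dd (\<lambda>y. dd (crep Z) y (crep B y)) ?x (crep A ?x) + dd (\<lambda>y. \<Gamma> y (crep B y) (crep Z y)) ?x (crep A ?x)"
      unfolding nab_def
      by (rule dd_plus [OF r smooth_dd_fields [OF B Z V] bilfam_apply(1) [OF r bilfam_subset [OF \<Gamma>_bil phiV [OF V]]] x(1) AE])
        (use vfield_chartD [OF B V] vfield_chartD [OF Z V] in auto)
    also have "dd (\<lambda>y. dd (crep Z) y (crep B y)) ?x (crep A ?x) =
       dd (\<lambda>y. dd (crep Z) y (crep B ?x)) ?x (crep A ?x) + dd (crep Z) ?x (dd (crep B) ?x (crep A ?x))"
      by (rule linfam_apply(2) [OF r subE linfam_dd [OF r vfield_chartD(1) [OF Z V]] vfield_chartD(1,2) [OF B V] x(1) AE])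
    also have "dd (\<lambda>y. \<Gamma> y (crep B y) (crep Z y)) ?x (crep A ?x) =
       dd (\<lambda>y. \<Gamma> y (crep B ?x) (crep Z ?x)) ?x (crep A ?x) + \<Gamma> ?x (dd (crep B) ?x (crep A ?x)) (crep Z ?x)
        + \<Gamma> ?x (crep B ?x) (dd (crep Z) ?x (crep A ?x))"
      by (rule bilfam_apply(2) [OF r bilfam_subset [OF \<Gamma>_bil phiV [OF V]] vfield_chartD(1,2) [OF B V] vfield_chartD(1,2) [OF Z V] x(1) AE])
    also have "\<Gamma> ?x (crep A ?x) (nab B Z ?x) =
       \<Gamma> ?x (crep A ?x) (dd (crep Z) ?x (crep B ?x)) + \<Gamma> ?x (crep A ?x) (\<Gamma> ?x (crep B ?x) (crep Z ?x))"
      unfolding nab_def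
      by (rule bilfam_rules(2) [OF \<Gamma>_bil x(2) dd_crep_E [OF Z V x(1) BE] \<Gamma>_E [OF x(2) BE ZE] AE])
    finally show "nab A (D B Z) ?x =
      (dd (\<lambda>y. dd (crep Z) y (crep B ?x)) ?x (crep A ?x) + dd (crep Z) ?x (dd (crep B) ?x (crep A ?x))) +
      (dd (\<lambda>y. \<Gamma> y (crep B ?x) (crep Z ?x)) ?x (crep A ?x) + \<Gamma> ?x (dd (crep B) ?x (crep A ?x)) (crep Z ?x)
        + \<Gamma> ?x (crep B ?x) (dd (crep Z) ?x (crep A ?x))) +
      (\<Gamma> ?x (crep A ?x) (dd (crep Z) ?x (crep B ?x)) + \<Gamma> ?x (crep A ?x) (\<Gamma> ?x (crep B ?x) (crep Z ?x)))" .
  qed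
  note XE = vfield_chartD(2) [OF X V x(1)] and YE = vfield_chartD(2) [OF Y V x(1)] and ZE = vfield_chartD(2) [OF Z V x(1)]
  note dY = dd_crep_E [OF Y V x(1) XE] and dX = dd_crep_E [OF X V x(1) YE]
  have lbv: "vfield M V (lie_bracket M X Y)" by (rule lie_bracket_vfield [OF X Y V])
  have lbr: "crep (lie_bracket M X Y) ?x = dd (crep Y) ?x (crep X ?x) - dd (crep X) ?x (crep Y ?x)"
    using lie_bracket_chart [OF X Y V p] x(3) dX dY subspace_diff [OF subE] by simp
  have nablb: "nab (lie_bracket M X Y) Z ?x =
     dd (crep Z) ?x (dd (crep Y) ?x (crep X ?x)) - dd (crep Z) ?x (dd (crep X) ?x (crep Y ?x)) +
     (\<Gamma> ?x (dd (crep Y) ?x (crep X ?x)) (crep Z ?x) - \<Gamma> ?x (dd (crep X) ?x (crep Y ?x)) (crep Z ?x))"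
  proof -
    have "dd (crep Z) ?x (dd (crep Y) ?x (crep X ?x) - dd (crep X) ?x (crep Y ?x)) =
       dd (crep Z) ?x (dd (crep Y) ?x (crep X ?x)) - dd (crep Z) ?x (dd (crep X) ?x (crep Y ?x))"
      using dd_add [OF r vfield_chartD(1) [OF Z V] x(1) dY, of "(-1) *\<^sub>R dd (crep X) ?x (crep Y ?x)"]
        dd_scaleR [OF r vfield_chartD(1) [OF Z V] x(1) dX, of "-1"] subspace_scale [OF subE dX, of "-1"] by simp
    then show ?thesis unfolding nab_def lbr bilfam_diff(1) [OF \<Gamma>_bil subE x(2) dY dX ZE] by simp
  qed
  have Dlb: "D (lie_bracket M X Y) Z p = tvc p (nab (lie_bracket M X Y) Z ?x)"
    using connection_eq_cov [OF V LC lbv Z p] unfolding cov_def .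
  have nlE: "nab (lie_bracket M X Y) Z ?x \<in> E" using nab_smooth(2) [OF V lbv Z x(1)] .
  have comm: "dd (\<lambda>y. dd (crep Z) y (crep Y ?x)) ?x (crep X ?x) = dd (\<lambda>y. dd (crep Z) y (crep X ?x)) ?x (crep Y ?x)"
    by (rule dd_commute [OF r vfield_chartD(1) [OF Z V] x(1) YE XE])
  have "curvature M D X Y Z p = tvc p (nab X (D Y Z) ?x - nab Y (D X Z) ?x - nab (lie_bracket M X Y) Z ?x)"
    unfolding curvature_def D2 [OF X Y] D2 [OF Y X] Dlb
    using tv_diff [OF x(3) subspace_diff [OF subE nabE [OF X Y] nabE [OF Y X]] nlE] tv_diff [OF x(3) nabE [OF X Y] nabE [OF Y X]]
    by simp
  also have "nab X (D Y Z) ?x - nab Y (D X Z) ?x - nab (lie_bracket M X Y) Z ?x = riem ?x (crep X ?x) (crep Y ?x) (crep Z ?x)"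
    unfolding nab2 [OF X Y] nab2 [OF Y X] nablb riem_def comm by simp
  finally show ?thesis .
qed

lemma sectional_chart:
  assumes LC: "levi_civita M g D" and V: "openin (mtop M) V" "V \<subseteq> U" and X: "vfield M V X" and Y: "vfield M V Y" and p: "p \<in> V"
  shows "sectional_curvature M g D X Y p = G (\<phi> p) (riem (\<phi> p) (crep X (\<phi> p)) (crep Y (\<phi> p)) (crep Y (\<phi> p))) (crep X (\<phi> p)) / gram_det g p (X p) (Y p)"
proof -
  have pU: "p \<in> U" using p V by auto
  have "X p = tvc p (rep (X p))" using vfield_chartD(3) [OF X V p] .
  then show ?thesis unfolding sectional_curvature_def curvature_chart [OF LC V X Y Y p] G_def using pU by simp
qed

lemma gram_chart:
  assumes V: "openin (mtop M) V" "V \<subseteq> U" and X: "vfield M V X" and Y: "vfield M V Y" and p: "p \<in> V"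
  shows "gram_det g p (X p) (Y p) =
    G (\<phi> p) (crep X (\<phi> p)) (crep X (\<phi> p)) * G (\<phi> p) (crep Y (\<phi> p)) (crep Y (\<phi> p)) - (G (\<phi> p) (crep X (\<phi> p)) (crep Y (\<phi> p)))\<^sup>2"
  unfolding gram_det_def using g_chart [OF X X V p] g_chart [OF Y Y V p] g_chart [OF X Y V p] by simp

end

section \<open>Constant sectional curvature in charts\<close>

lemma real_polynomial_function_finite_zeros:
  fixes f :: "real \<Rightarrow> real"
  assumes "real_polynomial_function f" "f a \<noteq> 0"
  shows "finite {t. f t = 0}"
proof -
  obtain c n where f: "f = (\<lambda>x. \<Sum>i\<le>n. c i * x ^ i)" using assms(1) real_polynomial_function_iff_sum by metis
  have "\<exists>i\<le>n. c i \<noteq> 0"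
  proof (rule ccontr)
    assume "\<not> ?thesis" then have "f a = 0" unfolding f by simp
    then show False using assms(2) by simp
  qed
  then show ?thesis using polyfun_finite_roots [of c n] unfolding f by simp
qed

text \<open>A nonzero value of p would leave p with finitely many zeros, and q has finitely many as
  well; but together the two zero sets are the whole line.\<close>

lemma real_polynomial_function_cancel:
  fixes p q :: "real \<Rightarrow> real"
  assumes "real_polynomial_function p" "real_polynomial_function q" "q a \<noteq> 0" "\<And>t. q t \<noteq> 0 \<Longrightarrow> p t = 0"
  shows "p t = 0"
proof (rule ccontr)
  assume "p t \<noteq> 0"
  then have "finite ({t. p t = 0} \<union> {t. q t = 0})"
    using real_polynomial_function_finite_zeros assms by blast
  moreover have "{t. p t = 0} \<union> {t. q t = 0} = UNIV" using assms(4) by blast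
  ultimately show False using infinite_UNIV_char_0 [where 'a = real] by simp
qed

text \<open>
  The sectional curvature controls \<open>K\<close> on nondegenerate planes only.  Along the line from a
  degenerate pair to a nondegenerate one both sides are polynomials, so the formula extends; if all
  planes are degenerate, the space has dimension at most 1 and \<open>K\<close> vanishes by antisymmetry.
\<close>

lemma sectional_extend:
  fixes E :: "'a::real_vector set" and B :: "'a \<Rightarrow> 'a \<Rightarrow> real" and K :: "'a \<Rightarrow> 'a \<Rightarrow> 'a \<Rightarrow> 'a \<Rightarrow> real"
  assumes E: "subspace E"
    and B1: "\<And>a b c. a \<in> E \<Longrightarrow> b \<in> E \<Longrightarrow> c \<in> E \<Longrightarrow> B (a + b) c = B a c + B b c"
    and B2: "\<And>a c r. a \<in> E \<Longrightarrow> c \<in> E \<Longrightarrow> B (r *\<^sub>R a) c = r * B a c"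
    and Bs: "\<And>a b. a \<in> E \<Longrightarrow> b \<in> E \<Longrightarrow> B a b = B b a"
    and Bn: "\<And>a. a \<in> E \<Longrightarrow> (\<And>b. b \<in> E \<Longrightarrow> B a b = 0) \<Longrightarrow> a = 0"
    and K1: "\<And>a b c d e. a \<in> E \<Longrightarrow> b \<in> E \<Longrightarrow> c \<in> E \<Longrightarrow> d \<in> E \<Longrightarrow> e \<in> E \<Longrightarrow> K (a + e) b c d = K a b c d + K e b c d"
    and K2: "\<And>a b c d e. a \<in> E \<Longrightarrow> b \<in> E \<Longrightarrow> c \<in> E \<Longrightarrow> d \<in> E \<Longrightarrow> e \<in> E \<Longrightarrow> K a (b + e) c d = K a b c d + K a e c d"
    and K3: "\<And>a b c d e. a \<in> E \<Longrightarrow> b \<in> E \<Longrightarrow> c \<in> E \<Longrightarrow> d \<in> E \<Longrightarrow> e \<in> E \<Longrightarrow> K a b (c + e) d = K a b c d + K a b e d"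
    and K4: "\<And>a b c d e. a \<in> E \<Longrightarrow> b \<in> E \<Longrightarrow> c \<in> E \<Longrightarrow> d \<in> E \<Longrightarrow> e \<in> E \<Longrightarrow> K a b c (d + e) = K a b c d + K a b c e"
    and S1: "\<And>a b c d r. a \<in> E \<Longrightarrow> b \<in> E \<Longrightarrow> c \<in> E \<Longrightarrow> d \<in> E \<Longrightarrow> K (r *\<^sub>R a) b c d = r * K a b c d"
    and S2: "\<And>a b c d r. a \<in> E \<Longrightarrow> b \<in> E \<Longrightarrow> c \<in> E \<Longrightarrow> d \<in> E \<Longrightarrow> K a (r *\<^sub>R b) c d = r * K a b c d"
    and S3: "\<And>a b c d r. a \<in> E \<Longrightarrow> b \<in> E \<Longrightarrow> c \<in> E \<Longrightarrow> d \<in> E \<Longrightarrow> K a b (r *\<^sub>R c) d = r * K a b c d"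
    and S4: "\<And>a b c d r. a \<in> E \<Longrightarrow> b \<in> E \<Longrightarrow> c \<in> E \<Longrightarrow> d \<in> E \<Longrightarrow> K a b c (r *\<^sub>R d) = r * K a b c d"
    and Ka: "\<And>a b c d. a \<in> E \<Longrightarrow> b \<in> E \<Longrightarrow> c \<in> E \<Longrightarrow> d \<in> E \<Longrightarrow> K a b c d = - K b a c d"
    and H: "\<And>a b. a \<in> E \<Longrightarrow> b \<in> E \<Longrightarrow> B a a * B b b - (B a b)\<^sup>2 \<noteq> 0 \<Longrightarrow> K a b b a = C * (B a a * B b b - (B a b)\<^sup>2)"
    and a: "a \<in> E" and b: "b \<in> E"
  shows "K a b b a = C * (B a a * B b b - (B a b)\<^sup>2)"
proof (cases "\<exists>c\<in>E. \<exists>d\<in>E. B c c * B d d - (B c d)\<^sup>2 \<noteq> 0")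
  case True
  then obtain c d where c: "c \<in> E" and d: "d \<in> E" and nz: "B c c * B d d - (B c d)\<^sup>2 \<noteq> 0" by blast
  define u v where "u = c - a" and "v = d - b"
  have u: "u \<in> E" and v: "v \<in> E" unfolding u_def v_def using a b c d subspace_diff [OF E] by auto
  define x y where "x t = a + t *\<^sub>R u" and "y t = b + t *\<^sub>R v" for t
  have tu: "t *\<^sub>R u \<in> E" and tv: "t *\<^sub>R v \<in> E" for t using u v subspace_scale [OF E] by auto
  have xE: "x t \<in> E" and yE: "y t \<in> E" for t unfolding x_def y_def using a b tu tv subspace_add [OF E] by auto
  have B1': "B c (a + b) = B c a + B c b" if "a \<in> E" "b \<in> E" "c \<in> E" for a b c
    using that B1 [OF that] Bs subspace_add [OF E] by metis
  have B2': "B c (r *\<^sub>R a) = r * B c a" if "a \<in> E" "c \<in> E" for a c r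
    using that B2 [OF that] Bs subspace_scale [OF E] by metis
  note poly = real_polynomial_function.intros
  have lin: "real_polynomial_function (\<lambda>t::real. t)" by (rule poly) (rule bounded_linear_ident)
  have BB: "B (p + t *\<^sub>R q) (r + t *\<^sub>R s) = B p r + t * B p s + t * (B q r + t * B q s)"
    if "p \<in> E" "q \<in> E" "r \<in> E" "s \<in> E" for p q r s t
    using that subspace_scale [OF E] subspace_add [OF E] by (simp add: B1 B1' B2 B2' algebra_simps)
  define g where "g t = B (x t) (x t) * B (y t) (y t) - (B (x t) (y t))\<^sup>2" for t
  have pg: "real_polynomial_function g"
    unfolding g_def x_def y_def BB [OF a u a u] BB [OF a u b v] BB [OF b v b v]
    by (intro poly(2,3,4) lin real_polynomial_function_diff real_polynomial_function_power)
  have "g 1 \<noteq> 0" unfolding g_def x_def y_def u_def v_def using nz by simp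
  define k where "k t = K (x t) (y t) (y t) (x t)" for t
  have pk: "real_polynomial_function k"
  proof -
    \<comment> \<open>\<open>K\<close> is multilinear and each argument is affine in t. The
      expansion is arranged so that the rules for sums and products of polynomial functions
      apply.\<close>
    have k_eq: "k = (\<lambda>t. 
       (K a b b a + t * K a b b u) + t * (K a b v a + t * K a b v u) +
       t * ((K a v b a + t * K a v b u) + t * (K a v v a + t * K a v v u)) +
       t * ((K u b b a + t * K u b b u) + t * (K u b v a + t * K u b v u) +
       t * ((K u v b a + t * K u v b u) + t * (K u v v a + t * K u v v u))))"
    proof
      fix t
      have 4: "K p q r (x t) = K p q r a + t * K p q r u" if "p \<in> E" "q \<in> E" "r \<in> E" for p q r
        unfolding x_def using K4 [OF that a tu] S4 [OF that u] by simp
      have 3: "K p q (y t) r = K p q b r + t * K p q v r" if "p \<in> E" "q \<in> E" "r \<in> E" for p q r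
        unfolding y_def using K3 [OF that(1,2) b that(3) tv] S3 [OF that(1,2) v that(3)] by simp
      have 2: "K p (y t) q r = K p b q r + t * K p v q r" if "p \<in> E" "q \<in> E" "r \<in> E" for p q r
        unfolding y_def using K2 [OF that(1) b that(2,3) tv] S2 [OF that(1) v that(2,3)] by simp
      have 1: "K (x t) p q r = K a p q r + t * K u p q r" if "p \<in> E" "q \<in> E" "r \<in> E" for p q r
        unfolding x_def using K1 [OF a that tu] S1 [OF u that] by simp
      show "k t = (K a b b a + t * K a b b u) + t * (K a b v a + t * K a b v u) +
       t * ((K a v b a + t * K a v b u) + t * (K a v v a + t * K a v v u)) +
       t * ((K u b b a + t * K u b b u) + t * (K u b v a + t * K u b v u) +
       t * ((K u v b a + t * K u v b u) + t * (K u v v a + t * K u v v u)))"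
        unfolding k_def using 1 2 3 4 a b u v xE yE by (simp add: algebra_simps)
    qed
    show ?thesis unfolding k_eq by (intro poly(2,3,4) lin)
  qed
  have "k 0 - C * g 0 = 0"
  proof (rule real_polynomial_function_cancel [where p = "\<lambda>t. k t - C * g t", OF _ pg \<open>g 1 \<noteq> 0\<close>])
    show "real_polynomial_function (\<lambda>t. k t - C * g t)"
      by (intro real_polynomial_function_diff pk poly(2,4) pg)
    show "k t - C * g t = 0" if "g t \<noteq> 0" for t
      using H [OF xE yE] that unfolding g_def k_def by simp
  qed
  then show ?thesis unfolding k_def g_def x_def y_def by simp
next
  case False
  then have deg: "B c c * B d d = (B c d)\<^sup>2" if "c \<in> E" "d \<in> E" for c d using that by force
  obtain u where u: "u \<in> E" "\<And>z. z \<in> E \<Longrightarrow> \<exists>s. z = s *\<^sub>R u"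
  proof (cases "\<forall>u\<in>E. B u u = 0")
    case True
    have "B c d = 0" if "c \<in> E" "d \<in> E" for c d using deg [OF that] True that by simp
    then have "\<And>z. z \<in> E \<Longrightarrow> z = 0" using Bn by blast
    then show ?thesis using that [of 0] subspace_0 [OF E] by auto
  next
    case False
    then obtain u where u: "u \<in> E" "B u u \<noteq> 0" by blast
    \<comment> \<open>The projection along a non-null vector \<open>u\<close> to its
      \<open>B\<close>-orthogonal complement. As all planes are degenerate, the plane of
      \<open>u\<close> and \<open>pr z\<close> forces \<open>pr z\<close> to be null, then
      orthogonal to everything, so \<open>pr z = 0\<close> and \<open>u\<close> spans
      \<open>E\<close>.\<close>
    define pr where "pr z = z - (B z u / B u u) *\<^sub>R u" for z
    have prE: "pr z \<in> E" and prB: "B (pr z) c = B z c - (B z u / B u u) * B u c" if "z \<in> E" "c \<in> E" for z c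
    proof -
      have e: "(- (B z u / B u u)) *\<^sub>R u \<in> E" using u subspace_scale [OF E] by blast
      have pe: "pr z = z + (- (B z u / B u u)) *\<^sub>R u" unfolding pr_def by simp
      show "pr z \<in> E" unfolding pe using e that subspace_add [OF E] by blast
      show "B (pr z) c = B z c - (B z u / B u u) * B u c"
        unfolding pe B1 [OF that(1) e that(2)] B2 [OF u(1) that(2)] by simp
    qed
    have pu: "B (pr z) u = 0" if "z \<in> E" for z using prB [OF that u(1)] u by simp
    have "B (pr z) (pr c) = 0" if "z \<in> E" "c \<in> E" for z c
    proof -
      have "B (pr z) (pr z) = 0"
        using deg [OF prE [OF that] u(1)] pu [OF that(1)] u(2) by simp
      then show ?thesis using deg [OF prE [OF that] prE [OF that(2,1)]] by simp
    qed
    moreover have "B (pr z) c = B (pr z) (pr c)" if "z \<in> E" "c \<in> E" for z c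
      using prB [OF that(2) prE [OF that]] Bs [OF prE [OF that] prE [OF that(2,1)]] Bs [OF prE [OF that] u(1)]
        Bs [OF prE [OF that] that(2)] pu [OF that(1)] by simp
    ultimately have "pr z = 0" if "z \<in> E" for z using Bn [OF prE [OF that that]] that by metis
    then show ?thesis using that [OF u(1)] unfolding pr_def by (metis eq_iff_diff_eq_0)
  qed
  obtain s t where st: "a = s *\<^sub>R u" "b = t *\<^sub>R u" using u(2) a b by metis
  have "K u u c d = 0" if "c \<in> E" "d \<in> E" for c d using Ka [OF u(1) u(1) that] by simp
  then have "K a b b a = 0" unfolding st using u(1) subspace_scale [OF E] by (simp add: S1 S2)
  then show ?thesis using deg [OF a b] by simp
qed

text \<open>The unknown vector is tested on all fields near p, so no chart or neighbourhood has to
  be chosen and the local connections are glued by definition. Where X or Y is not smooth near p the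
  condition is vacuous and the value is not controlled.\<close>

definition koszul_connection :: "('p, 'e::euclidean_space) mfd \<Rightarrow> 'p metric \<Rightarrow> 'p connection" where
  "koszul_connection M g X Y p = (THE \<xi>. \<xi> \<in> tangent_space M p \<and> (\<forall>V Z. openin (mtop M) V \<and> p \<in> V \<and> vfield M V X \<and> vfield M V Y \<and> vfield M V Z
      \<longrightarrow> 2 * g p \<xi> (Z p) = koszul M g X Y Z p))"

text \<open>Existence is the Koszul formula for \<open>cov\<close> on the intersection of
  \<open>V\<close> with the domain of the test field; uniqueness uses test fields on
  \<open>V\<close>.\<close>

lemma (in chris_chart) koszul_connection_eq_cov:
  assumes V: "openin (mtop M) V" "V \<subseteq> U" and X: "vfield M V X" and Y: "vfield M V Y" and p: "p \<in> V"
  shows "koszul_connection M g X Y p = cov X Y p"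
  unfolding koszul_connection_def
proof (rule the_equality, intro conjI allI impI)
  show "cov X Y p \<in> tangent_space M p" by (rule cov_tangent [OF V X Y p])
  fix W Z assume W: "openin (mtop M) W \<and> p \<in> W \<and> vfield M W X \<and> vfield M W Y \<and> vfield M W Z"
  have o: "openin (mtop M) (V \<inter> W)" using V W by blast
  have sub: "V \<inter> W \<subseteq> V" "V \<inter> W \<subseteq> W" "V \<inter> W \<subseteq> U" using V by auto
  show "2 * g p (cov X Y p) (Z p) = koszul M g X Y Z p"
    by (rule cov_koszul [OF o sub(3) vfield_subset [OF pm V(1) o sub(1) X] vfield_subset [OF pm V(1) o sub(1) Y]
        vfield_subset [OF pm _ o sub(2)]]) (use W p in auto)
next
  fix \<xi> assume \<xi>: "\<xi> \<in> tangent_space M p \<and> (\<forall>V Z. openin (mtop M) V \<and> p \<in> V \<and> vfield M V X \<and> vfield M V Y \<and> vfield M V Z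
      \<longrightarrow> 2 * g p \<xi> (Z p) = koszul M g X Y Z p)"
  show "\<xi> = cov X Y p"
  proof (rule tangent_unique [OF V p _ cov_tangent [OF V X Y p]])
    fix Z assume Z: "vfield M V Z"
    have "2 * g p \<xi> (Z p) = koszul M g X Y Z p" using \<xi> V p X Y Z by blast
    then show "g p \<xi> (Z p) = g p (cov X Y p) (Z p)" using cov_koszul [OF V X Y Z p] by simp
  qed (use \<xi> in blast)
qed

text \<open>The axioms of a Levi-Civita connection are local and hold for \<open>cov\<close> in a
  chart, where \<open>koszul_connection\<close> agrees with it.\<close>

lemma koszul_connection_levi_civita:
  assumes M: "pmfd M" and charts: "\<And>p. p \<in> pts M \<Longrightarrow> \<exists>U \<phi> \<Gamma>. p \<in> U \<and> chris_chart M U \<phi> g \<Gamma>"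
  shows "levi_civita M g (koszul_connection M g)"
proof -
  have vf: "vfield M V (koszul_connection M g X Y)" if V: "openin (mtop M) V" and X: "vfield M V X" and Y: "vfield M V Y" for V X Y
  proof (rule vfield_local [OF M V])
    fix p assume p: "p \<in> V"
    then have "p \<in> pts M" using V openin_subset by blast
    then obtain U \<phi> \<Gamma> where U: "p \<in> U" "chris_chart M U \<phi> g \<Gamma>" using charts by blast
    interpret chris_chart M U \<phi> g \<Gamma> by fact
    have o: "openin (mtop M) (V \<inter> U)" and s: "V \<inter> U \<subseteq> U" "V \<inter> U \<subseteq> V" using V ch(1) by auto
    note X' = vfield_subset [OF M V o s(2) X] and Y' = vfield_subset [OF M V o s(2) Y]
    have "vfield M (V \<inter> U) (koszul_connection M g X Y)"
      by (rule vfield_cong [OF M o cov_vfield [OF o s(1) X' Y']]) (rule koszul_connection_eq_cov [OF o s(1) X' Y', symmetric])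
    then show "\<exists>W. openin (mtop M) W \<and> p \<in> W \<and> vfield M W (koszul_connection M g X Y)" using o p U by blast
  qed
  have eqs: "koszul_connection M g (\<lambda>q h. X q h + Y q h) Z p = (\<lambda>h. koszul_connection M g X Z p h + koszul_connection M g Y Z p h) \<and>
      koszul_connection M g (\<lambda>q h. k q * X q h) Y p = (\<lambda>h. k p * koszul_connection M g X Y p h) \<and>
      koszul_connection M g X (\<lambda>q h. Y q h + Z q h) p = (\<lambda>h. koszul_connection M g X Y p h + koszul_connection M g X Z p h) \<and>
      koszul_connection M g X (\<lambda>q h. k q * Y q h) p = (\<lambda>h. X p k * Y p h + k p * koszul_connection M g X Y p h)" (is ?th1)
    "(\<lambda>h. koszul_connection M g X Y p h - koszul_connection M g Y X p h) = lie_bracket M X Y p \<and>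
     X p (\<lambda>q. g q (Y q) (Z q)) = g p (koszul_connection M g X Y p) (Z p) + g p (Y p) (koszul_connection M g X Z p)" (is ?th2)
    if V: "openin (mtop M) V" and X: "vfield M V X" and Y: "vfield M V Y" and Z: "vfield M V Z"
      and k: "smooth_fun (open_sub M V) k" and p: "p \<in> V" for V X Y Z k p
  proof -
    have "p \<in> pts M" using V p openin_subset by blast
    then obtain U \<phi> \<Gamma> where U: "p \<in> U" "chris_chart M U \<phi> g \<Gamma>" using charts by blast
    interpret chris_chart M U \<phi> g \<Gamma> by fact
    have o: "openin (mtop M) (V \<inter> U)" and s: "V \<inter> U \<subseteq> U" "V \<inter> U \<subseteq> V" and p': "p \<in> V \<inter> U" using V ch(1) p U by auto
    have k': "\<And>q. q \<in> V \<inter> U \<Longrightarrow> smooth_near M q k" using k smooth_fun_near_iff [OF M V] by blast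
    note X' = vfield_subset [OF M V o s(2) X] and Y' = vfield_subset [OF M V o s(2) Y]
      and Z' = vfield_subset [OF M V o s(2) Z]
    \<comment> \<open>Multiples and, below, sums of fields must be known to be fields before
      \<open>koszul_connection\<close> may be replaced by \<open>cov\<close> on them.\<close>
    have kX: "vfield M (V \<inter> U) (\<lambda>q h. k q * A q h)" if A: "vfield M (V \<inter> U) A" for A
    proof (rule vfield_chartI [OF _ _ o s(1)])
      have ks: "smooth_on E (\<phi> ` (V \<inter> U)) (\<lambda>x. k (pt x))" using smooth_on_chart_iff [OF pm mx o s(1)] k' by blast
      show "smooth_on E (\<phi> ` (V \<inter> U)) (\<lambda>x. k (pt x) *\<^sub>R crep A x)"
        by (rule smooth_on_scaleR [OF relV [OF o s(1)] ks vfield_chartD(1) [OF A o s(1)]])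
      show "k (pt x) *\<^sub>R crep A x \<in> E" if "x \<in> \<phi> ` (V \<inter> U)" for x
        using vfield_chartD(2) [OF A o s(1) that] subspace_scale [OF subE] by blast
      show "(\<lambda>h. k q * A q h) = tvc q (k (pt (\<phi> q)) *\<^sub>R crep A (\<phi> q))" if "q \<in> V \<inter> U" for q
        using tv_scale [of q "rep (A q)" "k q"] vfield_chartD(2) [OF A o s(1), of "\<phi> q"] vfield_chartD(3) [OF A o s(1) that] that
        by auto
    qed
    have AB: "vfield M (V \<inter> U) (\<lambda>q h. A q h + B q h)" if A: "vfield M (V \<inter> U) A" and B: "vfield M (V \<inter> U) B" for A B
    proof (rule vfield_chartI [OF _ _ o s(1)])
      show "smooth_on E (\<phi> ` (V \<inter> U)) (\<lambda>x. crep A x + crep B x)"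
        by (rule smooth_on_add [OF relV [OF o s(1)] vfield_chartD(1) [OF A o s(1)] vfield_chartD(1) [OF B o s(1)]])
      show "crep A x + crep B x \<in> E" if "x \<in> \<phi> ` (V \<inter> U)" for x
        using vfield_chartD(2) [OF A o s(1) that] vfield_chartD(2) [OF B o s(1) that] subspace_add [OF subE] by blast
      show "(\<lambda>h. A q h + B q h) = tvc q (crep A (\<phi> q) + crep B (\<phi> q))" if "q \<in> V \<inter> U" for q
        using tv_add [of q "rep (A q)" "rep (B q)"] vfield_chartD(2) [OF A o s(1), of "\<phi> q"] vfield_chartD(3) [OF A o s(1) that]
          vfield_chartD(2) [OF B o s(1), of "\<phi> q"] vfield_chartD(3) [OF B o s(1) that] that by auto
    qed
    have e: "koszul_connection M g A B p = cov A B p" if "vfield M (V \<inter> U) A" "vfield M (V \<inter> U) B" for A B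
      by (rule koszul_connection_eq_cov [OF o s(1) that p'])
    show ?th1
      unfolding e [OF AB [OF X' Y'] Z'] e [OF kX [OF X'] Y'] e [OF X' AB [OF Y' Z']] e [OF X' kX [OF Y']]
        e [OF X' Y'] e [OF X' Z'] e [OF Y' Z']
      using cov_add1 [OF o s(1) X' Y' Z' p'] cov_scale1 [OF o s(1) X' Y' p'] cov_add2 [OF o s(1) X' Y' Z' p']
        cov_scale2 [OF o s(1) X' Y' p' k'] by blast
    show ?th2
      unfolding e [OF X' Y'] e [OF Y' X'] e [OF X' Z']
      using cov_torsion [OF o s(1) X' Y' p'] cov_metric [OF o s(1) X' Y' Z' p'] by blast
  qed
  have k0: "smooth_fun (open_sub M V) (\<lambda>q. 0)" if V: "openin (mtop M) V" for V
  proof -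
    have "smooth_near M q (\<lambda>q. 0)" if "q \<in> V" for q
    proof -
      obtain U \<phi> where U: "mfd_chart M U \<phi>" "q \<in> U" using mfd_chart_exists [OF M V \<open>q \<in> V\<close>] by metis
      show ?thesis by (rule mfd_chart.const_near [OF U])
    qed
    then show ?thesis using smooth_fun_near_iff [OF M V] by blast
  qed
  have "affine_connection M (koszul_connection M g)"
    unfolding affine_connection_def
    by (intro allI impI, elim conjE, rule conjI, rule vf, assumption+, rule ballI, rule eqs(1), assumption+)
  moreover have "(\<lambda>h. koszul_connection M g X Y p h - koszul_connection M g Y X p h) = lie_bracket M X Y p \<and>
     X p (\<lambda>q. g q (Y q) (Z q)) = g p (koszul_connection M g X Y p) (Z p) + g p (Y p) (koszul_connection M g X Z p)"
    if "openin (mtop M) V \<and> vfield M V X \<and> vfield M V Y \<and> vfield M V Z" "p \<in> V" for V X Y Z p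
    using eqs(2) [of V X Y Z "\<lambda>q. 0" p] k0 that by blast
  ultimately show ?thesis unfolding levi_civita_def by blast
qed

text \<open>The symbols are the coordinates of \<open>D\<close> on fields that are constant in the
  chart. Bilinearity comes from the axioms with constant functions, symmetry from the vanishing
  brackets, and \<open>\<Gamma>_met\<close> is metric compatibility on these fields.\<close>

lemma (in metric_chart) levi_civita_chris:
  assumes D: "levi_civita M g D"
  shows "\<exists>\<Gamma>. chris_chart M U \<phi> g \<Gamma>"
proof -
  \<comment> \<open>The fields are set to 0 outside \<open>U\<close> so that
    \<open>cf (a + b)\<close> and \<open>cf (r *\<^sub>R a)\<close> are a sum and a multiple as
    functions on all points; only then can the axioms for \<open>D\<close> be applied by
    rewriting.\<close>
  define cf where "cf a q = (if q \<in> U then tvc q a else (\<lambda>h. 0))" for a q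
  have cv: "vfield M U (cf a)" if "a \<in> E" for a
    by (rule vfield_cong [OF pm ch(1) const_vfield [OF that ch(1) subset_refl]]) (simp add: cf_def)
  have rf: "crep (cf a) x = a" if "a \<in> E" "x \<in> \<phi> ` U" for a x
    using that pt_in rep_tv unfolding cf_def by simp
  have kc: "smooth_fun (open_sub M U) (\<lambda>q. r)" for r
    using const_near smooth_fun_near_iff [OF pm ch(1)] by blast
  have ac: "smooth_field (open_sub M U) (D X Y)"
        "p \<in> U \<Longrightarrow> D (\<lambda>q h. X q h + Y q h) Z p = (\<lambda>h. D X Z p h + D Y Z p h)"
        "p \<in> U \<Longrightarrow> D (\<lambda>q h. r * X q h) Y p = (\<lambda>h. r * D X Y p h)"
        "p \<in> U \<Longrightarrow> D X (\<lambda>q h. Y q h + Z q h) p = (\<lambda>h. D X Y p h + D X Z p h)"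
        "p \<in> U \<Longrightarrow> D X (\<lambda>q h. r * Y q h) p = (\<lambda>h. X p (\<lambda>q. r) * Y p h + r * D X Y p h)"
    if "vfield M U X" "vfield M U Y" "vfield M U Z" for X Y Z p r
    using D kc [of r] ch(1) that unfolding levi_civita_def affine_connection_def by blast+
  have lc: "(\<lambda>h. D X Y p h - D Y X p h) = lie_bracket M X Y p"
    "X p (\<lambda>q. g q (Y q) (Z q)) = g p (D X Y p) (Z p) + g p (Y p) (D X Z p)"
    if "vfield M U X" "vfield M U Y" "vfield M U Z" "p \<in> U" for X Y Z p
    using D ch(1) that unfolding levi_civita_def by blast+
  define \<Gamma> where "\<Gamma> x a b = rep (D (cf a) (cf b) (pt x))" for x a b
  have Dv: "vfield M U (D (cf a) (cf b))" if "a \<in> E" "b \<in> E" for a b using ac(1) cv that by blast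
  have sm: "smooth_on E (\<phi> ` U) (\<lambda>x. \<Gamma> x a b)" if "a \<in> E" "b \<in> E" for a b
    unfolding \<Gamma>_def using vfield_chartD(1) [OF Dv [OF that] ch(1) subset_refl] .
  have GE: "\<Gamma> x a b \<in> E" if "x \<in> \<phi> ` U" "a \<in> E" "b \<in> E" for x a b
    unfolding \<Gamma>_def using vfield_chartD(2) [OF Dv [OF that(2,3)] ch(1) subset_refl that(1)] .
  have cadd: "cf (a + b) = (\<lambda>q h. cf a q h + cf b q h)" if "a \<in> E" "b \<in> E" for a b
    unfolding cf_def using tv_add that by auto
  have csc: "cf (r *\<^sub>R a) = (\<lambda>q h. r * cf a q h)" if "a \<in> E" for a r
    unfolding cf_def using tv_scale that by auto
  have const0: "cf a p (\<lambda>q. r) = 0" if "a \<in> E" "p \<in> U" for a p r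
    using field_apply [OF cv [OF that(1)] ch(1) subset_refl that(2) const_near [OF that(2)]] by simp
  have lin: "\<Gamma> x (a + b) c = \<Gamma> x a c + \<Gamma> x b c" "\<Gamma> x c (a + b) = \<Gamma> x c a + \<Gamma> x c b"
    "\<Gamma> x (r *\<^sub>R a) c = r *\<^sub>R \<Gamma> x a c" "\<Gamma> x c (r *\<^sub>R a) = r *\<^sub>R \<Gamma> x c a"
    if x: "x \<in> \<phi> ` U" and abc: "a \<in> E" "b \<in> E" "c \<in> E" for x a b c r
  proof -
    note p = pt_in [OF x] and v = cv [OF abc(1)] cv [OF abc(2)] cv [OF abc(3)]
    show "\<Gamma> x (a + b) c = \<Gamma> x a c + \<Gamma> x b c" unfolding \<Gamma>_def cadd [OF abc(1,2)] ac(2) [OF v p] by (rule rep_add)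
    show "\<Gamma> x c (a + b) = \<Gamma> x c a + \<Gamma> x c b" unfolding \<Gamma>_def cadd [OF abc(1,2)] ac(4) [OF v(3,1,2) p] by (rule rep_add)
    show "\<Gamma> x (r *\<^sub>R a) c = r *\<^sub>R \<Gamma> x a c" unfolding \<Gamma>_def csc [OF abc(1)] ac(3) [OF v(1,3,3) p] by (rule rep_scale)
    show "\<Gamma> x c (r *\<^sub>R a) = r *\<^sub>R \<Gamma> x c a"
      unfolding \<Gamma>_def csc [OF abc(1)] ac(5) [OF v(3,1,1) p] const0 [OF abc(3) p] by (simp add: rep_scale)
  qed
  have sym: "\<Gamma> x a b = \<Gamma> x b a" if x: "x \<in> \<phi> ` U" and ab: "a \<in> E" "b \<in> E" for x a b
  proof -
    note p = pt_in [OF x] and v = cv [OF ab(1)] cv [OF ab(2)]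
    have d0: "dd (crep (cf c)) x d = 0" if "c \<in> E" "d \<in> E" for c d
      using dd_cong [OF ch(4) x that(2), of "crep (cf c)" "\<lambda>x. c"] rf [OF that(1)] by simp
    have "lie_bracket M (cf a) (cf b) (pt x) = (\<lambda>h. 0)"
      unfolding lie_bracket_chart [OF v ch(1) subset_refl p] phi_pt [OF x] rf [OF ab(1) x] rf [OF ab(2) x]
        d0 [OF ab] d0 [OF ab(2,1)] by (simp add: tv_zero [OF p])
    then have "D (cf a) (cf b) (pt x) h = D (cf b) (cf a) (pt x) h" for h
      using fun_cong [OF lc(1) [OF v v(1) p], of h] by simp
    then show ?thesis unfolding \<Gamma>_def by presburger
  qed
  have met: "dd (\<lambda>y. G y b c) x a = G x (\<Gamma> x a b) c + G x b (\<Gamma> x a c)"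
    if x: "x \<in> \<phi> ` U" and abc: "a \<in> E" "b \<in> E" "c \<in> E" for x a b c
  proof -
    note p = pt_in [OF x] and v = cv [OF abc(1)] cv [OF abc(2)] cv [OF abc(3)]
    have Gc: "G y b c = g (pt y) (cf b (pt y)) (cf c (pt y))" if "y \<in> \<phi> ` U" for y
      unfolding G_def cf_def using pt_in [OF that] by simp
    have "dd (\<lambda>y. G y b c) x a = dd (\<lambda>y. g (pt y) (cf b (pt y)) (cf c (pt y))) x a"
      by (rule dd_cong [OF ch(4) x abc(1) Gc])
    also have "\<dots> = cf a (pt x) (\<lambda>q. g q (cf b q) (cf c q))"
      using field_apply [OF v(1) ch(1) subset_refl p metric_smooth_near [OF v(2,3) ch(1) p]] rf [OF abc(1) x] phi_pt [OF x] by simp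
    also have "\<dots> = g (pt x) (D (cf a) (cf b) (pt x)) (cf c (pt x)) + g (pt x) (cf b (pt x)) (D (cf a) (cf c) (pt x))"
      by (rule lc(2) [OF v p])
    also have "\<dots> = G x (\<Gamma> x a b) c + G x b (\<Gamma> x a c)"
      using g_chart [OF Dv [OF abc(1,2)] v(3) ch(1) subset_refl p] g_chart [OF v(2) Dv [OF abc(1,3)] ch(1) subset_refl p]
        rf [OF abc(2) x] rf [OF abc(3) x] phi_pt [OF x] unfolding \<Gamma>_def by simp
    finally show ?thesis .
  qed
  have "chris_chart M U \<phi> g \<Gamma>"
    by unfold_locales (use sm GE lin sym met in \<open>auto simp: bilfam_def linfam_def\<close>)
  then show ?thesis by blast
qed

section \<open>Constant curvature as an identity for Christoffel symbols\<close>

context chris_chart begin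

text \<open>The denominator is cleared, so the identity makes sense on every plane. Warped metrics
  require this: the slice components of a nondegenerate pair can span a degenerate plane, and the
  curvature of the slice is needed there too.\<close>

definition const_curv :: "real \<Rightarrow> bool" where
  "const_curv C \<longleftrightarrow> (\<forall>x\<in>\<phi> ` U. \<forall>a\<in>E. \<forall>b\<in>E. G x (riem x a b b) a = C * (G x a a * G x b b - (G x a b)\<^sup>2))"

lemma riem_rules:
  assumes x: "x \<in> \<phi> ` U" and "a \<in> E" "b \<in> E" "c \<in> E" "e \<in> E"
  shows "riem x (a + e) b c = riem x a b c + riem x e b c" "riem x (r *\<^sub>R a) b c = r *\<^sub>R riem x a b c"
    "riem x a b (c + e) = riem x a b c + riem x a b e" "riem x a b (r *\<^sub>R c) = r *\<^sub>R riem x a b c"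
    "riem x a b c = - riem x b a c"
proof -
  have d1: "dd (\<lambda>y. \<Gamma> y b c) x (a + e) = dd (\<lambda>y. \<Gamma> y b c) x a + dd (\<lambda>y. \<Gamma> y b c) x e"
      "dd (\<lambda>y. \<Gamma> y b c) x (r *\<^sub>R a) = r *\<^sub>R dd (\<lambda>y. \<Gamma> y b c) x a" if "a \<in> E" "b \<in> E" "c \<in> E" "e \<in> E" for a b c e r
    using dd_add [OF ch(4) bilfam_smooth [OF \<Gamma>_bil] x] dd_scaleR [OF ch(4) bilfam_smooth [OF \<Gamma>_bil] x] that by auto
  have sm: "smooth_on E (\<phi> ` U) (\<lambda>y. \<Gamma> y b c)" if "b \<in> E" "c \<in> E" for b c using bilfam_smooth [OF \<Gamma>_bil that] .
  note rel = bilfam_rules [OF \<Gamma>_bil]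
  have d2: "dd (\<lambda>y. \<Gamma> y (b + e) c) x a = dd (\<lambda>y. \<Gamma> y b c) x a + dd (\<lambda>y. \<Gamma> y e c) x a"
    "dd (\<lambda>y. \<Gamma> y c (b + e)) x a = dd (\<lambda>y. \<Gamma> y c b) x a + dd (\<lambda>y. \<Gamma> y c e) x a"
    "dd (\<lambda>y. \<Gamma> y (r *\<^sub>R b) c) x a = r *\<^sub>R dd (\<lambda>y. \<Gamma> y b c) x a"
    "dd (\<lambda>y. \<Gamma> y c (r *\<^sub>R b)) x a = r *\<^sub>R dd (\<lambda>y. \<Gamma> y c b) x a"
    if A: "a \<in> E" "b \<in> E" "c \<in> E" "e \<in> E" for a b c e r
  proof -
    show "dd (\<lambda>y. \<Gamma> y (b + e) c) x a = dd (\<lambda>y. \<Gamma> y b c) x a + dd (\<lambda>y. \<Gamma> y e c) x a"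
      using dd_cong [OF ch(4) x A(1) rel(1) [OF _ A(2,4,3)]] dd_plus [OF ch(4) sm [OF A(2,3)] sm [OF A(4,3)] x A(1)] by simp
    show "dd (\<lambda>y. \<Gamma> y c (b + e)) x a = dd (\<lambda>y. \<Gamma> y c b) x a + dd (\<lambda>y. \<Gamma> y c e) x a"
      using dd_cong [OF ch(4) x A(1) rel(2) [OF _ A(2,4,3)]] dd_plus [OF ch(4) sm [OF A(3,2)] sm [OF A(3,4)] x A(1)] by simp
    show "dd (\<lambda>y. \<Gamma> y (r *\<^sub>R b) c) x a = r *\<^sub>R dd (\<lambda>y. \<Gamma> y b c) x a"
      using dd_cong [OF ch(4) x A(1) rel(3) [OF _ A(2,2,3)]] dd_linear [OF ch(4) bounded_linear_scaleR_right sm [OF A(2,3)] x A(1)] by simp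
    show "dd (\<lambda>y. \<Gamma> y c (r *\<^sub>R b)) x a = r *\<^sub>R dd (\<lambda>y. \<Gamma> y c b) x a"
      using dd_cong [OF ch(4) x A(1) rel(4) [OF _ A(2,2,3)]] dd_linear [OF ch(4) bounded_linear_scaleR_right sm [OF A(3,2)] x A(1)] by simp
  qed
  note rx = rel [OF x] and GE = \<Gamma>_E [OF x]
  show "riem x (a + e) b c = riem x a b c + riem x e b c" "riem x (r *\<^sub>R a) b c = r *\<^sub>R riem x a b c"
    "riem x a b (c + e) = riem x a b c + riem x a b e" "riem x a b (r *\<^sub>R c) = r *\<^sub>R riem x a b c"
    unfolding riem_def using assms by (simp_all add: d1 d2 rx GE algebra_simps)
  show "riem x a b c = - riem x b a c" unfolding riem_def by simp
qed

text \<open>Both sides are polynomial in a and b, so \<open>sectional_extend\<close> removes the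
  nondegeneracy condition.\<close>

lemma const_curvI:
  assumes "\<And>x a b. x \<in> \<phi> ` U \<Longrightarrow> a \<in> E \<Longrightarrow> b \<in> E \<Longrightarrow> G x a a * G x b b - (G x a b)\<^sup>2 \<noteq> 0 \<Longrightarrow>
     G x (riem x a b b) a = C * (G x a a * G x b b - (G x a b)\<^sup>2)"
  shows "const_curv C"
  unfolding const_curv_def
proof (intro ballI)
  fix x a b assume x: "x \<in> \<phi> ` U" and ab: "a \<in> E" "b \<in> E"
  have R2: "riem x a (b + e) c = riem x a b c + riem x a e c" "riem x a (r *\<^sub>R b) c = r *\<^sub>R riem x a b c"
    if "a \<in> E" "b \<in> E" "c \<in> E" "e \<in> E" for a b c e r
  proof -
    have be: "b + e \<in> E" "r *\<^sub>R b \<in> E" using that subspace_add [OF subE] subspace_scale [OF subE] by auto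
    show "riem x a (b + e) c = riem x a b c + riem x a e c"
      unfolding riem_rules(5) [OF x that(1) be(1) that(3,4)] riem_rules(5) [OF x that(1,2,3,4)] riem_rules(5) [OF x that(1,4,3,4)]
        riem_rules(1) [OF x that(2,1,3,4)] by simp
    show "riem x a (r *\<^sub>R b) c = r *\<^sub>R riem x a b c"
      unfolding riem_rules(5) [OF x that(1) be(2) that(3,4)] riem_rules(5) [OF x that(1,2,3,4)]
        riem_rules(2) [OF x that(2,1,3,4)] by simp
  qed
  note rules = riem_rules(1-4) [OF x] R2 G_rules [OF x] riem_E [OF x]
  show "G x (riem x a b b) a = C * (G x a a * G x b b - (G x a b)\<^sup>2)"
  proof (rule sectional_extend [where K = "\<lambda>a b c d. G x (riem x a b c) d", OF subE _ _ G_sym [OF x] G_nondeg [OF x] _ _ _ _ _ _ _ _ _ assms [OF x] ab])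
    fix a b c d assume A: "a \<in> E" "b \<in> E" "c \<in> E" "d \<in> E"
    have "G x (riem x a b c) d = G x ((-1) *\<^sub>R riem x b a c) d" using riem_rules(5) [OF x A(1,2,3,4)] by simp
    then show "G x (riem x a b c) d = - G x (riem x b a c) d"
      using G_rules(3) [OF x riem_E [OF x A(2,1,3)] A(4) A(4), of "-1"] by simp
  qed (auto simp: rules)
qed

end

lemma (in metric_chart) csc_const_curv:
  assumes "constant_sectional_curvature M g C"
  shows "\<exists>\<Gamma>. chris_chart M U \<phi> g \<Gamma> \<and> chris_chart.const_curv M U \<phi> g \<Gamma> C"
proof -
  obtain D where D: "levi_civita M g D"
    "\<And>V X Y p. openin (mtop M) V \<Longrightarrow> vfield M V X \<Longrightarrow> vfield M V Y \<Longrightarrow> p \<in> V \<Longrightarrow> gram_det g p (X p) (Y p) \<noteq> 0 \<Longrightarrow>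
       sectional_curvature M g D X Y p = C"
    using assms unfolding constant_sectional_curvature_def by metis
  obtain \<Gamma> where \<Gamma>: "chris_chart M U \<phi> g \<Gamma>" using levi_civita_chris [OF D(1)] by blast
  interpret C: chris_chart M U \<phi> g \<Gamma> by fact
  have "C.const_curv C"
  proof (rule C.const_curvI)
    fix x a b assume x: "x \<in> \<phi> ` U" and ab: "a \<in> E" "b \<in> E" and nz: "G x a a * G x b b - (G x a b)\<^sup>2 \<noteq> 0"
    note p = pt_in [OF x] and v = const_vfield [OF ab(1) ch(1) subset_refl] const_vfield [OF ab(2) ch(1) subset_refl]
    have gr: "gram_det g (pt x) (tvc (pt x) a) (tvc (pt x) b) = G x a a * G x b b - (G x a b)\<^sup>2"
      unfolding gram_det_def G_def ..
    have "sectional_curvature M g D (\<lambda>q. tvc q a) (\<lambda>q. tvc q b) (pt x) = C"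
      by (rule D(2) [OF ch(1) v p]) (use gr nz in simp)
    then show "G x (C.riem x a b b) a = C * (G x a a * G x b b - (G x a b)\<^sup>2)"
      using C.sectional_chart [OF D(1) ch(1) subset_refl v p] nz p ab phi_pt [OF x] by (simp add: gr field_simps)
  qed
  then show ?thesis using \<Gamma> by blast
qed

text \<open>The connection demanded by the definition is the glued one; its sectional curvature is
  then computed in the chart around each point.\<close>

lemma csc_of_const_curv:
  assumes M: "pmfd M"
    and charts: "\<And>p. p \<in> pts M \<Longrightarrow> \<exists>U \<phi> \<Gamma>. p \<in> U \<and> chris_chart M U \<phi> g \<Gamma> \<and> chris_chart.const_curv M U \<phi> g \<Gamma> C"
  shows "constant_sectional_curvature M g C"
  unfolding constant_sectional_curvature_def
proof (intro exI [of _ "koszul_connection M g"] conjI allI impI ballI)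
  show L: "levi_civita M g (koszul_connection M g)"
  proof (rule koszul_connection_levi_civita [OF M])
    fix p assume "p \<in> pts M"
    then obtain U \<phi> \<Gamma> where "p \<in> U" "chris_chart M U \<phi> g \<Gamma>" using charts by metis
    then show "\<exists>U \<phi> \<Gamma>. p \<in> U \<and> chris_chart M U \<phi> g \<Gamma>" by blast
  qed
  fix V X Y p
  assume A: "openin (mtop M) V \<and> vfield M V X \<and> vfield M V Y" and p: "p \<in> V" and nz: "gram_det g p (X p) (Y p) \<noteq> 0"
  have "p \<in> pts M" using A p openin_subset by blast
  then obtain U \<phi> \<Gamma> where U: "p \<in> U" "chris_chart M U \<phi> g \<Gamma>" "chris_chart.const_curv M U \<phi> g \<Gamma> C" using charts by blast
  interpret chris_chart M U \<phi> g \<Gamma> by fact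
  have o: "openin (mtop M) (V \<inter> U)" and s: "V \<inter> U \<subseteq> U" "V \<inter> U \<subseteq> V" and p': "p \<in> V \<inter> U" using A ch(1) p U by auto
  have X: "vfield M (V \<inter> U) X" and Y: "vfield M (V \<inter> U) Y" using vfield_subset [OF M _ o s(2)] A by auto
  have x: "\<phi> p \<in> \<phi> ` (V \<inter> U)" using p' by blast
  show "sectional_curvature M g (koszul_connection M g) X Y p = C"
    using U(3) nz vfield_chartD(2) [OF X o s(1) x] vfield_chartD(2) [OF Y o s(1) x] x
    unfolding sectional_chart [OF L o s(1) X Y p'] gram_chart [OF o s(1) X Y p'] const_curv_def by auto
qed

section \<open>Hypersurfaces\<close>

lemma relopen_Int_subspace:
  assumes "relopen E S" "subspace H" "H \<subseteq> E"
  shows "relopen H (S \<inter> H)"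
proof -
  obtain T where T: "open T" "S = E \<inter> T" using assms(1) unfolding relopen_def openin_open by blast
  have "S \<inter> H = H \<inter> T" using T assms(3) by auto
  then show ?thesis using T(1) assms(2) unfolding relopen_def openin_open by blast
qed

lemma smooth_on_restrict:
  assumes "relopen E S" "subspace H" "H \<subseteq> E" "smooth_on E S f"
  shows "smooth_on H (S \<inter> H) f"
  using smooth_on_compose [OF relopen_Int_subspace [OF assms(1-3)] assms(1)
      smooth_on_ident [OF relopen_Int_subspace [OF assms(1-3)]] assms(4)] by simp

lemma bilfam_restrict:
  assumes "relopen E S" "subspace H" "H \<subseteq> E" "bilfam E S A"
  shows "bilfam H (S \<inter> H) A"
proof -
  have "smooth_on H (S \<inter> H) (\<lambda>x. A x a b)" if "a \<in> H" "b \<in> H" for a b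
    by (rule smooth_on_restrict [OF assms(1-3) bilfam_smooth [OF assms(4)]]) (use that assms(3) in auto)
  moreover have "A x (a + b) c = A x a c + A x b c" "A x c (a + b) = A x c a + A x c b"
    "A x (r *\<^sub>R a) c = r *\<^sub>R A x a c" "A x c (r *\<^sub>R a) = r *\<^sub>R A x c a"
    if "x \<in> S \<inter> H" "a \<in> H" "b \<in> H" "c \<in> H" for x a b c r
    using bilfam_rules [OF assms(4), of x a b c] that assms(3) by (simp_all add: subset_iff)
  ultimately show ?thesis unfolding bilfam_def linfam_def by auto
qed

lemma smooth_at_from_emfd:
  assumes \<Omega>: "relopen E \<Omega>" and O': "relopen E O'" "O' \<subseteq> \<Omega>" "x \<in> O'" and V: "(V, \<psi>) \<in> maximal_atlas N"
    and F: "F ` O' \<subseteq> V" "smooth_on E O' (\<lambda>x. \<psi> (F x))"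
  shows "smooth_at (emfd E \<Omega>) N F x"
proof (rule smooth_atI [OF pmfd_emfd [OF \<Omega>] emfd_max [OF \<Omega>] V])
  show "openin (mtop (emfd E \<Omega>)) O'"
    using O' \<Omega> openin_subset_trans [of E O' \<Omega>] relopenD(3) [OF \<Omega>] unfolding relopen_def by auto
  have "inv_into \<Omega> id y = y" if "y \<in> O'" for y using O'(2) that inv_into_f_f [of id \<Omega> y] by auto
  then show "smooth_on (model (emfd E \<Omega>)) (id ` O') (\<lambda>x. \<psi> (F (inv_into \<Omega> id x)))"
    using F(2) smooth_on_cong [of O' "\<lambda>x. \<psi> (F (inv_into \<Omega> id x))" "\<lambda>x. \<psi> (F x)" E] by simp
qed (use O' F in auto)

lemma smooth_at_from_emfdD:
  assumes \<Omega>: "relopen E \<Omega>" and N: "pmfd N" and F: "smooth_at (emfd E \<Omega>) N F x" and x: "x \<in> \<Omega>"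
    and V: "(V, \<psi>) \<in> maximal_atlas N" "F x \<in> V"
  obtains O' where "relopen E O'" "O' \<subseteq> \<Omega>" "x \<in> O'" "F ` O' \<subseteq> V" "smooth_on E O' (\<lambda>x. \<psi> (F x))"
proof -
  obtain O' where O': "openin (mtop (emfd E \<Omega>)) O'" "x \<in> O'" "O' \<subseteq> \<Omega>" "F ` O' \<subseteq> V"
    "smooth_on (model (emfd E \<Omega>)) (id ` O') (\<lambda>x. \<psi> (F (inv_into \<Omega> id x)))"
    using smooth_at_chart [OF pmfd_emfd [OF \<Omega>] N F emfd_max [OF \<Omega>] x V] by metis
  have "inv_into \<Omega> id y = y" if "y \<in> O'" for y using O'(3) that inv_into_f_f [of id \<Omega> y] by auto
  then have "smooth_on E O' (\<lambda>x. \<psi> (F x))"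
    using O'(5) smooth_on_cong [of O' "\<lambda>x. \<psi> (F (inv_into \<Omega> id x))" "\<lambda>x. \<psi> (F x)" E] by simp
  moreover have "relopen E O'"
    using O'(1) \<Omega> openin_trans unfolding relopen_def emfd_simps by metis
  ultimately show ?thesis using that O' by blast
qed

text \<open>Continuity of the two mutually inverse maps gives the correspondence of open sets
  required of a chart, and their smoothness gives compatibility. Both the straightened level sets
  and the adapted chart enter the maximal atlas in this way.\<close>

lemma maximal_atlasI:
  fixes M :: "('p, 'e::euclidean_space) mfd"
  assumes M: "pmfd M" and W: "openin (mtop M) W" and \<Omega>: "relopen (model M) \<Omega>"
    and 1: "\<And>q. q \<in> W \<Longrightarrow> \<phi> q \<in> \<Omega>" "\<And>q. q \<in> W \<Longrightarrow> \<Phi> (\<phi> q) = q"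
    and 2: "\<And>x. x \<in> \<Omega> \<Longrightarrow> \<Phi> x \<in> W" "\<And>x. x \<in> \<Omega> \<Longrightarrow> \<phi> (\<Phi> x) = x"
    and s: "\<And>q. q \<in> W \<Longrightarrow> smooth_at M (emfd (model M) \<Omega>) \<phi> q"
    and t: "\<And>x. x \<in> \<Omega> \<Longrightarrow> smooth_at (emfd (model M) \<Omega>) M \<Phi> x"
  shows "(W, \<phi>) \<in> maximal_atlas M"
proof -
  let ?E = "model M"
  have inj: "inj_on \<phi> W" using 1 by (metis inj_onI)
  have img: "\<phi> ` W = \<Omega>" using 1 2 by force
  have inv: "inv_into W \<phi> x = \<Phi> x" if "x \<in> \<Omega>" for x using inv_into_f_f [OF inj 2(1) [OF that]] 2(2) [OF that] by simp
  have sW: "smooth_map (open_sub M W) (emfd ?E \<Omega>) \<phi>"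
    unfolding smooth_map_iff [OF pmfd_open_sub [OF M W] pmfd_emfd [OF \<Omega>]] pts_open_sub [OF W]
    using s smooth_at_open_sub [OF M W] by blast
  have sO: "smooth_map (emfd ?E \<Omega>) M \<Phi>"
    unfolding smooth_map_iff [OF pmfd_emfd [OF \<Omega>] M] using t by simp
  have iff: "openin (mtop M) V \<longleftrightarrow> relopen ?E (\<phi> ` V)" if V: "V \<subseteq> W" for V
  proof
    assume "openin (mtop M) V"
    then have "openin (top_of_set \<Omega>) {x \<in> \<Omega>. \<Phi> x \<in> V}"
      using sO unfolding smooth_map_def continuous_map_def by simp
    moreover have "{x \<in> \<Omega>. \<Phi> x \<in> V} = \<phi> ` V" using 1 2 V by force
    ultimately show "relopen ?E (\<phi> ` V)" using \<Omega> openin_trans unfolding relopen_def by metis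
  next
    assume r: "relopen ?E (\<phi> ` V)"
    have "openin (top_of_set \<Omega>) (\<phi> ` V)"
      using r openin_subset_trans [of ?E "\<phi> ` V" \<Omega>] V img relopenD(3) [OF \<Omega>] unfolding relopen_def by auto
    then have "openin (subtopology (mtop M) W) {x \<in> pts (open_sub M W). \<phi> x \<in> \<phi> ` V}"
      using sW unfolding smooth_map_def continuous_map_def by simp
    moreover have "{x \<in> pts (open_sub M W). \<phi> x \<in> \<phi> ` V} = V"
      unfolding pts_open_sub [OF W] using inj V by (auto dest: inj_onD)
    ultimately show "openin (mtop M) V" using openin_open_subtopology [OF W] by metis
  qed
  have ch: "is_chart M (W, \<phi>)" by (rule is_chartI [OF W inj iff])
  have "compatible M (W, \<phi>) (V, \<psi>)" if at: "(V, \<psi>) \<in> atlas M" for V \<psi>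
  proof -
    have V: "(V, \<psi>) \<in> maximal_atlas M" using atlas_max [OF M at] .
    note cV = max_chart [OF M V]
    have o: "openin (mtop M) (W \<inter> V)" using W cV(1) by blast
    have a: "smooth_on ?E (\<phi> ` (W \<inter> V)) (\<lambda>x. \<psi> (inv_into W \<phi> x))"
    proof (rule smooth_on_local)
      show r: "relopen ?E (\<phi> ` (W \<inter> V))" using iff o by blast
      fix x assume "x \<in> \<phi> ` (W \<inter> V)"
      then have x: "x \<in> \<Omega>" "\<Phi> x \<in> V" using 1 by auto
      obtain O' where O': "relopen ?E O'" "O' \<subseteq> \<Omega>" "x \<in> O'" "\<Phi> ` O' \<subseteq> V" "smooth_on ?E O' (\<lambda>x. \<psi> (\<Phi> x))"
        using smooth_at_from_emfdD [OF \<Omega> M t [OF x(1)] x(1) V x(2)] by metis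
      have "smooth_on ?E O' (\<lambda>x. \<psi> (inv_into W \<phi> x))"
        by (rule iffD2 [OF smooth_on_cong O'(5)]) (use inv O'(2) in auto)
      moreover have "O' \<subseteq> \<phi> ` (W \<inter> V)"
      proof
        fix y assume y: "y \<in> O'"
        then have "\<Phi> y \<in> W \<inter> V" "y = \<phi> (\<Phi> y)" using O' 2 by auto
        then show "y \<in> \<phi> ` (W \<inter> V)" by blast
      qed
      ultimately show "\<exists>T. relopen ?E T \<and> T \<subseteq> \<phi> ` (W \<inter> V) \<and> x \<in> T \<and> smooth_on ?E T (\<lambda>x. \<psi> (inv_into W \<phi> x))"
        using O' by blast
    qed
    have b: "smooth_on ?E (\<psi> ` (W \<inter> V)) (\<lambda>x. \<phi> (inv_into V \<psi> x))"
    proof (rule smooth_on_local)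
      show r: "relopen ?E (\<psi> ` (W \<inter> V))" using cV(6) [of "W \<inter> V"] o by blast
      fix x assume "x \<in> \<psi> ` (W \<inter> V)"
      then obtain q where q: "q \<in> W" "q \<in> V" "x = \<psi> q" by blast
      obtain O' where O': "openin (mtop M) O'" "q \<in> O'" "O' \<subseteq> V" "\<phi> ` O' \<subseteq> \<Omega>"
        "smooth_on ?E (\<psi> ` O') (\<lambda>x. \<phi> (inv_into V \<psi> x))"
        using smooth_at_emfdD [OF M \<Omega> s [OF q(1)] V q(2) 1(1) [OF q(1)]] by metis
      have r': "relopen ?E (\<psi> ` (O' \<inter> W))" "relopen ?E (\<psi> ` O')"
        using cV(6) [of "O' \<inter> W"] cV(6) [of O'] O' W by auto
      have "smooth_on ?E (\<psi> ` (O' \<inter> W)) (\<lambda>x. \<phi> (inv_into V \<psi> x))"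
        by (rule smooth_on_subset [OF O'(5)]) auto
      then show "\<exists>T. relopen ?E T \<and> T \<subseteq> \<psi> ` (W \<inter> V) \<and> x \<in> T \<and> smooth_on ?E T (\<lambda>x. \<phi> (inv_into V \<psi> x))"
        using r' O' q by (intro exI [of _ "\<psi> ` (O' \<inter> W)"]) auto
    qed
    show ?thesis unfolding compatible_def comp_def using a b by simp
  qed
  then show ?thesis unfolding maximal_atlas_def using ch by auto
qed

text \<open>The derivative \<open>v + dF v e\<close> is a rank-one change of the identity, with
  explicit inverse \<open>v - (dF v / (1 + dF e)) e\<close>. The inverse function theorem gives a
  differentiable k; the explicit inverse expresses its derivative by a smooth function composed with
  k, so k gains one order at each step.\<close>

lemma shear_inverse:
  fixes F :: "'a::euclidean_space \<Rightarrow> real" and e :: 'a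
  assumes U: "open U" "x0 \<in> U" and F: "smooth_on UNIV U F" and nz: "1 + dd F x0 e \<noteq> 0"
  obtains U' V k where "open U'" "U' \<subseteq> U" "x0 \<in> U'" "open V" "homeomorphism U' V (\<lambda>x. x + F x *\<^sub>R e) k"
    "smooth_on UNIV V k"
proof -
  define f where "f x = x + F x *\<^sub>R e" for x
  have rU: "relopen UNIV U" using U by simp
  have dF: "\<exists>F'. (F has_derivative F') (at x) \<and> (\<forall>v. dd F x v = F' v)" if x: "x \<in> U" for x
  proof -
    obtain F' where "(F has_derivative F') (at x within U)" "\<And>v. v \<in> UNIV \<Longrightarrow> dd F x v = F' v"
      using smooth_has_derivative [OF rU F x] by metis
    then show ?thesis using U(1) x at_within_open by (metis UNIV_I)
  qed
  have bl: "bounded_linear (\<lambda>v. v + dd F x v *\<^sub>R e)"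
    and df: "(f has_derivative (\<lambda>v. v + dd F x v *\<^sub>R e)) (at x)" if x: "x \<in> U" for x
  proof -
    obtain F' where F': "(F has_derivative F') (at x)" "\<And>v. dd F x v = F' v" using dF [OF x] by blast
    show "(f has_derivative (\<lambda>v. v + dd F x v *\<^sub>R e)) (at x)"
      unfolding f_def F'(2) by (auto intro!: derivative_eq_intros F'(1))
    then show "bounded_linear (\<lambda>v. v + dd F x v *\<^sub>R e)" by (rule has_derivative_bounded_linear)
  qed
  define f' where "f' x = Blinfun (\<lambda>v. v + dd F x v *\<^sub>R e)" for x
  have f'_app: "blinfun_apply (f' x) = (\<lambda>v. v + dd F x v *\<^sub>R e)" if "x \<in> U" for x
    unfolding f'_def using bounded_linear_Blinfun_apply [OF bl [OF that]] .
  have cont: "continuous_on U f'"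
  proof (rule continuous_on_blinfun_componentwise)
    fix i :: 'a assume "i \<in> Basis"
    have "continuous_on U (\<lambda>x. i + dd F x i *\<^sub>R e)"
      using smooth_on_imp_continuous_on [OF smooth_on_dd [OF rU F UNIV_I]] by (intro continuous_intros)
    then show "continuous_on U (\<lambda>x. blinfun_apply (f' x) i)"
      by (rule continuous_on_eq) (simp add: f'_app)
  qed
  define c where "c = 1 + dd F x0 e"
  obtain F0 where F0: "(F has_derivative F0) (at x0)" "\<And>v. dd F x0 v = F0 v" using dF [OF U(2)] by blast
  have linF0: "bounded_linear F0" using F0(1) by (rule has_derivative_bounded_linear)
  interpret F0: bounded_linear F0 by fact
  have ibl: "bounded_linear (\<lambda>v. v - (F0 v / c) *\<^sub>R e)"
    by (intro bounded_linear_sub bounded_linear_ident bounded_linear_compose [OF bounded_linear_scaleR_left]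
       bounded_linear_compose [OF bounded_linear_divide] linF0)
  have inv: "Blinfun (\<lambda>v. v - (F0 v / c) *\<^sub>R e) o\<^sub>L f' x0 = id_blinfun"
  proof (rule blinfun_eqI)
    fix v
    have "v + F0 v *\<^sub>R e - ((F0 v + F0 v * F0 e) / c) *\<^sub>R e = v"
      using nz unfolding c_def F0(2) by (simp add: divide_simps algebra_simps flip: scaleR_add_left)
    then show "blinfun_apply (Blinfun (\<lambda>v. v - (F0 v / c) *\<^sub>R e) o\<^sub>L f' x0) v = blinfun_apply id_blinfun v"
      by (simp add: f'_app [OF U(2)] bounded_linear_Blinfun_apply [OF ibl] F0(2) F0.add F0.scaleR)
  qed
  obtain U' V k k' where I: "open U'" "U' \<subseteq> U" "x0 \<in> U'" "open V" "f x0 \<in> V" "homeomorphism U' V f k"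
    and k': "\<And>y. y \<in> V \<Longrightarrow> (k has_derivative (k' y)) (at y)"
      "\<And>y. y \<in> V \<Longrightarrow> k' y = inv (blinfun_apply (f'(k y)))" "\<And>y. y \<in> V \<Longrightarrow> bij (blinfun_apply (f'(k y)))"
  proof (rule inverse_function_theorem [OF U(1) _ cont U(2) inv, of f])
    show "(f has_derivative blinfun_apply (f' x)) (at x)" if "x \<in> U" for x
      using df [OF that] unfolding f'_app [OF that] .
  qed (rule that)
  have rU': "relopen UNIV U'" and rV: "relopen UNIV V" using I by auto
  have kU': "k y \<in> U'" if "y \<in> V" for y using I(6) that unfolding homeomorphism_def by auto
  have FU': "smooth_on UNIV U' F" by (rule smooth_on_subset [OF F I(2)])
  have key: "1 + dd F (k y) e \<noteq> 0" "dd k y v = v - (dd F (k y) v / (1 + dd F (k y) e)) *\<^sub>R e" if y: "y \<in> V" for y v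
  proof -
    have xU: "k y \<in> U" using kU' [OF y] I(2) by auto
    obtain F1 where F1: "(F has_derivative F1) (at (k y))" "\<And>v. dd F (k y) v = F1 v" using dF [OF xU] by blast
    interpret F1: bounded_linear F1 using F1(1) by (rule has_derivative_bounded_linear)
    have b: "bij (\<lambda>v. v + F1 v *\<^sub>R e)" using k'(3) [OF y] unfolding f'_app [OF xU] F1(2) .
    \<comment> \<open>If this vanished, e would lie in the kernel of a bijective linear map, so e =
      0, and then the sum would be 1.\<close>
    show nz: "1 + dd F (k y) e \<noteq> 0"
    proof
      assume z: "1 + dd F (k y) e = 0"
      then have "e + F1 e *\<^sub>R e = 0 + F1 0 *\<^sub>R e" unfolding F1(2) F1.zero
        by (metis scaleR_add_left scaleR_one scaleR_zero_left add_0)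
      then have "e = 0" using b unfolding bij_def inj_def by blast
      then show False using z F1.zero F1(2) by simp
    qed
    have "(v - (F1 v / (1 + F1 e)) *\<^sub>R e) + F1 (v - (F1 v / (1 + F1 e)) *\<^sub>R e) *\<^sub>R e = v"
      using nz unfolding F1(2) F1.diff F1.scaleR by (simp add: divide_simps algebra_simps flip: scaleR_add_left)
    then have "inv (\<lambda>v. v + F1 v *\<^sub>R e) v = v - (F1 v / (1 + F1 e)) *\<^sub>R e"
      by (rule inv_f_eq [OF bij_is_inj [OF b]])
    then have "k' y v = v - (F1 v / (1 + F1 e)) *\<^sub>R e" unfolding k'(2) [OF y] f'_app [OF xU] F1(2) .
    moreover have "dd k y v = k' y v"
      using dd_eq [OF rV y, of v k "k' y"] k'(1) [OF y] has_derivative_at_withinI by blast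
    ultimately show "dd k y v = v - (dd F (k y) v / (1 + dd F (k y) e)) *\<^sub>R e" unfolding F1(2) by simp
  qed
  have fU: "k ` V = U'" using I(6) unfolding homeomorphism_def by auto
  have nzU: "1 + dd F x e \<noteq> 0" if "x \<in> U'" for x using key(1) fU that by blast
  have sq: "smooth_on UNIV U' (\<lambda>x. v - (dd F x v / (1 + dd F x e)) *\<^sub>R e)" for v
    by (intro smooth_on_diff smooth_on_scaleR smooth_on_divide smooth_on_add smooth_on_const smooth_on_dd FU' rU' UNIV_I nzU)
  have "Ck_on UNIV n k V" for n
  proof (induction n)
    case 0
    then show ?case using I(6) unfolding homeomorphism_def by simp
  next
    case (Suc n)
    show ?case unfolding Ck_on_Suc [OF rV]
    proof (intro conjI ballI)
      fix y assume "y \<in> V" then show "k differentiable (at y within V)"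
        using k'(1) has_derivative_at_withinI unfolding differentiable_def by blast
    next
      fix v :: 'a
      have "Ck_on UNIV n (\<lambda>y. k y - k y + (v - (dd F (k y) v / (1 + dd F (k y) e)) *\<^sub>R e)) V"
        using Ck_on_compose [OF rV rU' _ _ Suc, of "\<lambda>x. v - (dd F x v / (1 + dd F x e)) *\<^sub>R e"] sq [of v] fU
        unfolding smooth_on_def by simp
      then show "Ck_on UNIV n (\<lambda>y. dd k y v) V" using key(2) by (simp cong: Ck_on_cong)
    qed
  qed
  then have "smooth_on UNIV V k" unfolding smooth_on_def by blast
  then show ?thesis using that I unfolding f_def by blast
qed

lemma hyperplane_normal:
  fixes E H :: "'a::euclidean_space set"
  assumes "subspace E" "subspace H" "H \<subseteq> E" "dim H = dim E - 1" "E \<noteq> {0}"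
  obtains n where "n \<in> E" "norm n = 1" "\<And>h. h \<in> H \<Longrightarrow> h \<bullet> n = 0" "\<And>x. x \<in> E \<Longrightarrow> x \<in> H \<longleftrightarrow> x \<bullet> n = 0"
proof -
  \<comment> \<open>\<open>dim E - 1\<close> is truncated subtraction: with \<open>dim E = 0\<close>
    the hypothesis on dimensions would hold for \<open>H = E\<close>.\<close>
  have "dim E > 0" using assms(1,5) by (metis dim_eq_0 gr0I subset_singletonD subspace_0 empty_iff)
  then have lt: "dim H < dim E" using assms(4) by simp
  have "span H \<subset> span E" using assms(1-3) lt by (metis dim_subset psubsetI span_eq_iff nat_less_le)
  then obtain x where x: "x \<noteq> 0" "x \<in> E" "\<And>y. y \<in> H \<Longrightarrow> orthogonal x y"
    using orthogonal_to_subspace_exists_gen [of H E] assms(1) span_base span_eq_iff by (metis (no_types, lifting))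
  define n where "n = x /\<^sub>R norm x"
  have n: "n \<in> E" "norm n = 1" "\<And>h. h \<in> H \<Longrightarrow> h \<bullet> n = 0"
    unfolding n_def using x subspace_scale [OF assms(1)] by (auto simp: orthogonal_def inner_commute)
  \<comment> \<open>The orthogonal hyperplane of \<open>n\<close> in \<open>E\<close> contains
    \<open>H\<close> and misses \<open>n\<close>, so its dimension is at most that of
    \<open>H\<close> and the two are equal.\<close>
  define H' where "H' = {y \<in> E. y \<bullet> n = 0}"
  have sH': "subspace H'" using assms(1) unfolding H'_def subspace_def by (auto simp: inner_add_left)
  have HH': "H \<subseteq> H'" using n(3) assms(3) unfolding H'_def by auto
  have "n \<notin> H'" unfolding H'_def using n(2) by (simp add: norm_eq_1)
  then have "H' \<subset> E" using n(1) unfolding H'_def by blast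
  then have "dim H' < dim E" using assms(1) sH' by (metis dim_psubset span_eq_iff)
  then have "dim H' \<le> dim H" using assms(4) by simp
  then have "H' = H" using subspace_dim_equal [OF assms(2) sH' HH'] by simp
  then show ?thesis using that [OF n] unfolding H'_def by blast
qed

context mfd_chart begin

text \<open>
  Straightening a level set: the new chart is \<open>x \<mapsto> x + (F x - l - x \<bullet> n) e\<close> in the old coordinates, where
  \<open>e\<close> is transversal to both \<open>H\<close> and the level set; its normal coordinate is \<open>F - l\<close>.
\<close>

lemma slice_chart_exists:
  assumes H: "subspace H" "H \<subseteq> E" "dim H = dim E - 1" and f: "\<And>q. q \<in> U \<Longrightarrow> smooth_near M q f"
    and p: "p \<in> U" and c: "c \<in> E" "dd (\<lambda>x. f (pt x)) (\<phi> p) c \<noteq> 0"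
  shows "\<exists>V \<psi>. (V, \<psi>) \<in> maximal_atlas M \<and> p \<in> V \<and> V \<subseteq> U \<and> (\<forall>q\<in>V. \<psi> q \<in> H \<longleftrightarrow> f q = l)"
proof -
  define F where "F x = f (pt x)" for x
  have sF: "smooth_on E (\<phi> ` U) F" unfolding F_def using smooth_on_chart_iff [OF pm mx ch(1) subset_refl] f by blast
  have x0: "\<phi> p \<in> \<phi> ` U" using p by blast
  have "c \<noteq> 0"
  proof
    assume "c = 0"
    then show False using dd_scaleR [OF ch(4) sF x0 c(1), of 0] c(2) unfolding F_def by simp
  qed
  then have "E \<noteq> {0}" using c(1) by blast
  then obtain n where n: "n \<in> E" "norm n = 1" "\<And>h. h \<in> H \<Longrightarrow> h \<bullet> n = 0" "\<And>x. x \<in> E \<Longrightarrow> x \<in> H \<longleftrightarrow> x \<bullet> n = 0"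
    using hyperplane_normal [OF subE H] by metis
  have nn: "n \<bullet> n = 1" using n(2) by (simp add: norm_eq_1)
  \<comment> \<open>Transversality to \<open>H\<close> is a nonzero product with \<open>n\<close>,
    transversality to the level set a nonzero derivative of \<open>F\<close>. If neither
    \<open>c\<close> nor \<open>n\<close> has both properties, then \<open>c\<close> lacks the
    first, \<open>n\<close> lacks the second, and \<open>c + n\<close> has both. Scaling gives
    \<open>e \<bullet> n = 1\<close>.\<close>
  obtain e where e: "e \<in> E" "e \<bullet> n = 1" "dd F (\<phi> p) e \<noteq> 0"
  proof -
    have "\<exists>e\<in>E. e \<bullet> n \<noteq> 0 \<and> dd F (\<phi> p) e \<noteq> 0"
    proof (cases "c \<bullet> n \<noteq> 0 \<or> dd F (\<phi> p) n \<noteq> 0")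
      case True then show ?thesis using c n(1) nn unfolding F_def by (metis zero_neq_one)
    next
      case False
      then have "(c + n) \<bullet> n \<noteq> 0" "dd F (\<phi> p) (c + n) \<noteq> 0"
        using nn dd_add [OF ch(4) sF x0 c(1) n(1)] c(2) unfolding F_def by (auto simp: inner_add_left)
      then show ?thesis using c(1) n(1) subspace_add [OF subE] by blast
    qed
    then obtain e where e: "e \<in> E" "e \<bullet> n \<noteq> 0" "dd F (\<phi> p) e \<noteq> 0" by blast
    show ?thesis
      by (rule that [of "(1 / (e \<bullet> n)) *\<^sub>R e"])
        (use e subspace_scale [OF subE] dd_scaleR [OF ch(4) sF x0 e(1)] in auto)
  qed
  obtain B where B: "finite B" "B \<subseteq> E" "\<And>y. y \<in> E \<Longrightarrow> (\<Sum>b\<in>B. (y \<bullet> b) *\<^sub>R b) = y"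
    using subspace_expansion [OF subE] by metis
  \<comment> \<open>The orthogonal projection to \<open>E\<close> extends \<open>F\<close> to an
    open subset of the whole space, where \<open>shear_inverse\<close> applies.\<close>
  define P where "P y = (\<Sum>b\<in>B. (y \<bullet> b) *\<^sub>R b)" for y
  have blP: "bounded_linear P" unfolding P_def
    by (intro bounded_linear_sum bounded_linear_scaleR_const bounded_linear_inner_left)
  have PE: "P y \<in> E" for y unfolding P_def using B(2) by (intro subspace_sum [OF subE] subspace_scale [OF subE]) auto
  have Pid: "y \<in> E \<Longrightarrow> P y = y" for y using B(3) unfolding P_def .
  define Ut where "Ut = {y. P y \<in> \<phi> ` U}"
  have rUt: "relopen UNIV Ut"
    using relopen_preimage [of UNIV UNIV P E "\<phi> ` U"] ch(4) PE linear_continuous_on [OF blP] unfolding Ut_def by auto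
  have sP: "smooth_on UNIV Ut P" using smooth_on_linear [OF rUt blP smooth_on_ident [OF rUt]] .
  define Ft where "Ft y = F (P y) - l - y \<bullet> n" for y
  have sFP: "smooth_on UNIV Ut (\<lambda>y. F (P y))"
    by (rule smooth_on_compose [OF rUt ch(4) sP sF]) (auto simp: Ut_def)
  have sFt: "smooth_on UNIV Ut Ft" unfolding Ft_def
    by (intro smooth_on_diff sFP smooth_on_const smooth_on_linear [OF rUt bounded_linear_inner_left] smooth_on_ident rUt)
  have p0: "\<phi> p \<in> Ut" unfolding Ut_def using Pid phiE [OF p] x0 by simp
  have oUt: "open Ut" using rUt by simp
  have "dd (\<lambda>y. Ft y) (\<phi> p) e = dd F (\<phi> p) e - 1"
  proof -
    have 1: "dd (\<lambda>y. F (P y)) (\<phi> p) e = dd F (P (\<phi> p)) (dd P (\<phi> p) e)"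
      by (rule dd_compose [OF rUt ch(4) sP sF _ p0 UNIV_I]) (auto simp: Ut_def)
    have id1: "dd (\<lambda>y. y) (\<phi> p) e = e" using dd_eq [OF rUt p0 UNIV_I has_derivative_ident] .
    have 2: "dd P (\<phi> p) e = P e" using dd_linear [OF rUt blP smooth_on_ident [OF rUt] p0 UNIV_I] id1 by simp
    have 3: "dd (\<lambda>y. y \<bullet> n) (\<phi> p) e = 1"
      using dd_linear [OF rUt bounded_linear_inner_left smooth_on_ident [OF rUt] p0 UNIV_I] id1 e(2) by simp
    have s3: "smooth_on UNIV Ut (\<lambda>y. y \<bullet> n)"
      by (intro smooth_on_linear [OF rUt bounded_linear_inner_left] smooth_on_ident rUt)
    show ?thesis unfolding Ft_def
      using dd_minus [OF rUt smooth_on_diff [OF rUt sFP smooth_on_const [OF rUt]] s3 p0 UNIV_I]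
        dd_minus [OF rUt sFP smooth_on_const [OF rUt] p0 UNIV_I] 1 2 3 Pid [OF phiE [OF p]] Pid [OF e(1)] by simp
  qed
  then have nz: "1 + dd Ft (\<phi> p) e \<noteq> 0" using e(3) by simp
  obtain U' V' k where I: "open U'" "U' \<subseteq> Ut" "\<phi> p \<in> U'" "open V'" and hom: "homeomorphism U' V' (\<lambda>y. y + Ft y *\<^sub>R e) k"
    and sk: "smooth_on UNIV V' k"
    using shear_inverse [OF oUt p0 sFt nz] by metis
  define fs where "fs y = y + Ft y *\<^sub>R e" for y
  have hk: "\<And>y. y \<in> U' \<Longrightarrow> fs y \<in> V'" "\<And>y. y \<in> U' \<Longrightarrow> k (fs y) = y" "\<And>y. y \<in> V' \<Longrightarrow> k y \<in> U'" "\<And>y. y \<in> V' \<Longrightarrow> fs (k y) = y"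
    using hom unfolding homeomorphism_def fs_def by blast+
  \<comment> \<open>Shearing along a vector of \<open>E\<close> preserves \<open>E\<close> and its
    complement, so the map obtained in the whole space restricts to a chart with values in the
    model.\<close>
  have fsE: "fs y \<in> E \<longleftrightarrow> y \<in> E" for y
    unfolding fs_def using e(1) subspace_scale [OF subE e(1), of "Ft y"] subspace_add [OF subE, of y]
      subspace_diff [OF subE, of "y + Ft y *\<^sub>R e" "Ft y *\<^sub>R e"] by auto
  have U'U: "y \<in> \<phi> ` U" if "y \<in> U'" "y \<in> E" for y using that I(2) Pid unfolding Ut_def by auto
  define W where "W = {q \<in> U. \<phi> q \<in> U'}"
  define \<psi> where "\<psi> q = fs (\<phi> q)" for q
  have WI: "\<phi> ` W = E \<inter> U'" unfolding W_def using U'U phiE by auto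
  have rW: "relopen E (E \<inter> U')" "relopen E (E \<inter> V')" using subE I openin_open unfolding relopen_def by blast+
  have oW: "openin (mtop M) W" using ch(6) [of W] rW(1) WI unfolding W_def by auto
  have "(W, \<psi>) \<in> maximal_atlas M"
  proof (rule maximal_atlasI [where \<Phi> = "\<lambda>y. pt (k y)", OF pm oW rW(2)])
    show "\<psi> q \<in> E \<inter> V'" if "q \<in> W" for q
      using that hk(1) fsE phiE unfolding W_def \<psi>_def by auto
    show "pt (k (\<psi> q)) = q" if "q \<in> W" for q
      using that hk(2) unfolding W_def \<psi>_def by auto
    have kE: "k x \<in> E \<inter> U'" if "x \<in> E \<inter> V'" for x
      using that hk(3,4) fsE [of "k x"] by auto
    show "pt (k x) \<in> W" if "x \<in> E \<inter> V'" for x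
      using kE [OF that] U'U pt_in unfolding W_def by auto
    show "\<psi> (pt (k x)) = x" if "x \<in> E \<inter> V'" for x
      using kE [OF that] U'U hk(4) that unfolding \<psi>_def by auto
    show "smooth_at M (emfd E (E \<inter> V')) \<psi> q" if q: "q \<in> W" for q
    proof (rule smooth_at_emfdI [OF pm rW(2) mx oW _ q])
      have rU': "relopen UNIV U'" using I by simp
      have "smooth_on UNIV U' fs" unfolding fs_def
        by (intro smooth_on_add smooth_on_scaleR smooth_on_ident smooth_on_const smooth_on_subset [OF sFt I(2)] rU')
      then have s: "smooth_on E (E \<inter> U') fs"
        using smooth_on_restrict [OF rU' subE] by (simp add: Int_commute)
      have "\<psi> (pt x) = fs x" if "x \<in> E \<inter> U'" for x using that U'U unfolding \<psi>_def by auto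
      then show "smooth_on E (\<phi> ` W) (\<lambda>x. \<psi> (pt x))" unfolding WI
        by (intro iffD2 [OF smooth_on_cong s])
      show "\<psi> ` W \<subseteq> E \<inter> V'" using hk(1) fsE phiE unfolding W_def \<psi>_def by auto
    qed (auto simp: W_def)
    show "smooth_at (emfd E (E \<inter> V')) M (\<lambda>y. pt (k y)) x" if x: "x \<in> E \<inter> V'" for x
    proof (rule smooth_at_from_emfd [OF rW(2) rW(2) subset_refl x mx])
      show "(\<lambda>y. pt (k y)) ` (E \<inter> V') \<subseteq> U" using kE U'U pt_in by auto
      have rV': "relopen UNIV V'" using I by simp
      have s: "smooth_on E (E \<inter> V') k" using smooth_on_restrict [OF rV' subE _ sk] by (simp add: Int_commute)
      have "\<phi> (pt (k x)) = k x" if "x \<in> E \<inter> V'" for x using kE [OF that] U'U by auto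
      then show "smooth_on E (E \<inter> V') (\<lambda>y. \<phi> (pt (k y)))"
        by (intro iffD2 [OF smooth_on_cong s])
    qed
  qed
  moreover have "\<psi> q \<in> H \<longleftrightarrow> f q = l" if q: "q \<in> W" for q
  proof -
    have qU: "q \<in> U" using q unfolding W_def by auto
    have "\<psi> q \<in> E" using fsE phiE [OF qU] unfolding \<psi>_def by simp
    moreover have "\<psi> q \<bullet> n = f q - l"
      using e(2) Pid [OF phiE [OF qU]] qU unfolding \<psi>_def fs_def Ft_def F_def by (simp add: inner_add_left)
    ultimately show ?thesis using n(4) by simp
  qed
  ultimately show ?thesis using p I(3) unfolding W_def by blast
qed

end

text \<open>Smoothness of the metric on arbitrary fields is reduced to its coefficients in one chart
  around each point, because \<open>bilfam_apply\<close> evaluates smooth bilinear coefficients on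
  smooth coordinate functions.\<close>

lemma pseudo_riemannianI:
  assumes M: "pmfd M"
    and sym: "\<And>p u v. p \<in> pts M \<Longrightarrow> u \<in> tangent_space M p \<Longrightarrow> v \<in> tangent_space M p \<Longrightarrow> g p u v = g p v u"
    and lin: "\<And>p u v z a b. p \<in> pts M \<Longrightarrow> u \<in> tangent_space M p \<Longrightarrow> v \<in> tangent_space M p \<Longrightarrow> z \<in> tangent_space M p \<Longrightarrow>
       g p (\<lambda>h. a * u h + b * v h) z = a * g p u z + b * g p v z"
    and nd: "\<And>p u. p \<in> pts M \<Longrightarrow> u \<in> tangent_space M p \<Longrightarrow> (\<And>v. v \<in> tangent_space M p \<Longrightarrow> g p u v = 0) \<Longrightarrow> u = (\<lambda>h. 0)"
    and sm: "\<And>p. p \<in> pts M \<Longrightarrow> \<exists>U \<phi>. mfd_chart M U \<phi> \<and> p \<in> U \<and> (\<forall>a\<in>model M. \<forall>b\<in>model M.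
       smooth_on (model M) (\<phi> ` U) (\<lambda>x. g (inv_into U \<phi> x) (tv M U \<phi> (inv_into U \<phi> x) a) (tv M U \<phi> (inv_into U \<phi> x) b)))"
  shows "pseudo_riemannian M g"
proof -
  have "smooth_fun (open_sub M V) (\<lambda>p. g p (X p) (Y p))"
    if V: "openin (mtop M) V" and X: "vfield M V X" and Y: "vfield M V Y" for V X Y
    unfolding smooth_fun_near_iff [OF M V]
  proof
    fix p assume p: "p \<in> V"
    then have "p \<in> pts M" using V openin_subset by blast
    from sm [OF this] obtain U \<phi> where U: "mfd_chart M U \<phi>" "p \<in> U" and s: "\<forall>a\<in>model M. \<forall>b\<in>model M.
       smooth_on (model M) (\<phi> ` U) (\<lambda>x. g (inv_into U \<phi> x) (tv M U \<phi> (inv_into U \<phi> x) a) (tv M U \<phi> (inv_into U \<phi> x) b))"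
      by blast
    interpret mfd_chart M U \<phi> by fact
    define B where "B x a b = g (pt x) (tvc (pt x) a) (tvc (pt x) b)" for x a b
    have o: "openin (mtop M) (V \<inter> U)" and sub: "V \<inter> U \<subseteq> U" "V \<inter> U \<subseteq> V" using V ch(1) by auto
    have r: "relopen E (\<phi> ` (V \<inter> U))" using relV [OF o sub(1)] .
    have T: "tvc (pt x) a \<in> tangent_space M (pt x)" "pt x \<in> pts M" "pt x \<in> U" if "x \<in> \<phi> ` U" "a \<in> E" for x a
      using that tangent_space_eq pt_in ch(2) by auto
    have "bilfam E (\<phi> ` U) B"
    proof -
      have 1: "B x (r *\<^sub>R a + s *\<^sub>R b) c = r * B x a c + s * B x b c"
        if "x \<in> \<phi> ` U" "a \<in> E" "b \<in> E" "c \<in> E" for x a b c r s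
        unfolding B_def tv_lincomb [OF T(3) [OF that(1,2)] that(2,3)] using lin T that by auto
      have 2: "B x a b = B x b a" if "x \<in> \<phi> ` U" "a \<in> E" "b \<in> E" for x a b
        unfolding B_def using sym T that by auto
      have 3: "B x (a + b) c = B x a c + B x b c" "B x (r *\<^sub>R a) c = r * B x a c"
        if "x \<in> \<phi> ` U" "a \<in> E" "b \<in> E" "c \<in> E" for x a b c r
        using 1 [OF that, of 1 1] 1 [OF that(1,2,2,4), of r 0] by simp_all
      have 4: "B x c (a + b) = B x c a + B x c b" "B x c (r *\<^sub>R a) = r * B x c a"
        if "x \<in> \<phi> ` U" "a \<in> E" "b \<in> E" "c \<in> E" for x a b c r
        using 3 [OF that] 2 [OF that(1) _ that(4)] that(2,3) subspace_add [OF subE that(2,3)] subspace_scale [OF subE that(2)] by simp_all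
      show ?thesis unfolding bilfam_def linfam_def using 3 4 s unfolding B_def by auto
    qed
    then have B: "bilfam E (\<phi> ` (V \<inter> U)) B" by (rule bilfam_subset) auto
    note X' = vfield_subset [OF pm V o sub(2) X] and Y' = vfield_subset [OF pm V o sub(2) Y]
    have "smooth_on E (\<phi> ` (V \<inter> U)) (\<lambda>x. B x (crep X x) (crep Y x))"
      by (rule bilfam_apply(1) [OF r B vfield_chartD(1,2) [OF X' o sub(1)] vfield_chartD(1,2) [OF Y' o sub(1)]])
    moreover have "B x (crep X x) (crep Y x) = g (pt x) (X (pt x)) (Y (pt x))" if "x \<in> \<phi> ` (V \<inter> U)" for x
      unfolding B_def using vfield_chartD(3) [OF X' o sub(1)] vfield_chartD(3) [OF Y' o sub(1)] pt_in_sub [OF that sub(1)] by simp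
    ultimately have "smooth_on E (\<phi> ` (V \<inter> U)) (\<lambda>x. g (pt x) (X (pt x)) (Y (pt x)))" by (simp cong: smooth_on_cong)
    then show "smooth_near M p (\<lambda>p. g p (X p) (Y p))"
      using smooth_near_chart [OF pm mx U(2)] o p U(2) sub by blast
  qed
  note smooth = this
  show ?thesis unfolding pseudo_riemannian_def
  proof (intro conjI ballI allI impI, goal_cases)
    case (1 p u v) then show ?case by (rule sym)
  next
    case (2 p u v z a b) then show ?case by (rule lin)
  next
    case (3 p u) then show ?case by (intro nd) auto
  next
    case (4 U X Y) then show ?case by (elim conjE) (rule smooth)
  qed
qed

section \<open>The manifold structure of a hypersurface and its induced metric\<close>

locale hypersurface =
  fixes M :: "('p, 'e::euclidean_space) mfd" and H :: "'e set" and S :: "'p set"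
  assumes pm: "pmfd M" and subH: "subspace H" and HE: "H \<subseteq> model M" and SM: "S \<subseteq> pts M"
    and slices: "\<And>p. p \<in> S \<Longrightarrow> \<exists>V \<psi>. (V, \<psi>) \<in> maximal_atlas M \<and> \<psi> ` (V \<inter> S) = \<psi> ` V \<inter> H \<and> p \<in> V"
begin

abbreviation "N \<equiv> embedded_sub M H S"

lemma N_simps [simp]: "mtop N = subtopology (mtop M) S" "model N = H" "pts N = S"
  using SM by (auto simp: embedded_sub_def)

lemma relopen_slice:
  assumes V: "(V, \<psi>) \<in> maximal_atlas M" "\<psi> ` (V \<inter> S) = \<psi> ` V \<inter> H" and A: "A \<subseteq> V"
  shows "\<psi> ` (A \<inter> S) = \<psi> ` A \<inter> H"
proof -
  have inj: "inj_on \<psi> V" using max_chart(3) [OF pm V(1)] .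
  have "\<psi> ` (A \<inter> S) = \<psi> ` A \<inter> \<psi> ` (V \<inter> S)"
    using A inj by (auto dest: inj_onD)
  also have "\<dots> = \<psi> ` A \<inter> H" unfolding V(2) using A by auto
  finally show ?thesis .
qed

text \<open>An open subset of \<open>V \<inter> S\<close> is cut out by an open subset of
  \<open>V\<close>, its image by an open subset of the ambient space; the slice condition matches
  the two descriptions.\<close>

lemma slice_is_chart:
  assumes V: "(V, \<psi>) \<in> maximal_atlas M" "\<psi> ` (V \<inter> S) = \<psi> ` V \<inter> H"
  shows "is_chart N (V \<inter> S, \<psi>)"
proof (rule is_chartI)
  note c = max_chart [OF pm V(1)]
  show "openin (mtop N) (V \<inter> S)" using c(1) by (auto simp: openin_subtopology)
  show "inj_on \<psi> (V \<inter> S)" using c(3) inj_on_subset by blast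
  fix A assume A: "A \<subseteq> V \<inter> S"
  show "openin (mtop N) A \<longleftrightarrow> relopen (model N) (\<psi> ` A)"
  proof
    assume "openin (mtop N) A"
    then obtain T where T: "openin (mtop M) T" "A = T \<inter> S" by (auto simp: openin_subtopology)
    have "A = (V \<inter> T) \<inter> S" using T A by auto
    then have "\<psi> ` A = \<psi> ` (V \<inter> T) \<inter> H" using relopen_slice [OF V, of "V \<inter> T"] by auto
    then show "relopen (model N) (\<psi> ` A)"
      using relopen_Int_subspace [OF chart_img_Int [OF pm V(1) T(1)] subH HE] by simp
  next
    assume "relopen (model N) (\<psi> ` A)"
    then obtain T where T: "open T" "\<psi> ` A = H \<inter> T" unfolding relopen_def openin_open by auto
    define V' where "V' = {q \<in> V. \<psi> q \<in> T}"
    have "\<psi> ` V' = \<psi> ` V \<inter> T" unfolding V'_def by auto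
    moreover have "relopen (model M) (\<psi> ` V \<inter> T)"
      using c(4) T(1) unfolding relopen_def by (auto simp: openin_Int_open)
    ultimately have "openin (mtop M) V'" using c(6) [of V'] unfolding V'_def by auto
    moreover have "A = V' \<inter> S"
    proof
      show "A \<subseteq> V' \<inter> S" using A T(2) unfolding V'_def by auto
      show "V' \<inter> S \<subseteq> A"
      proof
        fix q assume q: "q \<in> V' \<inter> S"
        then have "\<psi> q \<in> H" using V(2) unfolding V'_def by auto
        then have "\<psi> q \<in> \<psi> ` A" using T(2) q unfolding V'_def by auto
        then show "q \<in> A" using inj_onD [OF c(3)] A q unfolding V'_def by blast
      qed
    qed
    ultimately show "openin (mtop N) A" by (auto simp: openin_subtopology)
  qed
qed

lemma pmfd_N: "pmfd N"
  unfolding pmfd_def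
proof (intro conjI ballI)
  show "subspace (model N)" using subH by simp
  show "is_chart N c" if "c \<in> atlas N" for c using that slice_is_chart unfolding embedded_sub_def by auto
  have "(\<Union>c\<in>atlas N. fst c) = S"
  proof
    show "S \<subseteq> (\<Union>c\<in>atlas N. fst c)"
    proof
      fix p assume p: "p \<in> S"
      then obtain V \<psi> where V: "(V, \<psi>) \<in> maximal_atlas M" "\<psi> ` (V \<inter> S) = \<psi> ` V \<inter> H" "p \<in> V" using slices by blast
      then have "(V \<inter> S, \<psi>) \<in> atlas N" unfolding embedded_sub_def by auto
      then show "p \<in> (\<Union>c\<in>atlas N. fst c)" using p V(3) by (intro UN_I [of "(V \<inter> S, \<psi>)"]) auto
    qed
  qed (auto simp: embedded_sub_def)
  then show "pts N = (\<Union>c\<in>atlas N. fst c)" by (simp only: N_simps(3))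
  have main: "smooth_on H (\<phi> ` (U \<inter> S \<inter> (V \<inter> S))) (\<lambda>x. \<psi> (inv_into (U \<inter> S) \<phi> x))"
    if U: "(U, \<phi>) \<in> maximal_atlas M" "\<phi> ` (U \<inter> S) = \<phi> ` U \<inter> H" and V: "(V, \<psi>) \<in> maximal_atlas M" for U \<phi> V \<psi>
  proof -
    have e: "\<phi> ` (U \<inter> S \<inter> (V \<inter> S)) = \<phi> ` (U \<inter> V) \<inter> H"
      using relopen_slice [OF U, of "U \<inter> V"] by (simp add: Int_ac)
    have "smooth_on H (\<phi> ` (U \<inter> V) \<inter> H) (\<lambda>x. \<psi> (inv_into U \<phi> x))"
      using smooth_on_restrict [OF chart_img_Int [OF pm U(1) max_chart(1) [OF pm V]] subH HE max_compatible [OF pm U(1) V]] .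
    then show ?thesis unfolding e [symmetric]
      by (rule iffD1 [OF smooth_on_cong, rotated])
        (auto intro!: inv_into_sub [OF max_chart(3) [OF pm U(1)], symmetric] arg_cong [where f = \<psi>])
  qed
  show "compatible N c d" if "c \<in> atlas N" "d \<in> atlas N" for c d
  proof -
    obtain U \<phi> V \<psi> where cd: "c = (U \<inter> S, \<phi>)" "d = (V \<inter> S, \<psi>)"
      and UV: "(U, \<phi>) \<in> maximal_atlas M" "\<phi> ` (U \<inter> S) = \<phi> ` U \<inter> H" "(V, \<psi>) \<in> maximal_atlas M" "\<psi> ` (V \<inter> S) = \<psi> ` V \<inter> H"
      using \<open>c \<in> atlas N\<close> \<open>d \<in> atlas N\<close> unfolding embedded_sub_def by auto
    show ?thesis unfolding cd compatible_def comp_def using main [OF UV(1-3)] main [OF UV(3,4,1)] by (simp add: Int_commute)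
  qed
qed

lemma slice_max: "(V, \<psi>) \<in> maximal_atlas M \<Longrightarrow> \<psi> ` (V \<inter> S) = \<psi> ` V \<inter> H \<Longrightarrow> (V \<inter> S, \<psi>) \<in> maximal_atlas N"
  by (rule atlas_max [OF pmfd_N]) (auto simp: embedded_sub_def)

end

locale slice_chart = hypersurface M H S + mfd_chart M V \<psi>
  for M :: "('p, 'e::euclidean_space) mfd" and H S V \<psi> +
  assumes slice: "\<psi> ` (V \<inter> S) = \<psi> ` V \<inter> H"
begin

lemma ptS: "y \<in> \<psi> ` (V \<inter> S) \<Longrightarrow> inv_into (V \<inter> S) \<psi> y = pt y"
  by (rule inv_into_sub [OF ch(3)]) auto

lemma relS: "relopen H (\<psi> ` (V \<inter> S))"
  unfolding slice by (rule relopen_Int_subspace [OF ch(4) subH HE])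

lemma chartS: "mfd_chart N (V \<inter> S) \<psi>"
  using pmfd_N slice_max [OF mx slice] by (simp add: mfd_chart_def)

lemma near_restrict:
  assumes "smooth_near M p h" "p \<in> V \<inter> S"
  shows "smooth_near N p h"
proof -
  obtain O' where O': "openin (mtop M) O'" "p \<in> O'" "O' \<subseteq> V" "relopen E (\<psi> ` O')" "smooth_on E (\<psi> ` O') (\<lambda>x. h (pt x))"
    using smooth_nearE [OF assms(1) IntD1 [OF assms(2)] ch(1) subset_refl] by metis
  have e: "\<psi> ` (O' \<inter> S) = \<psi> ` O' \<inter> H" using relopen_slice [OF mx slice O'(3)] .
  have "smooth_on H (\<psi> ` (O' \<inter> S)) (\<lambda>x. h (pt x))" unfolding e by (rule smooth_on_restrict [OF O'(4) subH HE O'(5)])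
  moreover have "inv_into (V \<inter> S) \<psi> y = pt y" if "y \<in> \<psi> ` (O' \<inter> S)" for y
    using that O'(3) by (intro ptS) auto
  ultimately have "smooth_on H (\<psi> ` (O' \<inter> S)) (\<lambda>x. h (inv_into (V \<inter> S) \<psi> x))" by (simp cong: smooth_on_cong)
  moreover have "openin (mtop N) (O' \<inter> S)" using O'(1) by (auto simp: openin_subtopology)
  ultimately show ?thesis
    using smooth_near_chart [OF pmfd_N slice_max [OF mx slice] assms(2), of h] O' assms(2) by auto
qed

text \<open>The charts of \<open>M\<close> and of \<open>N\<close> are given by the same map \<psi>,
  so in coordinates the inclusion is that of \<open>H\<close> in \<open>E\<close>.\<close>

lemma push_tv:
  assumes p: "p \<in> V \<inter> S" and c: "c \<in> H"
  shows "pushforward M (\<lambda>x. x) p (tv N (V \<inter> S) \<psi> p c) = tvc p c"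
proof
  fix h show "pushforward M (\<lambda>x. x) p (tv N (V \<inter> S) \<psi> p c) h = tvc p c h"
  proof (cases "smooth_near M p h")
    case True
    have "dd (\<lambda>x. h (inv_into (V \<inter> S) \<psi> x)) (\<psi> p) c = dd (\<lambda>x. h (pt x)) (\<psi> p) c"
      by (rule dd_cong [OF relS _ c]) (use p ptS in auto)
    then show ?thesis using True near_restrict [OF True p] unfolding pushforward_def tv_def by simp
  qed (simp add: pushforward_def tv_def)
qed

end

context hypersurface begin

lemma pushforward_lin: "pushforward M (\<lambda>x. x) p (\<lambda>h. a * u h + b * v h) = (\<lambda>h. a * pushforward M (\<lambda>x. x) p u h + b * pushforward M (\<lambda>x. x) p v h)"
  unfolding pushforward_def by auto

lemma slice_chart_at:
  assumes "p \<in> S"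
  obtains V \<psi> where "slice_chart M H S V \<psi>" "p \<in> V"
  using slices [OF assms] hypersurface_axioms pm that
  unfolding slice_chart_def slice_chart_axioms_def mfd_chart_def by metis

lemma push_tangent:
  assumes p: "p \<in> S" and u: "u \<in> tangent_space N p"
  shows "pushforward M (\<lambda>x. x) p u \<in> tangent_space M p"
proof -
  obtain V \<psi> where V: "slice_chart M H S V \<psi>" "p \<in> V" using slice_chart_at [OF p] by metis
  interpret slice_chart M H S V \<psi> by fact
  interpret C: mfd_chart N "V \<inter> S" \<psi> by (rule chartS)
  have pV: "p \<in> V \<inter> S" using p V by blast
  obtain c where c: "c \<in> H" "u = tv N (V \<inter> S) \<psi> p c" using C.tangent_space_eq [OF pV] u by auto
  show ?thesis unfolding c(2) push_tv [OF pV c(1)] using c(1) HE tangent_space_eq [OF V(2)] by auto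
qed

text \<open>A tangent vector of \<open>N\<close> orthogonal to all of them is also orthogonal to the
  non-null normal \<open>P\<close>. As \<open>H\<close> has codimension one, \<open>P\<close> and
  the tangent space of \<open>N\<close> span everything, so nondegeneracy of \<open>g\<close>
  applies.\<close>

lemma pseudo_riemannian_N:
  assumes pr: "pseudo_riemannian M g" and dimH: "dim H = dim (model M) - 1"
    and normal: "\<And>p. p \<in> S \<Longrightarrow> \<exists>P\<in>tangent_space M p. g p P P \<noteq> 0 \<and>
       (\<forall>u\<in>tangent_space N p. g p P (pushforward M (\<lambda>x. x) p u) = 0)"
  shows "pseudo_riemannian N (pullback M (\<lambda>x. x) g)"
proof (rule pseudo_riemannianI [OF pmfd_N])
  fix p assume "p \<in> pts N"
  then have p: "p \<in> S" by simp
  have pM: "p \<in> pts M" using p SM by auto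
  note T = push_tangent [OF p]
  show "pullback M (\<lambda>x. x) g p u v = pullback M (\<lambda>x. x) g p v u"
    if "u \<in> tangent_space N p" "v \<in> tangent_space N p" for u v
    unfolding pullback_def using pr_symD [OF pr pM T T] that by simp
  show "pullback M (\<lambda>x. x) g p (\<lambda>h. a * u h + b * v h) z = a * pullback M (\<lambda>x. x) g p u z + b * pullback M (\<lambda>x. x) g p v z"
    if "u \<in> tangent_space N p" "v \<in> tangent_space N p" "z \<in> tangent_space N p" for u v z a b
    unfolding pullback_def pushforward_lin by (rule pr_linD [OF pr pM T T T]) (use that in auto)
  obtain V \<psi> where V: "slice_chart M H S V \<psi>" "p \<in> V" using slice_chart_at [OF p] by metis
  interpret slice_chart M H S V \<psi> by fact
  interpret C: mfd_chart N "V \<inter> S" \<psi> by (rule chartS)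
  interpret G: metric_chart M V \<psi> g by unfold_locales (rule pr)
  have gp: "pullback M (\<lambda>x. x) g q (tv N (V \<inter> S) \<psi> q a) (tv N (V \<inter> S) \<psi> q b) = G.G (\<psi> q) a b"
    if "q \<in> V \<inter> S" "a \<in> H" "b \<in> H" for q a b
    unfolding pullback_def push_tv [OF that(1,2)] push_tv [OF that(1,3)] G.G_def using that(1) by simp
  show "\<exists>U \<phi>. mfd_chart N U \<phi> \<and> p \<in> U \<and> (\<forall>a\<in>model N. \<forall>b\<in>model N.
       smooth_on (model N) (\<phi> ` U) (\<lambda>x. pullback M (\<lambda>x. x) g (inv_into U \<phi> x) (tv N U \<phi> (inv_into U \<phi> x) a) (tv N U \<phi> (inv_into U \<phi> x) b)))"
  proof (intro exI conjI ballI)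
    show "mfd_chart N (V \<inter> S) \<psi>" by (rule chartS)
    show "p \<in> V \<inter> S" using p V by blast
    fix a b assume "a \<in> model N" "b \<in> model N"
    then have ab: "a \<in> H" "b \<in> H" by auto
    have "smooth_on H (\<psi> ` (V \<inter> S)) (\<lambda>x. G.G x a b)"
      unfolding slice by (rule bilfam_smooth [OF bilfam_restrict [OF ch(4) subH HE G.G_bilfam] ab])
    then show "smooth_on (model N) (\<psi> ` (V \<inter> S)) (\<lambda>x. pullback M (\<lambda>x. x) g (inv_into (V \<inter> S) \<psi> x)
        (tv N (V \<inter> S) \<psi> (inv_into (V \<inter> S) \<psi> x) a) (tv N (V \<inter> S) \<psi> (inv_into (V \<inter> S) \<psi> x) b))"
      unfolding N_simps using gp [OF C.pt_in ab] C.phi_pt by (simp cong: smooth_on_cong)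
  qed
  have pV: "p \<in> V \<inter> S" "\<psi> p \<in> \<psi> ` V" using p V by auto
  fix u assume u: "u \<in> tangent_space N p" and 0: "\<And>v. v \<in> tangent_space N p \<Longrightarrow> pullback M (\<lambda>x. x) g p u v = 0"
  obtain c where c: "c \<in> H" "u = tv N (V \<inter> S) \<psi> p c" using C.tangent_space_eq [OF pV(1)] u by auto
  obtain P where P: "P \<in> tangent_space M p" "g p P P \<noteq> 0" "\<And>u. u \<in> tangent_space N p \<Longrightarrow> g p P (pushforward M (\<lambda>x. x) p u) = 0"
    using normal [OF p] by blast
  obtain k where k: "k \<in> E" "P = tvc p k" using P(1) tangent_space_eq [OF V(2)] by auto
  have Gk: "G.G (\<psi> p) k k \<noteq> 0" using P(2) k V(2) unfolding G.G_def by simp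
  have kH: "G.G (\<psi> p) k a = 0" if "a \<in> H" for a
    using P(3) [of "tv N (V \<inter> S) \<psi> p a"] push_tv [OF pV(1) that] C.tangent_space_eq [OF pV(1)] that k V(2) unfolding G.G_def by simp
  have "k \<noteq> 0" using Gk G.G_rules(3) [OF pV(2) k(1) k(1) k(1), of 0] by auto
  then have "E \<noteq> {0}" using k by blast
  then obtain n where n: "n \<in> E" "norm n = 1" "\<And>h. h \<in> H \<Longrightarrow> h \<bullet> n = 0" "\<And>x. x \<in> E \<Longrightarrow> x \<in> H \<longleftrightarrow> x \<bullet> n = 0"
    using hyperplane_normal [OF subE subH HE dimH] by metis
  have kn: "k \<bullet> n \<noteq> 0" using n(4) [OF k(1)] kH Gk by blast
  have "c = 0"
  proof (rule G.G_nondeg [OF pV(2)])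
    show cE: "c \<in> E" using c HE by auto
    fix b assume b: "b \<in> E"
    \<comment> \<open>Chosen so that subtracting \<open>s *\<^sub>R k\<close> removes the
      \<open>n\<close>-component of b and leaves an element of \<open>H\<close>.\<close>
    define s where "s = (b \<bullet> n) / (k \<bullet> n)"
    have sk: "s *\<^sub>R k \<in> E" using subspace_scale [OF subE k(1)] .
    have hE: "b - s *\<^sub>R k \<in> E" using subspace_diff [OF subE b sk] .
    have hH: "b - s *\<^sub>R k \<in> H" using n(4) [OF hE] kn unfolding s_def by (simp add: inner_diff_left)
    have "G.G (\<psi> p) c (b - s *\<^sub>R k) = 0"
      using 0 [of "tv N (V \<inter> S) \<psi> p (b - s *\<^sub>R k)"] gp [OF pV(1) c(1) hH] c(2) C.tangent_space_eq [OF pV(1)] hH by simp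
    moreover have "G.G (\<psi> p) c (s *\<^sub>R k) = 0"
      using G.G_rules(4) [OF pV(2) k(1) k(1) cE] G.G_sym [OF pV(2) cE k(1)] kH [OF c(1)] by simp
    ultimately show "G.G (\<psi> p) c b = 0" using G.G_rules(2) [OF pV(2) hE sk cE] by simp
  qed
  then show "u = (\<lambda>h. 0)" using c(2) C.tv_zero [OF pV(1)] by simp
qed

end

section \<open>Warped metrics\<close>

text \<open>Bootstrap: if F is C^m then so is its derivative \<open>a F\<close>, hence F is C^(m+1).
  Together with \<open>smooth_on_riccati\<close> this yields smoothness of \<open>W\<close> and
  \<open>\<theta>\<close> for all branches of \<open>w\<close> from their equations alone.\<close>

lemma smooth_on_linear_ode:
  fixes F a :: "real \<Rightarrow> real"
  assumes T: "open T" and F: "\<And>r. r \<in> T \<Longrightarrow> (F has_real_derivative a r * F r) (at r)" and a: "smooth_on UNIV T a"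
  shows "smooth_on UNIV T F"
proof -
  have rT: "relopen UNIV T" using T by simp
  have "Ck_on UNIV m F T" for m
  proof (induction m)
    case 0
    then show ?case using F T by (auto simp: continuous_on_eq_continuous_at intro: DERIV_isCont)
  next
    case (Suc m)
    have "Ck_on UNIV m (\<lambda>r. a r * F r) T"
      by (rule Ck_on_bilinear [OF rT bounded_bilinear_mult _ Suc]) (use a in \<open>simp add: smooth_on_def\<close>)
    then show ?case using Ck_on_Suc_real [of T F "\<lambda>r. a r * F r" m] T F by blast
  qed
  then show ?thesis unfolding smooth_on_def by blast
qed

lemma smooth_on_riccati:
  fixes F :: "real \<Rightarrow> real"
  assumes T: "open T" and F: "\<And>r. r \<in> T \<Longrightarrow> (F has_real_derivative (F r)\<^sup>2 - c) (at r)"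
  shows "smooth_on UNIV T F"
proof -
  have rT: "relopen UNIV T" using T by simp
  have "Ck_on UNIV m F T" for m
  proof (induction m)
    case 0
    then show ?case using F T by (auto simp: continuous_on_eq_continuous_at intro: DERIV_isCont)
  next
    case (Suc m)
    have "Ck_on UNIV m (\<lambda>r. F r * F r + - c) T"
      by (intro Ck_on_add [OF rT] Ck_on_const [OF rT] Ck_on_bilinear [OF rT bounded_bilinear_mult Suc Suc])
    then show ?case using Ck_on_Suc_real [of T F "\<lambda>r. F r * F r + - c" m] T F by (simp add: power2_eq_square)
  qed
  then show ?thesis unfolding smooth_on_def by blast
qed

text \<open>
  A chart in which the metric is \<open>k W(\<rho>) (d\<rho>\<^sup>2 + h)\<close>, where \<open>\<rho> = x \<bullet> n\<close> and \<open>h\<close> is a metric on the hyperplane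
  orthogonal to \<open>n\<close> with Christoffel symbols \<open>\<Gamma>\<close>.  Here \<open>\<theta>\<close> stands for \<open>W' / (2 W)\<close>.
\<close>

locale warped_chart = metric_chart M U \<phi> g
  for M :: "('p, 'e::euclidean_space) mfd" and U \<phi> g +
  fixes H :: "'e set" and n :: 'e and \<Omega> :: "'e set" and h :: "'e \<Rightarrow> 'e \<Rightarrow> 'e \<Rightarrow> real"
    and \<Gamma> :: "'e \<Rightarrow> 'e \<Rightarrow> 'e \<Rightarrow> 'e" and T :: "real set" and W \<theta> :: "real \<Rightarrow> real" and k s C1 :: real
  assumes HE: "H \<subseteq> model M" and nE: "n \<in> model M" and nn: "n \<bullet> n = 1"
    and Hn: "\<And>x. x \<in> model M \<Longrightarrow> x \<in> H \<longleftrightarrow> x \<bullet> n = 0"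
    and \<Omega>: "relopen H \<Omega>" "\<And>x. x \<in> \<phi> ` U \<Longrightarrow> x - (x \<bullet> n) *\<^sub>R n \<in> \<Omega>"
    and h_bil: "bilfam H \<Omega> h" and h_sym: "\<And>y a b. y \<in> \<Omega> \<Longrightarrow> a \<in> H \<Longrightarrow> b \<in> H \<Longrightarrow> h y a b = h y b a"
    and \<Gamma>_bil: "bilfam H \<Omega> \<Gamma>" and \<Gamma>_sym: "\<And>y a b. y \<in> \<Omega> \<Longrightarrow> a \<in> H \<Longrightarrow> b \<in> H \<Longrightarrow> \<Gamma> y a b = \<Gamma> y b a"
    and \<Gamma>_H: "\<And>y a b. y \<in> \<Omega> \<Longrightarrow> a \<in> H \<Longrightarrow> b \<in> H \<Longrightarrow> \<Gamma> y a b \<in> H"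
    and \<Gamma>_met: "\<And>y a b c. y \<in> \<Omega> \<Longrightarrow> a \<in> H \<Longrightarrow> b \<in> H \<Longrightarrow> c \<in> H \<Longrightarrow>
      dd (\<lambda>z. h z b c) y a = h y (\<Gamma> y a b) c + h y b (\<Gamma> y a c)"
    and curv: "\<And>y a b. y \<in> \<Omega> \<Longrightarrow> a \<in> H \<Longrightarrow> b \<in> H \<Longrightarrow>
      h y (dd (\<lambda>z. \<Gamma> z b b) y a - dd (\<lambda>z. \<Gamma> z a b) y b + \<Gamma> y a (\<Gamma> y b b) - \<Gamma> y b (\<Gamma> y a b)) a =
      C1 * (h y a a * h y b b - (h y a b)\<^sup>2)"
    and T: "open T" "\<And>x. x \<in> \<phi> ` U \<Longrightarrow> x \<bullet> n \<in> T"
    and W: "\<And>r. r \<in> T \<Longrightarrow> (W has_real_derivative 2 * \<theta> r * W r) (at r)"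
    and \<theta>: "\<And>r. r \<in> T \<Longrightarrow> (\<theta> has_real_derivative (\<theta> r)\<^sup>2 - C1) (at r)" "smooth_on UNIV T \<theta>"
    and \<theta>2: "\<And>r. r \<in> T \<Longrightarrow> (\<theta> r)\<^sup>2 = C1 - s * W r"
    and k: "k \<noteq> 0"
    and G_eq: "\<And>x a b. x \<in> \<phi> ` U \<Longrightarrow> a \<in> model M \<Longrightarrow> b \<in> model M \<Longrightarrow>
      G x a b = k * W (x \<bullet> n) * ((a \<bullet> n) * (b \<bullet> n) + h (x - (x \<bullet> n) *\<^sub>R n) (a - (a \<bullet> n) *\<^sub>R n) (b - (b \<bullet> n) *\<^sub>R n))"
begin

definition hp :: "'e \<Rightarrow> 'e" where "hp x = x - (x \<bullet> n) *\<^sub>R n"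

lemma bl_hp: "bounded_linear hp"
  unfolding hp_def by (intro bounded_linear_sub bounded_linear_ident bounded_linear_scaleR_const bounded_linear_inner_left)

lemma subH: "subspace H" using relopenD(1) [OF \<Omega>(1)] .

lemma hp_n [simp]: "hp x \<bullet> n = 0"
  unfolding hp_def by (simp add: inner_diff_left nn)

lemma hp_H: "x \<in> E \<Longrightarrow> hp x \<in> H"
  using Hn [of "hp x"] hp_n subspace_diff [OF subE] subspace_scale [OF subE nE] unfolding hp_def by auto

lemma hp_id: "x \<in> H \<Longrightarrow> hp x = x"
  using Hn HE unfolding hp_def by auto

lemma hp_add: "hp (x + y) = hp x + hp y" and hp_diff: "hp (x - y) = hp x - hp y" and hp_scale: "hp (r *\<^sub>R x) = r *\<^sub>R hp x"
  and hp_nn: "hp n = 0"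
  unfolding hp_def by (auto simp: inner_add_left inner_diff_left algebra_simps nn)

lemma hp_\<Omega>: "x \<in> \<phi> ` U \<Longrightarrow> hp x \<in> \<Omega>"
  using \<Omega>(2) unfolding hp_def .

lemma H_n: "x \<in> H \<Longrightarrow> x \<bullet> n = 0"
  using Hn HE by auto

text \<open>The product metric \<open>d\<rho>\<^sup>2 + h\<close>, to which \<open>g\<close> is
  conformal.\<close>

definition gb :: "'e \<Rightarrow> 'e \<Rightarrow> 'e \<Rightarrow> real" where
  "gb x a b = (a \<bullet> n) * (b \<bullet> n) + h (hp x) (hp a) (hp b)"

text \<open>A conformal change by \<open>exp (2 u)\<close> changes the connection by
  \<open>du(a) b + du(b) a - gb(a, b) grad u\<close>. Here u depends on \<rho> only and
  \<open>u' = \<theta>\<close>, so \<open>grad u = \<theta> n\<close> and the change is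
  \<open>\<theta>\<close> times \<open>\<beta>\<close>.\<close>

definition \<beta> :: "'e \<Rightarrow> 'e \<Rightarrow> 'e \<Rightarrow> 'e" where
  "\<beta> x a b = (a \<bullet> n) *\<^sub>R b + (b \<bullet> n) *\<^sub>R a - gb x a b *\<^sub>R n"

definition \<Gamma>w :: "'e \<Rightarrow> 'e \<Rightarrow> 'e \<Rightarrow> 'e" where
  "\<Gamma>w x a b = \<Gamma> (hp x) (hp a) (hp b) + \<theta> (x \<bullet> n) *\<^sub>R \<beta> x a b"

lemma G_gb: "x \<in> \<phi> ` U \<Longrightarrow> a \<in> E \<Longrightarrow> b \<in> E \<Longrightarrow> G x a b = k * W (x \<bullet> n) * gb x a b"
  using G_eq unfolding gb_def hp_def .

lemma smooth_hp: "smooth_on E (\<phi> ` U) hp"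
  by (rule smooth_on_linear [OF ch(4) bl_hp smooth_on_ident [OF ch(4)]])

lemma dd_hp: "x \<in> \<phi> ` U \<Longrightarrow> v \<in> E \<Longrightarrow> dd hp x v = hp v"
  using dd_linear [OF ch(4) bl_hp smooth_on_ident [OF ch(4)]] dd_ident by simp

lemma comp_hp:
  assumes F: "smooth_on H \<Omega> F"
  shows "smooth_on E (\<phi> ` U) (\<lambda>x. F (hp x))"
    "x \<in> \<phi> ` U \<Longrightarrow> v \<in> E \<Longrightarrow> dd (\<lambda>x. F (hp x)) x v = dd F (hp x) (hp v)"
proof -
  have sub: "hp ` \<phi> ` U \<subseteq> \<Omega>" using hp_\<Omega> by auto
  show "smooth_on E (\<phi> ` U) (\<lambda>x. F (hp x))" by (rule smooth_on_compose [OF ch(4) \<Omega>(1) smooth_hp F sub])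
  assume "x \<in> \<phi> ` U" "v \<in> E"
  then show "dd (\<lambda>x. F (hp x)) x v = dd F (hp x) (hp v)"
    using dd_compose [OF ch(4) \<Omega>(1) smooth_hp F sub] dd_hp by simp
qed

lemma smooth_rho: "smooth_on E (\<phi> ` U) (\<lambda>x. x \<bullet> n)"
  by (rule smooth_on_linear [OF ch(4) bounded_linear_inner_left smooth_on_ident [OF ch(4)]])

lemma dd_rho: "x \<in> \<phi> ` U \<Longrightarrow> v \<in> E \<Longrightarrow> dd (\<lambda>x. x \<bullet> n) x v = v \<bullet> n"
  using dd_linear [OF ch(4) bounded_linear_inner_left smooth_on_ident [OF ch(4)]] dd_ident by simp

lemma comp_rho:
  assumes F: "smooth_on UNIV T F"
  shows "smooth_on E (\<phi> ` U) (\<lambda>x. F (x \<bullet> n))"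
    "x \<in> \<phi> ` U \<Longrightarrow> v \<in> E \<Longrightarrow> (F has_real_derivative D) (at (x \<bullet> n)) \<Longrightarrow> dd (\<lambda>x. F (x \<bullet> n)) x v = (v \<bullet> n) * D"
proof -
  have rT: "relopen UNIV T" using T(1) by simp
  have sub: "(\<lambda>x. x \<bullet> n) ` \<phi> ` U \<subseteq> T" using T(2) by auto
  show "smooth_on E (\<phi> ` U) (\<lambda>x. F (x \<bullet> n))" by (rule smooth_on_compose [OF ch(4) rT smooth_rho F sub])
  assume "x \<in> \<phi> ` U" "v \<in> E" "(F has_real_derivative D) (at (x \<bullet> n))"
  then show "dd (\<lambda>x. F (x \<bullet> n)) x v = (v \<bullet> n) * D"
    using dd_compose [OF ch(4) rT smooth_rho F sub] dd_rho dd_real by simp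
qed

lemma smooth_W: "smooth_on UNIV T W"
  by (rule smooth_on_linear_ode [OF T(1) W smooth_on_linear [OF _ bounded_linear_mult_right \<theta>(2)]]) (use T(1) in auto)

lemma h_rules:
  assumes "y \<in> \<Omega>" "a \<in> H" "b \<in> H" "c \<in> H"
  shows "h y (a + b) c = h y a c + h y b c" "h y c (a + b) = h y c a + h y c b"
    "h y (r *\<^sub>R a) c = r * h y a c" "h y c (r *\<^sub>R a) = r * h y c a"
  using bilfam_rules [OF h_bil assms] by auto

lemma h_scale: "y \<in> \<Omega> \<Longrightarrow> a \<in> H \<Longrightarrow> c \<in> H \<Longrightarrow> h y (r *\<^sub>R a) c = r * h y a c"
  "y \<in> \<Omega> \<Longrightarrow> a \<in> H \<Longrightarrow> c \<in> H \<Longrightarrow> h y c (r *\<^sub>R a) = r * h y c a"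
  using h_rules(3,4) by blast+

lemmas \<Gamma>_rules = bilfam_rules [OF \<Gamma>_bil]

lemma gb_rules:
  assumes "x \<in> \<phi> ` U" "a \<in> E" "b \<in> E" "c \<in> E"
  shows "gb x (a + b) c = gb x a c + gb x b c" "gb x c (a + b) = gb x c a + gb x c b"
    "gb x (r *\<^sub>R a) c = r * gb x a c" "gb x c (r *\<^sub>R a) = r * gb x c a"
  unfolding gb_def hp_add hp_scale using h_rules [OF hp_\<Omega> [OF assms(1)] hp_H hp_H hp_H] assms
  by (simp_all add: inner_add_left algebra_simps)

lemma smooth_h: "a \<in> E \<Longrightarrow> b \<in> E \<Longrightarrow> smooth_on H \<Omega> (\<lambda>y. h y (hp a) (hp b))"
  and smooth_\<Gamma>: "a \<in> E \<Longrightarrow> b \<in> E \<Longrightarrow> smooth_on H \<Omega> (\<lambda>y. \<Gamma> y (hp a) (hp b))"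
  using bilfam_smooth [OF h_bil] bilfam_smooth [OF \<Gamma>_bil] hp_H by auto

lemma smooth_gb:
  assumes "a \<in> E" "b \<in> E"
  shows "smooth_on E (\<phi> ` U) (\<lambda>x. gb x a b)"
    "x \<in> \<phi> ` U \<Longrightarrow> v \<in> E \<Longrightarrow> dd (\<lambda>x. gb x a b) x v = dd (\<lambda>y. h y (hp a) (hp b)) (hp x) (hp v)"
proof -
  note s = comp_hp(1) [OF smooth_h [OF assms]]
  show "smooth_on E (\<phi> ` U) (\<lambda>x. gb x a b)" unfolding gb_def
    by (intro smooth_on_add smooth_on_const s ch(4))
  assume "x \<in> \<phi> ` U" "v \<in> E"
  then show "dd (\<lambda>x. gb x a b) x v = dd (\<lambda>y. h y (hp a) (hp b)) (hp x) (hp v)" unfolding gb_def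
    using dd_plus [OF ch(4) smooth_on_const [OF ch(4)] s] comp_hp(2) [OF smooth_h [OF assms]] by simp
qed

lemma smooth_\<beta>:
  assumes "a \<in> E" "b \<in> E"
  shows "smooth_on E (\<phi> ` U) (\<lambda>x. \<beta> x a b)"
    "x \<in> \<phi> ` U \<Longrightarrow> v \<in> E \<Longrightarrow> dd (\<lambda>x. \<beta> x a b) x v = - (dd (\<lambda>y. h y (hp a) (hp b)) (hp x) (hp v) *\<^sub>R n)"
proof -
  note s = smooth_gb(1) [OF assms]
  have sn: "smooth_on E (\<phi> ` U) (\<lambda>x. gb x a b *\<^sub>R n)" by (intro smooth_on_scaleR s smooth_on_const ch(4))
  show "smooth_on E (\<phi> ` U) (\<lambda>x. \<beta> x a b)" unfolding \<beta>_def
    by (intro smooth_on_diff sn smooth_on_const ch(4))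
  assume x: "x \<in> \<phi> ` U" "v \<in> E"
  then show "dd (\<lambda>x. \<beta> x a b) x v = - (dd (\<lambda>y. h y (hp a) (hp b)) (hp x) (hp v) *\<^sub>R n)" unfolding \<beta>_def
    using dd_minus [OF ch(4) smooth_on_const [OF ch(4)] sn x] dd_scaleR_fun [OF ch(4) s smooth_on_const [OF ch(4)] x]
      smooth_gb(2) [OF assms x] by simp
qed

text \<open>The factor \<open>(\<theta> (x \<bullet> n))\<^sup>2 - C1\<close> is the derivative of
  \<open>\<theta>\<close>; the derivative of \<open>\<beta>\<close> comes from \<open>gb\<close>
  alone.\<close>

lemma smooth_\<Gamma>w:
  assumes "a \<in> E" "b \<in> E"
  shows "smooth_on E (\<phi> ` U) (\<lambda>x. \<Gamma>w x a b)"
    "x \<in> \<phi> ` U \<Longrightarrow> v \<in> E \<Longrightarrow> dd (\<lambda>x. \<Gamma>w x a b) x v = dd (\<lambda>y. \<Gamma> y (hp a) (hp b)) (hp x) (hp v) -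
       (\<theta> (x \<bullet> n) * dd (\<lambda>y. h y (hp a) (hp b)) (hp x) (hp v)) *\<^sub>R n +
       ((v \<bullet> n) * ((\<theta> (x \<bullet> n))\<^sup>2 - C1)) *\<^sub>R \<beta> x a b"
proof -
  note s1 = comp_hp [OF smooth_\<Gamma> [OF assms]] and s2 = comp_rho [OF \<theta>(2)] and s3 = smooth_\<beta> [OF assms]
  have s4: "smooth_on E (\<phi> ` U) (\<lambda>x. \<theta> (x \<bullet> n) *\<^sub>R \<beta> x a b)" by (rule smooth_on_scaleR [OF ch(4) s2(1) s3(1)])
  show "smooth_on E (\<phi> ` U) (\<lambda>x. \<Gamma>w x a b)" unfolding \<Gamma>w_def by (rule smooth_on_add [OF ch(4) s1(1) s4])
  assume x: "x \<in> \<phi> ` U" "v \<in> E"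
  show "dd (\<lambda>x. \<Gamma>w x a b) x v = dd (\<lambda>y. \<Gamma> y (hp a) (hp b)) (hp x) (hp v) -
       (\<theta> (x \<bullet> n) * dd (\<lambda>y. h y (hp a) (hp b)) (hp x) (hp v)) *\<^sub>R n +
       ((v \<bullet> n) * ((\<theta> (x \<bullet> n))\<^sup>2 - C1)) *\<^sub>R \<beta> x a b"
    unfolding \<Gamma>w_def
    using dd_plus [OF ch(4) s1(1) s4 x] dd_scaleR_fun [OF ch(4) s2(1) s3(1) x] s1(2) [OF x] s2(2) [OF x \<theta>(1)] s3(2) [OF x] T(2) [OF x(1)]
    by simp
qed

lemma \<Gamma>w_E:
  assumes "x \<in> \<phi> ` U" "a \<in> E" "b \<in> E" shows "\<Gamma>w x a b \<in> E"
proof -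
  have "\<Gamma> (hp x) (hp a) (hp b) \<in> E" using \<Gamma>_H [OF hp_\<Omega> hp_H hp_H] assms HE by blast
  then show ?thesis unfolding \<Gamma>w_def \<beta>_def using assms nE
    by (intro subspace_add [OF subE] subspace_scale [OF subE] subspace_diff [OF subE])
qed

lemma \<Gamma>w_n:
  assumes "x \<in> \<phi> ` U" "a \<in> E" "b \<in> E"
  shows "\<Gamma>w x a b \<bullet> n = \<theta> (x \<bullet> n) * ((a \<bullet> n) * (b \<bullet> n) - h (hp x) (hp a) (hp b))"
proof -
  have "\<Gamma> (hp x) (hp a) (hp b) \<bullet> n = 0" using H_n [OF \<Gamma>_H [OF hp_\<Omega> hp_H hp_H]] assms by blast
  then show ?thesis unfolding \<Gamma>w_def \<beta>_def gb_def by (simp add: inner_add_left inner_diff_left nn algebra_simps)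
qed

lemma \<Gamma>w_hp:
  assumes "x \<in> \<phi> ` U" "a \<in> E" "b \<in> E"
  shows "hp (\<Gamma>w x a b) = \<Gamma> (hp x) (hp a) (hp b) + \<theta> (x \<bullet> n) *\<^sub>R ((a \<bullet> n) *\<^sub>R hp b + (b \<bullet> n) *\<^sub>R hp a)"
proof -
  have "hp (\<Gamma> (hp x) (hp a) (hp b)) = \<Gamma> (hp x) (hp a) (hp b)" using hp_id [OF \<Gamma>_H [OF hp_\<Omega> hp_H hp_H]] assms by blast
  then show ?thesis unfolding \<Gamma>w_def \<beta>_def hp_add hp_scale hp_diff hp_nn by simp
qed

lemma \<Gamma>w_bil: "bilfam E (\<phi> ` U) \<Gamma>w"
proof -
  have "\<Gamma>w x (a + b) c = \<Gamma>w x a c + \<Gamma>w x b c" "\<Gamma>w x c (a + b) = \<Gamma>w x c a + \<Gamma>w x c b"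
    "\<Gamma>w x (r *\<^sub>R a) c = r *\<^sub>R \<Gamma>w x a c" "\<Gamma>w x c (r *\<^sub>R a) = r *\<^sub>R \<Gamma>w x c a"
    if A: "x \<in> \<phi> ` U" "a \<in> E" "b \<in> E" "c \<in> E" for x a b c r
    unfolding \<Gamma>w_def \<beta>_def hp_add hp_scale
    using \<Gamma>_rules [OF hp_\<Omega> [OF A(1)] hp_H [OF A(2)] hp_H [OF A(3)] hp_H [OF A(4)]] gb_rules [OF A]
    by (simp_all add: inner_add_left algebra_simps)
  then show ?thesis unfolding bilfam_def linfam_def using smooth_\<Gamma>w(1) by auto
qed

lemma \<Gamma>w_sym: "x \<in> \<phi> ` U \<Longrightarrow> a \<in> E \<Longrightarrow> b \<in> E \<Longrightarrow> \<Gamma>w x a b = \<Gamma>w x b a"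
  unfolding \<Gamma>w_def \<beta>_def gb_def using \<Gamma>_sym [OF hp_\<Omega> hp_H hp_H] h_sym [OF hp_\<Omega> hp_H hp_H] by (simp add: algebra_simps)

text \<open>Differentiating \<open>k W gb\<close> gives the derivative of \<open>gb\<close>, handled
  by \<open>\<Gamma>\<close>, and \<open>2 \<theta> d\<rho>(a)\<close> times the metric. The latter
  is the contribution of \<open>\<theta> \<beta>\<close>, because \<open>gb(\<beta>(a, b), c) +
  gb(b, \<beta>(a, c)) = 2 d\<rho>(a) gb(b, c)\<close>.\<close>

lemma \<Gamma>w_met:
  assumes x: "x \<in> \<phi> ` U" and E: "a \<in> E" "b \<in> E" "c \<in> E"
  shows "dd (\<lambda>y. G y b c) x a = G x (\<Gamma>w x a b) c + G x b (\<Gamma>w x a c)"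
proof -
  note s1 = comp_rho [OF smooth_W] and s2 = smooth_gb [OF E(2,3)]
  have "dd (\<lambda>y. G y b c) x a = dd (\<lambda>y. (k * W (y \<bullet> n)) * gb y b c) x a"
    by (rule dd_cong [OF ch(4) x E(1)]) (use G_gb E in auto)
  also have "\<dots> = (k * W (x \<bullet> n)) * dd (\<lambda>y. gb y b c) x a + dd (\<lambda>y. k * W (y \<bullet> n)) x a * gb x b c"
    by (rule dd_mult [OF ch(4) smooth_on_linear [OF ch(4) bounded_linear_mult_right s1(1)] s2(1) x E(1)])
  also have "dd (\<lambda>y. k * W (y \<bullet> n)) x a = k * ((a \<bullet> n) * (2 * \<theta> (x \<bullet> n) * W (x \<bullet> n)))"
    using dd_linear [OF ch(4) bounded_linear_mult_right s1(1) x E(1)] s1(2) [OF x E(1) W [OF T(2) [OF x]]] by simp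
  also have "dd (\<lambda>y. gb y b c) x a = h (hp x) (\<Gamma> (hp x) (hp a) (hp b)) (hp c) + h (hp x) (hp b) (\<Gamma> (hp x) (hp a) (hp c))"
    using s2(2) [OF x E(1)] \<Gamma>_met [OF hp_\<Omega> [OF x] hp_H hp_H hp_H] E by simp
  finally have L: "dd (\<lambda>y. G y b c) x a = k * W (x \<bullet> n) * (h (hp x) (\<Gamma> (hp x) (hp a) (hp b)) (hp c) + h (hp x) (hp b) (\<Gamma> (hp x) (hp a) (hp c)) +
     2 * \<theta> (x \<bullet> n) * (a \<bullet> n) * gb x b c)" by (simp add: algebra_simps)
  note y = hp_\<Omega> [OF x]
  note Hs = hp_H [OF E(1)] hp_H [OF E(2)] hp_H [OF E(3)] \<Gamma>_H [OF y] subspace_add [OF subH] subspace_scale [OF subH]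
  have "G x (\<Gamma>w x a b) c + G x b (\<Gamma>w x a c) = k * W (x \<bullet> n) * (gb x (\<Gamma>w x a b) c + gb x b (\<Gamma>w x a c))"
    using G_gb [OF x] \<Gamma>w_E [OF x] E by (simp add: algebra_simps)
  also have "gb x (\<Gamma>w x a b) c + gb x b (\<Gamma>w x a c) =
     h (hp x) (\<Gamma> (hp x) (hp a) (hp b)) (hp c) + h (hp x) (hp b) (\<Gamma> (hp x) (hp a) (hp c)) + 2 * \<theta> (x \<bullet> n) * (a \<bullet> n) * gb x b c"
    unfolding gb_def \<Gamma>w_n [OF x E(1,2)] \<Gamma>w_n [OF x E(1,3)] \<Gamma>w_hp [OF x E(1,2)] \<Gamma>w_hp [OF x E(1,3)]
    by (simp add: h_rules(1,2) [OF y] h_scale [OF y] Hs h_sym [OF y Hs(2,1)] algebra_simps)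
  finally show ?thesis unfolding L by simp
qed

lemma chris: "chris_chart M U \<phi> g \<Gamma>w"
  by unfold_locales (use \<Gamma>w_bil \<Gamma>w_E \<Gamma>w_sym \<Gamma>w_met in auto)

text \<open>The vector \<open>riem x a b b\<close> is split into a component along \<open>n\<close>
  and one in \<open>H\<close>, both expressed by the slice components \<open>A\<close>,
  \<open>B\<close> and the normal components \<open>p\<close>, \<open>q\<close>. Derivatives of
  \<open>\<Gamma>\<close> enter only through the curvature of the slice. The lowered curvature
  carries the factor \<open>k W\<close> once and \<open>s W\<close> from the equation for
  \<open>\<theta>\<^sup>2\<close>, the Gram determinant carries \<open>k W\<close> twice, which
  leaves \<open>s / k\<close>.\<close>

lemma warped_const_curv: "chris_chart.const_curv M U \<phi> g \<Gamma>w (s / k)"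
proof -
  interpret C: chris_chart M U \<phi> g \<Gamma>w by (rule chris)
  have "G x (C.riem x a b b) a = s / k * (G x a a * G x b b - (G x a b)\<^sup>2)"
    if x: "x \<in> \<phi> ` U" and E: "a \<in> E" "b \<in> E" for x a b
  proof -
    note y = hp_\<Omega> [OF x]
    define A B p q t where "A = hp a" and "B = hp b" and "p = a \<bullet> n" and "q = b \<bullet> n" and "t = \<theta> (x \<bullet> n)"
    define hh where "hh = h (hp x)"
    define \<Gamma>\<Gamma> where "\<Gamma>\<Gamma> = \<Gamma> (hp x)"
    define dG1 where "dG1 = dd (\<lambda>z. \<Gamma> z B B) (hp x) A"
    define dG2 where "dG2 = dd (\<lambda>z. \<Gamma> z A B) (hp x) B"
    have AB: "A \<in> H" "B \<in> H" unfolding A_def B_def using hp_H E by auto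
    have \<Gamma>H: "\<Gamma>\<Gamma> u v \<in> H" if "u \<in> H" "v \<in> H" for u v unfolding \<Gamma>\<Gamma>_def using \<Gamma>_H [OF y that] .
    have dG: "dG1 \<in> H" "dG2 \<in> H" unfolding dG1_def dG2_def
      using dd_in_subspace [OF \<Omega>(1) bilfam_smooth [OF \<Gamma>_bil] subH _ y] \<Gamma>_H AB by blast+
    note add = subspace_add [OF subH] and sc = subspace_scale [OF subH] and df = subspace_diff [OF subH]
    have hr1: "hh (u + v) z = hh u z + hh v z" "hh z (u + v) = hh z u + hh z v"
      if "u \<in> H" "v \<in> H" "z \<in> H" for u v z unfolding hh_def using h_rules [OF y that] by auto
    have hr2: "hh (r *\<^sub>R u) z = r * hh u z" "hh z (r *\<^sub>R u) = r * hh z u"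
      if "u \<in> H" "z \<in> H" for u z r unfolding hh_def using h_scale [OF y that] by auto
    note hr = hr1 hr2
    have hd: "hh (u - v) z = hh u z - hh v z" if "u \<in> H" "v \<in> H" "z \<in> H" for u v z
      unfolding hh_def using bilfam_diff(1) [OF h_bil subH y that] .
    have hs: "hh u v = hh v u" if "u \<in> H" "v \<in> H" for u v unfolding hh_def using h_sym [OF y that] .
    have \<Gamma>r1: "\<Gamma>\<Gamma> z (u + v) = \<Gamma>\<Gamma> z u + \<Gamma>\<Gamma> z v" if "u \<in> H" "v \<in> H" "z \<in> H" for u v z
      unfolding \<Gamma>\<Gamma>_def using \<Gamma>_rules [OF y that] by auto
    have \<Gamma>r2: "\<Gamma>\<Gamma> z (r *\<^sub>R u) = r *\<^sub>R \<Gamma>\<Gamma> z u" if "u \<in> H" "z \<in> H" for u z r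
      unfolding \<Gamma>\<Gamma>_def using \<Gamma>_rules(4) [OF y that(1,1,2)] .
    note \<Gamma>r = \<Gamma>r1 \<Gamma>r2
    have \<Gamma>s: "\<Gamma>\<Gamma> u v = \<Gamma>\<Gamma> v u" if "u \<in> H" "v \<in> H" for u v unfolding \<Gamma>\<Gamma>_def using \<Gamma>_sym [OF y that] .
    have dh: "dd (\<lambda>z. h z v z') (hp x) u = hh (\<Gamma>\<Gamma> u v) z' + hh v (\<Gamma>\<Gamma> u z')" if "u \<in> H" "v \<in> H" "z' \<in> H" for u v z'
      unfolding hh_def \<Gamma>\<Gamma>_def using \<Gamma>_met [OF y that] .
    have cv: "hh (dG1 - dG2 + \<Gamma>\<Gamma> A (\<Gamma>\<Gamma> B B) - \<Gamma>\<Gamma> B (\<Gamma>\<Gamma> A B)) A = C1 * (hh A A * hh B B - (hh A B)\<^sup>2)"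
      unfolding hh_def \<Gamma>\<Gamma>_def dG1_def dG2_def using curv [OF y AB] .
    \<comment> \<open>The inner values of the nested Christoffel terms; only their normal and slice
      components are used below.\<close>
    define zb where "zb = \<Gamma>w x b b"
    define za where "za = \<Gamma>w x a b"
    have zE: "zb \<in> E" "za \<in> E" unfolding zb_def za_def using \<Gamma>w_E [OF x] E by auto
    have zbn: "zb \<bullet> n = t * (q * q - hh B B)" and zan: "za \<bullet> n = t * (p * q - hh A B)"
      unfolding zb_def za_def hh_def A_def B_def p_def q_def t_def using \<Gamma>w_n [OF x] E by auto
    have zbh: "hp zb = \<Gamma>\<Gamma> B B + (2 * t * q) *\<^sub>R B" and zah: "hp za = \<Gamma>\<Gamma> A B + ((t * p) *\<^sub>R B + (t * q) *\<^sub>R A)"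
      unfolding zb_def za_def \<Gamma>\<Gamma>_def A_def B_def p_def q_def t_def using \<Gamma>w_hp [OF x] E
      by (auto simp: scaleR_add_right simp flip: scaleR_add_left)
    have dn1: "dG1 \<bullet> n = 0" "dG2 \<bullet> n = 0" "hp dG1 = dG1" "hp dG2 = dG2" using dG H_n hp_id by auto
    have \<beta>n: "\<beta> x b b \<bullet> n = q * q - hh B B" "\<beta> x a b \<bullet> n = p * q - hh A B"
      and \<beta>h: "hp (\<beta> x b b) = (2 * q) *\<^sub>R B" "hp (\<beta> x a b) = p *\<^sub>R B + q *\<^sub>R A"
      unfolding \<beta>_def gb_def hp_add hp_diff hp_scale hp_nn hh_def A_def B_def p_def q_def
      by (auto simp: inner_add_left inner_diff_left nn algebra_simps simp flip: scaleR_add_left)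
    \<comment> \<open>The two derivative terms are expanded with \<open>smooth_\<Gamma>w\<close>,
      and the derivatives of \<open>h\<close> become Christoffel terms by metric
      compatibility.\<close>
    have R: "C.riem x a b b = (dG1 - (t * (2 * hh (\<Gamma>\<Gamma> A B) B)) *\<^sub>R n + (p * (t\<^sup>2 - C1)) *\<^sub>R \<beta> x b b) -
        (dG2 - (t * (hh (\<Gamma>\<Gamma> B A) B + hh A (\<Gamma>\<Gamma> B B))) *\<^sub>R n + (q * (t\<^sup>2 - C1)) *\<^sub>R \<beta> x a b) +
        \<Gamma>w x a zb - \<Gamma>w x b za"
      unfolding C.riem_def smooth_\<Gamma>w(2) [OF E(2,2) x E(1)] smooth_\<Gamma>w(2) [OF E(1,2) x E(2)]
      using dh [OF AB(1,2,2)] dh [OF AB(2,1,2)] hs [OF AB(2) \<Gamma>H [OF AB]]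
      unfolding A_def [symmetric] B_def [symmetric] p_def [symmetric] q_def [symmetric] t_def [symmetric]
        dG1_def [symmetric] dG2_def [symmetric] zb_def za_def by simp
    have Rn: "C.riem x a b b \<bullet> n = - (t * (2 * hh (\<Gamma>\<Gamma> A B) B)) + p * (t\<^sup>2 - C1) * (q * q - hh B B) +
        t * (hh (\<Gamma>\<Gamma> A B) B + hh A (\<Gamma>\<Gamma> B B)) - q * (t\<^sup>2 - C1) * (p * q - hh A B) +
        t * (p * (t * (q * q - hh B B)) - hh A (\<Gamma>\<Gamma> B B + (2 * t * q) *\<^sub>R B)) -
        t * (q * (t * (p * q - hh A B)) - hh B (\<Gamma>\<Gamma> A B + ((t * p) *\<^sub>R B + (t * q) *\<^sub>R A)))"
      unfolding R inner_add_left inner_diff_left inner_scaleR_left dn1 \<beta>n nn \<Gamma>w_n [OF x E(1) zE(1)] \<Gamma>w_n [OF x E(2) zE(2)]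
        zbn zan zbh zah \<Gamma>s [OF AB(2,1)]
      unfolding A_def [symmetric] B_def [symmetric] p_def [symmetric] q_def [symmetric] t_def [symmetric] hh_def [symmetric]
      by simp
    have Rh: "hp (C.riem x a b b) = (dG1 + (p * (t\<^sup>2 - C1)) *\<^sub>R (2 * q) *\<^sub>R B) - (dG2 + (q * (t\<^sup>2 - C1)) *\<^sub>R (p *\<^sub>R B + q *\<^sub>R A)) +
        (\<Gamma>\<Gamma> A (\<Gamma>\<Gamma> B B + (2 * t * q) *\<^sub>R B) + t *\<^sub>R (p *\<^sub>R (\<Gamma>\<Gamma> B B + (2 * t * q) *\<^sub>R B) + (t * (q * q - hh B B)) *\<^sub>R A)) -
        (\<Gamma>\<Gamma> B (\<Gamma>\<Gamma> A B + ((t * p) *\<^sub>R B + (t * q) *\<^sub>R A)) + t *\<^sub>R (q *\<^sub>R (\<Gamma>\<Gamma> A B + ((t * p) *\<^sub>R B + (t * q) *\<^sub>R A)) + (t * (p * q - hh A B)) *\<^sub>R B))"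
      unfolding R hp_add hp_diff hp_scale dn1 \<beta>h hp_nn \<Gamma>w_hp [OF x E(1) zE(1)] \<Gamma>w_hp [OF x E(2) zE(2)] zbn zan zbh zah
      unfolding A_def [symmetric] B_def [symmetric] p_def [symmetric] q_def [symmetric] t_def [symmetric] \<Gamma>\<Gamma>_def [symmetric]
      by simp
    have cv': "hh dG1 A - hh dG2 A + hh (\<Gamma>\<Gamma> A (\<Gamma>\<Gamma> B B)) A - hh (\<Gamma>\<Gamma> B (\<Gamma>\<Gamma> A B)) A = C1 * (hh A A * hh B B - (hh A B)\<^sup>2)"
      using cv AB \<Gamma>H dG add df by (simp add: hr hd)
    have gbR: "gb x (C.riem x a b b) a = p * (C.riem x a b b \<bullet> n) + hh (hp (C.riem x a b b)) A"
      unfolding gb_def hh_def A_def p_def by (simp add: mult.commute)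
    have hR: "hh (hp (C.riem x a b b)) A = hh dG1 A - hh dG2 A + hh (\<Gamma>\<Gamma> A (\<Gamma>\<Gamma> B B)) A - hh (\<Gamma>\<Gamma> B (\<Gamma>\<Gamma> A B)) A
        + (p * (t\<^sup>2 - C1) * (2 * q)) * hh A B - q * (t\<^sup>2 - C1) * (p * hh A B + q * hh A A)
        + t * (p * (2 * t * q * hh A B) + t * (q * q - hh B B) * hh A A)
        - t * (q * (t * p * hh A B + t * q * hh A A) + t * (p * q - hh A B) * hh A B)"
      unfolding Rh using AB \<Gamma>H dG add df sc
      by (simp add: hr hd \<Gamma>r \<Gamma>s [OF AB(2,1)] hs [OF AB(2,1)] algebra_simps)
    have nR: "C.riem x a b b \<bullet> n = p * (t\<^sup>2 - C1) * (q * q - hh B B) - q * (t\<^sup>2 - C1) * (p * q - hh A B) +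
        t * (p * (t * (q * q - hh B B)) - 2 * t * q * hh A B) -
        t * (q * (t * (p * q - hh A B)) - (t * p * hh B B + t * q * hh A B))"
      unfolding Rn using AB \<Gamma>H sc add
      by (simp add: hr hs [OF AB(2,1)] hs [OF AB(2) \<Gamma>H [OF AB]] algebra_simps)
    have th: "t\<^sup>2 - C1 = - (s * W (x \<bullet> n))" unfolding t_def using \<theta>2 [OF T(2) [OF x]] by simp
    \<comment> \<open>The curvature of \<open>h\<close> contributes \<open>C1\<close> times the Gram
      determinant of \<open>A\<close> and \<open>B\<close>. The terms with the derivative
      \<open>t\<^sup>2 - C1\<close> of \<open>\<theta>\<close> and those quadratic in t complete it
      to the Gram determinant of \<open>gb\<close>.\<close>
    have "gb x (C.riem x a b b) a = (C1 - t\<^sup>2) * ((p * p + hh A A) * (q * q + hh B B) - (p * q + hh A B)\<^sup>2)"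
      unfolding gbR hR nR cv' by (simp add: power2_eq_square algebra_simps)
    also have "\<dots> = s * W (x \<bullet> n) * (gb x a a * gb x b b - (gb x a b)\<^sup>2)"
      using th unfolding gb_def hh_def A_def B_def p_def q_def by simp
    finally have main: "gb x (C.riem x a b b) a = s * W (x \<bullet> n) * (gb x a a * gb x b b - (gb x a b)\<^sup>2)" .
    have "G x (C.riem x a b b) a = k * W (x \<bullet> n) * (s * W (x \<bullet> n) * (gb x a a * gb x b b - (gb x a b)\<^sup>2))"
      using G_gb [OF x C.riem_E [OF x E(1,2,2)] E(1)] main by simp
    also have "\<dots> = s / k * (G x a a * G x b b - (G x a b)\<^sup>2)"
      unfolding G_gb [OF x E(1,1)] G_gb [OF x E(2,2)] G_gb [OF x E(1,2)]
      using k by (simp add: power2_eq_square field_simps)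
    finally show ?thesis .
  qed
  then show ?thesis unfolding C.const_curv_def by blast
qed

end

section \<open>Homogeneous pairs\<close>

lemma smooth_at_real:
  assumes "open T" "smooth_on UNIV T F" "r \<in> T"
  shows "smooth_at real_mfd real_mfd F r"
  using smooth_at_from_emfd [of UNIV UNIV T r UNIV id real_mfd F] assms emfd_max [of UNIV "UNIV :: real set"] by simp

lemma smooth_at_comp_real:
  assumes "pmfd X" "smooth_at X real_mfd h x" "open T" "smooth_on UNIV T F" "h x \<in> T"
  shows "smooth_at X real_mfd (\<lambda>z. F (h z)) x"
  by (rule smooth_at_compose [OF assms(1) pmfd_real pmfd_real assms(2) smooth_at_real [OF assms(3-5)]])

lemma smooth_near_comp_real:
  assumes "pmfd M" "smooth_near M p h" "open T" "smooth_on UNIV T F" "h p \<in> T"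
  shows "smooth_near M p (\<lambda>z. F (h z))"
  using smooth_at_comp_real [OF assms(1) iffD1 [OF smooth_near_iff [OF assms(1)] assms(2)] assms(3-5)]
    smooth_near_iff [OF assms(1)] by blast

lemma smooth_near_mult:
  assumes M: "pmfd M" and h: "smooth_near M p h" and k: "smooth_near M p k"
  shows "smooth_near M p (\<lambda>q. h q * k q)"
proof -
  have "\<exists>O'. openin (mtop M) O' \<and> p \<in> O'" using h unfolding smooth_near_def by blast
  then obtain O' where O': "openin (mtop M) O'" "p \<in> O'" by blast
  obtain U \<phi> where U: "mfd_chart M U \<phi>" "p \<in> U" using mfd_chart_exists [OF M O'] by metis
  interpret mfd_chart M U \<phi> by fact
  obtain A where A: "openin (mtop M) A" "p \<in> A" "A \<subseteq> U" "relopen E (\<phi> ` A)" "smooth_on E (\<phi> ` A) (\<lambda>x. h (pt x))"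
    using smooth_nearE [OF h U(2) ch(1) subset_refl] by metis
  obtain B where B: "openin (mtop M) B" "p \<in> B" "B \<subseteq> A" "relopen E (\<phi> ` B)" "smooth_on E (\<phi> ` B) (\<lambda>x. k (pt x))"
    using smooth_nearE [OF k A(2,1,3)] by metis
  have "smooth_on E (\<phi> ` B) (\<lambda>x. h (pt x) * k (pt x))"
    by (rule smooth_on_mult [OF B(4) smooth_on_subset [OF A(5)] B(5)]) (use B in auto)
  then show ?thesis using smooth_near_chart [OF pm mx U(2)] A B by blast
qed

lemma smooth_near_const:
  assumes M: "pmfd M" and p: "p \<in> pts M" shows "smooth_near M p (\<lambda>q. c)"
proof -
  obtain U \<phi> where U: "mfd_chart M U \<phi>" "p \<in> U" using mfd_chart_exists [OF M openin_topspace p] by metis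
  show ?thesis by (rule mfd_chart.const_near [OF U])
qed

lemma tangent_const:
  assumes "pmfd M" "p \<in> pts M" "u \<in> tangent_space M p" shows "u (\<lambda>q. c) = 0"
  using assms(3) unfolding tangent_space_def velocity_def by auto

section \<open>The action, its level sets and the projection along orbits\<close>

locale homogeneous =
  fixes M :: "('p, 'e::euclidean_space) mfd" and m :: "real \<Rightarrow> 'p \<Rightarrow> 'p" and \<alpha> :: real and g :: "'p metric"
    and f :: "'p \<Rightarrow> real" and l :: real and H :: "'e set"
  assumes pmM: "pmfd M" and action: "smooth_free_action M m" and \<alpha>: "\<alpha> \<noteq> 0"
    and pair: "homogeneous_pair M m \<alpha> g f" and l: "l > 0"
    and subspH: "subspace H" and HsubE: "H \<subseteq> model M" and dimH: "dim H = dim (model M) - 1"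
begin

lemma act_smooth: "smooth_map (prod_mfd (open_mfd {0<..}) M) M (\<lambda>(t, x). m t x)"
  using action unfolding smooth_free_action_def by blast

lemma act_one: "x \<in> pts M \<Longrightarrow> m 1 x = x"
  using action unfolding smooth_free_action_def by blast

lemma act_mult: "a > 0 \<Longrightarrow> b > 0 \<Longrightarrow> x \<in> pts M \<Longrightarrow> m a (m b x) = m (a * b) x"
  using action unfolding smooth_free_action_def by metis

lemma act_exp: "x \<in> pts M \<Longrightarrow> m (exp a) (m (exp b) x) = m (exp (a + b)) x"
  using act_mult [of "exp a" "exp b"] by (simp add: exp_add)

text \<open>Smoothness of the action is stated in product charts on the whole preimage of
  \<open>V\<close>. A box around \<open>(t0, x0)\<close> inside this open preimage gives joint
  smoothness in time and chart coordinates.\<close>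

lemma act_local:
  assumes U: "(U, \<phi>) \<in> atlas M" "x0 \<in> U" and V: "(V, \<psi>) \<in> atlas M" "m t0 x0 \<in> V" and t0: "t0 > 0"
  obtains A B where "open A" "A \<subseteq> {0<..}" "t0 \<in> A" "openin (mtop M) B" "x0 \<in> B" "B \<subseteq> U"
    "\<forall>t\<in>A. \<forall>x\<in>B. m t x \<in> V"
    "smooth_on (UNIV \<times> model M) (A \<times> \<phi> ` B) (\<lambda>z. \<psi> (m (fst z) (inv_into U \<phi> (snd z))))"
proof -
  note cU = max_chart [OF pmM atlas_max [OF pmM U(1)]] and cV = max_chart [OF pmM atlas_max [OF pmM V(1)]]
  let ?P = "prod_mfd (open_mfd {0<..}) M"
  let ?F = "\<lambda>(t, x). m t x"
  have at: "({0<..} \<times> U, map_prod id \<phi>) \<in> atlas ?P"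
    using U(1) unfolding prod_mfd_def open_mfd_def by auto
  have top: "mtop ?P = prod_topology (top_of_set {0<..}) (mtop M)" "model ?P = UNIV \<times> model M"
    unfolding prod_mfd_def open_mfd_def by simp_all
  have cont: "continuous_map (mtop ?P) (mtop M) ?F" using act_smooth unfolding smooth_map_def by blast
  have "openin (mtop ?P) {z \<in> topspace (mtop ?P). ?F z \<in> V}"
    using cont cV(1) unfolding continuous_map_def by blast
  moreover have "(t0, x0) \<in> {z \<in> topspace (mtop ?P). ?F z \<in> V}"
    using t0 U(2) V(2) cU(2) unfolding top by auto
  ultimately have "\<exists>A B. openin (top_of_set {0<..}) A \<and> openin (mtop M) B \<and> t0 \<in> A \<and> x0 \<in> B \<and>
    A \<times> B \<subseteq> {z \<in> topspace (mtop ?P). ?F z \<in> V}"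
    unfolding top by (rule openin_prod_topology_alt [THEN iffD1, rule_format])
  then obtain A B where AB: "openin (top_of_set {0<..}) A" "openin (mtop M) B" "t0 \<in> A" "x0 \<in> B"
    "A \<times> B \<subseteq> {z \<in> topspace (mtop ?P). ?F z \<in> V}"
    by blast
  have A: "open A" "A \<subseteq> {0<..}" using AB(1) openin_imp_subset by (auto simp: openin_open_eq)
  define B' where "B' = B \<inter> U"
  have B': "openin (mtop M) B'" "x0 \<in> B'" "B' \<subseteq> U" unfolding B'_def using AB cU(1) U(2) by auto
  have mV: "m t x \<in> V" if "t \<in> A" "x \<in> B'" for t x using AB(5) that unfolding B'_def by auto
  have "smooth_on (model ?P) (map_prod id \<phi> ` {x\<in>{0<..} \<times> U. ?F x \<in> V}) (\<psi> \<circ> ?F \<circ> inv_into ({0<..} \<times> U) (map_prod id \<phi>))"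
    using act_smooth at V(1) unfolding smooth_map_def by fast
  then have "smooth_on (UNIV \<times> model M) (A \<times> \<phi> ` B') (\<psi> \<circ> ?F \<circ> inv_into ({0<..} \<times> U) (map_prod id \<phi>))"
    unfolding top
  proof (rule smooth_on_subset)
    show "A \<times> \<phi> ` B' \<subseteq> map_prod id \<phi> ` {x\<in>{0<..} \<times> U. ?F x \<in> V}"
    proof
      fix z assume "z \<in> A \<times> \<phi> ` B'"
      then obtain t x where tx: "z = map_prod id \<phi> (t, x)" "t \<in> A" "x \<in> B'" by auto
      show "z \<in> map_prod id \<phi> ` {x\<in>{0<..} \<times> U. ?F x \<in> V}"
        unfolding tx(1) by (rule imageI) (use mV [OF tx(2,3)] tx A(2) B'(3) in auto)
    qed
  qed
  moreover have "(\<psi> \<circ> ?F \<circ> inv_into ({0<..} \<times> U) (map_prod id \<phi>)) z = \<psi> (m (fst z) (inv_into U \<phi> (snd z)))"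
    if z: "z \<in> A \<times> \<phi> ` B'" for z
  proof -
    obtain t x where tx: "z = map_prod id \<phi> (t, x)" "t \<in> A" "x \<in> B'" using z by auto
    have "inj_on (map_prod id \<phi>) ({0<..} \<times> U)" using cU(3) by (auto simp: inj_on_def)
    then have "inv_into ({0<..} \<times> U) (map_prod id \<phi>) z = (t, x)"
      unfolding tx(1) using tx A(2) B'(3) by (intro inv_into_f_f) auto
    then show ?thesis using tx cU(3) B'(3) by (auto simp: subset_iff)
  qed
  ultimately have "smooth_on (UNIV \<times> model M) (A \<times> \<phi> ` B') (\<lambda>z. \<psi> (m (fst z) (inv_into U \<phi> (snd z))))"
    by (simp cong: smooth_on_cong)
  then show ?thesis using that A B' mV AB(3) by blast
qed

lemma act_pts: "t > 0 \<Longrightarrow> x \<in> pts M \<Longrightarrow> m t x \<in> pts M"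
proof -
  assume "t > 0" "x \<in> pts M"
  then have "(t, x) \<in> topspace (mtop (prod_mfd (open_mfd {0<..}) M))" unfolding prod_mfd_def open_mfd_def by simp
  moreover have "(\<lambda>(t, x). m t x) \<in> topspace (mtop (prod_mfd (open_mfd {0<..}) M)) \<rightarrow> pts M"
    using act_smooth unfolding smooth_map_def continuous_map_def by (elim conjE)
  ultimately have "(\<lambda>(t, x). m t x) (t, x) \<in> pts M" by (rule funcset_mem [rotated])
  then show "m t x \<in> pts M" by simp
qed

text \<open>Time and point may both vary over an arbitrary manifold \<open>X\<close>: orbits, the
  projection \<open>prj\<close>, the maps \<open>m t\<close> and the inverse of the adapted chart
  are all of this form.\<close>

lemma smooth_at_action:
  assumes X: "pmfd X" and a: "smooth_at X real_mfd a x" "a x > 0" and b: "smooth_at X M b x" "b x \<in> pts M"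
  shows "smooth_at X M (\<lambda>z. m (a z) (b z)) x"
proof -
  obtain U \<phi> where U: "(U, \<phi>) \<in> atlas M" "(U, \<phi>) \<in> maximal_atlas M" "b x \<in> U" using pmfd_cover [OF pmM b(2)] by metis
  obtain V \<psi> where V: "(V, \<psi>) \<in> atlas M" "(V, \<psi>) \<in> maximal_atlas M" "m (a x) (b x) \<in> V"
    using pmfd_cover [OF pmM act_pts [OF a(2) b(2)]] by metis
  obtain A B where AB: "open A" "A \<subseteq> {0<..}" "a x \<in> A" "openin (mtop M) B" "b x \<in> B" "B \<subseteq> U"
    "\<forall>t\<in>A. \<forall>x\<in>B. m t x \<in> V"
    "smooth_on (UNIV \<times> model M) (A \<times> \<phi> ` B) (\<lambda>z. \<psi> (m (fst z) (inv_into U \<phi> (snd z))))"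
    by (rule act_local [OF U(1,3) V(1,3) a(2)])
  obtain Y \<zeta> where Y: "(Y, \<zeta>) \<in> maximal_atlas X" "x \<in> Y" using a(1) unfolding smooth_at_def by blast
  note cY = max_chart [OF X Y(1)] and cU = max_chart [OF pmM U(2)]
  have BU: "(B, \<phi>) \<in> maximal_atlas M" using max_restrict [OF pmM U(2) AB(4,6)] .
  have idA: "(A, id) \<in> maximal_atlas real_mfd"
    using max_restrict [OF pmfd_real emfd_max [of UNIV UNIV]] AB(1) by simp
  obtain O1 where O1: "openin (mtop X) O1" "x \<in> O1" "O1 \<subseteq> Y" "a ` O1 \<subseteq> A" "smooth_on (model X) (\<zeta> ` O1) (\<lambda>y. a (inv_into Y \<zeta> y))"
    using smooth_at_chart [OF X pmfd_real a(1) Y idA AB(3)] by auto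
  obtain O2 where O2: "openin (mtop X) O2" "x \<in> O2" "O2 \<subseteq> Y" "b ` O2 \<subseteq> B" "smooth_on (model X) (\<zeta> ` O2) (\<lambda>y. \<phi> (b (inv_into Y \<zeta> y)))"
    using smooth_at_chart [OF X pmM b(1) Y BU AB(5)] by metis
  have o: "openin (mtop X) (O1 \<inter> O2)" using O1 O2 by blast
  have r: "relopen (model X) (\<zeta> ` (O1 \<inter> O2))" using cY(6) [of "O1 \<inter> O2"] o O1 by blast
  have rB: "relopen (model M) (\<phi> ` B)" using cU(6) AB by blast
  have rAB: "relopen (UNIV \<times> model M) (A \<times> \<phi> ` B)"
    using rB AB(1) unfolding relopen_def by (auto intro!: openin_Times subspace_Times)
  have inv: "inv_into Y \<zeta> y \<in> O1 \<inter> O2" if y: "y \<in> \<zeta> ` (O1 \<inter> O2)" for y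
  proof -
    obtain z where "z \<in> O1 \<inter> O2" "y = \<zeta> z" using y by blast
    then show ?thesis using cY(3) O1(3) by (auto simp: subset_iff)
  qed
  have s: "smooth_on (model X) (\<zeta> ` (O1 \<inter> O2)) (\<lambda>y. (a (inv_into Y \<zeta> y), \<phi> (b (inv_into Y \<zeta> y))))"
    by (rule smooth_on_Pair [OF r smooth_on_subset [OF O1(5)] smooth_on_subset [OF O2(5)]]) auto
  have "smooth_on (model X) (\<zeta> ` (O1 \<inter> O2)) (\<lambda>y. \<psi> (m (fst (a (inv_into Y \<zeta> y), \<phi> (b (inv_into Y \<zeta> y))))
      (inv_into U \<phi> (snd (a (inv_into Y \<zeta> y), \<phi> (b (inv_into Y \<zeta> y)))))))"
    by (rule smooth_on_compose [OF r rAB s AB(8)]) (use inv O1(4) O2(4) in blast)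
  moreover have "inv_into U \<phi> (\<phi> (b (inv_into Y \<zeta> y))) = b (inv_into Y \<zeta> y)" if "y \<in> \<zeta> ` (O1 \<inter> O2)" for y
    using inv [OF that] O2(4) AB(6) cU(3) by (intro inv_into_f_f) auto
  ultimately have "smooth_on (model X) (\<zeta> ` (O1 \<inter> O2)) (\<lambda>y. \<psi> (m (a (inv_into Y \<zeta> y)) (b (inv_into Y \<zeta> y))))"
    by (simp cong: smooth_on_cong)
  then show ?thesis
    by (rule smooth_atI [OF X Y(1) V(2) o, rotated 3]) (use O1 O2 AB(7) in \<open>auto simp: image_subset_iff\<close>)
qed

lemma pr: "pseudo_riemannian M g"
  and f_act: "t > 0 \<Longrightarrow> x \<in> pts M \<Longrightarrow> f (m t x) = t powr \<alpha> * f x"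
  and g_act: "t > 0 \<Longrightarrow> x \<in> pts M \<Longrightarrow> u \<in> tangent_space M x \<Longrightarrow> v \<in> tangent_space M x \<Longrightarrow>
    pullback M (m t) g x u v = t powr \<alpha> * g x u v"
  and g_fund: "x \<in> pts M \<Longrightarrow> v \<in> tangent_space M x \<Longrightarrow> g x (fundamental_field M m x) v = v f"
  using pair unfolding homogeneous_pair_def by blast+

lemma f_pos: "x \<in> pts M \<Longrightarrow> f x > 0" and f_near: "x \<in> pts M \<Longrightarrow> smooth_near M x f"
proof -
  assume x: "x \<in> pts M"
  have r: "relopen UNIV ({0<..} :: real set)" by simp
  have s: "smooth_map M (emfd UNIV {0<..}) f" using pair unfolding homogeneous_pair_def open_mfd_emfd by blast
  then show p: "f x > 0" using x unfolding smooth_map_def continuous_map_def by auto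
  have sx: "smooth_at M (emfd UNIV {0<..}) f x" using s x smooth_map_iff [OF pmM pmfd_emfd [OF r]] by blast
  obtain U \<phi> where U: "(U, \<phi>) \<in> maximal_atlas M" "x \<in> U" using pmfd_cover [OF pmM x] by metis
  have px: "f x \<in> {0<..}" using p by simp
  obtain O' where "openin (mtop M) O'" "x \<in> O'" "O' \<subseteq> U" "f ` O' \<subseteq> {0<..}"
    "smooth_on (model M) (\<phi> ` O') (\<lambda>x. f (inv_into U \<phi> x))"
    by (rule smooth_at_emfdD [OF pmM r sx U px])
  then show "smooth_near M x f" using smooth_near_chart [OF pmM U, of f] by blast
qed

lemma f_act_exp: "x \<in> pts M \<Longrightarrow> f (m (exp t) x) = exp (\<alpha> * t) * f x"
  using f_act [of "exp t"] by (simp add: powr_def mult.commute)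

lemma curve_smooth: "x \<in> pts M \<Longrightarrow> smooth_at real_mfd M (\<lambda>t. m (exp t) x) t"
proof (rule smooth_at_action [OF pmfd_real])
  assume x: "x \<in> pts M"
  show "smooth_at real_mfd real_mfd exp t" by (rule smooth_at_real [OF open_UNIV smooth_on_exp]) simp
  obtain U \<phi> where U: "(U, \<phi>) \<in> maximal_atlas M" "x \<in> U" using pmfd_cover [OF pmM x] by metis
  show "smooth_at real_mfd M (\<lambda>t. x) t"
    by (rule smooth_at_from_emfd [where O' = UNIV, OF _ _ _ _ U(1)]) (use U in auto)
qed auto

lemma fund_tangent: "x \<in> pts M \<Longrightarrow> fundamental_field M m x \<in> tangent_space M x"
proof -
  assume x: "x \<in> pts M"
  obtain U \<phi> where U: "(U, \<phi>) \<in> maximal_atlas M" "x \<in> U" using pmfd_cover [OF pmM x] by metis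
  interpret mfd_chart M U \<phi> using U pmM by unfold_locales
  have 0: "m (exp 0) x = x" using act_one [OF x] by simp
  show ?thesis unfolding fundamental_field_def
    using velocity_tv [OF open_UNIV UNIV_I curve_smooth [OF x]] 0 U(2) tangent_space_eq [OF U(2)] by simp
qed

text \<open>Euler's relation, obtained by differentiating the homogeneity of \<open>f\<close> along
  an orbit.\<close>

lemma fund_f: "x \<in> pts M \<Longrightarrow> fundamental_field M m x f = \<alpha> * f x"
proof -
  assume x: "x \<in> pts M"
  have 0: "m (exp 0) x = x" using act_one [OF x] by simp
  have "((\<lambda>t. exp (\<alpha> * t) * f x) has_real_derivative \<alpha> * f x) (at 0)"
    by (auto intro!: derivative_eq_intros)
  then have "deriv (\<lambda>t. f (m (exp t) x)) 0 = \<alpha> * f x" unfolding f_act_exp [OF x] by (rule DERIV_imp_deriv)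
  then show ?thesis unfolding fundamental_field_def velocity_def using 0 f_near [OF x] by simp
qed

definition S :: "'p set" where "S = {x \<in> pts M. f x = l}"

text \<open>By Euler's relation \<open>f\<close> has nonzero derivative along the fundamental field,
  so its level set can be straightened near p.\<close>

lemma slice_exists:
  assumes p: "p \<in> S"
  shows "\<exists>V \<psi>. (V, \<psi>) \<in> maximal_atlas M \<and> \<psi> ` (V \<inter> S) = \<psi> ` V \<inter> H \<and> p \<in> V"
proof -
  have pM: "p \<in> pts M" using p unfolding S_def by auto
  obtain U \<phi> where U: "(U, \<phi>) \<in> maximal_atlas M" "p \<in> U" using pmfd_cover [OF pmM pM] by metis
  interpret mfd_chart M U \<phi> using U pmM by unfold_locales
  obtain c where c: "c \<in> E" "fundamental_field M m p = tvc p c" using fund_tangent [OF pM] tangent_space_eq [OF U(2)] by auto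
  have nz: "dd (\<lambda>x. f (pt x)) (\<phi> p) c \<noteq> 0"
    using fund_f [OF pM] f_pos [OF pM] \<alpha> tv_apply [OF f_near [OF pM], of c] unfolding c(2) by simp
  have near: "\<And>q. q \<in> U \<Longrightarrow> smooth_near M q f" using f_near ch(2) by auto
  have "\<exists>V \<psi>. (V, \<psi>) \<in> maximal_atlas M \<and> p \<in> V \<and> V \<subseteq> U \<and> (\<forall>q\<in>V. \<psi> q \<in> H \<longleftrightarrow> f q = l)"
    by (rule slice_chart_exists [OF subspH HsubE dimH near U(2) c(1) nz])
  then obtain V \<psi> where V: "(V, \<psi>) \<in> maximal_atlas M" "p \<in> V" "V \<subseteq> U" "\<forall>q\<in>V. \<psi> q \<in> H \<longleftrightarrow> f q = l"
    by blast
  have "\<psi> ` (V \<inter> S) = \<psi> ` V \<inter> H" using V(3,4) ch(2) unfolding S_def by auto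
  then show ?thesis using V by blast
qed

sublocale hyp: hypersurface M H S
  by unfold_locales (use pmM subspH HsubE slice_exists in \<open>auto simp: S_def\<close>)

text \<open>The fundamental field serves as P: \<open>g (P, P) = P f = \<alpha> f\<close> is
  nonzero, and \<open>g (P, u) = u f\<close> vanishes for u tangent to a level set.\<close>

lemma normal:
  assumes p: "p \<in> S"
  shows "\<exists>P\<in>tangent_space M p. g p P P \<noteq> 0 \<and> (\<forall>u\<in>tangent_space hyp.N p. g p P (pushforward M (\<lambda>x. x) p u) = 0)"
proof (intro bexI conjI ballI)
  have pM: "p \<in> pts M" using p unfolding S_def by auto
  show T: "fundamental_field M m p \<in> tangent_space M p" by (rule fund_tangent [OF pM])
  show "g p (fundamental_field M m p) (fundamental_field M m p) \<noteq> 0"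
    using g_fund [OF pM T] fund_f [OF pM] f_pos [OF pM] \<alpha> by simp
  fix u assume u: "u \<in> tangent_space hyp.N p"
  have pN: "p \<in> pts hyp.N" using p pM by simp
  have "g p (fundamental_field M m p) (pushforward M (\<lambda>x. x) p u) = pushforward M (\<lambda>x. x) p u f"
    by (rule g_fund [OF pM hyp.push_tangent [OF p u]])
  also have "\<dots> = u f" unfolding pushforward_def using f_near [OF pM] by simp
  \<comment> \<open>On \<open>S\<close> the function \<open>f\<close> is the constant
    \<open>l\<close>, and tangent vectors of the submanifold see only values on
    \<open>S\<close>.\<close>
  also have "\<dots> = u (\<lambda>q. l)"
    by (rule tangent_local [OF hyp.pmfd_N pN u openin_topspace pN])
      (simp only: hyp.N_simps(3), simp add: S_def)
  also have "\<dots> = 0" by (rule tangent_const [OF hyp.pmfd_N pN u])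
  finally show "g p (fundamental_field M m p) (pushforward M (\<lambda>x. x) p u) = 0" .
qed

lemma pr_S: "pseudo_riemannian hyp.N (pullback M (\<lambda>x. x) g)"
  by (rule hyp.pseudo_riemannian_N [OF pr dimH normal])

text \<open>The foot point on the level \<open>l\<close>: the flow time t solves
  \<open>exp (\<alpha> t) f q = l\<close>.\<close>

definition prj :: "'p \<Rightarrow> 'p" where
  "prj q = m (exp ((ln l - ln (f q)) / \<alpha>)) q"

lemma prj_pts: "q \<in> pts M \<Longrightarrow> prj q \<in> pts M"
  unfolding prj_def by (rule act_pts) auto

lemma prj_S: "q \<in> pts M \<Longrightarrow> prj q \<in> S"
  using prj_pts f_act_exp [of q "(ln l - ln (f q)) / \<alpha>"] f_pos [of q] l \<alpha> unfolding S_def prj_def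
  by (simp add: exp_diff)

lemma prj_act: "q \<in> pts M \<Longrightarrow> prj (m (exp t) q) = prj q"
  unfolding prj_def f_act_exp act_exp using f_pos [of q] \<alpha> by (simp add: ln_mult divide_simps act_exp algebra_simps)

lemma act_prj: "q \<in> pts M \<Longrightarrow> m (exp ((ln (f q) - ln l) / \<alpha>)) (prj q) = q"
  unfolding prj_def using act_one by (simp add: act_exp flip: add_divide_distrib)

lemma prj_id: "p \<in> S \<Longrightarrow> prj p = p"
  unfolding prj_def S_def using act_one by auto

lemma ln_f_near: "q \<in> pts M \<Longrightarrow> smooth_near M q (\<lambda>q. ln (f q))"
  by (rule smooth_near_comp_real [OF pmM f_near _ smooth_on_ln]) (use f_pos in auto)

lemma smooth_at_id: "q \<in> pts M \<Longrightarrow> smooth_at M M (\<lambda>x. x) q"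
proof -
  assume q: "q \<in> pts M"
  obtain U \<phi> where U: "(U, \<phi>) \<in> maximal_atlas M" "q \<in> U" using pmfd_cover [OF pmM q] by metis
  interpret mfd_chart M U \<phi> using U pmM by unfold_locales
  have "smooth_on E (\<phi> ` U) (\<lambda>x. \<phi> (pt x))" using smooth_on_ident [OF ch(4)] by (simp cong: smooth_on_cong)
  then show ?thesis unfolding smooth_at_def using U by blast
qed

lemma prj_smooth: "q \<in> pts M \<Longrightarrow> smooth_at M M prj q"
proof -
  assume q: "q \<in> pts M"
  have "smooth_on UNIV UNIV (\<lambda>r::real. exp ((ln l - r) / \<alpha>))"
    unfolding divide_inverse
    by (intro smooth_on_comp_real [OF _ _ open_UNIV smooth_on_exp] smooth_on_mult smooth_on_diff smooth_on_const smooth_on_ident) auto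
  then have "smooth_at M real_mfd (\<lambda>q. exp ((ln l - ln (f q)) / \<alpha>)) q"
    using smooth_at_comp_real [OF pmM _ open_UNIV, of "\<lambda>q. ln (f q)" q] ln_f_near [OF q] smooth_near_iff [OF pmM] by simp
  then show ?thesis unfolding prj_def
    using smooth_at_action [OF pmM _ _ smooth_at_id [OF q]] q by simp
qed

lemma act_smooth_at: "t > 0 \<Longrightarrow> q \<in> pts M \<Longrightarrow> smooth_at M M (m t) q"
proof -
  assume t: "t > 0" and q: "q \<in> pts M"
  have "smooth_at M real_mfd (\<lambda>q. t) q" using smooth_near_const [OF pmM q] smooth_near_iff [OF pmM] by blast
  then show ?thesis using smooth_at_action [OF pmM _ t smooth_at_id [OF q] q] by simp
qed

end

section \<open>The function w\<close>

text \<open>\<open>\<theta>\<close> is half the logarithmic derivative of \<open>w\<close> in the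
  variable \<rho> = ln r. With \<open>c = sqrt \<bar>C1\<bar>\<close> and argument
  \<open>c (\<rho> + C2)\<close> it is \<open>- c tanh\<close> for s > 0 and \<open>- c cot\<close>
  for s < 0, C1 < 0; it is the constant \<open>\<sigma> c\<close> for s = 0, and
  \<open>- 1 / (\<rho> + C2)\<close> in the last case. Positivity of \<open>w\<close> keeps the
  conformal metric nondegenerate.\<close>

lemma w_profile:
  assumes \<Delta>: "(s, C1, C2) \<in> \<Delta>\<^sub>1 \<union> \<Delta>\<^sub>2 \<union> \<Delta>\<^sub>3" and \<sigma>: "\<sigma> \<in> {1, -1}"
  obtains \<theta> where "\<And>\<rho>. exp \<rho> \<in> w_dom s C1 C2 \<Longrightarrow>
      ((\<lambda>\<rho>. w \<sigma> s C1 C2 (exp \<rho>)) has_real_derivative 2 * \<theta> \<rho> * w \<sigma> s C1 C2 (exp \<rho>)) (at \<rho>)"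
    "\<And>\<rho>. exp \<rho> \<in> w_dom s C1 C2 \<Longrightarrow> (\<theta> has_real_derivative (\<theta> \<rho>)\<^sup>2 - C1) (at \<rho>)"
    "\<And>\<rho>. exp \<rho> \<in> w_dom s C1 C2 \<Longrightarrow> (\<theta> \<rho>)\<^sup>2 = C1 - s * w \<sigma> s C1 C2 (exp \<rho>)"
    "\<And>\<rho>. exp \<rho> \<in> w_dom s C1 C2 \<Longrightarrow> w \<sigma> s C1 C2 (exp \<rho>) > 0"
proof -
  consider (1) "s > 0" "C1 > 0" | (2) "s = 0" "C1 \<ge> 0" | (3) "s < 0" "C1 < 0" | (4) "s < 0" "C1 = 0"
    using \<Delta> unfolding \<Delta>\<^sub>1_def \<Delta>\<^sub>2_def \<Delta>\<^sub>3_def by fastforce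
  then show ?thesis
  proof cases
    case 1
    define c where "c = sqrt C1"
    have c: "c > 0" "C1 = c\<^sup>2" unfolding c_def using 1 by auto
    have w: "w \<sigma> s C1 C2 (exp \<rho>) = c\<^sup>2 / (s * (cosh (c * (\<rho> + C2)))\<^sup>2)" for \<rho>
      unfolding w_def c_def [symmetric] using 1 c by simp
    have nz: "cosh x \<noteq> 0" for x :: real using cosh_real_pos [of x] by simp
    have pos: "1 + (sinh x)\<^sup>2 \<noteq> 0" for x :: real using zero_le_power2 [of "sinh x"] by linarith
    have sq: "(cosh x)\<^sup>2 = (sinh x)\<^sup>2 + 1" for x :: real by (rule cosh_square_eq)
    show ?thesis
    proof (rule that [of "\<lambda>\<rho>. - c * sinh (c * (\<rho> + C2)) / cosh (c * (\<rho> + C2))"])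
      fix \<rho> :: real
      show "((\<lambda>\<rho>. w \<sigma> s C1 C2 (exp \<rho>)) has_real_derivative 2 * (- c * sinh (c * (\<rho> + C2)) / cosh (c * (\<rho> + C2))) * w \<sigma> s C1 C2 (exp \<rho>)) (at \<rho>)"
        unfolding w using 1 nz by (auto intro!: derivative_eq_intros simp: field_simps power2_eq_square)
      show "((\<lambda>\<rho>. - c * sinh (c * (\<rho> + C2)) / cosh (c * (\<rho> + C2))) has_real_derivative (- c * sinh (c * (\<rho> + C2)) / cosh (c * (\<rho> + C2)))\<^sup>2 - C1) (at \<rho>)"
        unfolding c(2) using nz by (auto intro!: derivative_eq_intros simp: field_simps power2_eq_square)
      show "(- c * sinh (c * (\<rho> + C2)) / cosh (c * (\<rho> + C2)))\<^sup>2 = C1 - s * w \<sigma> s C1 C2 (exp \<rho>)"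
        unfolding w unfolding c(2) using 1 nz [of "c * (\<rho> + C2)"] sq [of "c * (\<rho> + C2)"]
        by (simp add: power_divide power_mult_distrib divide_simps) (simp add: algebra_simps pos)
      show "w \<sigma> s C1 C2 (exp \<rho>) > 0" unfolding w using 1 c nz by simp
    qed
  next
    case 2
    \<comment> \<open>The sign is absorbed into c, so that either choice gives
      \<open>c\<^sup>2 = C1\<close>.\<close>
    define c where "c = \<sigma> * sqrt C1"
    have c: "c\<^sup>2 = C1" unfolding c_def using 2 \<sigma> by (auto simp: power_mult_distrib)
    have w: "w \<sigma> s C1 C2 (exp \<rho>) = exp (C2 + 2 * c * \<rho>)" for \<rho>
      unfolding w_def c_def using 2 by (simp add: powr_def exp_add mult_ac)
    show ?thesis
      by (rule that [of "\<lambda>\<rho>. c"]) (unfold w, use 2 c in \<open>auto intro!: derivative_eq_intros\<close>)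
  next
    case 3
    define c where "c = sqrt (- C1)"
    have c: "c > 0" "C1 = - c\<^sup>2" unfolding c_def using 3 by auto
    have w: "w \<sigma> s C1 C2 (exp \<rho>) = - c\<^sup>2 / (s * (sin (c * (\<rho> + C2)))\<^sup>2)" for \<rho>
      unfolding w_def c_def [symmetric] using 3 c by simp
    have nz: "sin (c * (\<rho> + C2)) \<noteq> 0" if "exp \<rho> \<in> w_dom s C1 C2" for \<rho>
      using that 3 unfolding w_dom_def c_def by auto
    have sq: "(cos x)\<^sup>2 = 1 - (sin x)\<^sup>2" for x :: real by (rule cos_squared_eq)
    show ?thesis
    proof (rule that [of "\<lambda>\<rho>. - c * cos (c * (\<rho> + C2)) / sin (c * (\<rho> + C2))"])
      fix \<rho> :: real assume d: "exp \<rho> \<in> w_dom s C1 C2"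
      note nz = nz [OF d]
      show "((\<lambda>\<rho>. w \<sigma> s C1 C2 (exp \<rho>)) has_real_derivative 2 * (- c * cos (c * (\<rho> + C2)) / sin (c * (\<rho> + C2))) * w \<sigma> s C1 C2 (exp \<rho>)) (at \<rho>)"
        unfolding w using 3 nz by (auto intro!: derivative_eq_intros simp: field_simps power2_eq_square)
      show "((\<lambda>\<rho>. - c * cos (c * (\<rho> + C2)) / sin (c * (\<rho> + C2))) has_real_derivative (- c * cos (c * (\<rho> + C2)) / sin (c * (\<rho> + C2)))\<^sup>2 - C1) (at \<rho>)"
        unfolding c(2) using nz by (auto intro!: derivative_eq_intros simp: field_simps power2_eq_square)
      show "(- c * cos (c * (\<rho> + C2)) / sin (c * (\<rho> + C2)))\<^sup>2 = C1 - s * w \<sigma> s C1 C2 (exp \<rho>)"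
        unfolding w unfolding c(2) using 3 nz sq [of "c * (\<rho> + C2)"]
        by (simp add: power_divide power_mult_distrib divide_simps) (simp add: algebra_simps)
      show "w \<sigma> s C1 C2 (exp \<rho>) > 0" unfolding w using 3 c nz
        by (intro divide_neg_neg) (auto intro: mult_neg_pos)
    qed
  next
    case 4
    have w: "w \<sigma> s C1 C2 (exp \<rho>) = - 1 / (s * (\<rho> + C2)\<^sup>2)" for \<rho>
      unfolding w_def using 4 by simp
    have nz: "\<rho> + C2 \<noteq> 0" if "exp \<rho> \<in> w_dom s C1 C2" for \<rho>
      using that 4 unfolding w_dom_def by auto
    show ?thesis
    proof (rule that [of "\<lambda>\<rho>. - 1 / (\<rho> + C2)"])
      fix \<rho> :: real assume d: "exp \<rho> \<in> w_dom s C1 C2"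
      note nz = nz [OF d]
      show "((\<lambda>\<rho>. w \<sigma> s C1 C2 (exp \<rho>)) has_real_derivative 2 * (- 1 / (\<rho> + C2)) * w \<sigma> s C1 C2 (exp \<rho>)) (at \<rho>)"
        unfolding w using 4 nz by (auto intro!: derivative_eq_intros simp: divide_simps power2_eq_square) (simp add: algebra_simps)?
      show "((\<lambda>\<rho>. - 1 / (\<rho> + C2)) has_real_derivative (- 1 / (\<rho> + C2))\<^sup>2 - C1) (at \<rho>)"
        using 4 nz by (auto intro!: derivative_eq_intros simp: divide_simps power2_eq_square)
      show "(- 1 / (\<rho> + C2))\<^sup>2 = C1 - s * w \<sigma> s C1 C2 (exp \<rho>)"
        unfolding w using 4 nz by (simp add: power_divide divide_simps)
      show "w \<sigma> s C1 C2 (exp \<rho>) > 0" unfolding w using 4 nz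
        by (intro divide_neg_neg) (auto intro: mult_neg_pos)
    qed
  qed
qed

lemma open_w_dom: "open {\<rho>. exp \<rho> \<in> w_dom s C1 C2}"
proof -
  have "open {\<rho>::real. sin (sqrt (- C1) * (\<rho> + C2)) \<noteq> 0}" "open {\<rho>::real. \<rho> + C2 \<noteq> 0}"
    by (intro open_Collect_neq continuous_intros)+
  then show ?thesis unfolding w_dom_def by (cases "s < 0"; cases "C1 < 0") auto
qed

section \<open>The chart adapted to the action\<close>

locale adapted = homogeneous +
  fixes V :: "'a set" and \<psi> :: "'a \<Rightarrow> 'b" and n :: 'b
  assumes V: "(V, \<psi>) \<in> maximal_atlas M" and slice: "\<psi> ` (V \<inter> S) = \<psi> ` V \<inter> H"
    and nE: "n \<in> model M" and nn: "n \<bullet> n = 1" and Hn: "\<And>x. x \<in> model M \<Longrightarrow> x \<in> H \<longleftrightarrow> x \<bullet> n = 0"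
begin

sublocale sl: slice_chart M H S V \<psi>
  by unfold_locales (use V slice pmM in auto)

definition hp :: "'b \<Rightarrow> 'b" where "hp x = x - (x \<bullet> n) *\<^sub>R n"
definition \<Omega>h :: "'b set" where "\<Omega>h = {x \<in> model M. hp x \<in> \<psi> ` (V \<inter> S)}"
definition W0 :: "'a set" where "W0 = {q \<in> pts M. prj q \<in> V}"
text \<open>The splitting \<open>\<real> \<times> M\<^sub>l\<close> in coordinates. With
  \<open>ln f\<close> rather than \<open>f\<close> the flow acts by translations along
  \<open>n\<close>.\<close>

definition \<phi>a :: "'a \<Rightarrow> 'b" where "\<phi>a q = \<psi> (prj q) + ln (f q) *\<^sub>R n"
text \<open>Inverse of \<open>\<phi>a\<close>: \<open>ln f\<close> grows along the flow at rate
  \<open>\<alpha>\<close>, so the prescribed value \<open>x \<bullet> n\<close> is reached from the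
  level \<open>l\<close> after the time \<open>(x \<bullet> n - ln l) / \<alpha>\<close>.\<close>

definition \<Phi> :: "'b \<Rightarrow> 'a" where "\<Phi> x = m (exp ((x \<bullet> n - ln l) / \<alpha>)) (sl.pt (hp x))"

lemma bl_hp: "bounded_linear hp"
  unfolding hp_def by (intro bounded_linear_sub bounded_linear_ident bounded_linear_scaleR_const bounded_linear_inner_left)

lemma hp_H: "x \<in> model M \<Longrightarrow> hp x \<in> H"
  using Hn [of "hp x"] subspace_diff [OF sl.subE] subspace_scale [OF sl.subE nE]
  unfolding hp_def by (auto simp: inner_diff_left nn)

lemma H_n: "x \<in> H \<Longrightarrow> x \<bullet> n = 0" using Hn HsubE by auto

lemma relE: "relopen (model M) (model M)"
  using sl.subE unfolding relopen_def by simp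

lemma rel_\<Omega>h: "relopen (model M) \<Omega>h"
  unfolding \<Omega>h_def
  by (rule relopen_preimage [OF relE linear_continuous_on [OF bl_hp] sl.relS]) (use hp_H in auto)

lemma prj_VS: "q \<in> W0 \<Longrightarrow> prj q \<in> V \<inter> S"
  using prj_S unfolding W0_def by auto

lemma psi_H: "p \<in> V \<inter> S \<Longrightarrow> \<psi> p \<in> H"
  using slice by blast

lemma \<phi>a_n: "q \<in> W0 \<Longrightarrow> \<phi>a q \<bullet> n = ln (f q)" and \<phi>a_hp: "q \<in> W0 \<Longrightarrow> hp (\<phi>a q) = \<psi> (prj q)"
  using H_n [OF psi_H [OF prj_VS]] unfolding \<phi>a_def hp_def by (auto simp: inner_add_left nn)

lemma \<phi>a_\<Omega>h: "q \<in> W0 \<Longrightarrow> \<phi>a q \<in> \<Omega>h"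
proof -
  assume q: "q \<in> W0"
  have "\<phi>a q \<in> model M" unfolding \<phi>a_def
    using psi_H [OF prj_VS [OF q]] HsubE nE by (intro subspace_add [OF sl.subE] subspace_scale [OF sl.subE]) auto
  then show "\<phi>a q \<in> \<Omega>h" unfolding \<Omega>h_def using \<phi>a_hp [OF q] prj_VS [OF q] by auto
qed

lemma \<Phi>_\<phi>a: "q \<in> W0 \<Longrightarrow> \<Phi> (\<phi>a q) = q"
  unfolding \<Phi>_def by (simp add: \<phi>a_n \<phi>a_hp) (use prj_VS act_prj W0_def in auto)

lemma pt_hp: "x \<in> \<Omega>h \<Longrightarrow> sl.pt (hp x) \<in> V \<inter> S" and psi_pt: "x \<in> \<Omega>h \<Longrightarrow> \<psi> (sl.pt (hp x)) = hp x"
  unfolding \<Omega>h_def using sl.pt_in_sub [of "hp x" "V \<inter> S"] sl.phi_pt [of "hp x"] by auto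

lemma S_pts: "p \<in> S \<Longrightarrow> p \<in> pts M" unfolding S_def by auto

lemma f_\<Phi>: "x \<in> \<Omega>h \<Longrightarrow> f (\<Phi> x) = exp (x \<bullet> n)"
proof -
  assume "x \<in> \<Omega>h"
  then have "sl.pt (hp x) \<in> pts M" "f (sl.pt (hp x)) = l" using pt_hp unfolding S_def by auto
  then show "f (\<Phi> x) = exp (x \<bullet> n)" unfolding \<Phi>_def using f_act_exp \<alpha> l by (simp add: exp_diff)
qed

lemma prj_\<Phi>: "x \<in> \<Omega>h \<Longrightarrow> prj (\<Phi> x) = sl.pt (hp x)"
  unfolding \<Phi>_def using prj_act prj_id pt_hp S_pts by auto

lemma \<Phi>_W0: "x \<in> \<Omega>h \<Longrightarrow> \<Phi> x \<in> W0"
  unfolding W0_def using prj_\<Phi> pt_hp act_pts [of "exp ((x \<bullet> n - ln l) / \<alpha>)" "sl.pt (hp x)"] S_pts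
  by (auto simp: \<Phi>_def)

lemma \<phi>a_\<Phi>: "x \<in> \<Omega>h \<Longrightarrow> \<phi>a (\<Phi> x) = x"
  unfolding \<phi>a_def by (simp add: prj_\<Phi> f_\<Phi> psi_pt) (simp add: hp_def)

lemma open_W0: "openin (mtop M) W0"
proof -
  have "smooth_map M M prj" using smooth_map_iff [OF pmM pmM] prj_smooth by blast
  then show ?thesis unfolding W0_def smooth_map_def continuous_map_def using sl.ch(1) by blast
qed

lemma \<phi>a_smooth:
  assumes q: "q \<in> W0"
  shows "smooth_at M (emfd (model M) \<Omega>h) \<phi>a q"
proof -
  have qM: "q \<in> pts M" and qV: "prj q \<in> V" using q unfolding W0_def by auto
  obtain U \<phi> where U: "(U, \<phi>) \<in> maximal_atlas M" "q \<in> U" using pmfd_cover [OF pmM qM] by metis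
  interpret c: mfd_chart M U \<phi> using U pmM by unfold_locales
  obtain A where A: "openin (mtop M) A" "q \<in> A" "A \<subseteq> U" "prj ` A \<subseteq> V" "smooth_on (model M) (\<phi> ` A) (\<lambda>x. \<psi> (prj (c.pt x)))"
    by (rule smooth_at_chart [OF pmM pmM prj_smooth [OF qM] U V qV])
  have rA: "relopen (model M) (\<phi> ` A)" using c.relV A by blast
  have "smooth_on (model M) (\<phi> ` A) (\<lambda>x. ln (f (c.pt x)))"
    using smooth_on_chart_iff [OF pmM U(1) A(1,3), of "\<lambda>q. ln (f q)"] ln_f_near A(3) c.ch(2) by blast
  then have s: "smooth_on (model M) (\<phi> ` A) (\<lambda>x. \<phi>a (c.pt x))"
    unfolding \<phi>a_def by (intro smooth_on_add smooth_on_scaleR smooth_on_const rA A(5))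
  have "A \<subseteq> W0" unfolding W0_def using A(3,4) c.ch(2) by auto
  then have "\<phi>a ` A \<subseteq> \<Omega>h" using \<phi>a_\<Omega>h by auto
  then show ?thesis using smooth_at_emfdI [OF pmM rel_\<Omega>h U(1) A(1,3,2) _ s] by blast
qed

lemma \<Phi>_smooth:
  assumes x: "x \<in> \<Omega>h"
  shows "smooth_at (emfd (model M) \<Omega>h) M \<Phi> x"
  unfolding \<Phi>_def
proof (rule smooth_at_action [OF pmfd_emfd [OF rel_\<Omega>h]])
  have R: "(UNIV, id) \<in> maximal_atlas real_mfd" by (rule emfd_max) simp
  have "smooth_on (model M) \<Omega>h (\<lambda>x. exp ((x \<bullet> n - ln l) / \<alpha>))"
    by (intro smooth_on_comp_real [OF rel_\<Omega>h _ open_UNIV smooth_on_exp] smooth_on_divide smooth_on_diff smooth_on_const rel_\<Omega>h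
       smooth_on_linear [OF _ bounded_linear_inner_left] smooth_on_ident) (use \<alpha> in auto)
  then show "smooth_at (emfd (model M) \<Omega>h) real_mfd (\<lambda>x. exp ((x \<bullet> n - ln l) / \<alpha>)) x"
    using smooth_at_from_emfd [OF rel_\<Omega>h rel_\<Omega>h subset_refl x R] by simp
  have "smooth_on (model M) \<Omega>h hp" by (intro smooth_on_linear [OF _ bl_hp] smooth_on_ident rel_\<Omega>h)
  then have "smooth_on (model M) \<Omega>h (\<lambda>x. \<psi> (sl.pt (hp x)))" using psi_pt by (simp cong: smooth_on_cong)
  then show "smooth_at (emfd (model M) \<Omega>h) M (\<lambda>x. sl.pt (hp x)) x"
    by (rule smooth_at_from_emfd [OF rel_\<Omega>h rel_\<Omega>h subset_refl x V, rotated]) (use pt_hp in auto)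
  show "sl.pt (hp x) \<in> pts M" using pt_hp [OF x] S_pts by auto
qed simp

lemma adapted_max: "(W0, \<phi>a) \<in> maximal_atlas M"
  by (rule maximal_atlasI [where \<Phi> = \<Phi>, OF pmM open_W0 rel_\<Omega>h])
    (use \<phi>a_\<Omega>h \<Phi>_\<phi>a \<Phi>_W0 \<phi>a_\<Phi> \<phi>a_smooth \<Phi>_smooth in auto)

section \<open>The metric in adapted coordinates\<close>

context
  fixes W assumes W: "openin (mtop M) W" "W \<subseteq> W0"
begin

interpretation W: mfd_chart M W \<phi>a
  using max_restrict [OF pmM adapted_max W] pmM by unfold_locales

lemma WM: "q \<in> W \<Longrightarrow> q \<in> pts M" and W_W0: "q \<in> W \<Longrightarrow> q \<in> W0"
  using W unfolding W0_def by auto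

lemma ptW: "x \<in> \<phi>a ` W \<Longrightarrow> inv_into W \<phi>a x = \<Phi> x"
  using \<Phi>_\<phi>a W(2) by auto

text \<open>In adapted coordinates an orbit is a straight line: the foot point is fixed and
  \<open>ln f\<close> grows linearly.\<close>

lemma fund_adapted:
  assumes q: "q \<in> W"
  shows "fundamental_field M m q = tv M W \<phi>a q (\<alpha> *\<^sub>R n)"
proof -
  note qM = WM [OF q]
  have 0: "m (exp 0) q = q" using act_one [OF qM] by simp
  have "dd (\<lambda>t. \<phi>a (m (exp t) q)) 0 1 = \<alpha> *\<^sub>R n"
  proof -
    have e: "\<phi>a (m (exp t) q) = \<psi> (prj q) + (\<alpha> * t + ln (f q)) *\<^sub>R n" for t
      unfolding \<phi>a_def prj_act [OF qM] f_act_exp [OF qM] using f_pos [OF qM] by (simp add: ln_mult)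
    have "((\<lambda>t. \<psi> (prj q) + (\<alpha> * t + ln (f q)) *\<^sub>R n) has_vector_derivative \<alpha> *\<^sub>R n) (at 0)"
      by (auto intro!: derivative_eq_intros)
    then show ?thesis unfolding e dd_def by (intro vector_derivative_at) simp
  qed
  then show ?thesis unfolding fundamental_field_def
    using W.velocity_tv(1) [OF open_UNIV UNIV_I curve_smooth [OF qM]] 0 q by simp
qed

lemma tv_f:
  assumes q: "q \<in> W" and a: "a \<in> model M"
  shows "tv M W \<phi>a q a f = f q * (a \<bullet> n)"
proof -
  note qM = WM [OF q] and q0 = W_W0 [OF q]
  have x: "\<phi>a q \<in> \<phi>a ` W" using q by blast
  have "\<phi>a ` W \<subseteq> \<Omega>h" using W \<phi>a_\<Omega>h by auto
  then have e: "f (inv_into W \<phi>a x) = exp (x \<bullet> n)" if "x \<in> \<phi>a ` W" for x using ptW [OF that] f_\<Phi> that by auto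
  have "tv M W \<phi>a q a f = dd (\<lambda>x. f (inv_into W \<phi>a x)) (\<phi>a q) a" using W.tv_apply [OF f_near [OF qM]] .
  also have "\<dots> = dd (\<lambda>x. exp (x \<bullet> n)) (\<phi>a q) a" by (rule dd_cong [OF W.ch(4) x a e])
  also have "\<dots> = exp (\<phi>a q \<bullet> n) * (a \<bullet> n)"
  proof -
    have "((\<lambda>t. exp ((\<phi>a q + t *\<^sub>R a) \<bullet> n)) has_real_derivative exp (\<phi>a q \<bullet> n) * (a \<bullet> n)) (at 0)"
      by (auto intro!: derivative_eq_intros simp: inner_add_left)
    then show ?thesis unfolding dd_def has_real_derivative_iff_has_vector_derivative by (rule vector_derivative_at)
  qed
  finally show ?thesis using \<phi>a_n [OF q0] f_pos [OF qM] by simp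
qed

text \<open>This is \<open>g (P, .) = df\<close> divided by \<open>\<alpha>\<close>, since
  \<open>P\<close> has coordinates \<open>\<alpha> n\<close>.\<close>

lemma g_n:
  assumes q: "q \<in> W" and a: "a \<in> model M"
  shows "g q (tv M W \<phi>a q n) (tv M W \<phi>a q a) = f q * (a \<bullet> n) / \<alpha>"
proof -
  note qM = WM [OF q]
  have T: "tv M W \<phi>a q c \<in> tangent_space M q" if "c \<in> model M" for c using W.tangent_space_eq [OF q] that by blast
  have "\<alpha> * g q (tv M W \<phi>a q n) (tv M W \<phi>a q a) = g q (tv M W \<phi>a q (\<alpha> *\<^sub>R n)) (tv M W \<phi>a q a)"
    using pr_linD [OF pr qM T [OF nE] T [OF nE] T [OF a], of \<alpha> 0] W.tv_scale [OF q nE] by simp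
  also have "\<dots> = f q * (a \<bullet> n)"
    using g_fund [OF qM T [OF a]] fund_adapted [OF q] tv_f [OF q a] by simp
  finally show ?thesis using \<alpha> by (simp add: field_simps)
qed

text \<open>In adapted coordinates the flow is a translation along \<open>n\<close>, so its
  differential leaves the coordinates of vectors tangent to the level set unchanged.\<close>

lemma push_act:
  assumes q: "q \<in> W" and a: "a \<in> H"
  shows "pushforward M (m (exp ((ln (f q) - ln l) / \<alpha>))) (prj q) (tv M V \<psi> (prj q) a) = tv M W \<phi>a q a"
proof
  note qM = WM [OF q] and q0 = W_W0 [OF q]
  have aE: "a \<in> model M" using a HsubE by auto
  let ?t = "exp ((ln (f q) - ln l) / \<alpha>)"
  have mq: "m ?t (prj q) = q" by (rule act_prj [OF qM])
  fix h show "pushforward M (m ?t) (prj q) (tv M V \<psi> (prj q) a) h = tv M W \<phi>a q a h"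
  proof (cases "smooth_near M q h")
    case True
    have pM: "prj q \<in> pts M" using prj_pts [OF qM] .
    have "smooth_at M real_mfd (\<lambda>x. h (m ?t x)) (prj q)"
      by (rule smooth_at_compose [OF pmM pmM pmfd_real act_smooth_at [OF exp_gt_zero pM]])
        (use True mq smooth_near_iff [OF pmM] in simp)
    then have near: "smooth_near M (prj q) (\<lambda>x. h (m ?t x))" using smooth_near_iff [OF pmM] by blast
    have x: "\<phi>a q \<in> \<phi>a ` W" using q by blast
    have "tv M W \<phi>a q a h = dd (\<lambda>x. h (inv_into W \<phi>a x)) (\<phi>a q) a" using W.tv_apply [OF True] .
    also have "\<dots> = dd (\<lambda>x. h (\<Phi> x)) (\<phi>a q) a" by (rule dd_cong [OF W.ch(4) x aE]) (simp add: ptW)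
    also have "\<dots> = dd (\<lambda>y. h (m ?t (sl.pt y))) (\<psi> (prj q)) a"
    proof -
      have "hp (\<phi>a q + s *\<^sub>R a) = \<psi> (prj q) + s *\<^sub>R a" "(\<phi>a q + s *\<^sub>R a) \<bullet> n = ln (f q)" for s
        using \<phi>a_hp [OF q0] \<phi>a_n [OF q0] H_n [OF a] unfolding hp_def by (auto simp: inner_add_left)
      then show ?thesis unfolding dd_def \<Phi>_def by simp
    qed
    finally show ?thesis unfolding pushforward_def mq using True near by (simp add: tv_def)
  qed (simp add: pushforward_def mq tv_def)
qed

text \<open>By \<open>g_n\<close> the direction \<open>n\<close> is orthogonal to \<open>H\<close>
  and accounts for the first term. For the parts in \<open>H\<close>, the flow from the foot point
  to q multiplies the metric by the flow parameter to the power \<open>\<alpha>\<close>, which is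
  \<open>f q / l\<close>.\<close>

lemma g_adapted:
  assumes q: "q \<in> W" and a: "a \<in> model M" and b: "b \<in> model M"
  shows "g q (tv M W \<phi>a q a) (tv M W \<phi>a q b) =
    f q / \<alpha> * ((a \<bullet> n) * (b \<bullet> n) + \<alpha> / l * g (prj q) (tv M V \<psi> (prj q) (hp a)) (tv M V \<psi> (prj q) (hp b)))"
proof -
  note qM = WM [OF q] and q0 = W_W0 [OF q]
  have pM: "prj q \<in> pts M" and pV: "prj q \<in> V" using q0 prj_pts unfolding W0_def by auto
  let ?t = "exp ((ln (f q) - ln l) / \<alpha>)"
  let ?h = "g q (tv M W \<phi>a q (hp a)) (tv M W \<phi>a q (hp b))"
  have mq: "m ?t (prj q) = q" by (rule act_prj [OF qM])
  have T: "tv M W \<phi>a q c \<in> tangent_space M q" if "c \<in> model M" for c using W.tangent_space_eq [OF q] that by blast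
  have TV: "tv M V \<psi> (prj q) c \<in> tangent_space M (prj q)" if "c \<in> model M" for c using sl.tangent_space_eq [OF pV] that by blast
  have hE: "hp a \<in> model M" "hp b \<in> model M" using hp_H a b HsubE by auto
  have "?h = pullback M (m ?t) g (prj q) (tv M V \<psi> (prj q) (hp a)) (tv M V \<psi> (prj q) (hp b))"
    unfolding pullback_def push_act [OF q hp_H [OF a]] push_act [OF q hp_H [OF b]] mq ..
  also have "\<dots> = ?t powr \<alpha> * g (prj q) (tv M V \<psi> (prj q) (hp a)) (tv M V \<psi> (prj q) (hp b))"
    by (rule g_act [OF exp_gt_zero pM TV [OF hE(1)] TV [OF hE(2)]])
  also have "?t powr \<alpha> = f q / l" using \<alpha> f_pos [OF qM] l by (simp add: powr_def exp_diff)
  finally have h: "?h = f q / l * g (prj q) (tv M V \<psi> (prj q) (hp a)) (tv M V \<psi> (prj q) (hp b))" .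
  have dec: "tv M W \<phi>a q c = (\<lambda>k. 1 * tv M W \<phi>a q (hp c) k + (c \<bullet> n) * tv M W \<phi>a q n k)" if "c \<in> model M" for c
    using W.tv_lincomb [OF q _ nE, of "hp c" 1 "c \<bullet> n"] hp_H [OF that] HsubE by (auto simp: hp_def)
  have lin: "g q (tv M W \<phi>a q c) (tv M W \<phi>a q d) = g q (tv M W \<phi>a q (hp c)) (tv M W \<phi>a q d) + (c \<bullet> n) * g q (tv M W \<phi>a q n) (tv M W \<phi>a q d)"
    if "c \<in> model M" "d \<in> model M" for c d
    unfolding dec [OF that(1)] using pr_linD [OF pr qM T T [OF nE] T [OF that(2)], of "hp c" 1 "c \<bullet> n"] hp_H [OF that(1)] HsubE by auto
  have sym: "g q (tv M W \<phi>a q c) (tv M W \<phi>a q d) = g q (tv M W \<phi>a q d) (tv M W \<phi>a q c)" if "c \<in> model M" "d \<in> model M" for c d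
    using pr_symD [OF pr qM T T] that .
  have "g q (tv M W \<phi>a q (hp a)) (tv M W \<phi>a q b) = ?h"
    using lin [OF b hE(1)] sym [OF hE(1) b] sym [OF hE] g_n [OF q hE(1)] H_n [OF hp_H [OF a]] by simp
  then have "g q (tv M W \<phi>a q a) (tv M W \<phi>a q b) = ?h + (a \<bullet> n) * (f q * (b \<bullet> n) / \<alpha>)"
    using lin [OF a b] g_n [OF q b] by simp
  then show ?thesis unfolding h using \<alpha> l by (simp add: field_simps)
qed

end

end

section \<open>Curvature of the conformal metric\<close>

context homogeneous begin

text \<open>In dimension 0 the fundamental field would vanish, against Euler's relation. So
  \<open>dim (model M) - 1\<close> is a true predecessor as soon as there is a point.\<close>

lemma model_nontrivial: "p \<in> pts M \<Longrightarrow> model M \<noteq> {0}"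
proof
  assume p: "p \<in> pts M" and E0: "model M = {0}"
  obtain U \<phi> where U: "(U, \<phi>) \<in> maximal_atlas M" "p \<in> U" using pmfd_cover [OF pmM p] by metis
  interpret mfd_chart M U \<phi> using U pmM by unfold_locales
  have "fundamental_field M m p = tvc p 0" using fund_tangent [OF p] tangent_space_eq [OF U(2)] E0 by auto
  then show False using fund_f [OF p] f_pos [OF p] \<alpha> tv_zero [OF U(2)] by simp
qed

theorem conformal_constant_curvature:
  assumes csc: "constant_sectional_curvature hyp.N (pullback M (\<lambda>x. x) g) Chat"
    and \<Delta>: "(C / \<alpha>, l * Chat / \<alpha>, C2) \<in> \<Delta>\<^sub>1 \<union> \<Delta>\<^sub>2 \<union> \<Delta>\<^sub>3" and \<sigma>: "\<sigma> \<in> {1, -1}"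
    and v: "\<And>r. r \<in> w_dom (C / \<alpha>) (l * Chat / \<alpha>) C2 \<Longrightarrow> v r = 1 / r * w \<sigma> (C / \<alpha>) (l * Chat / \<alpha>) C2 r"
    and D: "D = {x \<in> pts M. f x \<in> w_dom (C / \<alpha>) (l * Chat / \<alpha>) C2}"
  shows "pseudo_riemannian (open_sub M D) (\<lambda>x u u'. v (f x) * g x u u')"
    "constant_sectional_curvature (open_sub M D) (\<lambda>x u u'. v (f x) * g x u u') C"
proof -
  define s C1 where "s = C / \<alpha>" and "C1 = l * Chat / \<alpha>"
  define W where "W \<rho> = w \<sigma> s C1 C2 (exp \<rho>)" for \<rho>
  define T where "T = {\<rho>. exp \<rho> \<in> w_dom s C1 C2}"
  let ?N = "open_sub M D"
  let ?gv = "\<lambda>x u u'. v (f x) * g x u u'"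
  obtain \<theta> where \<theta>: "\<And>\<rho>. \<rho> \<in> T \<Longrightarrow> (W has_real_derivative 2 * \<theta> \<rho> * W \<rho>) (at \<rho>)"
    "\<And>\<rho>. \<rho> \<in> T \<Longrightarrow> (\<theta> has_real_derivative (\<theta> \<rho>)\<^sup>2 - C1) (at \<rho>)"
    "\<And>\<rho>. \<rho> \<in> T \<Longrightarrow> (\<theta> \<rho>)\<^sup>2 = C1 - s * W \<rho>" "\<And>\<rho>. \<rho> \<in> T \<Longrightarrow> W \<rho> > 0"
    using w_profile [OF \<Delta> \<sigma>] unfolding T_def W_def s_def C1_def mem_Collect_eq by metis
  have oT: "open T" unfolding T_def by (rule open_w_dom)
  have rT: "relopen UNIV T" using oT by simp
  have s\<theta>: "smooth_on UNIV T \<theta>" by (rule smooth_on_riccati [OF oT \<theta>(2)])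
  have sW: "smooth_on UNIV T W"
    by (rule smooth_on_linear_ode [OF oT \<theta>(1) smooth_on_linear [OF rT bounded_linear_mult_right s\<theta>]])
  \<comment> \<open>The condition on \<open>f\<close> is rewritten in the variable \<rho> = ln f of
    \<open>W\<close> and of the adapted chart.\<close>
  have D': "x \<in> D \<longleftrightarrow> x \<in> pts M \<and> ln (f x) \<in> T" for x
    unfolding D T_def s_def C1_def using f_pos by auto
  \<comment> \<open>The factor \<open>1 / r\<close> of \<open>v\<close> becomes
    \<open>exp (- \<rho>)\<close>; below it cancels the factor \<open>f\<close> of \<open>g\<close>
    in adapted coordinates.\<close>
  have vf: "v (f x) = exp (- ln (f x)) * W (ln (f x))" if "x \<in> D" for x
    using v [of "f x"] that f_pos [of x] unfolding D W_def s_def C1_def by (simp add: exp_minus inverse_eq_divide)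
  have v0: "v (f x) \<noteq> 0" if "x \<in> D" for x using vf [OF that] \<theta>(4) D' that by fastforce
  have vnear: "smooth_near M x (\<lambda>x. v (f x))" if "x \<in> D" for x
  proof -
    have x: "x \<in> pts M" "ln (f x) \<in> T" using that D' by auto
    have "smooth_on UNIV T (\<lambda>\<rho>. exp (- \<rho>) * W \<rho>)"
      by (intro smooth_on_mult [OF rT _ sW] smooth_on_comp_real [OF rT _ open_UNIV smooth_on_exp] smooth_on_minus smooth_on_ident rT) auto
    from smooth_near_comp_real [OF pmM ln_f_near [OF x(1)] oT this x(2)]
    have n: "smooth_near M x (\<lambda>x. exp (- ln (f x)) * W (ln (f x)))" .
    have sm: "smooth_at M real_mfd (\<lambda>x. ln (f x)) x" using ln_f_near [OF x(1)] smooth_near_iff [OF pmM] by blast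
    have oT': "openin (mtop real_mfd) T" using oT by simp
    obtain A where A: "openin (mtop M) A" "x \<in> A" "(\<lambda>x. ln (f x)) ` A \<subseteq> T"
      using smooth_at_nbhd [OF pmM pmfd_real sm oT' x(2)] by metis
    have "A \<subseteq> D" using A(3) openin_subset [OF A(1)] D' by auto
    then show ?thesis by (intro smooth_near_cong [OF pmM n A(1,2)]) (use vf in auto)
  qed
  have oD: "openin (mtop M) D"
  proof -
    have "smooth_map M real_mfd (\<lambda>x. ln (f x))"
      using smooth_map_iff [OF pmM pmfd_real] ln_f_near smooth_near_iff [OF pmM] by blast
    then have "openin (mtop M) {x \<in> pts M. ln (f x) \<in> T}"
      using oT unfolding smooth_map_def continuous_map_def by simp
    also have "{x \<in> pts M. ln (f x) \<in> T} = D" using D' by auto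
    finally show ?thesis .
  qed
  have ptsD: "p \<in> D \<Longrightarrow> p \<in> pts M" for p using D' by auto
  have pmN: "pmfd ?N" by (rule pmfd_open_sub [OF pmM oD])
  have TN: "tangent_space ?N p = tangent_space M p" if "p \<in> D" for p by (rule tangent_space_open_sub [OF pmM oD that])
  show prN: "pseudo_riemannian ?N ?gv"
    unfolding pseudo_riemannian_def pts_open_sub [OF oD]
  proof (intro conjI ballI allI impI, goal_cases)
    case (1 p x y)
    then show ?case using pr_symD [OF pr ptsD, of p x y] TN by simp
  next
    case (2 p x y z a b)
    then show ?case using pr_linD [OF pr ptsD, of p x y z a b] TN by (simp add: algebra_simps)
  next
    case (3 p x)
    then show ?case using pr_nondegD [OF pr ptsD, of p x] TN v0 by simp
  next
    case (4 A X Y)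
    then have A: "openin (mtop M) A" "A \<subseteq> D" using openin_open_sub [OF oD] by auto
    have e: "open_sub ?N A = open_sub M A" by (rule open_sub_open_sub [OF A(2)])
    have "smooth_fun (open_sub M A) (\<lambda>p. g p (X p) (Y p))"
      using pr A 4 unfolding e pseudo_riemannian_def by blast
    then show ?case unfolding e smooth_fun_near_iff [OF pmM A(1)]
      using smooth_near_mult [OF pmM vnear] A(2) by blast
  qed
  show "constant_sectional_curvature ?N ?gv C"
  proof (rule csc_of_const_curv [OF pmN])
    fix p assume "p \<in> pts ?N"
    then have p: "p \<in> D" using pts_open_sub [OF oD] by simp
    note pM = ptsD [OF p]
    obtain V \<psi> where Vs: "(V, \<psi>) \<in> maximal_atlas M" "\<psi> ` (V \<inter> S) = \<psi> ` V \<inter> H" "prj p \<in> V"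
      using slice_exists [OF prj_S [OF pM]] by blast
    obtain n where nf: "n \<in> model M" "norm n = 1" "\<And>x. x \<in> model M \<Longrightarrow> x \<in> H \<longleftrightarrow> x \<bullet> n = 0"
      using hyperplane_normal [OF pmfd_subspace [OF pmM] subspH HsubE dimH model_nontrivial [OF pM]] by metis
    interpret adapted M m \<alpha> g f l H V \<psi> n
      by unfold_locales (use Vs nf in \<open>auto simp: norm_eq_1\<close>)
    \<comment> \<open>The adapted chart is cut down to \<open>D\<close>, where \<open>v\<close> is
      prescribed.\<close>
    define W' where "W' = W0 \<inter> D"
    have W': "openin (mtop M) W'" "W' \<subseteq> W0" "W' \<subseteq> D" unfolding W'_def using open_W0 oD by auto
    have pW': "p \<in> W'" unfolding W'_def W0_def using p pM Vs(3) by auto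
    have WM: "(W', \<phi>a) \<in> maximal_atlas M" by (rule max_restrict [OF pmM adapted_max W'(1,2)])
    have WN: "(W', \<phi>a) \<in> maximal_atlas ?N" using max_atlas_open_sub [OF pmM oD] WM W'(3) by blast
    interpret NC: metric_chart ?N W' \<phi>a ?gv using pmN WN prN by unfold_locales
    interpret SC: metric_chart hyp.N "V \<inter> S" \<psi> "pullback M (\<lambda>x. x) g"
      using sl.chartS pr_S unfolding metric_chart_def metric_chart_axioms_def by blast
    obtain \<Gamma> where \<Gamma>: "chris_chart hyp.N (V \<inter> S) \<psi> (pullback M (\<lambda>x. x) g) \<Gamma>"
      "chris_chart.const_curv hyp.N (V \<inter> S) \<psi> (pullback M (\<lambda>x. x) g) \<Gamma> Chat"
      using SC.csc_const_curv [OF csc] by blast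
    interpret CS: chris_chart hyp.N "V \<inter> S" \<psi> "pullback M (\<lambda>x. x) g" \<Gamma> by fact
    \<comment> \<open>This scaling lets the normal part and the slice part of \<open>g\<close> share
      the factor \<open>f / \<alpha>\<close> in \<open>g_adapted\<close>.\<close>
    define h where "h y a b = \<alpha> / l * SC.G y a b" for y a b
    have EH: "SC.E = H" by simp
    have SG: "SC.G (\<psi> q) a b = g q (tv M V \<psi> q a) (tv M V \<psi> q b)" if "q \<in> V \<inter> S" "a \<in> H" "b \<in> H" for q a b
      unfolding SC.G_def unfolding SC.pt_phi [OF that(1)] pullback_def using sl.push_tv [OF that(1)] that by simp
    have tvN: "tv ?N W' \<phi>a q = tv M W' \<phi>a q" if "q \<in> W'" for q
      unfolding tv_def using smooth_near_open_sub [OF pmM oD] that W'(3) by (intro ext) auto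
    have smG: "smooth_on H (\<psi> ` (V \<inter> S)) (\<lambda>y. SC.G y a b)" if "a \<in> H" "b \<in> H" for a b
      using bilfam_smooth [OF SC.G_bilfam] that by simp
    \<comment> \<open>Here \<open>k = 1 / \<alpha>\<close> and \<open>s = C / \<alpha>\<close>, so
      the curvature \<open>s / k\<close> of the warped metric is \<open>C\<close>.\<close>
    interpret wc: warped_chart ?N W' \<phi>a ?gv H n "\<psi> ` (V \<inter> S)" h \<Gamma> T W \<theta> "1 / \<alpha>" s C1
    proof unfold_locales
      show "H \<subseteq> model ?N" "n \<in> model ?N" using HsubE nE by auto
      show "n \<bullet> n = 1" by (rule nn)
      show "x \<in> H \<longleftrightarrow> x \<bullet> n = 0" if "x \<in> model ?N" for x using that Hn by simp
      show "relopen H (\<psi> ` (V \<inter> S))" by (rule sl.relS)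
      show "x - (x \<bullet> n) *\<^sub>R n \<in> \<psi> ` (V \<inter> S)" if "x \<in> \<phi>a ` W'" for x
        using that \<phi>a_hp prj_VS W'(2) unfolding hp_def by auto
      show "bilfam H (\<psi> ` (V \<inter> S)) h"
      proof -
        have "smooth_on H (\<psi> ` (V \<inter> S)) (\<lambda>y. h y a b)" if "a \<in> H" "b \<in> H" for a b
          unfolding h_def by (rule smooth_on_linear [OF sl.relS bounded_linear_mult_right smG [OF that]])
        then show ?thesis using SC.G_rules unfolding EH h_def bilfam_def linfam_def by (auto simp: algebra_simps)
      qed
      show "h y a b = h y b a" if "y \<in> \<psi> ` (V \<inter> S)" "a \<in> H" "b \<in> H" for y a b
        unfolding h_def using SC.G_sym that by simp
      show "bilfam H (\<psi> ` (V \<inter> S)) \<Gamma>" using CS.\<Gamma>_bil by simp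
      show "\<Gamma> y a b = \<Gamma> y b a" "\<Gamma> y a b \<in> H" if "y \<in> \<psi> ` (V \<inter> S)" "a \<in> H" "b \<in> H" for y a b
        using CS.\<Gamma>_sym [of y a b] CS.\<Gamma>_E [of y a b] that by auto
      show "dd (\<lambda>z. h z b c) y a = h y (\<Gamma> y a b) c + h y b (\<Gamma> y a c)"
        if "y \<in> \<psi> ` (V \<inter> S)" "a \<in> H" "b \<in> H" "c \<in> H" for y a b c
        unfolding h_def
        using dd_linear [OF sl.relS bounded_linear_mult_right smG [OF that(3,4)] that(1,2), of "\<alpha> / l"] CS.\<Gamma>_met [of y a b c] that
        by (simp add: algebra_simps)
      show "h y (dd (\<lambda>z. \<Gamma> z b b) y a - dd (\<lambda>z. \<Gamma> z a b) y b + \<Gamma> y a (\<Gamma> y b b) - \<Gamma> y b (\<Gamma> y a b)) a =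
          C1 * (h y a a * h y b b - (h y a b)\<^sup>2)" if "y \<in> \<psi> ` (V \<inter> S)" "a \<in> H" "b \<in> H" for y a b
      proof -
        \<comment> \<open>Scaling a metric by \<open>\<alpha> / l\<close> keeps its Christoffel
          symbols and divides its curvature by that factor; hence the value of
          \<open>C1\<close>.\<close>
        have eq: "SC.G y (CS.riem y a b b) a = Chat * (SC.G y a a * SC.G y b b - (SC.G y a b)\<^sup>2)"
          using \<Gamma>(2) that unfolding CS.const_curv_def EH by blast
        show ?thesis unfolding h_def CS.riem_def [symmetric] C1_def eq using \<alpha> l
          by (simp add: power2_eq_square field_simps)
      qed
      show "open T" by (rule oT)
      show "x \<bullet> n \<in> T" if "x \<in> \<phi>a ` W'" for x using that \<phi>a_n W' D' by (auto simp: subset_iff)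
      show "(W has_real_derivative 2 * \<theta> r * W r) (at r)" "(\<theta> has_real_derivative (\<theta> r)\<^sup>2 - C1) (at r)"
        "(\<theta> r)\<^sup>2 = C1 - s * W r" if "r \<in> T" for r using \<theta> that by auto
      show "smooth_on UNIV T \<theta>" by (rule s\<theta>)
      show "1 / \<alpha> \<noteq> 0" using \<alpha> by simp
      fix x a b assume x: "x \<in> \<phi>a ` W'" and ab: "a \<in> model ?N" "b \<in> model ?N"
      then obtain q where q: "q \<in> W'" "x = \<phi>a q" by blast
      have abM: "a \<in> model M" "b \<in> model M" using ab by auto
      have q0: "q \<in> W0" "q \<in> D" using q W' by auto
      have "NC.G x a b = v (f q) * g q (tv M W' \<phi>a q a) (tv M W' \<phi>a q b)"
        unfolding NC.G_def q(2) NC.pt_phi [OF q(1)] tvN [OF q(1)] ..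
      also have "\<dots> = v (f q) * (f q / \<alpha> * ((a \<bullet> n) * (b \<bullet> n) + h (\<psi> (prj q)) (hp a) (hp b)))"
        unfolding g_adapted [OF W'(1,2) q(1) abM] h_def SG [OF prj_VS [OF q0(1)] hp_H [OF abM(1)] hp_H [OF abM(2)]] ..
      also have "v (f q) = W (x \<bullet> n) / f q"
        using vf [OF q0(2)] f_pos [OF ptsD [OF q0(2)]] \<phi>a_n [OF q0(1)] q(2) by (simp add: exp_minus divide_inverse mult.commute)
      finally show "NC.G x a b = 1 / \<alpha> * W (x \<bullet> n) * ((a \<bullet> n) * (b \<bullet> n) +
          h (x - (x \<bullet> n) *\<^sub>R n) (a - (a \<bullet> n) *\<^sub>R n) (b - (b \<bullet> n) *\<^sub>R n))"
        using \<phi>a_hp [OF q0(1)] f_pos [OF ptsD [OF q0(2)]] unfolding q(2) hp_def by simp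
    qed
    have "chris_chart.const_curv ?N W' \<phi>a ?gv wc.\<Gamma>w C"
      using wc.warped_const_curv \<alpha> unfolding s_def by simp
    then show "\<exists>U \<phi> \<Gamma>. p \<in> U \<and> chris_chart ?N U \<phi> ?gv \<Gamma> \<and> chris_chart.const_curv ?N U \<phi> ?gv \<Gamma> C"
      using wc.chris pW' by blast
  qed
qed

end

theorem proposition3p11:
  fixes M :: "('p, 'e::euclidean_space) mfd"
    and m :: "real \<Rightarrow> 'p \<Rightarrow> 'p"
    and g :: "'p metric"
    and f :: "'p \<Rightarrow> real"
    and H :: "'e set"
    and \<alpha> l Chat C C2 \<sigma> :: real
    and v :: "real \<Rightarrow> real"
  assumes "smooth_manifold M"
    and "smooth_free_action M m"
    and "\<alpha> \<noteq> 0"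
    and "homogeneous_pair M m \<alpha> g f"
    and "l > 0"
    and "subspace H" and "H \<subseteq> model M" and "dim H = dim (model M) - 1"
    and "constant_sectional_curvature
           (embedded_sub M H {x \<in> pts M. f x = l}) (pullback M (\<lambda>x. x) g) Chat"
    and "(C / \<alpha>, l * Chat / \<alpha>, C2) \<in> \<Delta>\<^sub>1 \<union> \<Delta>\<^sub>2 \<union> \<Delta>\<^sub>3"
    and "\<sigma> \<in> {1, -1}"
    and "\<And>r. r \<in> w_dom (C / \<alpha>) (l * Chat / \<alpha>) C2 \<Longrightarrow> v r = 1 / r * w \<sigma> (C / \<alpha>) (l * Chat / \<alpha>) C2 r"
  defines "N \<equiv> open_sub M {x \<in> pts M. f x \<in> w_dom (C / \<alpha>) (l * Chat / \<alpha>) C2}"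
  shows "pseudo_riemannian N (\<lambda>x u u'. v (f x) * g x u u') \<and>
         constant_sectional_curvature N (\<lambda>x u u'. v (f x) * g x u u') C"
proof -
  interpret homogeneous M m \<alpha> g f l H
    by unfold_locales (use assms smooth_manifold_pmfd in auto)
  have csc: "constant_sectional_curvature (embedded_sub M H S) (pullback M (\<lambda>x. x) g) Chat"
    unfolding S_def by (rule assms(9))
  show ?thesis unfolding N_def
    using conformal_constant_curvature [OF csc assms(10-12) refl] by blast
qed

end
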